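(* Let $\phi_i(z),\phi^*_i(z),\psi^*_i(z)$ ($i=1,2$) be the bosonized type I, dual type I and dual type II vertex operator components, and let $R^{ij}_{kl}(z)$ be the R-matrix entries, all as defined in the context. Then for all $i,j\in\{1,2\}$ the graded Faddeev–Zamolodchikov relations hold: $$\phi_j(z_2)\phi_i(z_1)=\sum_{k,l=1}^{2}R^{kl}_{ij}\Big(\frac{z_1}{z_2}\Big)\phi_k(z_1)\phi_l(z_2)(-1)^{[i][j]},$$ $$\psi^*_i(z_1)\psi^*_j(z_2)=\sum_{k,l=1}^{2}R^{ij}_{kl}\Big(\frac{z_1}{z_2}\Big)\psi^*_l(z_2)\psi^*_k(z_1)(-1)^{[i][j]},$$ $$\psi^*_i(z_1)\phi_j(z_2)=\phi_j(z_2)\psi^*_i(z_1)(-1)^{[i][j]},$$ together with the invertibility relations $$\phi_i(z)\phi^*_j(z)=-q\,\delta_{ij}\,\mathrm{id}.$$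
   Context: $q$ is the deformation parameter and $[n]_q=\frac{q^n-q^{-n}}{q-q^{-1}}$. Bosons: $a^j_n,c_n,Q_{a^j},Q_c$ ($n\in\mathbf Z$, $j=1,2$) satisfy $[a^i_n,a^j_m]=(-1)^{i+1}\delta_{ij}\delta_{m+n,0}\frac{[n]_q^2}{n}$ and $[c_n,c_m]=\delta_{n+m,0}\frac{[n]_q^2}{n}$ (for $n,m\ne0$), $[a^i_0,Q_{a^j}]=\delta_{ij}$, $[c_0,Q_c]=1$; all other commutators vanish. Put $A^1_n=a^1_n+a^2_n$, $A^2_n=\frac{q^n+q^{-n}}{2}(a^1_n-a^2_n)$, $Q_{A^1}=Q_{a^1}-Q_{a^2}$, $Q_{A^2}=Q_{a^1}+Q_{a^2}$; $A^{*1}_n=\frac{1}{q^n+q^{-n}}A^2_n$ for $n\neq0$, $A^{*1}_0=\frac12A^2_0$, $Q^*_{A^1}=\frac12Q_{A^2}$. Currents: $H^1(z;\kappa)=Q_{A^1}+A^1_0\ln z-\sum_{n\ne0}\frac{A^1_n}{[n]_q}q^{\kappa|n|}z^{-n}$, $H^{*,1}(z;\kappa)=Q^*_{A^1}+A^{*1}_0\ln z-\sum_{n\ne0}\frac{A^{*1}_n}{[n]_q}q^{\kappa|n|}z^{-n}$, $c(z)=Q_c+c_0\ln z-\sum_{n\ne0}\frac{c_n}{[n]_q}z^{-n}$. Normal ordering $:\ :$ puts modes with $n>0$ to the right of modes with $n<0$, and $Q$'s to the left of zero modes. The $q$-derivative is $\partial_zf(z)=\frac{f(qz)-f(q^{-1}z)}{(q-q^{-1})z}$.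 In the level-one free boson realization of the quantum affine superalgebra $U_q[\widehat{gl(1|1)}]$ one has $X^+(z)=:e^{H^1(z;-1/2)}e^{c(z)}:$ and $X^-(z)=:e^{-H^1(z;1/2)}\partial_z\{e^{-c(z)}\}:$, with $X^\pm(z)=\sum_{n\in\mathbf Z}X^\pm_nz^{-n-1}$, $e_1=X^+_0$, $f_1=X^-_0$ (both odd). Bracket: $[a,b]_x=ab-(-1)^{[a][b]}x\,ba$, where $[\,\cdot\,]$ is the $\mathbf Z_2$-grading. $V$ is the two-dimensional graded space with basis $v_1,v_2$ and $[v_j]=\frac{(-1)^j+1}{2}$, so the index gradings are $[1]=0$, $[2]=1$; the components $\phi_i,\phi^*_i,\psi^*_i$ have grading $[i]$. Vertex operator components: $\phi_2(z)=:e^{-H^{*,1}(qz;\frac12)+H^1(q^2z;\frac12)}e^{c(qz)}:e^{-\sqrt{-1}\pi c_0}$, and $-\phi_1(z)=[\phi_2(z),f_1]_{q^{-1}}$; $\phi^*_1(z)=:e^{H^{*,1}(qz;\frac12)}:e^{\sqrt{-1}\pi c_0}$, and $q\phi^*_2(z)=[\phi^*_1(z),f_1]_q$; $\psi^*_2(z)=:e^{H^{*,1}(qz;-\frac12)-H^1(z;-\frac12)}\partial_z\{e^{-c(qz)}\}:e^{\sqrt{-1}\pi c_0}$, and $q^{-1}\psi^*_1(z)=[\psi^*_2(z),e_1]_{q^{-1}}$. R-matrix: $R(z)\in\mathrm{End}(V\otimes V)$, $R(z)(v_i\otimes v_j)=\sum_{k,l=1}^2R^{ij}_{kl}(z)\,v_k\otimes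 v_l$, with $R^{11}_{11}(z)=1$, $R^{22}_{22}(z)=\frac{zq^{-1}-q}{zq-q^{-1}}$, $R^{12}_{12}(z)=R^{21}_{21}(z)=\frac{z-1}{zq-q^{-1}}$, $R^{21}_{12}(z)=\frac{q-q^{-1}}{zq-q^{-1}}$, $R^{12}_{21}(z)=\frac{(q-q^{-1})z}{zq-q^{-1}}$, and all other entries $0$.
   Formalization: The invertibility relation is proved as φ_i(z)φ*_j(z) = +q δ_ij id instead of −q δ_ij id: with the given definitions, moving e^{-√-1πc_0} past f_1 produces an extra sign, so the printed −q is false. *)

theory Defs
  imports "HOL-Complex_Analysis.Complex_Analysis" "HOL-Library.Multiset" "HOL-Library.Function_Algebras"
begin

text \<open>
  The deformation parameter is \<open>q = exp h\<close>, and \<open>q\<^sup>x\<close> means \<open>exp (x * h)\<close>; thus \<open>h\<close> fixes the branch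
  of \<open>q\<^sup>1\<^sup>/\<^sup>2\<close> and of \<open>ln q\<close>. Likewise a vertex operator at the point \<open>z\<close> is a function of \<open>\<zeta> = ln z\<close>:
  the point \<open>q\<^sup>m z\<close> is \<open>\<zeta> + m * h\<close>, and non-integral powers of \<open>z\<close>, which do occur on Fock modules
  with non-integral momentum, are single valued in \<open>\<zeta>\<close>.
\<close>

definition qint :: "complex \<Rightarrow> int \<Rightarrow> complex" where
  "qint h n = (exp (of_int n * h) - exp (- (of_int n * h))) / (exp h - exp (- h))"

section \<open>Fock space and bosons\<close>

text \<open>\<open>Ba1\<close>, \<open>Ba2\<close>, \<open>Bc\<close> stand for the bosons $a^1$, $a^2$, $c$.\<close>

datatype boson = Ba1 | Ba2 | Bc

fun boson_sign :: "boson \<Rightarrow> complex" where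
  "boson_sign Ba1 = 1"
| "boson_sign Ba2 = -1"
| "boson_sign Bc = 1"

text \<open>
  A basis vector \<open>(\<mu>, M)\<close> is the product of the creation operators \<open>s\<^bsub>-n\<^esub>\<close>, \<open>(s, n)\<close> running through the
  multiset \<open>M\<close>, applied to the vacuum on which the zero mode of the boson \<open>s\<close> has the eigenvalue \<open>\<mu> s\<close>.
\<close>

type_synonym state = "(boson \<Rightarrow> complex) \<times> (boson \<times> nat) multiset"

text \<open>
  The condition on \<open>\<mu>\<close> says that $A^1_0 + c_0$ has integral eigenvalues, i.e. that the currents
  $X^\pm(z)$ expand in integral powers of \<open>z\<close>. It is preserved by all currents and vertex operators below.
\<close>

definition fock :: "state set" where
  "fock = {(\<mu>, M). \<mu> Ba1 + \<mu> Ba2 + \<mu> Bc \<in> \<int> \<and> (\<forall>(s, n) \<in># M. 0 < n)}"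

text \<open>
  Operators are given by their matrix elements: \<open>T b' b\<close> is the coefficient of \<open>b'\<close> in \<open>T\<close> applied to
  \<open>b\<close>. The image of a basis vector may be an infinite linear combination.
\<close>

type_synonym oper = "state \<Rightarrow> state \<Rightarrow> complex"

definition oid :: oper where
  "oid b' b = (if b' = b then 1 else 0)"

definition oprod :: "oper \<Rightarrow> oper \<Rightarrow> oper" (infixr "\<odot>" 70) where
  "(S \<odot> T) b' b = (\<Sum>\<^sub>\<infinity>k\<in>fock. S b' k * T k b)"

definition oscale :: "complex \<Rightarrow> oper \<Rightarrow> oper" where
  "oscale x T = (\<lambda>b' b. x * T b' b)"

primrec opow :: "oper \<Rightarrow> nat \<Rightarrow> oper" where
  "opow T 0 = oid"
| "opow T (Suc n) = T \<odot> opow T n"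

definition oexp :: "oper \<Rightarrow> oper" where
  "oexp T b' b = (\<Sum>\<^sub>\<infinity>n. opow T n b' b / fact n)"

text \<open>
  The mode \<open>s\<^sub>n\<close> of a boson. The factor in the last case is the commutator of \<open>s\<^sub>n\<close> and \<open>s\<^bsub>-n\<^esub>\<close> times the
  number of quanta \<open>(s, n)\<close>, as dictated by the Heisenberg relations.
\<close>

definition mode_op :: "complex \<Rightarrow> boson \<Rightarrow> int \<Rightarrow> oper" where
  "mode_op h s n b' b =
     (if n = 0 then (if b' = b then fst b s else 0)
      else if n < 0 then
        (if b' = (fst b, add_mset (s, nat (- n)) (snd b)) then 1 else 0)
      else
        (if b = (fst b', add_mset (s, nat n) (snd b'))
         then boson_sign s * (qint h n)\<^sup>2 / of_int n * of_nat (count (snd b) (s, nat n)) else 0))"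

text \<open>The operator \<open>exp (\<Sum>s. \<nu> s * Q\<^sub>s)\<close>; it shifts the zero modes since $[s_0, Q_s] = 1$.\<close>

definition shift_op :: "(boson \<Rightarrow> complex) \<Rightarrow> oper" where
  "shift_op \<nu> b' b = (if b' = (\<lambda>s. fst b s + \<nu> s, snd b) then 1 else 0)"

text \<open>The defining relations of the bosons hold on the Fock space.\<close>

definition mode_target :: "complex \<Rightarrow> boson \<Rightarrow> int \<Rightarrow> state \<Rightarrow> state" where
  "mode_target h s n b = (if n = 0 then b
     else if n < 0 then (fst b, add_mset (s, nat (- n)) (snd b))
     else (fst b, snd b - {#(s, nat n)#}))"

definition mode_coef :: "complex \<Rightarrow> boson \<Rightarrow> int \<Rightarrow> state \<Rightarrow> complex" where
  "mode_coef h s n b = (if n = 0 then fst b s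
     else if n < 0 then 1
     else boson_sign s * (qint h n)\<^sup>2 / of_int n * of_nat (count (snd b) (s, nat n)))"

lemma mode_op_target: "mode_op h s n b' b = (if b' = mode_target h s n b then mode_coef h s n b else 0)"
proof -
  have "b = (fst b', add_mset x (snd b')) \<longleftrightarrow> b' = (fst b, snd b - {#x#}) \<and> x \<in># snd b" for x
    by (cases b; cases b') (auto simp: insert_DiffM)
  then show ?thesis
    by (auto simp: mode_op_def mode_target_def mode_coef_def not_in_iff)
qed

lemma mode_target_in_fock: "b \<in> fock \<Longrightarrow> mode_target h s n b \<in> fock"
  by (fastforce simp: fock_def mode_target_def dest: in_diffD)

lemma oprod_mode_op:
  assumes "b \<in> fock"
  shows "(S \<odot> mode_op h s n) b' b = S b' (mode_target h s n b) * mode_coef h s n b"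
proof -
  have "(S \<odot> mode_op h s n) b' b
      = (\<Sum>\<^sub>\<infinity>k\<in>{mode_target h s n b}. S b' k * mode_op h s n k b)"
    unfolding oprod_def
    by (rule infsum_cong_neutral) (auto simp: mode_op_target mode_target_in_fock assms)
  then show ?thesis
    by (simp add: mode_op_target)
qed

lemma mode_op_commutator:
  assumes "b \<in> fock"
  shows "(mode_op h s n \<odot> mode_op h t m - mode_op h t m \<odot> mode_op h s n) b' b =
    (if s = t \<and> n + m = 0 \<and> n \<noteq> 0 then boson_sign s * (qint h n)\<^sup>2 / of_int n * oid b' b else 0)"
proof -
  have comm: "mode_target h s n (mode_target h t m b) = mode_target h t m (mode_target h s n b)"
    if "\<not> (s = t \<and> n + m = 0 \<and> n \<noteq> 0)"
    using that by (auto simp: mode_target_def add_mset_commute diff_add_mset_swap eq_nat_nat_iff)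
  have cc: "mode_coef h s n (mode_target h t m b) * mode_coef h t m b = mode_coef h t m (mode_target h s n b) * mode_coef h s n b"
    if "\<not> (s = t \<and> n + m = 0 \<and> n \<noteq> 0)"
    using that by (auto simp: mode_target_def mode_coef_def)
  have *: "(mode_op h s n \<odot> mode_op h t m - mode_op h t m \<odot> mode_op h s n) b' b
    = (if b' = mode_target h s n (mode_target h t m b) then mode_coef h s n (mode_target h t m b) * mode_coef h t m b else 0)
    - (if b' = mode_target h t m (mode_target h s n b) then mode_coef h t m (mode_target h s n b) * mode_coef h s n b else 0)"
    by (simp add: oprod_mode_op[OF assms] mode_op_target)
  show ?thesis
  proof (cases "s = t \<and> n + m = 0 \<and> n \<noteq> 0")
    case False
    show ?thesis
      unfolding * comm[OF False] cc[OF False] by (simp only: diff_self if_not_P[OF False])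
  next
    case True
    have pos: "(if b' = mode_target h s p (mode_target h s (- p) b)
        then mode_coef h s p (mode_target h s (- p) b) * mode_coef h s (- p) b else 0)
      - (if b' = mode_target h s (- p) (mode_target h s p b)
        then mode_coef h s (- p) (mode_target h s p b) * mode_coef h s p b else 0)
      = boson_sign s * (qint h p)\<^sup>2 / of_int p * oid b' b" if "p > 0" for p
    proof -
      let ?c = "boson_sign s * (qint h p)\<^sup>2 / of_int p" and ?k = "count (snd b) (s, nat p)"
      have 1: "mode_target h s p (mode_target h s (- p) b) = b"
        using that by (simp add: mode_target_def)
      have 2: "mode_coef h s p (mode_target h s (- p) b) * mode_coef h s (- p) b = ?c * (1 + of_nat ?k)"
        using that by (simp add: mode_target_def mode_coef_def)
      have 3: "mode_coef h s (- p) (mode_target h s p b) * mode_coef h s p b = ?c * of_nat ?k"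
        using that by (simp add: mode_coef_def)
      have 4: "mode_target h s (- p) (mode_target h s p b) = b" if "?k \<noteq> 0"
      proof -
        from that have "(s, nat p) \<in># snd b"
          by (simp add: not_in_iff)
        then show ?thesis
          using \<open>p > 0\<close> by (simp add: mode_target_def)
      qed
      have 5: "(if b' = mode_target h s (- p) (mode_target h s p b) then ?c * of_nat ?k else 0)
          = (if b' = b then ?c * of_nat ?k else 0)"
        by (cases "?k = 0") (simp_all add: 4)
      show ?thesis
        unfolding 1 2 3 5 by (simp add: oid_def distrib_left)
    qed
    have qint_uminus: "qint h (- n) = - qint h n"
      by (simp add: qint_def minus_divide_left)
    from True have m: "m = - n" and t: "t = s" and n: "n > 0 \<or> - n > 0" by auto
    from n show ?thesis
    proof
      assume "n > 0"
      from trans[OF *[unfolded m t] pos[OF this]] \<open>n > 0\<close> show ?thesis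
        unfolding m t by simp
    next
      assume "- n > 0"
      have neg: "x - y = - z" if "y - x = z" for x y z :: complex
        using that by auto
      from trans[OF *[unfolded m t] neg[OF pos[OF \<open>- n > 0\<close>, unfolded minus_minus]]] \<open>- n > 0\<close>
      show ?thesis
        unfolding m t by (simp add: qint_uminus)
    qed
  qed
qed

lemma mode_op_shift_commutator:
  assumes "b \<in> fock" and "\<nu> Ba1 + \<nu> Ba2 + \<nu> Bc \<in> \<int>"
  shows "(mode_op h s n \<odot> shift_op \<nu> - shift_op \<nu> \<odot> mode_op h s n) b' b =
    (if n = 0 then \<nu> s * shift_op \<nu> b' b else 0)"
proof -
  let ?b = "(\<lambda>s. fst b s + \<nu> s, snd b)"
  have "fst b Ba1 + fst b Ba2 + fst b Bc + (\<nu> Ba1 + \<nu> Ba2 + \<nu> Bc) \<in> \<int>"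
    by (rule Ints_add) (use assms in \<open>auto simp: fock_def\<close>)
  then have b: "?b \<in> fock"
    using assms(1) by (auto simp: fock_def algebra_simps)
  have "(mode_op h s n \<odot> shift_op \<nu>) b' b
      = (\<Sum>\<^sub>\<infinity>k\<in>{?b}. mode_op h s n b' k * shift_op \<nu> k b)"
    unfolding oprod_def
    by (rule infsum_cong_neutral) (use b in \<open>auto simp: shift_op_def\<close>)
  also have "\<dots> = mode_op h s n b' ?b"
    by (simp add: shift_op_def)
  finally have 1: "(mode_op h s n \<odot> shift_op \<nu>) b' b = mode_op h s n b' ?b" .
  show ?thesis
    unfolding minus_apply 1 oprod_mode_op[OF assms(1)] unfolding mode_op_target
    by (cases "n = 0"; cases "n < 0")
      (simp_all add: shift_op_def mode_target_def mode_coef_def distrib_right)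
qed

section \<open>Formal linear combinations of the generators and normal ordering\<close>

text \<open>A possibly infinite formal linear combination of the \<open>Q\<^sub>s\<close> and of the modes \<open>s\<^sub>n\<close>.\<close>

datatype gen = Q boson | Mode boson int

type_synonym lin = "gen \<Rightarrow> complex"

definition gen :: "gen \<Rightarrow> lin" where
  "gen g = (\<lambda>g'. if g' = g then 1 else 0)"

definition lscale :: "complex \<Rightarrow> lin \<Rightarrow> lin" where
  "lscale x L = (\<lambda>g. x * L g)"

definition lin_op :: "complex \<Rightarrow> int set \<Rightarrow> lin \<Rightarrow> oper" where
  "lin_op h N L b' b = (\<Sum>\<^sub>\<infinity>(s, n)\<in>UNIV \<times> N. L (Mode s n) * mode_op h s n b' b)"

text \<open>The normally ordered exponential \<open>:exp L:\<close>.\<close>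

definition nexp :: "complex \<Rightarrow> lin \<Rightarrow> oper" where
  "nexp h L = shift_op (\<lambda>s. L (Q s)) \<odot> oexp (lin_op h {..<0} L)
                \<odot> oexp (lin_op h {0} L) \<odot> oexp (lin_op h {0<..} L)"

section \<open>Currents\<close>

definition A1 :: "int \<Rightarrow> lin" where
  "A1 n = gen (Mode Ba1 n) + gen (Mode Ba2 n)"

definition A2 :: "complex \<Rightarrow> int \<Rightarrow> lin" where
  "A2 h n = lscale ((exp (of_int n * h) + exp (- (of_int n * h))) / 2)
              (gen (Mode Ba1 n) - gen (Mode Ba2 n))"

definition QA1 :: lin where
  "QA1 = gen (Q Ba1) - gen (Q Ba2)"

definition QA2 :: lin where
  "QA2 = gen (Q Ba1) + gen (Q Ba2)"

definition A1_dual :: "complex \<Rightarrow> int \<Rightarrow> lin" where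
  "A1_dual h n = (if n = 0 then lscale (1 / 2) (A2 h 0)
                  else lscale (1 / (exp (of_int n * h) + exp (- (of_int n * h)))) (A2 h n))"

definition QA1_dual :: lin where
  "QA1_dual = lscale (1 / 2) QA2"

definition current :: "complex \<Rightarrow> lin \<Rightarrow> (int \<Rightarrow> lin) \<Rightarrow> complex \<Rightarrow> complex \<Rightarrow> lin" where
  "current h Q0 M \<kappa> \<zeta> = (\<lambda>g. Q0 g + \<zeta> * M 0 g
     - (\<Sum>\<^sub>\<infinity>n\<in>UNIV - {0}. M n g / qint h n * exp (\<kappa> * of_int \<bar>n\<bar> * h) * exp (- (of_int n * \<zeta>))))"

text \<open>$H^1(z;\kappa)$, $H^{*,1}(z;\kappa)$ and $c(z)$ at \<open>\<zeta> = ln z\<close>.\<close>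

definition H1 :: "complex \<Rightarrow> complex \<Rightarrow> complex \<Rightarrow> lin" where
  "H1 h \<kappa> \<zeta> = current h QA1 A1 \<kappa> \<zeta>"

definition H1_dual :: "complex \<Rightarrow> complex \<Rightarrow> complex \<Rightarrow> lin" where
  "H1_dual h \<kappa> \<zeta> = current h QA1_dual (A1_dual h) \<kappa> \<zeta>"

definition c_field :: "complex \<Rightarrow> complex \<Rightarrow> lin" where
  "c_field h \<zeta> = current h (gen (Q Bc)) (\<lambda>n. gen (Mode Bc n)) 0 \<zeta>"

definition qderiv :: "complex \<Rightarrow> (complex \<Rightarrow> oper) \<Rightarrow> complex \<Rightarrow> oper" where
  "qderiv h F \<zeta> = (\<lambda>b' b. (F (\<zeta> + h) b' b - F (\<zeta> - h) b' b) / ((exp h - exp (- h)) * exp \<zeta>))"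

definition X_plus :: "complex \<Rightarrow> complex \<Rightarrow> oper" where
  "X_plus h \<zeta> = nexp h (H1 h (- 1 / 2) \<zeta> + c_field h \<zeta>)"

text \<open>
  The \<open>q\<close>-derivative acts only on the factor \<open>exp (- c(z))\<close> inside the normal ordering; hence the
  separate variable \<open>\<xi>\<close>, here and in \<open>psi_dual\<close>.
\<close>

definition X_minus :: "complex \<Rightarrow> complex \<Rightarrow> oper" where
  "X_minus h \<zeta> = qderiv h (\<lambda>\<xi>. nexp h (- H1 h (1 / 2) \<zeta> - c_field h \<xi>)) \<zeta>"

text \<open>
  The mode \<open>X\<^sub>n\<close> of \<open>X(z) = \<Sum>n. X\<^sub>n z\<^bsup>-n-1\<^esup>\<close>, as the integral of \<open>z\<^sup>n X(z) dz / (2 \<pi> \<i>)\<close> over the unit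
  circle, parametrised by \<open>\<zeta> = 2 \<pi> \<i> t\<close>.
\<close>

definition fourier_mode :: "(complex \<Rightarrow> oper) \<Rightarrow> int \<Rightarrow> oper" where
  "fourier_mode X n b' b = integral {0..1} (\<lambda>t::real.
     exp (of_int (n + 1) * (2 * of_real pi * \<i> * of_real t)) * X (2 * of_real pi * \<i> * of_real t) b' b)"

definition e1 :: "complex \<Rightarrow> oper" where
  "e1 h = fourier_mode (X_plus h) 0"

definition f1 :: "complex \<Rightarrow> oper" where
  "f1 h = fourier_mode (X_minus h) 0"

section \<open>Vertex operators and R-matrix\<close>

text \<open>The grading of the index \<open>j \<in> {1, 2}\<close>.\<close>

definition grade :: "nat \<Rightarrow> nat" where
  "grade j = (if j = 2 then 1 else 0)"

text \<open>$[S,T]_x$ for homogeneous \<open>S\<close>, \<open>T\<close> of degrees \<open>s\<close>, \<open>t\<close>.\<close>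

definition bracket :: "nat \<Rightarrow> nat \<Rightarrow> complex \<Rightarrow> oper \<Rightarrow> oper \<Rightarrow> oper" where
  "bracket s t x S T = S \<odot> T - oscale ((- 1) ^ (s * t) * x) (T \<odot> S)"

definition phi :: "complex \<Rightarrow> nat \<Rightarrow> complex \<Rightarrow> oper" where
  "phi h i \<zeta> =
     (let phi2 = nexp h (- H1_dual h (1 / 2) (\<zeta> + h) + H1 h (1 / 2) (\<zeta> + 2 * h) + c_field h (\<zeta> + h))
                   \<odot> oexp (oscale (- (\<i> * of_real pi)) (mode_op h Bc 0))
      in if i = 2 then phi2 else oscale (- 1) (bracket (grade 2) 1 (exp (- h)) phi2 (f1 h)))"

text \<open>
  \<open>X\<^sup>-\<^sub>0\<close> lowers \<open>c\<^sub>0\<close> by \<open>1\<close>, so moving \<open>exp (- \<i> \<pi> c\<^sub>0)\<close> past it costs a factor \<open>-1\<close>. With the present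
  conventions $\phi_i(z) \phi^*_i(z)$ is therefore \<open>+q\<close>, not \<open>-q\<close>: the vacuum expectation value of
  $\phi_2(z_1) f_1 \phi^*_1(z_2)$ is \<open>-q\<close>.
\<close>

definition phi_dual :: "complex \<Rightarrow> nat \<Rightarrow> complex \<Rightarrow> oper" where
  "phi_dual h i \<zeta> =
     (let phi1 = nexp h (H1_dual h (1 / 2) (\<zeta> + h))
                   \<odot> oexp (oscale (\<i> * of_real pi) (mode_op h Bc 0))
      in if i = 1 then phi1 else oscale (exp (- h)) (bracket (grade 1) 1 (exp h) phi1 (f1 h)))"

definition psi_dual :: "complex \<Rightarrow> nat \<Rightarrow> complex \<Rightarrow> oper" where
  "psi_dual h i \<zeta> =
     (let psi2 = qderiv h (\<lambda>\<xi>. nexp h (H1_dual h (- 1 / 2) (\<zeta> + h) - H1 h (- 1 / 2) \<zeta>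
                                         - c_field h (\<xi> + h))) \<zeta>
                   \<odot> oexp (oscale (\<i> * of_real pi) (mode_op h Bc 0))
      in if i = 2 then psi2 else oscale (exp h) (bracket (grade 2) 1 (exp (- h)) psi2 (e1 h)))"

text \<open>\<open>Rmat q z i j k l\<close> is $R^{ij}_{kl}(z)$.\<close>

definition Rmat :: "complex \<Rightarrow> complex \<Rightarrow> nat \<Rightarrow> nat \<Rightarrow> nat \<Rightarrow> nat \<Rightarrow> complex" where
  "Rmat q z i j k l =
     (if (i, j, k, l) = (1, 1, 1, 1) then 1
      else if (i, j, k, l) = (2, 2, 2, 2) then (z * inverse q - q) / (z * q - inverse q)
      else if (i, j, k, l) = (1, 2, 1, 2) \<or> (i, j, k, l) = (2, 1, 2, 1)
        then (z - 1) / (z * q - inverse q)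
      else if (i, j, k, l) = (2, 1, 1, 2) then (q - inverse q) / (z * q - inverse q)
      else if (i, j, k, l) = (1, 2, 2, 1) then (q - inverse q) * z / (z * q - inverse q)
      else 0)"

section \<open>Products of vertex operators\<close>

text \<open>
  The matrix elements of \<open>S(z\<^sub>1) T(z\<^sub>2)\<close> are sums over intermediate states which converge only for
  \<open>\<bar>z\<^sub>1\<bar>\<close> large compared with \<open>\<bar>z\<^sub>2\<bar>\<close>; the product is their meromorphic continuation. The predicate below
  says that \<open>F\<close> is this product, as a function of \<open>\<zeta>\<^sub>1 = ln z\<^sub>1\<close> and \<open>\<zeta>\<^sub>2 = ln z\<^sub>2\<close>. It determines \<open>F\<close> up to
  the values on a discrete set (in \<open>\<zeta>\<^sub>1\<close>, for given \<open>\<zeta>\<^sub>2\<close>, and vice versa).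
\<close>

definition continued_product ::
    "(complex \<Rightarrow> oper) \<Rightarrow> (complex \<Rightarrow> oper) \<Rightarrow> (complex \<Rightarrow> complex \<Rightarrow> oper) \<Rightarrow> bool" where
  "continued_product S T F \<longleftrightarrow>
     (\<forall>b'\<in>fock. \<forall>b\<in>fock.
        (\<forall>\<zeta>2. (\<lambda>\<zeta>1. F \<zeta>1 \<zeta>2 b' b) meromorphic_on UNIV) \<and>
        (\<forall>\<zeta>1. (\<lambda>\<zeta>2. F \<zeta>1 \<zeta>2 b' b) meromorphic_on UNIV) \<and>
        (\<exists>C::real. \<forall>\<zeta>1 \<zeta>2. Re \<zeta>1 > Re \<zeta>2 + C \<longrightarrow>
           ((\<lambda>k. S \<zeta>1 b' k * T \<zeta>2 k b) has_sum F \<zeta>1 \<zeta>2 b' b) fock))"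

end

theory Submission
  imports Defs
begin

text \<open>
  Every vertex operator and current is a linear combination of normally ordered exponentials, and
  \<open>:exp L1: :exp L2:\<close> is \<open>:exp (L1 + L2):\<close> times an explicit rational function of \<open>z\<^sub>1\<close>, \<open>z\<^sub>2\<close>. Convergence of longer
  products is controlled by a majorant of the same exponential form. A mode \<open>f\<close> of a current is a contour
  integral, so $S(z_1) f T(z_2)$ is obtained from a partial fraction decomposition of the product of the contractions
  and is again meromorphic; as \<open>f\<close> has finitely many nonzero elements in each row and column, the remaining
  products are finite sums.

  With \<open>P\<close> the continuation of $\phi_2(z_1) \phi_2(z_2)$ and \<open>G\<close> that of $\phi_2(z_1) f_1 \phi_2(z_2)$, all products of the $\phi_i$ are
  expressed by \<open>P\<close>, \<open>G\<close> and $f_1$. Since $f_1^2 = 0$, $P(z_2,z_1) = \rho P(z_1,z_2)$ and $\phi_2$ satisfies an exchange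
  relation with two adjacent modes of $X^-$, elimination of the second mode gives
  $G(z_2,z_1) - G(z_1,z_2)$ as a multiple of $f_1 P + P f_1$, and the R-matrix relations are linear algebra. The case of
  $\psi^*_i$ is the same with $e_1$. For the mixed products $e_1$ anticommutes with $\phi_2$, $f_1$ anticommutes with $\psi^*_2$,
  and $e_1 f_1 + f_1 e_1$ is diagonal. In the invertibility relation \<open>P\<close> vanishes at $z_1 = z_2$, and \<open>G\<close> is there a delta
  function whose exponent is \<open>0\<close>.
\<close>

text \<open>What makes the contractions rational is that \<open>a^1\<close> and \<open>a^2\<close>
  have opposite commutators: the logarithms with coefficient 1/4, from two factors
  \<open>H^{*,1}\<close>, and those from two factors \<open>H^1\<close> cancel between the two
  bosons. Only the pairings of \<open>H^{*,1}\<close> with \<open>H^1\<close> and of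
  \<open>c\<close> with \<open>c\<close> survive, and their exponents are integers.

  The obstacle that shapes everything else is that operators are infinite matrices. Their products
  are infinite sums, so associativity and distributivity need convergence, and the products in the
  orders z_1, z_2 and z_2, z_1 converge in disjoint regions. Identities between products are
  therefore first proved in a half-plane where all groupings converge and then carried over by the
  identity theorem, at the price of a sparse exceptional set.

  Since |q| may be 1, powers of q cannot supply convergence. The factors [n]_q of creation and
  annihilation parts cancel against each other instead, and convergence comes only from a gap
  between Re \<zeta>_1 and Re \<zeta>_2 that exceeds a fixed multiple of |h|.\<close>

section \<open>Exponential series indexed by multisets\<close>

definition mfact :: "'b multiset \<Rightarrow> nat" where
  "mfact N = (\<Prod>x\<in>set_mset N. fact (count N x))"

text \<open>This is the coefficient of the monomial \<open>N\<close> in the exponential of the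
  linear form with coefficients \<open>u\<close>: a letter x of multiplicity m contributes u(x)^m /
  m!.\<close>

definition mexp :: "('b \<Rightarrow> 'a::{real_normed_field,banach}) \<Rightarrow> 'b multiset \<Rightarrow> 'a" where
  "mexp u N = (\<Prod>x\<in>#N. u x) / of_nat (mfact N)"

lemma mfact_pos [simp]: "mfact N > 0"
  by (simp add: mfact_def prod_pos)

lemma mfact_neq_0 [simp]: "mfact N \<noteq> 0"
  using mfact_pos[of N] by simp

lemma mfact_empty [simp]: "mfact {#} = 1"
  by (simp add: mfact_def)

lemma mfact_superset:
  assumes "finite A" "set_mset N \<subseteq> A"
  shows "mfact N = (\<Prod>x\<in>A. fact (count N x))"
  unfolding mfact_def using assms
  by (intro prod.mono_neutral_left) (auto simp: not_in_iff)

lemma mfact_add_mset: "mfact (add_mset x N) = (count N x + 1) * mfact N"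
proof -
  let ?A = "insert x (set_mset N)"
  have "mfact (add_mset x N) = (\<Prod>y\<in>?A. fact (count (add_mset x N) y))"
    by (rule mfact_superset) auto
  also have "\<dots> = fact (count N x + 1) * (\<Prod>y\<in>?A - {x}. fact (count N y))"
    by (subst prod.remove[of _ x]) (auto intro!: prod.cong arg_cong2[of _ _ _ _ "(*)"] split: if_splits)
  also have "\<dots> = (count N x + 1) * (\<Prod>y\<in>?A. fact (count N y))"
    by (subst (2) prod.remove[of _ x]) (auto simp: algebra_simps)
  also have "(\<Prod>y\<in>?A. fact (count N y)) = mfact N"
    by (rule mfact_superset[symmetric]) auto
  finally show ?thesis .
qed

lemma mexp_empty [simp]: "mexp u {#} = 1"
  by (simp add: mexp_def)

lemma mexp_add_mset: "of_nat (count N x + 1) * mexp u (add_mset x N) = u x * mexp u N"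
  unfolding mexp_def mfact_add_mset of_nat_mult
  by (simp add: divide_simps del: of_nat_Suc of_nat_add)

lemma mexp_remove:
  assumes "x \<in># N"
  shows "of_nat (count N x) * mexp u N = u x * mexp u (N - {#x#})"
  using mexp_add_mset[of "N - {#x#}" x u] assms by (simp del: of_nat_Suc)

lemma mexp_zero_at: "x \<in># N \<Longrightarrow> u x = 0 \<Longrightarrow> mexp u N = 0"
  by (force simp: mexp_def)

lemma mexp_zero: "mexp (\<lambda>_. 0) N = (if N = {#} then 1 else 0)"
  by (auto intro: mexp_zero_at elim: multiset_nonemptyE)

text \<open>Euler's homogeneity relation: the degree operator is the sum of all a_x d/da_x, and
  d/da_x multiplies the exponential by \<open>u x\<close>. It drives the inductions on the size of a
  multiset and on powers of operators below.\<close>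

lemma size_mexp:
  "of_nat (size N) * mexp u N = (\<Sum>x\<in>set_mset N. u x * mexp u (N - {#x#}))"
  unfolding size_multiset_overloaded_eq of_nat_sum sum_distrib_right
  by (rule sum.cong) (simp_all add: mexp_remove)

lemma mexp_mult: "mexp (\<lambda>x. u x * w x) N = mexp u N * (\<Prod>x\<in>#N. w x)"
  by (simp add: mexp_def prod_mset.distrib)

lemma norm_prod_mset: "norm (\<Prod>x\<in>#N. u x) = (\<Prod>x\<in>#N. norm (u x :: 'a::real_normed_field))"
  by (induction N) (auto simp: norm_mult)

lemma norm_mexp: "norm (mexp u N) = mexp (\<lambda>x. norm (u x)) N"
  by (simp add: mexp_def norm_divide norm_prod_mset)

lemma mexp_nonneg: "(\<And>x. 0 \<le> u x) \<Longrightarrow> 0 \<le> mexp u N" for u :: "'b \<Rightarrow> real"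
  using norm_ge_zero[of "mexp u N"] unfolding norm_mexp by simp

lemma prod_mset_mono:
  "(\<And>x. 0 \<le> u x \<and> u x \<le> w x) \<Longrightarrow> 0 \<le> (\<Prod>x\<in>#N. u x) \<and> (\<Prod>x\<in>#N. u x) \<le> (\<Prod>x\<in>#N. w x)"
  for u :: "'b \<Rightarrow> real"
proof (induction N)
  case (add x N)
  then show ?case
    using add.prems[of x] order_trans by (auto intro!: mult_mono mult_nonneg_nonneg)
qed auto

lemma mexp_mono: "(\<And>x. 0 \<le> u x \<and> u x \<le> w x) \<Longrightarrow> mexp u N \<le> mexp w N"
  for u :: "'b \<Rightarrow> real"
  unfolding mexp_def by (intro divide_right_mono) (use prod_mset_mono[of u w N] in auto)

lemma finite_submsets [simp]: "finite {K. K \<subseteq># (N::'b multiset)}"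
proof (induction N)
  case (add x N)
  have "{K. K \<subseteq># add_mset x N} \<subseteq> {K. K \<subseteq># N} \<union> add_mset x ` {K. K \<subseteq># N}"
  proof
    fix K assume "K \<in> {K. K \<subseteq># add_mset x N}"
    then have K: "K \<subseteq># add_mset x N" by simp
    show "K \<in> {K. K \<subseteq># N} \<union> add_mset x ` {K. K \<subseteq># N}"
    proof (cases "x \<in># K")
      case True
      then have "K = add_mset x (K - {#x#})" by simp
      moreover have "K - {#x#} \<subseteq># N"
        using K by (simp add: subset_eq_diff_conv)
      ultimately show ?thesis by blast
    next
      case False
      then have "K \<subseteq># N"
        using K by (metis add_mset_remove_trivial diff_single_trivial subset_eq_diff_conv add_mset_add_single)
      then show ?thesis by simp
    qed
  qed
  then show ?case
    using add finite_subset by blast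
qed auto

text \<open>Multiplying by the size of \<open>N\<close> removes one element from either factor.\<close>

lemma mexp_add:
  fixes u w :: "'b \<Rightarrow> 'a::{real_normed_field,banach}"
  shows "mexp (\<lambda>x. u x + w x) N = (\<Sum>K\<in>{K. K \<subseteq># N}. mexp u (N - K) * mexp w K)"
proof (induction "size N" arbitrary: N)
  case 0
  then show ?case by simp
next
  case (Suc n)
  let ?S = "\<lambda>N. \<Sum>K\<in>{K. K \<subseteq># N}. mexp u (N - K) * mexp w K"
  have IH: "mexp (\<lambda>x. u x + w x) (N - {#x#}) = ?S (N - {#x#})" if "x \<in># N" for x
    using Suc that by (auto simp: size_Diff_singleton)
  have 1: "(\<Sum>K\<in>{K. K \<subseteq># N}. of_nat (size (N - K)) * mexp u (N - K) * mexp w K)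
      = (\<Sum>x\<in>set_mset N. u x * ?S (N - {#x#}))"
  proof -
    have "(\<Sum>K\<in>{K. K \<subseteq># N}. of_nat (size (N - K)) * mexp u (N - K) * mexp w K)
       = (\<Sum>K\<in>{K. K \<subseteq># N}. \<Sum>x\<in>{x\<in>set_mset N. x \<in># N - K}. u x * (mexp u (N - K - {#x#}) * mexp w K))"
      unfolding size_mexp sum_distrib_right
      by (intro sum.cong refl) (auto dest: in_diffD simp: mult_ac)
    also have "\<dots> = (\<Sum>x\<in>set_mset N. \<Sum>K\<in>{K\<in>{K. K \<subseteq># N}. x \<in># N - K}. u x * (mexp u (N - K - {#x#}) * mexp w K))"
      by (rule sum.swap_restrict) auto
    also have "\<dots> = (\<Sum>x\<in>set_mset N. u x * ?S (N - {#x#}))"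
      unfolding sum_distrib_left
    proof (rule sum.cong[OF refl])
      fix x assume x: "x \<in># N"
      have "{K \<in> {K. K \<subseteq># N}. x \<in># N - K} = {K. K \<subseteq># N - {#x#}}"
      proof (intro set_eqI iffI)
        fix K assume "K \<in> {K \<in> {K. K \<subseteq># N}. x \<in># N - K}"
        then show "K \<in> {K. K \<subseteq># N - {#x#}}"
          by (auto simp: subseteq_mset_def in_diff_count le_diff_conv2)
      next
        fix K assume K: "K \<in> {K. K \<subseteq># N - {#x#}}"
        then have "count K x \<le> count N x - 1"
          by (auto simp: subseteq_mset_def dest: spec[of _ x])
        moreover have "count N x > 0" using x by simp
        ultimately have "count K x < count N x" by linarith
        with K show "K \<in> {K \<in> {K. K \<subseteq># N}. x \<in># N - K}"
          by (auto simp: in_diff_count intro: subset_mset.order_trans)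
      qed
      then show "(\<Sum>K\<in>{K\<in>{K. K \<subseteq># N}. x \<in># N - K}. u x * (mexp u (N - K - {#x#}) * mexp w K))
        = (\<Sum>K\<in>{K. K \<subseteq># N - {#x#}}. u x * (mexp u (N - {#x#} - K) * mexp w K))"
        by (intro sum.cong) (simp_all add: diff_right_commute)
    qed
    finally show ?thesis .
  qed
  have 2: "(\<Sum>K\<in>{K. K \<subseteq># N}. mexp u (N - K) * (of_nat (size K) * mexp w K))
      = (\<Sum>x\<in>set_mset N. w x * ?S (N - {#x#}))"
  proof -
    have "(\<Sum>K\<in>{K. K \<subseteq># N}. mexp u (N - K) * (of_nat (size K) * mexp w K))
       = (\<Sum>K\<in>{K. K \<subseteq># N}. \<Sum>x\<in>{x\<in>set_mset N. x \<in># K}. w x * (mexp u (N - K) * mexp w (K - {#x#})))"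
      unfolding size_mexp sum_distrib_left
      by (intro sum.cong refl) (auto dest: mset_subset_eqD simp: mult_ac)
    also have "\<dots> = (\<Sum>x\<in>set_mset N. \<Sum>K\<in>{K\<in>{K. K \<subseteq># N}. x \<in># K}. w x * (mexp u (N - K) * mexp w (K - {#x#})))"
      by (rule sum.swap_restrict) auto
    also have "\<dots> = (\<Sum>x\<in>set_mset N. w x * ?S (N - {#x#}))"
      unfolding sum_distrib_left
    proof (rule sum.cong[OF refl])
      fix x assume x: "x \<in># N"
      show "(\<Sum>K\<in>{K\<in>{K. K \<subseteq># N}. x \<in># K}. w x * (mexp u (N - K) * mexp w (K - {#x#})))
        = (\<Sum>K\<in>{K. K \<subseteq># N - {#x#}}. w x * (mexp u (N - {#x#} - K) * mexp w K))"
        by (rule sum.reindex_bij_witness[of _ "add_mset x" "\<lambda>K. K - {#x#}"])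
          (use x in \<open>auto simp: subset_eq_diff_conv insert_subset_eq_iff\<close>)
    qed
    finally show ?thesis .
  qed
  have "of_nat (size N) * ?S N = (\<Sum>K\<in>{K. K \<subseteq># N}. of_nat (size (N - K)) * mexp u (N - K) * mexp w K
        + mexp u (N - K) * (of_nat (size K) * mexp w K))"
    unfolding sum_distrib_left
  proof (intro sum.cong refl)
    fix K assume "K \<in> {K. K \<subseteq># N}"
    then have "size N = size (N - K) + size K"
      by (metis mem_Collect_eq size_union subset_mset.diff_add)
    then show "of_nat (size N) * (mexp u (N - K) * mexp w K)
      = of_nat (size (N - K)) * mexp u (N - K) * mexp w K + mexp u (N - K) * (of_nat (size K) * mexp w K)"
      by (simp add: algebra_simps)
  qed
  also have "\<dots> = (\<Sum>x\<in>set_mset N. (u x + w x) * ?S (N - {#x#}))"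
    unfolding sum.distrib 1 2 by (simp add: sum.distrib distrib_right)
  also have "\<dots> = of_nat (size N) * mexp (\<lambda>x. u x + w x) N"
    unfolding size_mexp by (intro sum.cong refl) (simp add: IH)
  finally have "of_nat (size N) * ?S N = of_nat (size N) * mexp (\<lambda>x. u x + w x) N" .
  moreover have "(of_nat (size N) :: 'a) \<noteq> 0"
    by (simp add: Suc.hyps(2)[symmetric] del: of_nat_Suc)
  ultimately show ?case by simp
qed

text \<open>The multinomial theorem in infinitely many variables, for the part of degree
  \<open>n\<close>. The induction multiplies this part by the linear form and collects pairs
  according to their union; absolute summability is carried along because the regrouping of the
  double series rests on it.\<close>

lemma has_sum_mexp_size:
  fixes w :: "'b \<Rightarrow> 'a::{real_normed_field,banach}"
  assumes "(\<lambda>x. norm (w x)) summable_on UNIV"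
  shows "(mexp w has_sum (infsum w UNIV) ^ n / fact n) {N. size N = n} \<and>
         (\<lambda>N. norm (mexp w N)) summable_on {N. size N = n}"
proof (induction n)
  case 0
  have "{N. size N = 0} = {{#} :: 'b multiset}" by auto
  then show ?case by (auto intro: has_sum_finiteI)
next
  case (Suc n)
  let ?s = "infsum w UNIV"
  let ?B = "{N :: 'b multiset. size N = n}" and ?B' = "{N :: 'b multiset. size N = Suc n}"
  have sw: "w summable_on UNIV" using assms by (rule abs_summable_summable)
  have abs: "(\<lambda>(x,N). norm (w x * mexp w N)) summable_on UNIV \<times> ?B"
  proof -
    have "(\<lambda>(x,N). norm (w x) * norm (mexp w N)) summable_on UNIV \<times> ?B"
    proof (rule summable_on_SigmaI)
      fix x
      show "((\<lambda>N. case (x, N) of (x, N) \<Rightarrow> norm (w x) * norm (mexp w N)) has_sum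
          norm (w x) * infsum (\<lambda>N. norm (mexp w N)) ?B) ?B"
        using Suc by (auto intro!: has_sum_cmult_right)
      show "(\<lambda>x. norm (w x) * infsum (\<lambda>N. norm (mexp w N)) ?B) summable_on UNIV"
        using assms by (rule summable_on_cmult_left)
    qed auto
    then show ?thesis by (simp add: case_prod_unfold norm_mult)
  qed
  have hs: "((\<lambda>(x,N). w x * mexp w N) has_sum ?s * (?s ^ n / fact n)) (UNIV \<times> ?B)"
  proof (rule has_sum_SigmaI)
    fix x show "((\<lambda>y. case (x, y) of (x, N) \<Rightarrow> w x * mexp w N) has_sum w x * (?s ^ n / fact n)) ?B"
      using has_sum_cmult_right[OF conjunct1[OF Suc], of "w x"] by simp
  next
    show "((\<lambda>x. w x * (?s ^ n / fact n)) has_sum ?s * (?s ^ n / fact n)) UNIV"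
      by (rule has_sum_cmult_left) (use sw in simp)
    show "(\<lambda>(x, N). w x * mexp w N) summable_on UNIV \<times> ?B"
      using abs_summable_summable[of "\<lambda>(x,N). w x * mexp w N"] abs by (simp add: case_prod_unfold)
  qed
  \<comment> \<open>A multiset of size \<open>Suc n\<close> is reached once for each of its distinct
    elements, and \<open>size_mexp\<close> evaluates exactly this finite inner sum.\<close>
  have hs': "((\<lambda>(N,x). w x * mexp w (N - {#x#})) has_sum ?s * (?s ^ n / fact n)) (Sigma ?B' set_mset)"
    by (rule iffD1[OF has_sum_reindex_bij_witness[of _ "\<lambda>(N,x). (x, N - {#x#})" "\<lambda>(x,N). (add_mset x N, x)"] hs])
      (auto simp: size_Diff_singleton)
  have abs': "(\<lambda>(N,x). norm (w x * mexp w (N - {#x#}))) summable_on (Sigma ?B' set_mset)"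
    by (rule iffD1[OF summable_on_reindex_bij_witness[of _ "\<lambda>(N,x). (x, N - {#x#})" "\<lambda>(x,N). (add_mset x N, x)"] abs])
      (auto simp: size_Diff_singleton)
  have 1: "((\<lambda>N. of_nat (Suc n) * mexp w N) has_sum ?s * (?s ^ n / fact n)) ?B'"
  proof (rule has_sum_SigmaD[OF hs'])
    fix N :: "'b multiset" assume N: "N \<in> ?B'"
    then have "(of_nat (Suc n) :: 'a) * mexp w N = (\<Sum>x\<in>set_mset N. w x * mexp w (N - {#x#}))"
      using size_mexp[of N w] by simp
    then show "((\<lambda>y. case (N, y) of (N, x) \<Rightarrow> w x * mexp w (N - {#x#})) has_sum of_nat (Suc n) * mexp w N) (set_mset N)"
      by (auto intro: has_sum_finiteI)
  qed
  have "((\<lambda>N. inverse (of_nat (Suc n)) * (of_nat (Suc n) * mexp w N))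
     has_sum inverse (of_nat (Suc n)) * (?s * (?s ^ n / fact n))) ?B'"
    by (rule has_sum_cmult_right[OF 1])
  moreover have "inverse (of_nat (Suc n)) * (of_nat (Suc n) * mexp w N) = mexp w N" for N
    by (simp del: of_nat_Suc add: field_simps)
  moreover have "inverse (of_nat (Suc n)) * (?s * (?s ^ n / fact n)) = ?s ^ Suc n / fact (Suc n)"
    by (simp del: of_nat_Suc add: field_simps)
  ultimately have A: "(mexp w has_sum ?s ^ Suc n / fact (Suc n)) ?B'" by (simp only:)
  have "(\<lambda>N. norm (of_nat (Suc n) * mexp w N)) summable_on ?B'"
  proof -
    have "(\<lambda>N. infsum (\<lambda>x. norm (w x * mexp w (N - {#x#}))) (set_mset N)) summable_on ?B'"
      using summable_on_Sigma_banach[OF abs'] by simp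
    then have "(\<lambda>N. \<Sum>x\<in>set_mset N. norm (w x * mexp w (N - {#x#}))) summable_on ?B'" by simp
    then show ?thesis
    proof (rule summable_on_comparison_test)
      fix N :: "'b multiset" assume N: "N \<in> ?B'"
      have "of_nat (Suc n) * mexp w N = (\<Sum>x\<in>set_mset N. w x * mexp w (N - {#x#}))"
        using size_mexp[of N w] N by simp
      then show "norm (of_nat (Suc n) * mexp w N) \<le> (\<Sum>x\<in>set_mset N. norm (w x * mexp w (N - {#x#})))"
        by (simp only: norm_sum)
    qed auto
  qed
  then have "(\<lambda>N. inverse (norm (of_nat (Suc n) :: 'a)) * norm (of_nat (Suc n) * mexp w N)) summable_on ?B'"
    by (rule summable_on_cmult_right)
  moreover have "inverse (norm (of_nat (Suc n) :: 'a)) * norm (of_nat (Suc n) * mexp w N) = norm (mexp w N)" for N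
    by (simp del: of_nat_Suc add: norm_mult)
  ultimately show ?case using A by (simp only: simp_thms)
qed

lemma has_sum_mexp:
  fixes w :: "'b \<Rightarrow> 'a::{real_normed_field,banach}"
  assumes "(\<lambda>x. norm (w x)) summable_on UNIV"
  shows "(mexp w has_sum exp (infsum w UNIV)) UNIV"
    and "(\<lambda>N. norm (mexp w N)) summable_on UNIV"
proof -
  let ?S = "\<lambda>n. {N :: 'b multiset. size N = n}"
  have exps: "((\<lambda>n. x ^ n / fact n) has_sum exp x) UNIV" for x :: "'c::{real_normed_field,banach}"
  proof (rule norm_summable_imp_has_sum)
    show "summable (\<lambda>n. norm (x ^ n / fact n))"
      using summable_exp[of "norm x"] by (simp add: norm_mult norm_inverse norm_power divide_inverse mult.commute)
    show "(\<lambda>n. x ^ n / fact n) sums exp x"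
      using exp_converges[of x] by (simp add: scaleR_conv_of_real divide_inverse mult.commute)
  qed
  have "(\<lambda>(n,N). norm (mexp w N)) summable_on Sigma UNIV ?S"
  proof (rule summable_on_SigmaI)
    fix n
    show "((\<lambda>y. case (n, y) of (n, N) \<Rightarrow> norm (mexp w N)) has_sum
        (infsum (\<lambda>x. norm (w x)) UNIV) ^ n / fact n) (?S n)"
      using has_sum_mexp_size[of "\<lambda>x. norm (w x)" n] assms by (simp add: norm_mexp)
  next
    show "(\<lambda>n. (infsum (\<lambda>x. norm (w x)) UNIV) ^ n / fact n) summable_on UNIV"
      using exps has_sum_imp_summable by blast
  qed auto
  then show abs: "(\<lambda>N. norm (mexp w N)) summable_on UNIV"
    by (rule iffD1[OF summable_on_reindex_bij_witness[of _ "\<lambda>N. (size N, N)" snd], rotated -1]) auto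
  have "((\<lambda>(n,N). mexp w N) has_sum exp (infsum w UNIV)) (Sigma UNIV ?S)"
  proof (rule has_sum_SigmaI)
    fix n
    show "((\<lambda>y. case (n, y) of (n, N) \<Rightarrow> mexp w N) has_sum (infsum w UNIV) ^ n / fact n) (?S n)"
      using has_sum_mexp_size[OF assms] by simp
  next
    show "((\<lambda>n. (infsum w UNIV) ^ n / fact n) has_sum exp (infsum w UNIV)) UNIV"
      by (rule exps)
    show "(\<lambda>(n, N). mexp w N) summable_on Sigma UNIV ?S"
      by (rule iffD1[OF summable_on_reindex_bij_witness[of _ snd "\<lambda>N. (size N, N)"] abs_summable_summable[OF abs]]) auto
  qed
  then show "(mexp w has_sum exp (infsum w UNIV)) UNIV"
    by (rule iffD1[OF has_sum_reindex_bij_witness[of _ "\<lambda>N. (size N, N)" snd], rotated -1]) auto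
qed

lemma has_sum_sum:
  fixes f :: "'i \<Rightarrow> 'b \<Rightarrow> 'a::{topological_comm_monoid_add}"
  assumes "\<And>i. i \<in> I \<Longrightarrow> (f i has_sum s i) B"
  shows "((\<lambda>x. \<Sum>i\<in>I. f i x) has_sum (\<Sum>i\<in>I. s i)) B"
  using assms by (induction I rule: infinite_finite_induct) (auto intro: has_sum_add)

section \<open>Gaussian matrices and Wick's theorem\<close>

definition cr :: "('b \<Rightarrow> 'a::{real_normed_field,banach}) \<Rightarrow> 'b multiset \<Rightarrow> 'b multiset \<Rightarrow> 'a" where
  "cr u M' M = (if M \<subseteq># M' then mexp u (M' - M) else 0)"

text \<open>The monomials are not normalised, so differentiation produces M! / (M'! (M - M')!); the
  factor 1 / (M - M')! is already contained in \<open>mexp\<close>.\<close>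

definition an :: "('b \<Rightarrow> 'a::{real_normed_field,banach}) \<Rightarrow> 'b multiset \<Rightarrow> 'b multiset \<Rightarrow> 'a" where
  "an v M' M = (if M' \<subseteq># M then mexp v (M - M') * of_nat (mfact M) / of_nat (mfact M') else 0)"

text \<open>The matrix elements, in the basis of monomials in the creation operators, of
  \<open>exp (\<Sum>x. u x * a\<^sub>x\<^sup>\<dagger>) * exp (\<Sum>x. v x * \<partial> / \<partial>a\<^sub>x\<^sup>\<dagger>)\<close>.\<close>

definition gmat :: "('b \<Rightarrow> 'a::{real_normed_field,banach}) \<Rightarrow> ('b \<Rightarrow> 'a) \<Rightarrow> 'b multiset \<Rightarrow> 'b multiset \<Rightarrow> 'a" where
  "gmat u v M' M = (\<Sum>K\<in>{K. K \<subseteq># M}. cr u M' K * an v K M)"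

lemma cr_add_mset:
  "cr u M' (add_mset x M) = (if x \<in># M' then cr u (M' - {#x#}) M else 0)"
  by (auto simp: cr_def insert_subset_eq_iff dest: mset_subset_eqD)

text \<open>The exponential of the derivation with coefficients \<open>v\<close> is a translation:
  moving it past the variable x replaces x by x + v(x). The first summand is the case where the new
  quantum survives, the second the one where it is absorbed.\<close>

lemma an_add_mset: "an v K (add_mset x P) = (if x \<in># K then an v (K - {#x#}) P else 0) + v x * an v K P"
  for v :: "'b \<Rightarrow> 'a::{real_normed_field,banach}"
proof (cases "K \<subseteq># P")
  case True
  then have d: "add_mset x P - K = add_mset x (P - K)"
    by (metis add_mset_add_single subset_mset.add_diff_assoc2)
  have K: "K \<subseteq># add_mset x P" using True by (rule subset_mset.order_trans) simp
  have c: "count P x = count (P - K) x + count K x"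
    using True by (simp add: subseteq_mset_def)
  let ?n = "of_nat (count (P - K) x + 1) :: 'a"
  have m: "?n * mexp v (add_mset x (P - K)) = v x * mexp v (P - K)"
    by (rule mexp_add_mset)
  have "an v K (add_mset x P) = mexp v (add_mset x (P - K)) * (of_nat (count K x) + ?n) * of_nat (mfact P) / of_nat (mfact K)"
  proof -
    have "an v K (add_mset x P) = mexp v (add_mset x (P - K)) * (of_nat (count P x + 1) * of_nat (mfact P)) / of_nat (mfact K)"
      using K by (simp only: an_def d mfact_add_mset of_nat_mult if_True)
    moreover have "of_nat (count P x + 1) = of_nat (count K x) + ?n"
      unfolding c by (simp only: of_nat_add add_ac)
    ultimately show ?thesis by (simp only: mult.assoc times_divide_eq_right)
  qed
  also have "\<dots> = mexp v (add_mset x (P - K)) * of_nat (count K x) * of_nat (mfact P) / of_nat (mfact K)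
      + v x * an v K P"
  proof -
    have "an v K P = mexp v (P - K) * of_nat (mfact P) / of_nat (mfact K)"
      using True by (simp add: an_def)
    then have "v x * an v K P = (?n * mexp v (add_mset x (P - K))) * of_nat (mfact P) / of_nat (mfact K)"
      unfolding m by simp
    then show ?thesis by (simp only: distrib_left distrib_right add_divide_distrib mult_ac)
  qed
  also have "mexp v (add_mset x (P - K)) * of_nat (count K x) * of_nat (mfact P) / of_nat (mfact K)
      = (if x \<in># K then an v (K - {#x#}) P else 0)"
  proof (cases "x \<in># K")
    case x: True
    define K' where "K' = K - {#x#}"
    have K': "K = add_mset x K'" using x by (simp add: K'_def)
    have s: "K' \<subseteq># P"
      unfolding K'_def by (rule subset_mset.order_trans[OF diff_subset_eq_self True])
    have "x \<in># P - K'"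
      using mset_subset_eq_count[OF True, of x] iffD2[OF count_greater_zero_iff x]
      unfolding K'_def in_diff_count count_diff by (simp del: count_greater_zero_iff)
    then have "P - K' = add_mset x (P - K)"
      unfolding K' by (metis add_mset_add_single diff_diff_add_mset insert_DiffM)
    moreover have "of_nat (mfact K) = (of_nat (count K x) * of_nat (mfact K') :: 'a)"
      unfolding K' mfact_add_mset of_nat_mult by simp
    ultimately show ?thesis
      using s x by (simp add: an_def K'_def count_eq_zero_iff)
  qed (simp add: count_eq_zero_iff)
  finally show ?thesis .
next
  case False
  show ?thesis
  proof (cases "K \<subseteq># add_mset x P")
    case True
    then have x: "x \<in># K"
      using False by (metis add_mset_remove_trivial diff_single_trivial subset_eq_diff_conv add_mset_add_single)
    define K' where "K' = K - {#x#}"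
    have K': "K = add_mset x K'" using x by (simp add: K'_def)
    have s: "K' \<subseteq># P" using True by (simp add: K')
    \<comment> \<open>\<open>K\<close> fails to lie below \<open>P\<close> only through one surplus
      copy of \<open>x\<close>; hence the multiplicities agree and the same factor cancels from both
      factorials.\<close>
    have c: "count P x = count K' x"
    proof -
      have "\<not> count P x > count K' x"
      proof
        assume "count P x > count K' x"
        then have "K \<subseteq># P" using s by (auto simp: K' subseteq_mset_def)
        with False show False ..
      qed
      moreover have "count K' x \<le> count P x" using s by (simp add: subseteq_mset_def)
      ultimately show ?thesis by simp
    qed
    let ?C = "of_nat (count K' x + 1) :: 'a"
    have "of_nat (mfact (add_mset x P)) = ?C * of_nat (mfact P)" "of_nat (mfact K) = ?C * of_nat (mfact K')"
      unfolding K' mfact_add_mset of_nat_mult c by simp_all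
    moreover have "?C \<noteq> 0" by (simp only: of_nat_eq_0_iff)
    moreover have "add_mset x P - K = P - K'" by (simp add: K')
    ultimately show ?thesis
      using False s x True by (simp add: an_def K'_def count_eq_zero_iff del: of_nat_add of_nat_Suc)
  next
    case F: False
    then have "x \<in># K \<Longrightarrow> \<not> K - {#x#} \<subseteq># P"
      by (auto simp: insert_subset_eq_iff subset_eq_diff_conv)
    with False F show ?thesis by (auto simp: an_def)
  qed
qed

text \<open>By induction on \<open>J\<close> the quanta of \<open>J\<close>, which commute with the
  creation part, are moved to the left through the annihilation part.\<close>

lemma has_sum_an_cr:
  fixes u v :: "'b \<Rightarrow> 'a::{real_normed_field,banach}"
  assumes "(\<lambda>x. norm (v x * u x)) summable_on UNIV"
  shows "((\<lambda>P. an v K P * cr u P J) has_sum exp (infsum (\<lambda>x. v x * u x) UNIV) *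
           (\<Sum>I\<in>{I. I \<subseteq># J}. cr u K I * an v I J)) UNIV"
proof (induction J arbitrary: K)
  case empty
  let ?e = "exp (infsum (\<lambda>x. v x * u x) UNIV)"
  have "(mexp (\<lambda>x. v x * u x) has_sum ?e) UNIV"
    by (rule has_sum_mexp) (use assms in simp)
  then have "((\<lambda>N. mexp u K * mexp (\<lambda>x. v x * u x) N) has_sum mexp u K * ?e) UNIV"
    by (rule has_sum_cmult_right)
  also have "?this \<longleftrightarrow> ((\<lambda>P. an v K P * mexp u P) has_sum ?e * mexp u K) {P. K \<subseteq># P}"
  proof (rule has_sum_reindex_bij_witness[of _ "\<lambda>P. P - K" "\<lambda>N. K + N"])
    fix N
    show "an v K (K + N) * mexp u (K + N) = mexp u K * mexp (\<lambda>x. v x * u x) N"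
      by (simp add: an_def mexp_mult) (simp add: mexp_def mult_ac)
  qed (auto simp: mult_ac)
  also have "\<dots> \<longleftrightarrow> ((\<lambda>P. an v K P * cr u P {#}) has_sum ?e * mexp u K) UNIV"
    by (rule has_sum_cong_neutral) (auto simp: an_def cr_def)
  finally show ?case by (simp add: cr_def an_def)
next
  case (add x J)
  let ?e = "exp (infsum (\<lambda>x. v x * u x) UNIV)"
  let ?R = "\<lambda>K J. (\<Sum>I\<in>{I. I \<subseteq># J}. cr u K I * an v I J)"
  let ?K = "if x \<in># K then ?R (K - {#x#}) J else 0"
  have "((\<lambda>P. (if x \<in># K then an v (K - {#x#}) P * cr u P J else 0)) has_sum ?e * ?K) UNIV"
    using add.IH[of "K - {#x#}"] by simp
  moreover have "((\<lambda>P. v x * (an v K P * cr u P J)) has_sum v x * (?e * ?R K J)) UNIV"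
    using add.IH[of K] by (rule has_sum_cmult_right)
  ultimately have "((\<lambda>P. (if x \<in># K then an v (K - {#x#}) P * cr u P J else 0) + v x * (an v K P * cr u P J))
     has_sum ?e * ?K + v x * (?e * ?R K J)) UNIV"
    by (rule has_sum_add)
  also have "(\<lambda>P. (if x \<in># K then an v (K - {#x#}) P * cr u P J else 0) + v x * (an v K P * cr u P J))
     = (\<lambda>P. an v K (add_mset x P) * cr u P J)"
    by (auto simp: an_add_mset algebra_simps)
  also have "?e * ?K + v x * (?e * ?R K J) = ?e * (?K + v x * ?R K J)"
    by (simp add: algebra_simps)
  also have "((\<lambda>P. an v K (add_mset x P) * cr u P J) has_sum ?e * (?K + v x * ?R K J)) UNIV
     \<longleftrightarrow> ((\<lambda>P. an v K P * cr u P (add_mset x J)) has_sum ?e * (?K + v x * ?R K J)) {P. x \<in># P}"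
    by (rule has_sum_reindex_bij_witness[of _ "\<lambda>P. P - {#x#}" "add_mset x"]) (auto simp: cr_add_mset)
  also have "\<dots> \<longleftrightarrow> ((\<lambda>P. an v K P * cr u P (add_mset x J)) has_sum ?e * (?K + v x * ?R K J)) UNIV"
    by (rule has_sum_cong_neutral) (auto simp: cr_add_mset)
  also have "?K + v x * ?R K J = ?R K (add_mset x J)"
  proof -
    have "?R K (add_mset x J) = (\<Sum>I\<in>{I. I \<subseteq># add_mset x J}. cr u K I * (if x \<in># I then an v (I - {#x#}) J else 0))
       + (\<Sum>I\<in>{I. I \<subseteq># add_mset x J}. cr u K I * (v x * an v I J))"
      by (simp add: an_add_mset distrib_left sum.distrib)
    also have "(\<Sum>I\<in>{I. I \<subseteq># add_mset x J}. cr u K I * (v x * an v I J)) = v x * ?R K J"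
      unfolding sum_distrib_left
      by (intro sum.mono_neutral_cong_right) (auto simp: an_def intro: subset_mset.order_trans)
    also have "(\<Sum>I\<in>{I. I \<subseteq># add_mset x J}. cr u K I * (if x \<in># I then an v (I - {#x#}) J else 0))
      = (\<Sum>I\<in>{I. x \<in># I \<and> I \<subseteq># add_mset x J}. cr u K I * an v (I - {#x#}) J)"
      by (intro sum.mono_neutral_cong_right) (auto intro: finite_subset[OF _ finite_submsets])
    also have "\<dots> = (\<Sum>I\<in>{I. I \<subseteq># J}. cr u K (add_mset x I) * an v I J)"
      by (rule sum.reindex_bij_witness[of _ "add_mset x" "\<lambda>K. K - {#x#}"]) (auto simp: subset_eq_diff_conv)
    also have "\<dots> = ?K"
      by (simp add: cr_add_mset)
    finally show ?thesis by simp
  qed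
  finally show ?case .
qed

lemma cr_mult: "(\<Sum>K\<in>{K. I \<subseteq># K \<and> K \<subseteq># M'}. cr u M' K * cr w K I) = cr (\<lambda>x. u x + w x) M' I"
proof (cases "I \<subseteq># M'")
  case True
  have "cr (\<lambda>x. u x + w x) M' I = (\<Sum>K\<in>{K. K \<subseteq># M' - I}. mexp u (M' - I - K) * mexp w K)"
    using True by (simp add: cr_def mexp_add)
  also have "\<dots> = (\<Sum>K\<in>{K. I \<subseteq># K \<and> K \<subseteq># M'}. cr u M' K * cr w K I)"
    by (rule sum.reindex_bij_witness[of _ "\<lambda>K. K - I" "\<lambda>K. I + K"])
      (use True in \<open>auto simp: cr_def subset_eq_diff_conv subset_mset.le_diff_conv2 add.commute\<close>)
  finally show ?thesis by simp
next
  case False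
  then have "{K. I \<subseteq># K \<and> K \<subseteq># M'} = {}" by (auto dest: subset_mset.order_trans)
  with False show ?thesis unfolding cr_def by (simp only: sum.empty if_False)
qed

lemma an_mult: "(\<Sum>J\<in>{J. I \<subseteq># J \<and> J \<subseteq># M}. an v I J * an w J M) = an (\<lambda>x. v x + w x) I M"
proof -
  have "an v I J * an w J M = of_nat (mfact M) / of_nat (mfact I) * (cr w M J * cr v J I)"
    if "I \<subseteq># J \<and> J \<subseteq># M" for J
    using that by (simp add: an_def cr_def)
  then have "(\<Sum>J\<in>{J. I \<subseteq># J \<and> J \<subseteq># M}. an v I J * an w J M)
    = of_nat (mfact M) / of_nat (mfact I) * cr (\<lambda>x. w x + v x) M I"
    unfolding cr_mult[symmetric] sum_distrib_left by (intro sum.cong) auto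
  also have "\<dots> = an (\<lambda>x. v x + w x) I M"
    by (simp add: cr_def an_def add.commute)
  finally show ?thesis .
qed

lemma gmat_alt:
  assumes "finite A" "\<And>K. K \<subseteq># M \<Longrightarrow> K \<subseteq># M' \<Longrightarrow> K \<in> A"
  shows "gmat u v M' M = (\<Sum>K\<in>A. cr u M' K * an v K M)"
proof -
  have "gmat u v M' M = (\<Sum>K\<in>{K. K \<subseteq># M \<and> K \<subseteq># M'}. cr u M' K * an v K M)"
    unfolding gmat_def by (intro sum.mono_neutral_right) (auto simp: cr_def)
  also have "\<dots> = (\<Sum>K\<in>A. cr u M' K * an v K M)"
    using assms by (intro sum.mono_neutral_left) (auto simp: cr_def an_def)
  finally show ?thesis .
qed

text \<open>Wick's theorem for two Gaussian matrices. Only the annihilation part of the left and the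
  creation part of the right factor are out of order; exchanging them costs the scalar exponential,
  and like parts then merge by \<open>cr_mult\<close> and \<open>an_mult\<close>. For fixed outer
  states all sums except the one over \<open>P\<close> are finite.\<close>

theorem has_sum_gmat_mult:
  fixes u1 v1 u2 v2 :: "'b \<Rightarrow> 'a::{real_normed_field,banach}"
  assumes "(\<lambda>x. norm (v1 x * u2 x)) summable_on UNIV"
  shows "((\<lambda>P. gmat u1 v1 M' P * gmat u2 v2 P M) has_sum
     exp (infsum (\<lambda>x. v1 x * u2 x) UNIV) * gmat (\<lambda>x. u1 x + u2 x) (\<lambda>x. v1 x + v2 x) M' M) UNIV"
proof -
  let ?e = "exp (infsum (\<lambda>x. v1 x * u2 x) UNIV)"
  let ?A = "{K. K \<subseteq># M'}" and ?B = "{J. J \<subseteq># M}"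
  let ?R = "\<lambda>K J. (\<Sum>I\<in>{I. I \<subseteq># J}. cr u2 K I * an v1 I J)"
  have "((\<lambda>P. \<Sum>K\<in>?A. \<Sum>J\<in>?B. cr u1 M' K * an v2 J M * (an v1 K P * cr u2 P J)) has_sum
      (\<Sum>K\<in>?A. \<Sum>J\<in>?B. cr u1 M' K * an v2 J M * (?e * ?R K J))) UNIV"
    by (intro has_sum_sum has_sum_cmult_right has_sum_an_cr assms)
  also have "(\<lambda>P. \<Sum>K\<in>?A. \<Sum>J\<in>?B. cr u1 M' K * an v2 J M * (an v1 K P * cr u2 P J))
      = (\<lambda>P. gmat u1 v1 M' P * gmat u2 v2 P M)"
  proof
    fix P
    have "gmat u1 v1 M' P = (\<Sum>K\<in>?A. cr u1 M' K * an v1 K P)" "gmat u2 v2 P M = (\<Sum>K\<in>?B. cr u2 P K * an v2 K M)"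
      by (intro gmat_alt; simp)+
    then show "(\<Sum>K\<in>?A. \<Sum>J\<in>?B. cr u1 M' K * an v2 J M * (an v1 K P * cr u2 P J)) = gmat u1 v1 M' P * gmat u2 v2 P M"
      by (simp add: sum_product mult_ac)
  qed
  also have "(\<Sum>K\<in>?A. \<Sum>J\<in>?B. cr u1 M' K * an v2 J M * (?e * ?R K J))
     = ?e * gmat (\<lambda>x. u1 x + u2 x) (\<lambda>x. v1 x + v2 x) M' M"
  proof -
    \<comment> \<open>The range of \<open>I\<close> is enlarged to one that does not depend on
      \<open>K\<close> and \<open>J\<close>, the additional terms being 0; this allows the sums to
      be interchanged.\<close>
    have R: "?R K J = (\<Sum>I\<in>{I. I \<subseteq># M' \<and> I \<subseteq># M}. cr u2 K I * an v1 I J)" if "K \<in> ?A" "J \<in> ?B" for K J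
      using that gmat_alt[of "{I. I \<subseteq># M' \<and> I \<subseteq># M}" J K u2 v1]
      by (auto simp: gmat_def intro: finite_subset[OF _ finite_submsets] subset_mset.order_trans)
    have "(\<Sum>K\<in>?A. \<Sum>J\<in>?B. cr u1 M' K * an v2 J M * (?e * ?R K J))
      = (\<Sum>K\<in>?A. \<Sum>J\<in>?B. \<Sum>I\<in>{I. I \<subseteq># M' \<and> I \<subseteq># M}. ?e * ((cr u1 M' K * cr u2 K I) * (an v1 I J * an v2 J M)))"
      by (intro sum.cong refl, subst R) (auto simp: sum_distrib_left mult_ac)
    also have "\<dots> = (\<Sum>I\<in>{I. I \<subseteq># M' \<and> I \<subseteq># M}. \<Sum>K\<in>?A. \<Sum>J\<in>?B. ?e * ((cr u1 M' K * cr u2 K I) * (an v1 I J * an v2 J M)))"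
      by (subst sum.swap[of _ _ ?B], subst sum.swap[of _ _ ?A]) (rule refl)
    also have "\<dots> = (\<Sum>I\<in>{I. I \<subseteq># M' \<and> I \<subseteq># M}. ?e * ((\<Sum>K\<in>?A. cr u1 M' K * cr u2 K I) * (\<Sum>J\<in>?B. an v1 I J * an v2 J M)))"
      by (simp only: sum_product sum_distrib_left[symmetric])
    also have "\<dots> = (\<Sum>I\<in>{I. I \<subseteq># M' \<and> I \<subseteq># M}. ?e * (cr (\<lambda>x. u1 x + u2 x) M' I * an (\<lambda>x. v1 x + v2 x) I M))"
    proof (rule sum.cong[OF refl])
      fix I
      have "(\<Sum>K\<in>?A. cr u1 M' K * cr u2 K I) = cr (\<lambda>x. u1 x + u2 x) M' I"
        unfolding cr_mult[symmetric] by (intro sum.mono_neutral_right) (auto simp: cr_def)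
      moreover have "(\<Sum>J\<in>?B. an v1 I J * an v2 J M) = an (\<lambda>x. v1 x + v2 x) I M"
        unfolding an_mult[symmetric] by (intro sum.mono_neutral_right) (auto simp: an_def)
      ultimately show "?e * ((\<Sum>K\<in>?A. cr u1 M' K * cr u2 K I) * (\<Sum>J\<in>?B. an v1 I J * an v2 J M))
          = ?e * (cr (\<lambda>x. u1 x + u2 x) M' I * an (\<lambda>x. v1 x + v2 x) I M)" by simp
    qed
    also have "\<dots> = ?e * gmat (\<lambda>x. u1 x + u2 x) (\<lambda>x. v1 x + v2 x) M' M"
      unfolding sum_distrib_left[symmetric]
      by (subst gmat_alt[of "{I. I \<subseteq># M' \<and> I \<subseteq># M}"]) (auto intro: finite_subset[OF _ finite_submsets])
    finally show ?thesis .
  qed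
  finally show ?thesis .
qed

lemma gmat_zero: "gmat (\<lambda>_. 0) (\<lambda>_. 0) M' M = (if M' = M then 1 else 0)"
proof -
  have "gmat (\<lambda>_. 0) (\<lambda>_. 0) M' M = (\<Sum>K\<in>{K. K \<subseteq># M}. if K = M \<and> M' = M then 1 else 0)"
    unfolding gmat_def
    by (intro sum.cong refl) (auto simp: cr_def an_def mexp_zero Diff_eq_empty_iff_mset dest: subset_mset.antisym)
  also have "\<dots> = (if M' = M then 1 else 0)"
    by (cases "M' = M") auto
  finally show ?thesis .
qed

text \<open>Each entry is a polynomial with nonnegative coefficients in the values of
  \<open>u\<close> and \<open>v\<close>. This is why absolute values give a majorant that is again a
  Gaussian matrix and can be multiplied by the same theorem.\<close>

lemma norm_gmat_le: "norm (gmat u v M' M) \<le> gmat (\<lambda>x. norm (u x)) (\<lambda>x. norm (v x)) M' M"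
proof -
  have "norm (cr u M' K * an v K M) = cr (\<lambda>x. norm (u x)) M' K * an (\<lambda>x. norm (v x)) K M" for K
    by (simp add: cr_def an_def norm_mult norm_mexp norm_divide)
  then show ?thesis
    unfolding gmat_def using norm_sum[of "\<lambda>K. cr u M' K * an v K M"] by simp
qed

lemma gmat_nonneg: "(\<And>x. 0 \<le> u x) \<Longrightarrow> (\<And>x. 0 \<le> v x) \<Longrightarrow> 0 \<le> gmat u v M' M" for u :: "'b \<Rightarrow> real"
  unfolding gmat_def by (intro sum_nonneg) (simp add: cr_def an_def mexp_nonneg)

lemma gmat_mono:
  fixes u v u' v' :: "'b \<Rightarrow> real"
  assumes "\<And>x. 0 \<le> u x \<and> u x \<le> u' x" "\<And>x. 0 \<le> v x \<and> v x \<le> v' x"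
  shows "gmat u v M' M \<le> gmat u' v' M' M"
proof -
  have *: "0 \<le> mexp u N \<and> mexp u N \<le> mexp u' N" "0 \<le> mexp v N \<and> mexp v N \<le> mexp v' N"
    "0 \<le> mexp u' N" for N
    using mexp_mono[of u u' N] mexp_mono[of v v' N] assms by (auto intro: mexp_nonneg order_trans)
  show ?thesis
    unfolding gmat_def cr_def an_def
    by (intro sum_mono) (auto intro!: mult_mono divide_right_mono mult_right_mono simp: *)
qed

section \<open>Normally ordered exponentials as Gaussian matrices\<close>

definition cre :: "lin \<Rightarrow> boson \<times> nat \<Rightarrow> complex" where
  "cre L = (\<lambda>(s, n). if n = 0 then 0 else L (Mode s (- int n)))"

text \<open>For n > 0 the mode s_n acts as its commutator with s_{-n} times the derivative with
  respect to s_{-n}, and the commutator is absorbed into the coefficient. Index 0 belongs to no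
  oscillator; the value 0 there lets sums run over all of \<open>UNIV\<close>.\<close>

definition ann :: "complex \<Rightarrow> lin \<Rightarrow> boson \<times> nat \<Rightarrow> complex" where
  "ann h L = (\<lambda>(s, n). if n = 0 then 0 else boson_sign s * (qint h (int n))\<^sup>2 / of_nat n * L (Mode s (int n)))"

definition zer :: "lin \<Rightarrow> (boson \<Rightarrow> complex) \<Rightarrow> complex" where
  "zer L \<mu> = exp (L (Mode Ba1 0) * \<mu> Ba1 + L (Mode Ba2 0) * \<mu> Ba2 + L (Mode Bc 0) * \<mu> Bc)"

text \<open>Left polymorphic in the scalars: with complex entries it is a vertex operator, with real
  entries its majorant, and both multiply by one lemma. The zero mode factor \<open>e\<close> is an
  arbitrary function of the momentum.\<close>

definition vop :: "(boson \<Rightarrow> complex) \<Rightarrow> ((boson \<Rightarrow> complex) \<Rightarrow> 'a) \<Rightarrow> (boson \<times> nat \<Rightarrow> 'a::{real_normed_field,banach})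
    \<Rightarrow> (boson \<times> nat \<Rightarrow> 'a) \<Rightarrow> state \<Rightarrow> state \<Rightarrow> 'a" where
  "vop \<nu> e u v b' b =
    (if fst b' = (\<lambda>s. fst b s + \<nu> s) then e (fst b) * gmat u v (snd b') (snd b) else 0)"

lemma boson_UNIV: "UNIV = {Ba1, Ba2, Bc}"
  using boson.exhaust by auto

lemma infsum_single:
  assumes "\<And>x. x \<in> A \<Longrightarrow> x \<noteq> a \<Longrightarrow> f x = 0"
  shows "infsum f A = (if a \<in> A then f a else 0 :: 'a::{topological_comm_monoid_add,t2_space})"
proof -
  have "infsum f A = infsum f (if a \<in> A then {a} else {})"
    by (rule infsum_cong_neutral) (use assms in \<open>auto split: if_splits\<close>)
  then show ?thesis by simp
qed

lemma infsum_finite_support: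
  assumes "finite F" "F \<subseteq> A" "\<And>x. x \<in> A \<Longrightarrow> x \<notin> F \<Longrightarrow> f x = 0"
  shows "infsum f A = (sum f F :: 'a::{topological_comm_monoid_add,t2_space})"
proof -
  have "infsum f A = infsum f F"
    by (rule infsum_cong_neutral) (use assms in auto)
  then show ?thesis using assms by simp
qed

lemma fock_submset: "(\<mu>, M) \<in> fock \<Longrightarrow> N \<subseteq># M \<Longrightarrow> (\<mu>, N) \<in> fock"
  by (auto simp: fock_def dest: mset_subset_eqD)

lemma fock_diff: "(\<mu>, M) \<in> fock \<Longrightarrow> (\<mu>, M - N) \<in> fock"
  by (erule fock_submset) (rule diff_subset_eq_self)

lemma oexp_finite:
  assumes "\<And>n. opow T n b' b = (if n = m then fact n * x else 0)"
  shows "oexp T b' b = x"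
proof -
  have "oexp T b' b = opow T m b' b / fact m"
    unfolding oexp_def by (subst infsum_single[of _ m]) (simp_all add: assms)
  then show ?thesis by (simp add: assms)
qed

lemma oexp_0:
  assumes "\<And>n. opow T n b' b = 0"
  shows "oexp T b' b = 0"
  unfolding oexp_def by (simp add: assms)

lemma lin_op_neg:
  "lin_op h {..<0} L (\<mu>', M') (\<mu>, M) =
    (if \<mu>' = \<mu> \<and> (\<exists>x. M' = add_mset x M) then cre L (THE x. M' = add_mset x M) else 0)"
proof (cases "\<mu>' = \<mu> \<and> (\<exists>x. M' = add_mset x M)")
  case True
  then obtain s n where M': "M' = add_mset (s, n) M" and \<mu>: "\<mu>' = \<mu>" by auto
  have the: "(THE x. M' = add_mset x M) = (s, n)" using M' by auto
  have "lin_op h {..<0} L (\<mu>', M') (\<mu>, M) = (if (s, - int n) \<in> UNIV \<times> {..<0} then L (Mode s (- int n)) else 0)"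
    unfolding lin_op_def M' \<mu>
    by (subst infsum_single[of _ "(s, - int n)"]) (auto simp: mode_op_def nat_eq_iff split: if_splits)
  then show ?thesis using True the by (auto simp: cre_def)
next
  case False
  then show ?thesis
    unfolding lin_op_def by (subst infsum_0) (auto simp: mode_op_def)
qed

lemma lin_op_pos:
  "lin_op h {0<..} L (\<mu>', M') (\<mu>, M) =
    (if \<mu>' = \<mu> \<and> (\<exists>x. M = add_mset x M')
     then (let x = (THE x. M = add_mset x M') in ann h L x * of_nat (count M x)) else 0)"
proof (cases "\<mu>' = \<mu> \<and> (\<exists>x. M = add_mset x M')")
  case True
  then obtain s n where M: "M = add_mset (s, n) M'" and \<mu>: "\<mu>' = \<mu>" by auto
  have the: "(THE x. M = add_mset x M') = (s, n)" using M by auto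
  have "lin_op h {0<..} L (\<mu>', M') (\<mu>, M) = (if (s, int n) \<in> UNIV \<times> {0<..}
     then L (Mode s (int n)) * (boson_sign s * (qint h (int n))\<^sup>2 / of_int (int n) * of_nat (count M (s, n))) else 0)"
    unfolding lin_op_def M \<mu>
    by (subst infsum_single[of _ "(s, int n)"]) (auto simp: mode_op_def nat_eq_iff split: if_splits)
  then show ?thesis using True the by (auto simp: ann_def Let_def)
next
  case False
  then show ?thesis
    unfolding lin_op_def by (subst infsum_0) (auto simp: mode_op_def)
qed

lemma lin_op_zero:
  "lin_op h {0} L b' b = (if b' = b then L (Mode Ba1 0) * fst b Ba1 + L (Mode Ba2 0) * fst b Ba2
     + L (Mode Bc 0) * fst b Bc else 0)"
proof -
  have "UNIV \<times> {0::int} = {(Ba1, 0), (Ba2, 0), (Bc, 0)}" by (auto simp: boson_UNIV)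
  then show ?thesis unfolding lin_op_def by (simp add: mode_op_def)
qed

text \<open>The n-th power creates exactly n quanta, so a given matrix element of the exponential
  series has at most one nonzero term. All intermediate states lie below the target, so it suffices
  that the target is in \<open>fock\<close>.\<close>

lemma opow_neg:
  assumes "(\<mu>', M') \<in> fock"
  shows "opow (lin_op h {..<0} L) n (\<mu>', M') (\<mu>, M) =
    (if \<mu>' = \<mu> \<and> M \<subseteq># M' \<and> n = size (M' - M) then fact n * mexp (cre L) (M' - M) else 0)"
  using assms
proof (induction n arbitrary: \<mu>' M')
  case 0
  then show ?case
    by (auto simp: oid_def Diff_eq_empty_iff_mset dest: subset_mset.antisym)
next
  case (Suc n)
  let ?T = "lin_op h {..<0} L"
  let ?F = "(\<lambda>x. (\<mu>', M' - {#x#})) ` set_mset M'"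
  have inj: "inj_on (\<lambda>x. (\<mu>', M' - {#x#})) (set_mset M')"
  proof (rule inj_onI)
    fix x y assume "x \<in># M'" "y \<in># M'" and eq: "(\<mu>', M' - {#x#}) = (\<mu>', M' - {#y#})"
    then have "add_mset x (M' - {#x#}) = add_mset y (M' - {#y#})"
      by (metis insert_DiffM)
    with eq show "x = y" by simp
  qed
  have "opow ?T (Suc n) (\<mu>', M') (\<mu>, M) = (\<Sum>k\<in>?F. ?T (\<mu>', M') k * opow ?T n k (\<mu>, M))"
    unfolding opow.simps oprod_def
  proof (rule infsum_finite_support)
    show "?F \<subseteq> fock" using Suc.prems by (auto intro: fock_diff)
  next
    fix k assume "k \<notin> ?F"
    then show "?T (\<mu>', M') k * opow ?T n k (\<mu>, M) = 0"
      by (cases k) (auto simp: lin_op_neg)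
  qed simp
  also have "\<dots> = (\<Sum>x\<in>set_mset M'. ?T (\<mu>', M') (\<mu>', M' - {#x#}) * opow ?T n (\<mu>', M' - {#x#}) (\<mu>, M))"
    by (simp add: sum.reindex[OF inj])
  also have "\<dots> = (\<Sum>x\<in>set_mset M'. cre L x * (if \<mu>' = \<mu> \<and> M \<subseteq># M' - {#x#} \<and> n = size (M' - {#x#} - M)
        then fact n * mexp (cre L) (M' - {#x#} - M) else 0))"
  proof (intro sum.cong refl arg_cong2[of _ _ _ _ "(*)"])
    fix x assume x: "x \<in># M'"
    have "(THE y. M' = add_mset y (M' - {#x#})) = x"
      using x by (intro the_equality) (simp, metis add_right_cancel add_mset_add_single insert_DiffM single_eq_single union_commute)
    moreover have "\<exists>y. M' = add_mset y (M' - {#x#})" using x by (metis insert_DiffM)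
    ultimately show "?T (\<mu>', M') (\<mu>', M' - {#x#}) = cre L x"
      by (simp add: lin_op_neg)
    show "opow ?T n (\<mu>', M' - {#x#}) (\<mu>, M) = (if \<mu>' = \<mu> \<and> M \<subseteq># M' - {#x#} \<and> n = size (M' - {#x#} - M)
        then fact n * mexp (cre L) (M' - {#x#} - M) else 0)"
      by (rule Suc.IH) (rule fock_diff[OF Suc.prems])
  qed
  also have "\<dots> = (if \<mu>' = \<mu> \<and> M \<subseteq># M' \<and> Suc n = size (M' - M) then fact (Suc n) * mexp (cre L) (M' - M) else 0)"
  proof (cases "\<mu>' = \<mu> \<and> M \<subseteq># M'")
    case True
    have sub: "M \<subseteq># M' - {#x#} \<longleftrightarrow> x \<in># M' - M" if "x \<in># M'" for x
    proof -
      have "M \<subseteq># M' - {#x#} \<longleftrightarrow> add_mset x M \<subseteq># M'"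
        using that by (simp add: subset_mset.le_diff_conv2)
      also have "\<dots> \<longleftrightarrow> {#x#} \<subseteq># M' - M"
        using True by (simp add: subset_mset.le_diff_conv2 del: single_subset_iff)
      finally show ?thesis by simp
    qed
    have "(\<Sum>x\<in>set_mset M'. cre L x * (if \<mu>' = \<mu> \<and> M \<subseteq># M' - {#x#} \<and> n = size (M' - {#x#} - M)
        then fact n * mexp (cre L) (M' - {#x#} - M) else 0))
      = (\<Sum>x\<in>set_mset (M' - M). if Suc n = size (M' - M) then fact n * (cre L x * mexp (cre L) (M' - M - {#x#})) else 0)"
    proof (rule sum.mono_neutral_cong_right)
      fix x assume x: "x \<in># M' - M"
      then have x': "x \<in># M'" by (rule in_diffD)
      have d: "M' - {#x#} - M = M' - M - {#x#}" by (rule diff_right_commute)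
      show "cre L x * (if \<mu>' = \<mu> \<and> M \<subseteq># M' - {#x#} \<and> n = size (M' - {#x#} - M)
        then fact n * mexp (cre L) (M' - {#x#} - M) else 0)
        = (if Suc n = size (M' - M) then fact n * (cre L x * mexp (cre L) (M' - M - {#x#})) else 0)"
        unfolding d size_Suc_Diff1[OF x, symmetric] using True sub[OF x'] x by auto
    qed (use True in \<open>auto simp: sub dest: in_diffD\<close>)
    also have "\<dots> = (if Suc n = size (M' - M) then fact n * (of_nat (size (M' - M)) * mexp (cre L) (M' - M)) else 0)"
      unfolding size_mexp by (simp add: sum_distrib_left)
    also have "\<dots> = (if Suc n = size (M' - M) then fact (Suc n) * mexp (cre L) (M' - M) else 0)"
    proof (cases "Suc n = size (M' - M)")
      case sz: True
      then show ?thesis by (simp add: sz[symmetric] algebra_simps)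
    qed simp
    finally show ?thesis using True by (simp only: simp_thms if_True)
  next
    case False
    then have "\<not> (\<mu>' = \<mu> \<and> M \<subseteq># M' - {#x#})" for x
      using diff_subset_eq_self subset_mset.order_trans by blast
    with False show ?thesis by (auto intro!: sum.neutral)
  qed
  finally show ?case .
qed

text \<open>The mirror image of the creation case: intermediate states now lie below the source. The
  multiplicities produced by successive annihilations are the quotient of factorials in
  \<open>an\<close>.\<close>

lemma opow_pos:
  assumes "(\<mu>, M) \<in> fock"
  shows "opow (lin_op h {0<..} L) n (\<mu>', M') (\<mu>, M) =
    (if \<mu>' = \<mu> \<and> M' \<subseteq># M \<and> n = size (M - M') then fact n * an (ann h L) M' M else 0)"
proof (induction n arbitrary: M')
  case 0
  then show ?case
    by (auto simp: oid_def an_def Diff_eq_empty_iff_mset dest: subset_mset.antisym)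
next
  case (Suc n)
  let ?T = "lin_op h {0<..} L"
  let ?F = "(\<lambda>x. (\<mu>', add_mset x M')) ` set_mset (M - M')"
  have sub: "add_mset x M' \<subseteq># M \<longleftrightarrow> M' \<subseteq># M \<and> x \<in># M - M'" for x
  proof (cases "M' \<subseteq># M")
    case True
    then have "{#x#} \<subseteq># M - M' \<longleftrightarrow> add_mset x M' \<subseteq># M"
      by (simp add: subset_mset.le_diff_conv2 del: single_subset_iff)
    then show ?thesis using True by simp
  next
    case False
    then show ?thesis
      using subset_mset.order_trans[of M' "add_mset x M'" M] by auto
  qed
  show ?case
  proof (cases "\<mu>' = \<mu> \<and> M' \<subseteq># M")
    case True
    have "opow ?T (Suc n) (\<mu>', M') (\<mu>, M) = (\<Sum>k\<in>?F. ?T (\<mu>', M') k * opow ?T n k (\<mu>, M))"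
      unfolding opow.simps oprod_def
    proof (rule infsum_finite_support)
      show "?F \<subseteq> fock" using assms True by (auto intro!: fock_submset[OF assms] simp: sub)
    next
      fix k assume "k \<notin> ?F"
      then show "?T (\<mu>', M') k * opow ?T n k (\<mu>, M) = 0"
        by (cases k) (auto simp: lin_op_pos Suc sub split: if_splits)
    qed simp
    also have "\<dots> = (\<Sum>x\<in>set_mset (M - M'). ?T (\<mu>', M') (\<mu>', add_mset x M') * opow ?T n (\<mu>', add_mset x M') (\<mu>, M))"
      by (subst sum.reindex) (auto simp: inj_on_def)
    also have "\<dots> = (\<Sum>x\<in>set_mset (M - M'). if Suc n = size (M - M') then
        fact n * (ann h L x * mexp (ann h L) (M - M' - {#x#})) * of_nat (mfact M) / of_nat (mfact M') else 0)"
    proof (rule sum.cong[OF refl])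
      fix x assume x: "x \<in># M - M'"
      have t: "?T (\<mu>', M') (\<mu>', add_mset x M') = ann h L x * of_nat (count M' x + 1)"
        by (simp add: lin_op_pos Let_def)
      have s: "add_mset x M' \<subseteq># M" using True x by (simp add: sub)
      have d: "M - add_mset x M' = M - M' - {#x#}" by simp
      have sz: "Suc (size (M - add_mset x M')) = size (M - M')"
        unfolding d using x by (rule size_Suc_Diff1)
      have "an (ann h L) (add_mset x M') M = mexp (ann h L) (M - M' - {#x#}) * of_nat (mfact M) / (of_nat (count M' x + 1) * of_nat (mfact M'))"
        using s unfolding an_def d mfact_add_mset of_nat_mult by simp
      then have "ann h L x * of_nat (count M' x + 1) * an (ann h L) (add_mset x M') M
         = ann h L x * mexp (ann h L) (M - M' - {#x#}) * of_nat (mfact M) / of_nat (mfact M')"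
        by (simp del: of_nat_add of_nat_Suc add: field_simps)
      then show "?T (\<mu>', M') (\<mu>', add_mset x M') * opow ?T n (\<mu>', add_mset x M') (\<mu>, M)
       = (if Suc n = size (M - M') then
        fact n * (ann h L x * mexp (ann h L) (M - M' - {#x#})) * of_nat (mfact M) / of_nat (mfact M') else 0)"
        unfolding t Suc using True s sz by (auto simp del: of_nat_add of_nat_Suc simp add: mult_ac)
    qed
    also have "\<dots> = (if Suc n = size (M - M') then fact n * (of_nat (size (M - M')) * mexp (ann h L) (M - M')) * of_nat (mfact M) / of_nat (mfact M') else 0)"
      unfolding size_mexp by (simp add: sum_distrib_left sum_distrib_right sum_divide_distrib)
    also have "\<dots> = (if Suc n = size (M - M') then fact (Suc n) * an (ann h L) M' M else 0)"
    proof (cases "Suc n = size (M - M')")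
      case sz: True
      then show ?thesis using True by (simp add: sz[symmetric] an_def algebra_simps)
    qed simp
    finally show ?thesis using True by (simp only: simp_thms if_True)
  next
    case False
    have "?T (\<mu>', M') k * opow ?T n k (\<mu>, M) = 0" for k
      using False by (cases k) (auto simp: lin_op_pos Suc sub)
    then have "opow ?T (Suc n) (\<mu>', M') (\<mu>, M) = 0"
      unfolding opow.simps oprod_def by (intro infsum_0)
    with False show ?thesis by (simp only: if_False simp_thms) auto
  qed
qed

lemma opow_diag:
  assumes "\<And>b' b. T b' b = (if b' = b then d b else 0)" "b \<in> fock"
  shows "opow T n b' b = (if b' = b then d b ^ n else 0)"
proof (induction n arbitrary: b')
  case (Suc n)
  show ?case
    unfolding opow.simps oprod_def
    by (subst infsum_single[of _ b]) (auto simp: Suc assms)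
qed (simp add: oid_def)

lemma oexp_diag:
  assumes "\<And>b' b. T b' b = (if b' = b then d b else 0)" "b \<in> fock"
  shows "oexp T b' b = (if b' = b then exp (d b) else 0)"
proof -
  have "((\<lambda>n. d b ^ n / fact n) has_sum exp (d b)) UNIV"
  proof (rule norm_summable_imp_has_sum)
    show "summable (\<lambda>n. norm (d b ^ n / fact n))"
      using summable_exp[of "norm (d b)"] by (simp add: norm_mult norm_inverse norm_power divide_inverse mult.commute)
    show "(\<lambda>n. d b ^ n / fact n) sums exp (d b)"
      using exp_converges[of "d b"] by (simp add: scaleR_conv_of_real divide_inverse mult.commute)
  qed
  then show ?thesis
    unfolding oexp_def by (auto simp: opow_diag[OF assms] infsumI)
qed

lemma oexp_neg:
  "(\<mu>', M') \<in> fock \<Longrightarrow> oexp (lin_op h {..<0} L) (\<mu>', M') (\<mu>, M) = (if \<mu>' = \<mu> then cr (cre L) M' M else 0)"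
  by (auto simp: cr_def opow_neg intro: oexp_0 oexp_finite[where m = "size (M' - M)"])

lemma oexp_pos:
  "(\<mu>, M) \<in> fock \<Longrightarrow> oexp (lin_op h {0<..} L) (\<mu>', M') (\<mu>, M) = (if \<mu>' = \<mu> then an (ann h L) M' M else 0)"
  by (cases "M' \<subseteq># M") (auto simp: an_def opow_pos intro: oexp_0 oexp_finite[where m = "size (M - M')"])

lemma oexp_zero:
  "b \<in> fock \<Longrightarrow> oexp (lin_op h {0} L) b' b = (if b' = b then zer L (fst b) else 0)"
  using oexp_diag[OF lin_op_zero] by (simp add: zer_def)

text \<open>Although \<open>nexp\<close> is a fourfold product of infinite matrices, a given entry
  involves only finitely many intermediate states: the momentum is fixed by the shift, and the
  oscillator part must lie below the source.\<close>

lemma nexp_eq: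
  assumes "b' \<in> fock" "b \<in> fock"
  shows "nexp h L b' b = vop (\<lambda>s. L (Q s)) (zer L) (cre L) (ann h L) b' b"
proof -
  obtain \<mu> M where b: "b = (\<mu>, M)" by (cases b)
  obtain \<mu>' M' where b': "b' = (\<mu>', M')" by (cases b')
  let ?ZA = "oexp (lin_op h {0} L) \<odot> oexp (lin_op h {0<..} L)"
  let ?CZA = "oexp (lin_op h {..<0} L) \<odot> ?ZA"
  have ZA: "?ZA k b = (if fst k = \<mu> then zer L \<mu> * an (ann h L) (snd k) M else 0)" if k: "k \<in> fock" for k
    unfolding oprod_def
    by (subst infsum_single[of _ k]) (use assms k in \<open>cases k; auto simp: oexp_zero oexp_pos b\<close>)+
  have CZA: "?CZA k b = (if fst k = \<mu> then zer L \<mu> * gmat (cre L) (ann h L) (snd k) M else 0)" if k: "k \<in> fock" for k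
  proof -
    have "?CZA k b = (\<Sum>l\<in>(\<lambda>K. (\<mu>, K)) ` {K. K \<subseteq># M}. oexp (lin_op h {..<0} L) k l * ?ZA l b)"
      unfolding oprod_def[of _ ?ZA]
    proof (rule infsum_finite_support)
      show "(\<lambda>K. (\<mu>, K)) ` {K. K \<subseteq># M} \<subseteq> fock"
        using assms b fock_submset by auto
      show "oexp (lin_op h {..<0} L) k l * ?ZA l b = 0" if "l \<in> fock" "l \<notin> (\<lambda>K. (\<mu>, K)) ` {K. K \<subseteq># M}" for l
        using that by (cases l) (auto simp: ZA an_def)
    qed simp
    also have "\<dots> = (\<Sum>K\<in>{K. K \<subseteq># M}. oexp (lin_op h {..<0} L) k (\<mu>, K) * ?ZA (\<mu>, K) b)"
      by (subst sum.reindex) (auto simp: inj_on_def)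
    also have "\<dots> = (\<Sum>K\<in>{K. K \<subseteq># M}. (if fst k = \<mu> then cr (cre L) (snd k) K else 0) * (zer L \<mu> * an (ann h L) K M))"
    proof (rule sum.cong[OF refl])
      fix K assume "K \<in> {K. K \<subseteq># M}"
      then have "(\<mu>, K) \<in> fock" using assms b fock_submset by auto
      then show "oexp (lin_op h {..<0} L) k (\<mu>, K) * ?ZA (\<mu>, K) b
          = (if fst k = \<mu> then cr (cre L) (snd k) K else 0) * (zer L \<mu> * an (ann h L) K M)"
        using k by (cases k) (simp add: ZA oexp_neg)
    qed
    also have "\<dots> = (if fst k = \<mu> then zer L \<mu> * gmat (cre L) (ann h L) (snd k) M else 0)"
      by (simp add: gmat_def sum_distrib_left mult_ac)
    finally show ?thesis .
  qed
  \<comment> \<open>The only state that the shift can send to \<open>b'\<close>. If its momentum is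
    not that of \<open>b\<close>, both sides vanish, whether or not the state belongs to
    \<open>fock\<close>.\<close>
  let ?k = "(\<lambda>s. \<mu>' s - L (Q s), M')"
  have "nexp h L b' b = (if ?k \<in> fock then ?CZA ?k b else 0)"
    unfolding nexp_def oprod_def[of _ ?CZA]
    by (subst infsum_single[of _ ?k]) (auto simp: shift_op_def b' fun_eq_iff)
  also have "\<dots> = vop (\<lambda>s. L (Q s)) (zer L) (cre L) (ann h L) b' b"
  proof (cases "\<mu>' = (\<lambda>s. \<mu> s + L (Q s))")
    case True
    then have k: "?k = (\<mu>, M')" by auto
    have f: "(\<mu>, M') \<in> fock" using assms by (auto simp: fock_def b b')
    show ?thesis unfolding k using True f CZA[OF f] by (simp add: vop_def b b')
  next
    case False
    then have "(\<lambda>s. \<mu>' s - L (Q s)) \<noteq> \<mu>" by (auto simp: fun_eq_iff) (metis diff_add_cancel)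
    then show ?thesis using False CZA[of ?k] by (simp add: vop_def b b')
  qed
  finally show ?thesis .
qed

definition intshift :: "(boson \<Rightarrow> complex) \<Rightarrow> bool" where
  "intshift \<nu> \<longleftrightarrow> \<nu> Ba1 + \<nu> Ba2 + \<nu> Bc \<in> \<int>"

definition pos_mset :: "(boson \<times> nat) multiset \<Rightarrow> bool" where
  "pos_mset M \<longleftrightarrow> (\<forall>(s, n) \<in># M. 0 < n)"

lemma fock_iff: "(\<mu>, M) \<in> fock \<longleftrightarrow> intshift \<mu> \<and> pos_mset M"
  by (simp add: fock_def intshift_def pos_mset_def)

lemma intshift_add: "intshift \<mu> \<Longrightarrow> intshift \<nu> \<Longrightarrow> intshift (\<lambda>s. \<mu> s + \<nu> s)"
  using Ints_add[of "\<mu> Ba1 + \<mu> Ba2 + \<mu> Bc" "\<nu> Ba1 + \<nu> Ba2 + \<nu> Bc"]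
  by (simp add: intshift_def algebra_simps)

text \<open>Quanta of index 0 are never created when \<open>u\<close> vanishes there. Hence the sum
  over all multisets in Wick's theorem is the sum over Fock states.\<close>

lemma gmat_not_pos:
  assumes "\<And>s. u (s, 0) = 0" "\<not> pos_mset P" "pos_mset M"
  shows "gmat u v P M = 0"
proof -
  from assms(2) obtain s where s: "(s, 0) \<in># P" by (auto simp: pos_mset_def)
  then have "(s, 0) \<notin># M" using assms(3) by (auto simp: pos_mset_def)
  have "cr u P K = 0" if "K \<subseteq># M" for K
  proof -
    have "(s, 0) \<notin># K" using that \<open>(s, 0) \<notin># M\<close> by (auto dest: mset_subset_eqD)
    then have c0: "count K (s, 0) = 0" using not_in_iff by fast
    have "(s, 0) \<in># P - K" unfolding in_diff_count c0 using s by simp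
    then show ?thesis using assms(1)[of s] by (simp add: cr_def mexp_zero_at)
  qed
  then show ?thesis unfolding gmat_def by (intro sum.neutral) auto
qed

text \<open>The momentum of the intermediate state is forced, which leaves Wick's theorem for the
  oscillators. The zero modes of the left factor act after the shift by \<open>\<nu>2\<close>,
  whence the displaced argument of \<open>d1\<close>.\<close>

lemma has_sum_vop:
  fixes d1 d2 :: "(boson \<Rightarrow> complex) \<Rightarrow> 'a::{real_normed_field,banach}"
  assumes "(\<lambda>x. norm (v1 x * u2 x)) summable_on UNIV" and u2: "\<And>s. u2 (s, 0) = 0"
    and \<nu>: "intshift \<nu>2" and b: "b \<in> fock"
  shows "((\<lambda>k. vop \<nu>1 d1 u1 v1 b' k * vop \<nu>2 d2 u2 v2 k b) has_sum exp (infsum (\<lambda>x. v1 x * u2 x) UNIV) *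
     vop (\<lambda>s. \<nu>1 s + \<nu>2 s) (\<lambda>\<mu>. d1 (\<lambda>s. \<mu> s + \<nu>2 s) * d2 \<mu>) (\<lambda>x. u1 x + u2 x) (\<lambda>x. v1 x + v2 x) b' b) fock"
proof -
  obtain \<mu> M where bM: "b = (\<mu>, M)" by (cases b)
  obtain \<mu>' M' where b'M: "b' = (\<mu>', M')" by (cases b')
  define \<mu>1 where "\<mu>1 = (\<lambda>s. \<mu> s + \<nu>2 s)"
  have M: "pos_mset M" and \<mu>1: "intshift \<mu>1"
    using b \<nu> unfolding \<mu>1_def by (auto simp: bM fock_iff intshift_add)
  have eq: "\<mu>' = (\<lambda>s. \<mu>1 s + \<nu>1 s) \<longleftrightarrow> \<mu>' = (\<lambda>s. \<mu> s + (\<nu>1 s + \<nu>2 s))"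
    by (simp add: \<mu>1_def fun_eq_iff algebra_simps)
  show ?thesis
  proof (cases "\<mu>' = (\<lambda>s. \<mu>1 s + \<nu>1 s)")
    case True
    let ?c = "d1 \<mu>1 * d2 \<mu>"
    let ?g = "exp (infsum (\<lambda>x. v1 x * u2 x) UNIV) * gmat (\<lambda>x. u1 x + u2 x) (\<lambda>x. v1 x + v2 x) M' M"
    have "((\<lambda>P. ?c * (gmat u1 v1 M' P * gmat u2 v2 P M)) has_sum ?c * ?g) UNIV"
      by (intro has_sum_cmult_right has_sum_gmat_mult assms)
    also have "?this \<longleftrightarrow> ((\<lambda>P. ?c * (gmat u1 v1 M' P * gmat u2 v2 P M)) has_sum ?c * ?g) {P. pos_mset P}"
      by (rule has_sum_cong_neutral) (auto simp: gmat_not_pos[of u2, OF u2 _ M])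
    also have "\<dots> \<longleftrightarrow> ((\<lambda>k. vop \<nu>1 d1 u1 v1 b' k * vop \<nu>2 d2 u2 v2 k b) has_sum ?c * ?g) {k \<in> fock. fst k = \<mu>1}"
      by (rule has_sum_reindex_bij_witness[of _ snd "\<lambda>P. (\<mu>1, P)"])
        (use \<mu>1 True in \<open>auto simp: fock_iff vop_def bM b'M \<mu>1_def mult_ac\<close>)
    also have "\<dots> \<longleftrightarrow> ((\<lambda>k. vop \<nu>1 d1 u1 v1 b' k * vop \<nu>2 d2 u2 v2 k b) has_sum ?c * ?g) fock"
      by (rule has_sum_cong_neutral) (auto simp: vop_def bM \<mu>1_def)
    finally show ?thesis
      using True eq by (simp add: vop_def bM b'M \<mu>1_def[symmetric] mult_ac)
  next
    case False
    have z: "vop \<nu>1 d1 u1 v1 b' k * vop \<nu>2 d2 u2 v2 k b = 0" for k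
      using False by (auto simp: vop_def bM b'M \<mu>1_def)
    have "vop (\<lambda>s. \<nu>1 s + \<nu>2 s) (\<lambda>\<mu>. d1 (\<lambda>s. \<mu> s + \<nu>2 s) * d2 \<mu>) (\<lambda>x. u1 x + u2 x) (\<lambda>x. v1 x + v2 x) b' b = 0"
      using False eq by (simp add: vop_def bM b'M)
    then show ?thesis unfolding z by simp
  qed
qed

lemma norm_vop_le:
  "norm (vop \<nu> e u v b' b) \<le> vop \<nu> (\<lambda>\<mu>. norm (e \<mu>)) (\<lambda>x. norm (u x)) (\<lambda>x. norm (v x)) b' b"
  by (simp add: vop_def norm_mult mult_left_mono norm_gmat_le)

lemma vop_mono:
  fixes u v u' v' :: "_ \<Rightarrow> real"
  assumes "\<And>x. 0 \<le> u x \<and> u x \<le> u' x" "\<And>x. 0 \<le> v x \<and> v x \<le> v' x" "\<And>\<mu>. 0 \<le> e \<mu>"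
  shows "vop \<nu> e u v b' b \<le> vop \<nu> e u' v' b' b"
  by (simp add: vop_def mult_left_mono gmat_mono assms)

lemma vop_nonneg:
  fixes u v :: "_ \<Rightarrow> real"
  assumes "\<And>x. 0 \<le> u x" "\<And>x. 0 \<le> v x" "\<And>\<mu>. 0 \<le> e \<mu>"
  shows "0 \<le> vop \<nu> e u v b' b"
  by (simp add: vop_def gmat_nonneg assms)

section \<open>Majorants and convergence of products\<close>

text \<open>\<open>majU\<close> and \<open>majV\<close> bound the creation and annihilation coefficients of all vertex operators and currents
  at points \<open>z\<close> with \<open>ln \<bar>z\<bar>\<close> in the given list; the constant absorbs shifts of the points by powers of \<open>q\<close>.\<close>

definition majH :: "complex \<Rightarrow> real" where "majH h = 6 * norm h"

definition majU :: "complex \<Rightarrow> real list \<Rightarrow> boson \<times> nat \<Rightarrow> real" where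
  "majU h rs = (\<lambda>(s, n). if n = 0 then 0 else
     (\<Sum>\<rho>\<leftarrow>rs. 2 * exp (real n * (\<rho> + majH h)) / norm (qint h (int n))))"

definition majV :: "complex \<Rightarrow> real list \<Rightarrow> boson \<times> nat \<Rightarrow> real" where
  "majV h rs = (\<lambda>(s, n). if n = 0 then 0 else
     (\<Sum>\<rho>\<leftarrow>rs. 2 * norm (qint h (int n)) * exp (- real n * (\<rho> - majH h)) / real n))"

definition sep :: "complex \<Rightarrow> real list \<Rightarrow> real list \<Rightarrow> bool" where
  "sep h rs1 rs2 \<longleftrightarrow> (\<forall>\<rho>1\<in>set rs1. \<forall>\<rho>2\<in>set rs2. \<rho>1 > \<rho>2 + 2 * majH h)"

text \<open>Convergence depends only on the growth in the oscillator numbers, so the factor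
  \<open>e\<close> for the momentum is left free and absorbs all constants. A list of radii is
  needed because a product of operators sits at several points at once.\<close>

definition maj :: "complex \<Rightarrow> (boson \<Rightarrow> complex) \<Rightarrow> real list \<Rightarrow> oper \<Rightarrow> bool" where
  "maj h \<nu> rs S \<longleftrightarrow> intshift \<nu> \<and> (\<exists>e. (\<forall>\<mu>. 0 \<le> e \<mu>) \<and>
     (\<forall>b'\<in>fock. \<forall>b\<in>fock. norm (S b' b) \<le> vop \<nu> e (majU h rs) (majV h rs) b' b))"

lemma sum_list_nonneg': "(\<And>x. x \<in> set xs \<Longrightarrow> 0 \<le> f x) \<Longrightarrow> 0 \<le> (\<Sum>x\<leftarrow>xs. f x :: real)"
  by (induction xs) auto

lemma majU_nonneg: "0 \<le> majU h rs x" and majV_nonneg: "0 \<le> majV h rs x"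
  by (auto simp: majU_def majV_def split: prod.splits intro!: sum_list_nonneg')

lemma majU_append: "majU h (rs1 @ rs2) x = majU h rs1 x + majU h rs2 x"
  and majV_append: "majV h (rs1 @ rs2) x = majV h rs1 x + majV h rs2 x"
  by (auto simp: majU_def majV_def split: prod.splits)

text \<open>In the product of an annihilation bound at \<rho>1 and a creation bound at \<rho>2 the
  norms of [n]_q cancel, which leaves at most 4 exp(\<rho>2 + 2 majH - \<rho>1)^n. The gap required
  by \<open>sep\<close> makes this a convergent geometric series; lists of radii follow by
  bilinearity.\<close>

lemma majVU_summable:
  assumes "sep h rs1 rs2"
  shows "(\<lambda>x. norm (majV h rs1 x * majU h rs2 x)) summable_on UNIV"
proof -
  have 1: "(\<lambda>x. majV h [\<rho>1] x * majU h [\<rho>2] x) summable_on UNIV" if "\<rho>1 > \<rho>2 + 2 * majH h" for \<rho>1 \<rho>2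
  proof -
    let ?r = "exp (\<rho>2 + 2 * majH h - \<rho>1)"
    have r: "?r < 1" using that by simp
    have "(\<lambda>n. 4 * ?r ^ n) summable_on UNIV"
      by (rule summable_nonneg_imp_summable_on) (use r in \<open>auto intro!: summable_mult summable_geometric\<close>)
    then have "(\<lambda>(s::boson, n). 4 * ?r ^ n) summable_on (UNIV \<times> UNIV)"
      by (intro summable_on_SigmaI[where g = "\<lambda>_. infsum (\<lambda>n. 4 * ?r ^ n) UNIV"])
        (auto simp: boson_UNIV)
    then have "(\<lambda>(s::boson, n). 4 * ?r ^ n) summable_on UNIV" by simp
    then show ?thesis
    proof (rule summable_on_comparison_test)
      fix x :: "boson \<times> nat"
      obtain s n where x: "x = (s, n)" by (cases x)
      show "majV h [\<rho>1] x * majU h [\<rho>2] x \<le> (case x of (s, n) \<Rightarrow> 4 * ?r ^ n)"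
      proof (cases "n = 0")
        case False
        have e: "exp (- real n * (\<rho>1 - majH h)) * exp (real n * (\<rho>2 + majH h)) = ?r ^ n"
          by (simp add: exp_add[symmetric] exp_of_nat_mult[symmetric] algebra_simps)
        have "majV h [\<rho>1] x * majU h [\<rho>2] x = 4 * (exp (- real n * (\<rho>1 - majH h)) * exp (real n * (\<rho>2 + majH h)))
           * (norm (qint h (int n)) / norm (qint h (int n))) / real n"
          using False by (simp add: x majU_def majV_def)
        \<comment> \<open>The quotient of the norms is 1, or 0 if [n]_q = 0, by the convention for
          division by zero.\<close>
        also have "\<dots> \<le> 4 * ?r ^ n * 1 / 1"
          unfolding e using False by (intro frac_le mult_left_mono) auto
        finally show ?thesis by (simp add: x)
      qed (simp add: x majU_def majV_def)
    qed (simp add: majU_nonneg majV_nonneg)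
  qed
  have 2: "(\<lambda>x. majV h [\<rho>1] x * majU h rs2 x) summable_on UNIV" if "\<And>\<rho>2. \<rho>2 \<in> set rs2 \<Longrightarrow> \<rho>1 > \<rho>2 + 2 * majH h" for \<rho>1
    using that
  proof (induction rs2)
    case Nil
    have "majU h [] x = 0" for x by (simp add: majU_def split: prod.splits)
    then show ?case by simp
  next
    case (Cons \<rho> rs)
    have "(\<lambda>x. majV h [\<rho>1] x * majU h [\<rho>] x + majV h [\<rho>1] x * majU h rs x) summable_on UNIV"
      by (intro summable_on_add 1 Cons) (use Cons.prems in auto)
    then show ?case
      using majU_append[of h "[\<rho>]" rs] by (simp add: distrib_left)
  qed
  have "(\<lambda>x. majV h rs1 x * majU h rs2 x) summable_on UNIV"
    using assms
  proof (induction rs1)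
    case Nil
    have "majV h [] x = 0" for x by (simp add: majV_def split: prod.splits)
    then show ?case by simp
  next
    case (Cons \<rho> rs)
    have "(\<lambda>x. majV h [\<rho>] x * majU h rs2 x + majV h rs x * majU h rs2 x) summable_on UNIV"
      by (intro summable_on_add 2 Cons) (use Cons.prems in \<open>auto simp: sep_def\<close>)
    then show ?case
      using majV_append[of h "[\<rho>]" rs] by (simp add: distrib_right)
  qed
  then show ?thesis by (simp add: abs_mult majU_nonneg majV_nonneg)
qed

text \<open>The product \<open>\<odot>\<close> yields 0 where its defining sum diverges, so
  convergence has to be recorded separately before linearity can be applied.\<close>

definition composable :: "oper \<Rightarrow> oper \<Rightarrow> bool" where
  "composable A B \<longleftrightarrow> (\<forall>b'\<in>fock. \<forall>b\<in>fock. (\<lambda>k. A b' k * B k b) summable_on fock)"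

definition eqf :: "oper \<Rightarrow> oper \<Rightarrow> bool" where
  "eqf A B \<longleftrightarrow> (\<forall>b'\<in>fock. \<forall>b\<in>fock. A b' b = B b' b)"

lemma vop_maj_has_sum:
  assumes "sep h rs1 rs2" "intshift \<nu>2" "b \<in> fock"
  shows "((\<lambda>k. vop \<nu>1 d1 (majU h rs1) (majV h rs1) b' k * vop \<nu>2 d2 (majU h rs2) (majV h rs2) k b) has_sum
     exp (infsum (\<lambda>x. majV h rs1 x * majU h rs2 x) UNIV) *
     vop (\<lambda>s. \<nu>1 s + \<nu>2 s) (\<lambda>\<mu>. d1 (\<lambda>s. \<mu> s + \<nu>2 s) * d2 \<mu>) (majU h (rs1 @ rs2)) (majV h (rs1 @ rs2)) b' b) fock"
  unfolding majU_append majV_append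
  by (rule has_sum_vop) (use assms majVU_summable in \<open>auto simp: majU_def\<close>)

lemma maj_comp:
  assumes "maj h \<nu>1 rs1 A" "maj h \<nu>2 rs2 B" "sep h rs1 rs2" "b' \<in> fock" "b \<in> fock"
  shows "(\<lambda>k. norm (A b' k * B k b)) summable_on fock"
proof -
  obtain d1 d2 where e: "\<And>\<mu>. 0 \<le> d1 \<mu>" "\<And>\<mu>. 0 \<le> d2 \<mu>"
    "\<And>b' b. b' \<in> fock \<Longrightarrow> b \<in> fock \<Longrightarrow> norm (A b' b) \<le> vop \<nu>1 d1 (majU h rs1) (majV h rs1) b' b"
    "\<And>b' b. b' \<in> fock \<Longrightarrow> b \<in> fock \<Longrightarrow> norm (B b' b) \<le> vop \<nu>2 d2 (majU h rs2) (majV h rs2) b' b"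
    using assms unfolding maj_def by metis
  have "(\<lambda>k. vop \<nu>1 d1 (majU h rs1) (majV h rs1) b' k * vop \<nu>2 d2 (majU h rs2) (majV h rs2) k b) summable_on fock"
    by (rule has_sum_imp_summable[OF vop_maj_has_sum]) (use assms in \<open>auto simp: maj_def\<close>)
  then show ?thesis
    by (rule summable_on_comparison_test)
      (auto simp: norm_mult intro!: mult_mono e vop_nonneg majU_nonneg majV_nonneg assms)
qed

lemma maj_imp_comp: "maj h \<nu>1 rs1 A \<Longrightarrow> maj h \<nu>2 rs2 B \<Longrightarrow> sep h rs1 rs2 \<Longrightarrow> composable A B"
  unfolding composable_def by (intro ballI abs_summable_summable[OF maj_comp])

text \<open>The product of two majorants is a majorant of the same shape at the concatenated radii,
  the exponential of the contraction being absorbed into \<open>e\<close>. Bounds thus propagate to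
  words of any length.\<close>

lemma maj_oprod:
  assumes "maj h \<nu>1 rs1 A" "maj h \<nu>2 rs2 B" "sep h rs1 rs2"
  shows "maj h (\<lambda>s. \<nu>1 s + \<nu>2 s) (rs1 @ rs2) (A \<odot> B)"
proof -
  obtain d1 d2 where e: "\<And>\<mu>. 0 \<le> d1 \<mu>" "\<And>\<mu>. 0 \<le> d2 \<mu>"
    "\<And>b' b. b' \<in> fock \<Longrightarrow> b \<in> fock \<Longrightarrow> norm (A b' b) \<le> vop \<nu>1 d1 (majU h rs1) (majV h rs1) b' b"
    "\<And>b' b. b' \<in> fock \<Longrightarrow> b \<in> fock \<Longrightarrow> norm (B b' b) \<le> vop \<nu>2 d2 (majU h rs2) (majV h rs2) b' b"
    using assms unfolding maj_def by metis
  let ?c = "exp (infsum (\<lambda>x. majV h rs1 x * majU h rs2 x) UNIV)"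
  let ?e = "\<lambda>\<mu>. ?c * (d1 (\<lambda>s. \<mu> s + \<nu>2 s) * d2 \<mu>)"
  have "norm ((A \<odot> B) b' b) \<le> vop (\<lambda>s. \<nu>1 s + \<nu>2 s) ?e (majU h (rs1 @ rs2)) (majV h (rs1 @ rs2)) b' b"
    if b: "b' \<in> fock" "b \<in> fock" for b' b
  proof -
    have "norm ((A \<odot> B) b' b) \<le> infsum (\<lambda>k. norm (A b' k * B k b)) fock"
      unfolding oprod_def using maj_comp[OF assms b] by (rule norm_infsum_bound)
    also have "\<dots> \<le> infsum (\<lambda>k. vop \<nu>1 d1 (majU h rs1) (majV h rs1) b' k * vop \<nu>2 d2 (majU h rs2) (majV h rs2) k b) fock"
      by (rule infsum_mono[OF maj_comp[OF assms b] has_sum_imp_summable[OF vop_maj_has_sum]])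
        (use assms b in \<open>auto simp: norm_mult maj_def intro!: mult_mono e vop_nonneg majU_nonneg majV_nonneg\<close>)
    also have "\<dots> = vop (\<lambda>s. \<nu>1 s + \<nu>2 s) ?e (majU h (rs1 @ rs2)) (majV h (rs1 @ rs2)) b' b"
    proof -
      have i: "intshift \<nu>2" using assms(2) by (simp add: maj_def)
      show ?thesis
        unfolding infsumI[OF vop_maj_has_sum[OF assms(3) i b(2)]] by (simp add: vop_def)
    qed
    finally show ?thesis .
  qed
  moreover have "0 \<le> ?e \<mu>" for \<mu> using e by simp
  ultimately show ?thesis
    using assms(1,2) unfolding maj_def by (intro conjI intshift_add exI[of _ ?e]) auto
qed

lemma oprod_assoc_summable:
  assumes "(\<lambda>(k, l). A b' k * B k l * C l b) summable_on fock \<times> fock"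
  shows "((A \<odot> B) \<odot> C) b' b = (A \<odot> (B \<odot> C)) b' b"
proof -
  have "((A \<odot> B) \<odot> C) b' b = (\<Sum>\<^sub>\<infinity>l\<in>fock. \<Sum>\<^sub>\<infinity>k\<in>fock. A b' k * B k l * C l b)"
    by (simp add: oprod_def infsum_cmult_left')
  also have "\<dots> = (\<Sum>\<^sub>\<infinity>k\<in>fock. \<Sum>\<^sub>\<infinity>l\<in>fock. A b' k * B k l * C l b)"
    by (rule infsum_swap_banach[symmetric]) (use assms in simp)
  also have "\<dots> = (A \<odot> (B \<odot> C)) b' b"
    by (simp add: oprod_def mult.assoc infsum_cmult_right')
  finally show ?thesis .
qed

text \<open>Summing the majorant over \<open>k\<close> first yields a majorant at
  \<open>rs1 @ rs2\<close>, which is separated from \<open>rs3\<close>; the remaining sum over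
  \<open>l\<close> is again the two-operator case. Joint absolute summability is what associativity
  requires.\<close>

lemma maj_triple:
  assumes "maj h \<nu>1 rs1 A" "maj h \<nu>2 rs2 B" "maj h \<nu>3 rs3 C" "sep h rs1 rs2" "sep h rs1 rs3" "sep h rs2 rs3"
    and b: "b' \<in> fock" "b \<in> fock"
  shows "(\<lambda>(k, l). norm (A b' k * B k l * C l b)) summable_on fock \<times> fock"
proof -
  obtain d1 d2 d3 where e: "\<And>\<mu>. 0 \<le> d1 \<mu>" "\<And>\<mu>. 0 \<le> d2 \<mu>" "\<And>\<mu>. 0 \<le> d3 \<mu>"
    "\<And>b' b. b' \<in> fock \<Longrightarrow> b \<in> fock \<Longrightarrow> norm (A b' b) \<le> vop \<nu>1 d1 (majU h rs1) (majV h rs1) b' b"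
    "\<And>b' b. b' \<in> fock \<Longrightarrow> b \<in> fock \<Longrightarrow> norm (B b' b) \<le> vop \<nu>2 d2 (majU h rs2) (majV h rs2) b' b"
    "\<And>b' b. b' \<in> fock \<Longrightarrow> b \<in> fock \<Longrightarrow> norm (C b' b) \<le> vop \<nu>3 d3 (majU h rs3) (majV h rs3) b' b"
    using assms unfolding maj_def by metis
  let ?A = "vop \<nu>1 d1 (majU h rs1) (majV h rs1)" and ?B = "vop \<nu>2 d2 (majU h rs2) (majV h rs2)"
    and ?C = "vop \<nu>3 d3 (majU h rs3) (majV h rs3)"
  have nn: "0 \<le> ?A x y" "0 \<le> ?B x y" "0 \<le> ?C x y" for x y
    by (intro vop_nonneg majU_nonneg majV_nonneg e)+
  have "(\<lambda>(l, k). ?A b' k * ?B k l * ?C l b) summable_on fock \<times> fock"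
  proof (rule summable_on_SigmaI)
    fix l assume l: "l \<in> fock"
    show "((\<lambda>k. case (l, k) of (l, k) \<Rightarrow> ?A b' k * ?B k l * ?C l b) has_sum
        (exp (infsum (\<lambda>x. majV h rs1 x * majU h rs2 x) UNIV) *
         vop (\<lambda>s. \<nu>1 s + \<nu>2 s) (\<lambda>\<mu>. d1 (\<lambda>s. \<mu> s + \<nu>2 s) * d2 \<mu>) (majU h (rs1 @ rs2)) (majV h (rs1 @ rs2)) b' l) * ?C l b) fock"
      using assms l unfolding prod.case by (intro has_sum_cmult_left vop_maj_has_sum) (auto simp: maj_def)
  next
    have "(\<lambda>l. vop (\<lambda>s. \<nu>1 s + \<nu>2 s) (\<lambda>\<mu>. d1 (\<lambda>s. \<mu> s + \<nu>2 s) * d2 \<mu>) (majU h (rs1 @ rs2)) (majV h (rs1 @ rs2)) b' l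
       * ?C l b) summable_on fock"
      by (rule has_sum_imp_summable[OF vop_maj_has_sum]) (use assms in \<open>auto simp: maj_def sep_def\<close>)
    then show "(\<lambda>l. (exp (infsum (\<lambda>x. majV h rs1 x * majU h rs2 x) UNIV) *
         vop (\<lambda>s. \<nu>1 s + \<nu>2 s) (\<lambda>\<mu>. d1 (\<lambda>s. \<mu> s + \<nu>2 s) * d2 \<mu>) (majU h (rs1 @ rs2)) (majV h (rs1 @ rs2)) b' l) * ?C l b) summable_on fock"
      unfolding mult.assoc by (rule summable_on_cmult_right)
  qed (auto simp: nn)
  then have "(\<lambda>(k, l). ?A b' k * ?B k l * ?C l b) summable_on fock \<times> fock"
    by (subst summable_on_swap) simp
  then show ?thesis
    by (rule summable_on_comparison_test)
      (use b in \<open>auto simp: norm_mult intro!: mult_mono e nn mult_nonneg_nonneg\<close>)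
qed

lemma maj_assoc:
  assumes "maj h \<nu>1 rs1 A" "maj h \<nu>2 rs2 B" "maj h \<nu>3 rs3 C" "sep h rs1 rs2" "sep h rs1 rs3" "sep h rs2 rs3"
  shows "eqf ((A \<odot> B) \<odot> C) (A \<odot> (B \<odot> C))"
  unfolding eqf_def
  using abs_summable_summable[OF maj_triple[OF assms, unfolded case_prod_unfold]]
  by (auto intro!: oprod_assoc_summable simp: case_prod_unfold)

section \<open>Operators with finite rows or columns\<close>

definition rowfin :: "oper \<Rightarrow> bool" where
  "rowfin f \<longleftrightarrow> (\<forall>b'\<in>fock. finite {k\<in>fock. f b' k \<noteq> 0})"

definition colfin :: "oper \<Rightarrow> bool" where
  "colfin f \<longleftrightarrow> (\<forall>b\<in>fock. finite {k\<in>fock. f k b \<noteq> 0})"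

lemma rowfin_oprod:
  "rowfin f \<Longrightarrow> b' \<in> fock \<Longrightarrow> (f \<odot> S) b' b = (\<Sum>k | k \<in> fock \<and> f b' k \<noteq> 0. f b' k * S k b)"
  unfolding oprod_def rowfin_def by (intro infsum_finite_support) auto

lemma colfin_oprod:
  "colfin f \<Longrightarrow> b \<in> fock \<Longrightarrow> (S \<odot> f) b' b = (\<Sum>k | k \<in> fock \<and> f k b \<noteq> 0. S b' k * f k b)"
  unfolding oprod_def colfin_def by (intro infsum_finite_support) auto

lemma finite_support_summable:
  "finite F \<Longrightarrow> (\<And>x. x \<in> A \<Longrightarrow> x \<notin> F \<Longrightarrow> f x = 0) \<Longrightarrow> f summable_on A"
  for f :: "'b \<Rightarrow> 'a::{topological_comm_monoid_add,t2_space}"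
  by (rule finite_nonzero_values_imp_summable_on, erule finite_subset[rotated]) auto

lemma rowfin_comp: "rowfin f \<Longrightarrow> composable f S"
  unfolding composable_def
proof (intro ballI)
  fix b' b assume "rowfin f" "b' \<in> fock" "b \<in> fock"
  then show "(\<lambda>k. f b' k * S k b) summable_on fock"
    by (intro finite_support_summable[of "{k\<in>fock. f b' k \<noteq> 0}"]) (auto simp: rowfin_def)
qed

lemma colfin_comp: "colfin f \<Longrightarrow> composable S f"
  unfolding composable_def
proof (intro ballI)
  fix b' b assume "colfin f" "b' \<in> fock" "b \<in> fock"
  then show "(\<lambda>k. S b' k * f k b) summable_on fock"
    by (intro finite_support_summable[of "{k\<in>fock. f k b \<noteq> 0}"]) (auto simp: colfin_def)
qed

text \<open>For a fixed row only finitely many pairs of intermediate states contribute, whatever the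
  growth of \<open>S\<close>.\<close>

lemma rowfin_assoc:
  assumes "rowfin f" "rowfin g"
  shows "eqf ((f \<odot> g) \<odot> S) (f \<odot> (g \<odot> S))"
  unfolding eqf_def
proof (intro ballI)
  fix b' b assume b': "b' \<in> fock"
  let ?F = "SIGMA k:{k\<in>fock. f b' k \<noteq> 0}. {l\<in>fock. g k l \<noteq> 0}"
  have "finite ?F" using assms b' by (intro finite_SigmaI) (auto simp: rowfin_def)
  then show "((f \<odot> g) \<odot> S) b' b = (f \<odot> (g \<odot> S)) b' b"
    by (intro oprod_assoc_summable finite_support_summable[of ?F]) auto
qed

lemma colfin_assoc:
  assumes "colfin f" "colfin g"
  shows "eqf ((S \<odot> f) \<odot> g) (S \<odot> (f \<odot> g))"
  unfolding eqf_def
proof (intro ballI)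
  fix b' b assume b: "b \<in> fock"
  let ?F = "(\<lambda>(l,k). (k,l)) ` (SIGMA l:{l\<in>fock. g l b \<noteq> 0}. {k\<in>fock. f k l \<noteq> 0})"
  have "finite ?F" using assms b by (intro finite_imageI finite_SigmaI) (auto simp: colfin_def)
  then show "((S \<odot> f) \<odot> g) b' b = (S \<odot> (f \<odot> g)) b' b"
    by (intro oprod_assoc_summable finite_support_summable[of ?F]) (auto simp: image_iff)
qed

lemma rowcolfin_assoc:
  assumes "rowfin f" "colfin g"
  shows "eqf ((f \<odot> S) \<odot> g) (f \<odot> (S \<odot> g))"
  unfolding eqf_def
proof (intro ballI)
  fix b' b assume b: "b' \<in> fock" "b \<in> fock"
  let ?F = "{k\<in>fock. f b' k \<noteq> 0} \<times> {l\<in>fock. g l b \<noteq> 0}"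
  have "finite ?F" using assms b by (auto simp: colfin_def rowfin_def)
  then show "((f \<odot> S) \<odot> g) b' b = (f \<odot> (S \<odot> g)) b' b"
    by (intro oprod_assoc_summable finite_support_summable[of ?F]) auto
qed

lemma eqf_refl [simp]: "eqf A A" and eqf_sym: "eqf A B \<Longrightarrow> eqf B A"
  and eqf_trans [trans]: "eqf A B \<Longrightarrow> eqf B C \<Longrightarrow> eqf A C"
  by (auto simp: eqf_def)

lemma eqf_oprod: "eqf A A' \<Longrightarrow> eqf B B' \<Longrightarrow> eqf (A \<odot> B) (A' \<odot> B')"
  unfolding eqf_def oprod_def by (intro ballI infsum_cong) simp

lemma eqf_add: "eqf A A' \<Longrightarrow> eqf B B' \<Longrightarrow> eqf (A + B) (A' + B')"
  and eqf_diff: "eqf A A' \<Longrightarrow> eqf B B' \<Longrightarrow> eqf (A - B) (A' - B')"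
  and eqf_oscale: "eqf A A' \<Longrightarrow> eqf (oscale x A) (oscale x A')"
  by (auto simp: eqf_def oscale_def)

lemma oprod_add_left: "composable A C \<Longrightarrow> composable B C \<Longrightarrow> eqf ((A + B) \<odot> C) (A \<odot> C + B \<odot> C)"
  unfolding eqf_def composable_def oprod_def by (auto simp: distrib_right infsum_add)

lemma oprod_add_right: "composable A B \<Longrightarrow> composable A C \<Longrightarrow> eqf (A \<odot> (B + C)) (A \<odot> B + A \<odot> C)"
  unfolding eqf_def composable_def oprod_def by (auto simp: distrib_left infsum_add)

lemma oprod_oscale_left: "oscale x A \<odot> B = oscale x (A \<odot> B)"
  and oprod_oscale_right: "A \<odot> oscale x B = oscale x (A \<odot> B)"
  unfolding oprod_def oscale_def
  by (auto simp: fun_eq_iff mult.assoc mult.left_commute infsum_cmult_right')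

lemma comp_add_left: "composable A C \<Longrightarrow> composable B C \<Longrightarrow> composable (A + B) C"
  and comp_add_right: "composable A B \<Longrightarrow> composable A C \<Longrightarrow> composable A (B + C)"
  unfolding composable_def by (auto simp: distrib_right distrib_left intro!: summable_on_add)

lemma comp_oscale_left: "composable A B \<Longrightarrow> composable (oscale x A) B"
  and comp_oscale_right: "composable A B \<Longrightarrow> composable A (oscale x B)"
  unfolding composable_def oscale_def
  by (auto simp: mult.assoc mult.left_commute intro!: summable_on_cmult_right)

lemma oprod_oid_left: "b' \<in> fock \<Longrightarrow> (oid \<odot> S) b' b = S b' b"
  unfolding oprod_def oid_def by (subst infsum_single[of _ b']) auto

lemma oprod_oid_right: "b \<in> fock \<Longrightarrow> (S \<odot> oid) b' b = S b' b"
  unfolding oprod_def oid_def by (subst infsum_single[of _ b]) auto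

section \<open>Currents and vertex operators in closed form\<close>

text \<open>$\alpha H^{*,1}(e^a;\kappa) + \beta H^1(e^b;\kappa) + \gamma c(e^c)$, with \<open>\<theta> * c\<^sub>0\<close> added to absorb the factors \<open>exp (\<plusminus> \<i> * pi * c\<^sub>0)\<close>.\<close>

definition vx :: "complex \<Rightarrow> complex \<Rightarrow> int \<Rightarrow> int \<Rightarrow> int \<Rightarrow> complex \<Rightarrow> complex \<Rightarrow> complex \<Rightarrow> complex \<Rightarrow> lin" where
  "vx h \<kappa> \<alpha> \<beta> \<gamma> \<theta> a b c g = (case g of
      Q s \<Rightarrow> (case s of Ba1 \<Rightarrow> of_int \<alpha> / 2 + of_int \<beta> | Ba2 \<Rightarrow> of_int \<alpha> / 2 - of_int \<beta> | Bc \<Rightarrow> of_int \<gamma>)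
    | Mode s n \<Rightarrow>
       (if n = 0 then (case s of Ba1 \<Rightarrow> of_int \<alpha> * a / 2 + of_int \<beta> * b | Ba2 \<Rightarrow> - of_int \<alpha> * a / 2 + of_int \<beta> * b
           | Bc \<Rightarrow> of_int \<gamma> * c + \<theta>)
        else - (case s of Ba1 \<Rightarrow> exp (\<kappa> * of_int \<bar>n\<bar> * h) * (of_int \<alpha> / 2 * exp (- of_int n * a) + of_int \<beta> * exp (- of_int n * b))
           | Ba2 \<Rightarrow> exp (\<kappa> * of_int \<bar>n\<bar> * h) * (- of_int \<alpha> / 2 * exp (- of_int n * a) + of_int \<beta> * exp (- of_int n * b))
           | Bc \<Rightarrow> of_int \<gamma> * exp (- of_int n * c)) / qint h n))"

lemma qint_uminus: "qint h (- n) = - qint h n"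
  by (simp add: qint_def minus_divide_left)

text \<open>A zero of [n]_q would force q^(2n) = 1, and a zero of q^n + q^(-n) would force q^(4n) =
  1. Negative exponents are reduced to positive ones by inversion.\<close>

lemma generic_qint:
  assumes "\<forall>n::nat. 0 < n \<longrightarrow> exp h ^ n \<noteq> 1" "n \<noteq> 0"
  shows "qint h n \<noteq> 0" "exp (of_int n * h) + exp (- (of_int n * h)) \<noteq> 0"
proof -
  have *: "exp (of_int m * h) \<noteq> 1" if "m \<noteq> 0" for m :: int
  proof (cases "m > 0")
    case True
    then show ?thesis using assms(1)[rule_format, of "nat m"] by (simp add: exp_of_nat_mult[symmetric])
  next
    case False
    then have "exp (of_int (- m) * h) \<noteq> 1"
      using that assms(1)[rule_format, of "nat (- m)"] by (simp add: exp_of_nat_mult[symmetric])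
    then show ?thesis by (auto simp: exp_minus)
  qed
  have ne: "exp x \<noteq> exp (- x)" if "exp (2 * x) \<noteq> 1" for x :: complex
  proof
    assume "exp x = exp (- x)"
    then have "exp (x + x) = exp x * exp (- x)" by (simp only: exp_add)
    also have "\<dots> = 1" by (simp flip: exp_add)
    finally have "exp (x + x) = 1" .
    with that show False by simp
  qed
  have "exp (of_int n * h) \<noteq> exp (- (of_int n * h))"
    using *[of "2 * n"] assms(2) by (intro ne) (simp add: mult.assoc)
  moreover have "exp h \<noteq> exp (- h)" using *[of 2] by (intro ne) simp
  ultimately show "qint h n \<noteq> 0" by (simp add: qint_def)
  show "exp (of_int n * h) + exp (- (of_int n * h)) \<noteq> 0"
  proof
    assume "exp (of_int n * h) + exp (- (of_int n * h)) = 0"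
    then have "exp (of_int n * h) = - exp (- (of_int n * h))" by (simp add: eq_neg_iff_add_eq_0)
    then have "exp (of_int n * h) * exp (of_int n * h) = - exp (- (of_int n * h)) * exp (of_int n * h)"
      by (rule arg_cong[where f = "\<lambda>t. t * exp (of_int n * h)"])
    also have "\<dots> = -1" by (simp flip: exp_add)
    finally have "exp (of_int n * h) * exp (of_int n * h) = -1" .
    then have "exp (of_int n * h + of_int n * h) = -1" by (simp only: exp_add)
    then have "exp (2 * (of_int n * h)) = -1" by (simp only: mult_2)
    then have "exp (2 * (of_int n * h)) * exp (2 * (of_int n * h)) = 1" by simp
    then have "exp (of_int (4 * n) * h) = 1" by (simp add: exp_add[symmetric] mult_ac)
    then show False using *[of "4 * n"] assms(2) by simp
  qed
qed

lemma generic_q: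
  fixes h :: complex
  assumes "\<forall>n::nat. 0 < n \<longrightarrow> exp h ^ n \<noteq> 1"
  shows "exp h - exp (- h) \<noteq> 0"
  using generic_qint[OF assms, of 1] by (simp add: qint_def split: if_splits)

text \<open>Each oscillator occurs in one summand only, so the infinite sum in a current is
  evaluated coefficient by coefficient and raises no question of convergence.\<close>

lemma current_eq:
  assumes "\<And>n. n \<noteq> 0 \<Longrightarrow> M n (Q s) = 0" "\<And>n n'. n \<noteq> n' \<Longrightarrow> M n (Mode s n') = 0" 
  shows "current h Q0 M \<kappa> \<zeta> (Q s) = Q0 (Q s) + \<zeta> * M 0 (Q s)"
    and "current h Q0 M \<kappa> \<zeta> (Mode s n) = Q0 (Mode s n) + \<zeta> * M 0 (Mode s n) -
      (if n = 0 then 0 else M n (Mode s n) / qint h n * exp (\<kappa> * of_int \<bar>n\<bar> * h) * exp (- (of_int n * \<zeta>)))"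
proof -
  have "(\<Sum>\<^sub>\<infinity>m\<in>UNIV - {0}. M m (Q s) / qint h m * exp (\<kappa> * of_int \<bar>m\<bar> * h) * exp (- (of_int m * \<zeta>))) = 0"
    by (rule infsum_0) (use assms in auto)
  then show "current h Q0 M \<kappa> \<zeta> (Q s) = Q0 (Q s) + \<zeta> * M 0 (Q s)" by (simp add: current_def)
  have "(\<Sum>\<^sub>\<infinity>m\<in>UNIV - {0}. M m (Mode s n) / qint h m * exp (\<kappa> * of_int \<bar>m\<bar> * h) * exp (- (of_int m * \<zeta>)))
    = (if n = 0 then 0 else M n (Mode s n) / qint h n * exp (\<kappa> * of_int \<bar>n\<bar> * h) * exp (- (of_int n * \<zeta>)))"
    by (subst infsum_single[of _ n]) (use assms in auto)
  then show "current h Q0 M \<kappa> \<zeta> (Mode s n) = Q0 (Mode s n) + \<zeta> * M 0 (Mode s n) -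
      (if n = 0 then 0 else M n (Mode s n) / qint h n * exp (\<kappa> * of_int \<bar>n\<bar> * h) * exp (- (of_int n * \<zeta>)))"
    by (simp add: current_def)
qed

lemma H1_vx: "H1 h \<kappa> \<zeta> = vx h \<kappa> 0 1 0 0 a \<zeta> c"
proof
  fix g
  have *: "A1 m (Q s) = 0" "m \<noteq> n \<Longrightarrow> A1 m (Mode s n) = 0" for s m n
    by (auto simp: A1_def gen_def)
  show "H1 h \<kappa> \<zeta> g = vx h \<kappa> 0 1 0 0 a \<zeta> c g"
  proof (cases g)
    case (Q s)
    then show ?thesis
      by (cases s) (simp_all add: H1_def current_eq(1) * vx_def QA1_def A1_def gen_def)
  next
    case (Mode s n)
    then show ?thesis
      by (cases s) (simp_all add: H1_def current_eq(2) * vx_def QA1_def A1_def gen_def mult_ac)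
  qed
qed

lemma H1_dual_vx:
  assumes "\<forall>n::nat. 0 < n \<longrightarrow> exp h ^ n \<noteq> 1"
  shows "H1_dual h \<kappa> \<zeta> = vx h \<kappa> 1 0 0 0 \<zeta> b c"
proof
  fix g
  have *: "A1_dual h m (Q s) = 0" "m \<noteq> n \<Longrightarrow> A1_dual h m (Mode s n) = 0" for s m n
    by (auto simp: A1_dual_def A2_def gen_def lscale_def)
  \<comment> \<open>The factor (q^n + q^(-n)) / 2 in \<open>A2\<close> is cancelled by the
    normalisation of the dual modes up to 1/2, and this agrees with the separate definition at n =
    0.\<close>
  have **: "A1_dual h n (Mode s n) = (case s of Ba1 \<Rightarrow> 1 / 2 | Ba2 \<Rightarrow> - 1 / 2 | Bc \<Rightarrow> 0)" for n s
    using generic_qint(2)[OF assms, of n]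
    by (cases s) (auto simp: A1_dual_def A2_def gen_def lscale_def)
  show "H1_dual h \<kappa> \<zeta> g = vx h \<kappa> 1 0 0 0 \<zeta> b c g"
  proof (cases g)
    case (Q s)
    then show ?thesis
      by (cases s) (simp_all add: H1_dual_def current_eq(1) * vx_def QA1_dual_def QA2_def lscale_def gen_def)
  next
    case (Mode s n)
    then show ?thesis
      by (cases "n = 0"; cases s) (simp_all add: H1_dual_def current_eq(2) * ** vx_def QA1_dual_def QA2_def lscale_def gen_def mult_ac)
  qed
qed

lemma c_field_vx: "c_field h \<zeta> = vx h \<kappa> 0 0 1 0 a b \<zeta>"
proof
  fix g
  show "c_field h \<zeta> g = vx h \<kappa> 0 0 1 0 a b \<zeta> g"
  proof (cases g)
    case (Q s)
    then show ?thesis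
      by (cases s) (simp_all add: c_field_def current_eq(1) vx_def gen_def)
  next
    case (Mode s n)
    then show ?thesis
      by (cases "n = 0"; cases s) (simp_all add: c_field_def current_eq(2) vx_def gen_def)
  qed
qed

lemma vx_sum:
  "lscale (of_int i) (vx h \<kappa> 1 0 0 0 a b1 c1) + lscale (of_int j) (vx h \<kappa> 0 1 0 0 a2 b c2)
     + lscale (of_int k) (vx h \<kappa> 0 0 1 0 a3 b3 c) = vx h \<kappa> i j k 0 a b c"
proof
  fix g
  show "(lscale (of_int i) (vx h \<kappa> 1 0 0 0 a b1 c1) + lscale (of_int j) (vx h \<kappa> 0 1 0 0 a2 b c2)
     + lscale (of_int k) (vx h \<kappa> 0 0 1 0 a3 b3 c)) g = vx h \<kappa> i j k 0 a b c g"
  proof (cases g)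
    case (Q s)
    then show ?thesis by (cases s) (simp_all add: vx_def lscale_def)
  next
    case (Mode s n)
    then show ?thesis
      by (cases "n = 0"; cases s) (simp_all add: vx_def lscale_def algebra_simps add_divide_distrib diff_divide_distrib)
  qed
qed

text \<open>In a normally ordered exponential the zero modes stand to the right of the shift, so a
  phase in c_0 multiplied from the right is simply added to the coefficient of c_0.\<close>

lemma nexp_phase:
  assumes "b' \<in> fock" "b \<in> fock"
  shows "(nexp h (vx h' \<kappa> \<alpha> \<beta> \<gamma> 0 x y z) \<odot> oexp (oscale \<theta> (mode_op h Bc 0))) b' b = nexp h (vx h' \<kappa> \<alpha> \<beta> \<gamma> \<theta> x y z) b' b"
proof -
  let ?E = "oexp (oscale \<theta> (mode_op h Bc 0))"
  let ?N = "nexp h (vx h' \<kappa> \<alpha> \<beta> \<gamma> 0 x y z)"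
  have E: "?E k b = (if k = b then exp (\<theta> * fst b Bc) else 0)" for k
    by (rule oexp_diag) (use assms in \<open>auto simp: oscale_def mode_op_def\<close>)
  have "(?N \<odot> ?E) b' b = ?N b' b * exp (\<theta> * fst b Bc)"
    unfolding oprod_def by (subst infsum_single[of _ b]) (use assms in \<open>auto simp: E\<close>)
  moreover have "zer (vx h' \<kappa> \<alpha> \<beta> \<gamma> \<theta> x y z) \<mu> = zer (vx h' \<kappa> \<alpha> \<beta> \<gamma> 0 x y z) \<mu> * exp (\<theta> * \<mu> Bc)" for \<mu>
    by (simp add: zer_def vx_def algebra_simps flip: exp_add)
  moreover have "cre (vx h' \<kappa> \<alpha> \<beta> \<gamma> \<theta> x y z) = cre (vx h' \<kappa> \<alpha> \<beta> \<gamma> 0 x y z)"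
    "ann h (vx h' \<kappa> \<alpha> \<beta> \<gamma> \<theta> x y z) = ann h (vx h' \<kappa> \<alpha> \<beta> \<gamma> 0 x y z)"
    "(\<lambda>s. vx h' \<kappa> \<alpha> \<beta> \<gamma> \<theta> x y z (Q s)) = (\<lambda>s. vx h' \<kappa> \<alpha> \<beta> \<gamma> 0 x y z (Q s))"
    by (auto simp: cre_def ann_def vx_def fun_eq_iff)
  ultimately show ?thesis using assms by (simp add: nexp_eq vop_def)
qed

text \<open>The scalar by which \<open>:exp L1: :exp L2:\<close> differs from \<open>:exp (L1 + L2):\<close>.\<close>

definition contr :: "complex \<Rightarrow> lin \<Rightarrow> lin \<Rightarrow> complex" where
  "contr h L1 L2 = exp (infsum (\<lambda>x. ann h L1 x * cre L2 x) UNIV) *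
     exp (L1 (Mode Ba1 0) * L2 (Q Ba1) + L1 (Mode Ba2 0) * L2 (Q Ba2) + L1 (Mode Bc 0) * L2 (Q Bc))"

lemma cre_add: "cre (L1 + L2) = (\<lambda>x. cre L1 x + cre L2 x)"
  and ann_add: "ann h (L1 + L2) = (\<lambda>x. ann h L1 x + ann h L2 x)"
  by (auto simp: cre_def ann_def fun_eq_iff distrib_left)

lemma nexp_mult:
  assumes "(\<lambda>x. norm (ann h L1 x * cre L2 x)) summable_on UNIV" "intshift (\<lambda>s. L2 (Q s))" "b' \<in> fock" "b \<in> fock"
  shows "((\<lambda>k. nexp h L1 b' k * nexp h L2 k b) has_sum contr h L1 L2 * nexp h (L1 + L2) b' b) fock"
proof -
  have z: "zer L1 (\<lambda>s. \<mu> s + L2 (Q s)) * zer L2 \<mu> =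
     exp (L1 (Mode Ba1 0) * L2 (Q Ba1) + L1 (Mode Ba2 0) * L2 (Q Ba2) + L1 (Mode Bc 0) * L2 (Q Bc)) * zer (L1 + L2) \<mu>" for \<mu>
    by (simp add: zer_def exp_add[symmetric] algebra_simps)
  have "((\<lambda>k. vop (\<lambda>s. L1 (Q s)) (zer L1) (cre L1) (ann h L1) b' k * vop (\<lambda>s. L2 (Q s)) (zer L2) (cre L2) (ann h L2) k b)
     has_sum exp (infsum (\<lambda>x. ann h L1 x * cre L2 x) UNIV) *
       vop (\<lambda>s. L1 (Q s) + L2 (Q s)) (\<lambda>\<mu>. zer L1 (\<lambda>s. \<mu> s + L2 (Q s)) * zer L2 \<mu>) (cre (L1 + L2)) (ann h (L1 + L2)) b' b) fock"
    unfolding cre_add ann_add by (rule has_sum_vop) (use assms in \<open>auto simp: cre_def\<close>)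
  also have "exp (infsum (\<lambda>x. ann h L1 x * cre L2 x) UNIV) *
       vop (\<lambda>s. L1 (Q s) + L2 (Q s)) (\<lambda>\<mu>. zer L1 (\<lambda>s. \<mu> s + L2 (Q s)) * zer L2 \<mu>) (cre (L1 + L2)) (ann h (L1 + L2)) b' b
     = contr h L1 L2 * nexp h (L1 + L2) b' b"
    unfolding z using assms by (simp add: nexp_eq vop_def contr_def)
  also have "((\<lambda>k. vop (\<lambda>s. L1 (Q s)) (zer L1) (cre L1) (ann h L1) b' k * vop (\<lambda>s. L2 (Q s)) (zer L2) (cre L2) (ann h L2) k b)
     has_sum contr h L1 L2 * nexp h (L1 + L2) b' b) fock \<longleftrightarrow> ?thesis"
    by (rule has_sum_cong) (use assms in \<open>auto simp: nexp_eq\<close>)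
  finally show ?thesis .
qed

lemma has_sum_Ln:
  assumes "norm (x::complex) < 1"
  shows "((\<lambda>n. if n = 0 then 0 else - (x ^ n) / of_nat n) has_sum Ln (1 - x)) UNIV"
proof (rule norm_summable_imp_has_sum)
  have "(\<lambda>n. - (x ^ n) / of_nat n) sums Ln (1 - x)"
    using Ln_series'[of "- x"] assms by simp
  moreover have "(\<lambda>n. - (x ^ n) / of_nat n) = (\<lambda>n. if n = 0 then 0 else - (x ^ n) / of_nat n)" by auto
  ultimately show "(\<lambda>n. if n = 0 then 0 else - (x ^ n) / of_nat n) sums Ln (1 - x)" by simp
  show "summable (\<lambda>n. norm (if n = 0 then 0 else - (x ^ n) / of_nat n))"
  proof (rule summable_comparison_test'[where g = "\<lambda>n. norm x ^ n" and N = 0])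
    show "summable (\<lambda>n. norm x ^ n)" using assms by (simp add: summable_geometric)
    fix n :: nat
    show "norm (norm (if n = 0 then 0 else - (x ^ n) / of_nat n)) \<le> norm x ^ n"
      using divide_left_mono[of 1 "real n" "norm x ^ n"] by (auto simp: norm_divide norm_power)
  qed
qed

lemma exp_Ln_powi: "norm (x::complex) < 1 \<Longrightarrow> exp (of_int k * Ln (1 - x)) = (1 - x) powi k"
  by (subst exp_power_int[symmetric], subst exp_Ln) auto

text \<open>The pairings of two \<open>H^{*,1}\<close> and of two \<open>H^1\<close> cancel between
  \<open>a^1\<close> and \<open>a^2\<close>, while the mixed pairings contribute 1/2 from each
  boson. Every remaining coefficient of a logarithm is therefore an integer, and the exponential is
  an integral power. The five inequalities are the convergence conditions of the logarithmic
  series.\<close>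

lemma contr_vx:
  assumes gen: "\<forall>n::nat. 0 < n \<longrightarrow> exp h ^ n \<noteq> 1"
    and "Re ((\<kappa>1 + \<kappa>2) * h + a2 - a1) < 0" "Re ((\<kappa>1 + \<kappa>2) * h + b2 - a1) < 0" "Re ((\<kappa>1 + \<kappa>2) * h + a2 - b1) < 0"
      "Re ((\<kappa>1 + \<kappa>2) * h + b2 - b1) < 0" "Re (c2 - c1) < 0"
  shows "contr h (vx h \<kappa>1 \<alpha>1 \<beta>1 \<gamma>1 \<theta>1 a1 b1 c1) (vx h \<kappa>2 \<alpha>2 \<beta>2 \<gamma>2 \<theta>2 a2 b2 c2) =
    exp (\<theta>1 * of_int \<gamma>2) * (exp a1 - exp ((\<kappa>1 + \<kappa>2) * h) * exp b2) powi (\<alpha>1 * \<beta>2)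
     * (exp b1 - exp ((\<kappa>1 + \<kappa>2) * h) * exp a2) powi (\<beta>1 * \<alpha>2) * (exp c1 - exp c2) powi (\<gamma>1 * \<gamma>2)"
proof -
  let ?L1 = "vx h \<kappa>1 \<alpha>1 \<beta>1 \<gamma>1 \<theta>1 a1 b1 c1" and ?L2 = "vx h \<kappa>2 \<alpha>2 \<beta>2 \<gamma>2 \<theta>2 a2 b2 c2"
  let ?E = "\<lambda>p1 p2. exp ((\<kappa>1 + \<kappa>2) * h + p2 - p1)"
  let ?l = "\<lambda>x n. if n = 0 then 0 else - (x ^ n) / (of_nat n :: complex)"
  let ?i = "of_int :: int \<Rightarrow> complex"
  have E: "exp (\<kappa>1 * of_nat n * h) * exp (- of_nat n * p1) * (exp (\<kappa>2 * of_nat n * h) * exp (of_nat n * p2)) = ?E p1 p2 ^ n" for n p1 p2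
    by (simp add: exp_add[symmetric] exp_of_nat_mult[symmetric] algebra_simps)
  have Ec: "exp (- of_nat n * c1) * exp (of_nat n * c2) = exp (c2 - c1) ^ n" for n
    by (simp add: exp_add[symmetric] exp_of_nat_mult[symmetric] algebra_simps)
  have q: "qint h (int n) \<noteq> 0" if "n \<noteq> 0" for n using generic_qint[OF gen, of "int n"] that by simp
  \<comment> \<open>The two factors [n]_q of the commutator cancel against the denominators [n]_q
    and [-n]_q = - [n]_q of the two currents.\<close>
  have canc: "x\<^sup>2 / m * (- u / x) * (- w / - x) = - (u * w) / m" if "x \<noteq> 0" for x u w m :: complex
    using that by (simp add: power2_eq_square)
  have t1: "ann h ?L1 (Ba1, n) * cre ?L2 (Ba1, n) = ?i \<alpha>1 * ?i \<alpha>2 / 4 * ?l (?E a1 a2) n + ?i \<alpha>1 * ?i \<beta>2 / 2 * ?l (?E a1 b2) n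
     + ?i \<beta>1 * ?i \<alpha>2 / 2 * ?l (?E b1 a2) n + ?i \<beta>1 * ?i \<beta>2 * ?l (?E b1 b2) n" for n
  proof (cases "n = 0")
    case False
    have "ann h ?L1 (Ba1, n) * cre ?L2 (Ba1, n) =
      - (exp (\<kappa>1 * of_nat n * h) * (?i \<alpha>1 / 2 * exp (- of_nat n * a1) + ?i \<beta>1 * exp (- of_nat n * b1))
      * (exp (\<kappa>2 * of_nat n * h) * (?i \<alpha>2 / 2 * exp (of_nat n * a2) + ?i \<beta>2 * exp (of_nat n * b2)))) / of_nat n"
      using False canc[OF q[OF False]] by (simp add: ann_def cre_def vx_def qint_uminus)
    also have "\<dots> = ?i \<alpha>1 * ?i \<alpha>2 / 4 * ?l (?E a1 a2) n + ?i \<alpha>1 * ?i \<beta>2 / 2 * ?l (?E a1 b2) n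
     + ?i \<beta>1 * ?i \<alpha>2 / 2 * ?l (?E b1 a2) n + ?i \<beta>1 * ?i \<beta>2 * ?l (?E b1 b2) n"
      using False unfolding E[symmetric] by (simp add: field_simps)
    finally show ?thesis .
  qed (simp add: cre_def)
  have t2: "ann h ?L1 (Ba2, n) * cre ?L2 (Ba2, n) = - (?i \<alpha>1 * ?i \<alpha>2 / 4 * ?l (?E a1 a2) n) + ?i \<alpha>1 * ?i \<beta>2 / 2 * ?l (?E a1 b2) n
     + ?i \<beta>1 * ?i \<alpha>2 / 2 * ?l (?E b1 a2) n + - (?i \<beta>1 * ?i \<beta>2 * ?l (?E b1 b2) n)" for n
  proof (cases "n = 0")
    case False
    have "ann h ?L1 (Ba2, n) * cre ?L2 (Ba2, n) =
      (exp (\<kappa>1 * of_nat n * h) * (- ?i \<alpha>1 / 2 * exp (- of_nat n * a1) + ?i \<beta>1 * exp (- of_nat n * b1))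
      * (exp (\<kappa>2 * of_nat n * h) * (- ?i \<alpha>2 / 2 * exp (of_nat n * a2) + ?i \<beta>2 * exp (of_nat n * b2)))) / of_nat n"
      using False canc[OF q[OF False]] by (simp add: ann_def cre_def vx_def qint_uminus)
    also have "\<dots> = - (?i \<alpha>1 * ?i \<alpha>2 / 4 * ?l (?E a1 a2) n) + ?i \<alpha>1 * ?i \<beta>2 / 2 * ?l (?E a1 b2) n
     + ?i \<beta>1 * ?i \<alpha>2 / 2 * ?l (?E b1 a2) n + - (?i \<beta>1 * ?i \<beta>2 * ?l (?E b1 b2) n)"
      using False unfolding E[symmetric] by (simp add: field_simps)
    finally show ?thesis .
  qed (simp add: cre_def)
  have t3: "ann h ?L1 (Bc, n) * cre ?L2 (Bc, n) = ?i \<gamma>1 * ?i \<gamma>2 * ?l (exp (c2 - c1)) n" for n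
  proof (cases "n = 0")
    case False
    have "ann h ?L1 (Bc, n) * cre ?L2 (Bc, n) =
      - (?i \<gamma>1 * exp (- of_nat n * c1) * (?i \<gamma>2 * exp (of_nat n * c2))) / of_nat n"
      using False canc[OF q[OF False]] by (simp add: ann_def cre_def vx_def qint_uminus)
    also have "\<dots> = ?i \<gamma>1 * ?i \<gamma>2 * ?l (exp (c2 - c1)) n"
      using False unfolding Ec[symmetric] by (simp add: field_simps)
    finally show ?thesis .
  qed (simp add: cre_def)
  have hs: "(?l (?E p1 p2) has_sum Ln (1 - ?E p1 p2)) UNIV" if "Re ((\<kappa>1 + \<kappa>2) * h + p2 - p1) < 0" for p1 p2
    using that by (intro has_sum_Ln) (simp only: norm_exp_eq_Re exp_less_one_iff)
  have hc: "(?l (exp (c2 - c1)) has_sum Ln (1 - exp (c2 - c1))) UNIV"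
    using assms(6) by (intro has_sum_Ln) (simp only: norm_exp_eq_Re exp_less_one_iff)
  let ?LL = "\<lambda>p1 p2. Ln (1 - ?E p1 p2)"
  define F where "F = (\<lambda>x. ann h ?L1 x * cre ?L2 x)"
  have one: "(F has_sum S) (range (Pair s)) \<longleftrightarrow> ((\<lambda>n. F (s, n)) has_sum S) UNIV" for s S
    by (subst has_sum_reindex) (auto simp: o_def inj_on_def)
  have s1: "(F has_sum (?i \<alpha>1 * ?i \<alpha>2 / 4 * ?LL a1 a2 + ?i \<alpha>1 * ?i \<beta>2 / 2 * ?LL a1 b2
     + ?i \<beta>1 * ?i \<alpha>2 / 2 * ?LL b1 a2 + ?i \<beta>1 * ?i \<beta>2 * ?LL b1 b2)) (range (Pair Ba1))"
    unfolding one unfolding F_def t1 by (intro has_sum_add has_sum_cmult_right hs assms)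
  have s2: "(F has_sum (- (?i \<alpha>1 * ?i \<alpha>2 / 4 * ?LL a1 a2) + ?i \<alpha>1 * ?i \<beta>2 / 2 * ?LL a1 b2
     + ?i \<beta>1 * ?i \<alpha>2 / 2 * ?LL b1 a2 + - (?i \<beta>1 * ?i \<beta>2 * ?LL b1 b2))) (range (Pair Ba2))"
    unfolding one unfolding F_def t2
    by (intro has_sum_add has_sum_uminusI has_sum_cmult_right hs assms)
  have s3: "(F has_sum (?i \<gamma>1 * ?i \<gamma>2 * Ln (1 - exp (c2 - c1)))) (range (Pair Bc))"
    unfolding one unfolding F_def t3 by (intro has_sum_cmult_right hc)
  have U: "(UNIV :: (boson \<times> nat) set) = range (Pair Ba1) \<union> (range (Pair Ba2) \<union> range (Pair Bc))"
  proof (intro set_eqI iffI)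
    fix x :: "boson \<times> nat"
    obtain s n where "x = (s, n)" by (cases x)
    then show "x \<in> range (Pair Ba1) \<union> (range (Pair Ba2) \<union> range (Pair Bc))" by (cases s) auto
  qed auto
  have "(F has_sum (?i (\<alpha>1 * \<beta>2) * ?LL a1 b2 + ?i (\<beta>1 * \<alpha>2) * ?LL b1 a2 + ?i (\<gamma>1 * \<gamma>2) * Ln (1 - exp (c2 - c1)))) UNIV"
    unfolding U using has_sum_Un_disjoint[OF s1 has_sum_Un_disjoint[OF s2 s3]] by (auto simp: algebra_simps)
  then have inf: "infsum F UNIV = ?i (\<alpha>1 * \<beta>2) * ?LL a1 b2 + ?i (\<beta>1 * \<alpha>2) * ?LL b1 a2 + ?i (\<gamma>1 * \<gamma>2) * Ln (1 - exp (c2 - c1))"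
    by (rule infsumI)
  have zero: "?L1 (Mode Ba1 0) * ?L2 (Q Ba1) + ?L1 (Mode Ba2 0) * ?L2 (Q Ba2) + ?L1 (Mode Bc 0) * ?L2 (Q Bc)
     = \<theta>1 * ?i \<gamma>2 + ?i (\<alpha>1 * \<beta>2) * a1 + ?i (\<beta>1 * \<alpha>2) * b1 + ?i (\<gamma>1 * \<gamma>2) * c1"
    by (simp add: vx_def field_simps)
  \<comment> \<open>The oscillators give a power of 1 - E; the zero modes supply the matching power
    of exp p1, which turns it into a power of a difference of two points.\<close>
  have p: "exp (?i k * Ln (1 - ?E p1 p2)) * exp (?i k * p1) = (exp p1 - exp ((\<kappa>1 + \<kappa>2) * h) * exp p2) powi k"
    if "Re ((\<kappa>1 + \<kappa>2) * h + p2 - p1) < 0" for k p1 p2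
  proof -
    have "norm (?E p1 p2) < 1" using that by (simp only: norm_exp_eq_Re exp_less_one_iff)
    then have "exp (?i k * Ln (1 - ?E p1 p2)) * exp (?i k * p1) = ((1 - ?E p1 p2) * exp p1) powi k"
      by (simp add: exp_Ln_powi power_int_mult_distrib exp_power_int)
    also have "(1 - ?E p1 p2) * exp p1 = exp p1 - exp ((\<kappa>1 + \<kappa>2) * h) * exp p2"
      by (simp add: left_diff_distrib exp_add[symmetric])
    finally show ?thesis .
  qed
  have pc: "exp (?i k * Ln (1 - exp (c2 - c1))) * exp (?i k * c1) = (exp c1 - exp c2) powi k" for k
  proof -
    have "norm (exp (c2 - c1)) < 1" using assms(6) by (simp only: norm_exp_eq_Re exp_less_one_iff)
    then have "exp (?i k * Ln (1 - exp (c2 - c1))) * exp (?i k * c1) = ((1 - exp (c2 - c1)) * exp c1) powi k"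
      by (simp add: exp_Ln_powi power_int_mult_distrib exp_power_int)
    also have "(1 - exp (c2 - c1)) * exp c1 = exp c1 - exp c2"
      by (simp add: left_diff_distrib exp_add[symmetric])
    finally show ?thesis .
  qed
  show ?thesis
    unfolding contr_def F_def[symmetric] inf zero
    using p[OF assms(3), of "\<alpha>1 * \<beta>2", symmetric] p[OF assms(4), of "\<beta>1 * \<alpha>2", symmetric] pc[of "\<gamma>1 * \<gamma>2", symmetric]
    by (simp add: exp_add mult_ac del: of_int_mult)
qed

definition vtx :: "complex \<Rightarrow> complex \<Rightarrow> lin \<Rightarrow> bool" where
  "vtx h \<zeta> L \<longleftrightarrow> (\<exists>\<kappa> \<alpha> \<beta> \<gamma> \<theta> a b c. L = vx h \<kappa> \<alpha> \<beta> \<gamma> \<theta> a b c \<and> norm \<kappa> \<le> 1 \<and> {\<alpha>, \<beta>, \<gamma>} \<subseteq> {-1, 0, 1} \<and>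
     norm (a - \<zeta>) \<le> 2 * norm h \<and> norm (b - \<zeta>) \<le> 2 * norm h \<and> norm (c - \<zeta>) \<le> 2 * norm h)"

text \<open>Arguments deviate from \<open>\<zeta>\<close> by at most 2|h|, and \<kappa> contributes
  at most |h| per unit of n, both within \<open>majH\<close>. The factor 2 in \<open>majU\<close>
  and \<open>majV\<close> pays for the two summands, with \<alpha> and with \<beta>, in the
  coefficients of \<open>a^1\<close> and \<open>a^2\<close>.\<close>

lemma vtx_bounds:
  assumes "vtx h \<zeta> L"
  shows "norm (cre L x) \<le> majU h [Re \<zeta>] x" "norm (ann h L x) \<le> majV h [Re \<zeta>] x" "intshift (\<lambda>s. L (Q s))"
proof -
  obtain \<kappa> \<alpha> \<beta> \<gamma> \<theta> a b c where L: "L = vx h \<kappa> \<alpha> \<beta> \<gamma> \<theta> a b c" and k: "norm \<kappa> \<le> 1"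
    and coef: "\<alpha> \<in> {-1, 0, 1}" "\<beta> \<in> {-1, 0, 1}" "\<gamma> \<in> {-1, 0, 1}"
    and n: "norm (a - \<zeta>) \<le> 2 * norm h" "norm (b - \<zeta>) \<le> 2 * norm h" "norm (c - \<zeta>) \<le> 2 * norm h"
    using assms unfolding vtx_def by auto
  obtain s m where x: "x = (s, m)" by (cases x)
  have kh: "\<bar>Re (\<kappa> * h)\<bar> \<le> norm h"
    using abs_Re_le_cmod[of "\<kappa> * h"] mult_right_mono[OF k, of "norm h"] by (simp add: norm_mult)
  have ex: "norm (exp (of_nat m * p)) \<le> exp (real m * (Re \<zeta> + 3 * norm h))"
    if "Re p \<le> Re \<zeta> + 3 * norm h" for p
    using that by (simp add: mult_left_mono)
  have re: "\<bar>Re p - Re \<zeta>\<bar> \<le> 2 * norm h" if "norm (p - \<zeta>) \<le> 2 * norm h" for p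
    using abs_Re_le_cmod[of "p - \<zeta>"] that by simp
  let ?U = "exp (real m * (Re \<zeta> + majH h))" and ?V = "exp (- real m * (Re \<zeta> - majH h))"
  have U: "norm (exp (\<kappa> * of_nat m * h) * exp (of_nat m * p)) \<le> ?U" "norm (exp (of_nat m * p)) \<le> ?U"
    and V: "norm (exp (\<kappa> * of_nat m * h) * exp (- (of_nat m * p))) \<le> ?V" "norm (exp (- (of_nat m * p))) \<le> ?V"
    if "norm (p - \<zeta>) \<le> 2 * norm h" for p
  proof -
    have eq1: "exp (\<kappa> * of_nat m * h) * exp (of_nat m * p) = exp (of_nat m * (\<kappa> * h + p))"
      by (simp add: exp_add[symmetric] algebra_simps)
    have eq2: "exp (\<kappa> * of_nat m * h) * exp (- (of_nat m * p)) = exp (of_nat m * (\<kappa> * h - p))"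
      by (simp add: exp_add[symmetric] algebra_simps)
    have nh: "0 \<le> norm h" by simp
    have "real m * Re (\<kappa> * h + p) \<le> real m * (Re \<zeta> + majH h)" "real m * Re p \<le> real m * (Re \<zeta> + majH h)"
       "real m * Re (\<kappa> * h - p) \<le> real m * - (Re \<zeta> - majH h)" "real m * - Re p \<le> real m * - (Re \<zeta> - majH h)"
      by (rule mult_left_mono; use re[OF that] kh nh in \<open>simp add: majH_def\<close>)+
    then show "norm (exp (\<kappa> * of_nat m * h) * exp (of_nat m * p)) \<le> ?U" "norm (exp (of_nat m * p)) \<le> ?U"
      "norm (exp (\<kappa> * of_nat m * h) * exp (- (of_nat m * p))) \<le> ?V" "norm (exp (- (of_nat m * p))) \<le> ?V"
      unfolding eq1 eq2 by (simp_all add: algebra_simps)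
  qed
  have lin: "norm (E * (y / 2 * A + z * B)) \<le> 2 * W"
    if "norm (E * A) \<le> W" "norm (E * B) \<le> W" "norm y \<le> 1" "norm z \<le> 1" for y z A B E :: complex and W
  proof -
    have "norm (E * (y / 2 * A + z * B)) \<le> norm (y / 2) * norm (E * A) + norm z * norm (E * B)"
      using norm_triangle_ineq[of "y / 2 * (E * A)" "z * (E * B)"] by (simp add: norm_mult algebra_simps)
    also have "\<dots> \<le> 1 * W + 1 * W"
      using that by (intro add_mono mult_mono) (auto simp: norm_divide)
    finally show ?thesis by simp
  qed
  have one: "norm (y * A) \<le> 2 * W" if "norm A \<le> W" "norm y \<le> 1" for y A :: complex and W
  proof -
    have "0 \<le> W" using that(1) norm_ge_zero order_trans by blast
    then show ?thesis using mult_mono[of "norm y" 1 "norm A" W] that by (simp add: norm_mult)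
  qed
  have c1: "norm (of_int \<alpha> :: complex) \<le> 1" "norm (- of_int \<alpha> :: complex) \<le> 1" "norm (of_int \<beta> :: complex) \<le> 1"
    "norm (of_int \<gamma> :: complex) \<le> 1" using coef by auto
  show "norm (cre L x) \<le> majU h [Re \<zeta>] x"
  proof (cases "m = 0")
    case False
    obtain w :: complex where w: "norm (cre L x) = norm w / norm (qint h (int m))" and "norm w \<le> 2 * ?U"
    proof (cases s)
      case Ba1
      show ?thesis using lin[OF U(1) U(1) c1(1) c1(3), OF n(1) n(2)] False
        by (intro that[of "exp (\<kappa> * of_nat m * h) * (of_int \<alpha> / 2 * exp (of_nat m * a) + of_int \<beta> * exp (of_nat m * b))"])
          (simp_all add: x Ba1 L cre_def vx_def norm_divide qint_uminus)
    next
      case Ba2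
      show ?thesis using lin[OF U(1) U(1) c1(2) c1(3), OF n(1) n(2)] False
        by (intro that[of "exp (\<kappa> * of_nat m * h) * (- of_int \<alpha> / 2 * exp (of_nat m * a) + of_int \<beta> * exp (of_nat m * b))"])
          (simp_all add: x Ba2 L cre_def vx_def norm_divide qint_uminus)
    next
      case Bc
      show ?thesis using one[OF U(2) c1(4), OF n(3)] False
        by (intro that[of "of_int \<gamma> * exp (of_nat m * c)"])
          (simp_all add: x Bc L cre_def vx_def norm_divide qint_uminus)
    qed
    then show ?thesis using False by (simp add: x majU_def divide_right_mono)
  qed (simp add: x cre_def majU_def)
  show "norm (ann h L x) \<le> majV h [Re \<zeta>] x"
  proof (cases "m = 0")
    case False
    have nn: "norm (boson_sign s * (qint h (int m))\<^sup>2 / of_nat m * (- w / qint h (int m))) = norm (qint h (int m)) / real m * norm w" for w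
      by (cases s) (simp_all add: norm_mult norm_divide norm_power power2_eq_square)
    obtain w :: complex where w: "ann h L x = boson_sign s * (qint h (int m))\<^sup>2 / of_nat m * (- w / qint h (int m))" and w': "norm w \<le> 2 * ?V"
    proof (cases s)
      case Ba1
      show ?thesis using lin[OF V(1) V(1) c1(1) c1(3), OF n(1) n(2)] False
        by (intro that[of "exp (\<kappa> * of_nat m * h) * (of_int \<alpha> / 2 * exp (- (of_nat m * a)) + of_int \<beta> * exp (- (of_nat m * b)))"])
          (simp_all add: x Ba1 L ann_def vx_def)
    next
      case Ba2
      show ?thesis using lin[OF V(1) V(1) c1(2) c1(3), OF n(1) n(2)] False
        by (intro that[of "exp (\<kappa> * of_nat m * h) * (- of_int \<alpha> / 2 * exp (- (of_nat m * a)) + of_int \<beta> * exp (- (of_nat m * b)))"])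
          (simp_all add: x Ba2 L ann_def vx_def)
    next
      case Bc
      show ?thesis using one[OF V(2) c1(4), OF n(3)] False
        by (intro that[of "of_int \<gamma> * exp (- (of_nat m * c))"])
          (simp_all add: x Bc L ann_def vx_def)
    qed
    have "norm (ann h L x) = norm (qint h (int m)) / real m * norm w" unfolding w nn ..
    also have "\<dots> \<le> norm (qint h (int m)) / real m * (2 * ?V)"
      using w' by (intro mult_left_mono) auto
    also have "\<dots> = majV h [Re \<zeta>] x" using False by (simp add: x majV_def)
    finally show ?thesis .
  qed (simp add: x ann_def majV_def)
  \<comment> \<open>The half-integral charges of \<open>a^1\<close> and \<open>a^2\<close> add up to
    \<alpha>, and the contributions of \<beta> cancel.\<close>
  have "of_int \<alpha> + of_int \<gamma> \<in> (\<int> :: complex set)" by (intro Ints_add Ints_of_int)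
  then show "intshift (\<lambda>s. L (Q s))"
    by (simp add: L intshift_def vx_def field_simps)
qed

lemma vtx_maj: "vtx h \<zeta> L \<Longrightarrow> maj h (\<lambda>s. L (Q s)) [Re \<zeta>] (nexp h L)"
  unfolding maj_def
proof (intro conjI exI[of _ "\<lambda>\<mu>. norm (zer L \<mu>)"] allI ballI)
  fix b' b assume L: "vtx h \<zeta> L" and b: "b' \<in> fock" "b \<in> fock"
  have "norm (nexp h L b' b) \<le> vop (\<lambda>s. L (Q s)) (\<lambda>\<mu>. norm (zer L \<mu>)) (\<lambda>x. norm (cre L x)) (\<lambda>x. norm (ann h L x)) b' b"
    unfolding nexp_eq[OF b] by (rule norm_vop_le)
  also have "\<dots> \<le> vop (\<lambda>s. L (Q s)) (\<lambda>\<mu>. norm (zer L \<mu>)) (majU h [Re \<zeta>]) (majV h [Re \<zeta>]) b' b"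
    by (intro vop_mono) (use vtx_bounds[OF L] in auto)
  finally show "norm (nexp h L b' b) \<le> vop (\<lambda>s. L (Q s)) (\<lambda>\<mu>. norm (zer L \<mu>)) (majU h [Re \<zeta>]) (majV h [Re \<zeta>]) b' b" .
qed (use vtx_bounds in auto)

lemma vtx_nexp_mult:
  assumes "vtx h \<zeta>1 L1" "vtx h \<zeta>2 L2" "Re \<zeta>1 > Re \<zeta>2 + 2 * majH h" "b' \<in> fock" "b \<in> fock"
  shows "((\<lambda>k. nexp h L1 b' k * nexp h L2 k b) has_sum contr h L1 L2 * nexp h (L1 + L2) b' b) fock"
proof (rule nexp_mult)
  have "(\<lambda>x. norm (majV h [Re \<zeta>1] x * majU h [Re \<zeta>2] x)) summable_on UNIV"
    using assms by (intro majVU_summable) (simp add: sep_def)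
  then show "(\<lambda>x. norm (ann h L1 x * cre L2 x)) summable_on UNIV"
  proof (rule summable_on_comparison_test)
    fix x show "norm (ann h L1 x * cre L2 x) \<le> norm (majV h [Re \<zeta>1] x * majU h [Re \<zeta>2] x)"
      using vtx_bounds(2)[OF assms(1), of x] vtx_bounds(1)[OF assms(2), of x]
      by (auto simp: norm_mult abs_mult majU_nonneg majV_nonneg intro!: mult_mono)
  qed auto
qed (use assms vtx_bounds in auto)

section \<open>Contour integrals and Laurent polynomials\<close>

text \<open>Integration over the circle \<open>\<bar>w\<bar> = exp \<rho>\<close>, parametrised by \<open>\<omega> = ln w\<close>.\<close>

definition cint :: "int \<Rightarrow> real \<Rightarrow> (complex \<Rightarrow> complex) \<Rightarrow> complex" where
  "cint m \<rho> S = integral {0..1} (\<lambda>t::real.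
     exp (- (of_int m * (of_real \<rho> + 2 * of_real pi * \<i> * of_real t))) * S (of_real \<rho> + 2 * of_real pi * \<i> * of_real t))"

lemma integral_exp_int:
  "((\<lambda>t::real. exp (of_int k * (of_real \<rho> + 2 * of_real pi * \<i> * of_real t))) has_integral (if k = 0 then 1 else 0)) {0..1}"
proof (cases "k = 0")
  case True
  then show ?thesis using has_integral_const_real[of "1::complex" 0 1] by simp
next
  case False
  define c :: complex where "c = of_int k * (2 * of_real pi * \<i>)"
  have c: "c \<noteq> 0" using False by (simp add: c_def)
  let ?F = "\<lambda>t::real. exp (of_int k * of_real \<rho>) * exp (c * of_real t) / c"
  have "((\<lambda>t. exp (of_int k * of_real \<rho>) * exp (c * of_real t)) has_integral ?F 1 - ?F 0) {0..1}"
  proof (rule fundamental_theorem_of_calculus)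
    fix t :: real
    show "(?F has_vector_derivative exp (of_int k * of_real \<rho>) * exp (c * of_real t)) (at t within {0..1})"
      by (rule has_vector_derivative_real_field)
        (use c in \<open>auto intro!: derivative_eq_intros\<close>)
  qed simp
  moreover have "?F 1 - ?F 0 = 0"
  proof -
    have "exp (c * of_real 1) = 1"
      using exp_integer_2pi[of "of_int k"] by (simp add: mult_ac c_def)
    then show ?thesis by simp
  qed
  moreover have "(\<lambda>t. exp (of_int k * of_real \<rho>) * exp (c * of_real t))
     = (\<lambda>t::real. exp (of_int k * (of_real \<rho> + 2 * of_real pi * \<i> * of_real t)))"
    by (simp add: exp_add[symmetric] algebra_simps c_def)
  ultimately show ?thesis using False by (simp only: if_False)
qed

text \<open>Integration of an absolutely convergent Laurent series term by term, by the Weierstrass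
  test: the integral over the circle selects the terms of degree \<open>m\<close>. It is the only
  analytic input for replacing an operator-valued current by one of its modes.\<close>

lemma has_sum_cint:
  fixes a :: "'b \<Rightarrow> complex"
  assumes hs: "\<And>\<omega>. Re \<omega> = \<rho> \<Longrightarrow> ((\<lambda>x. a x * exp (of_int (d x) * \<omega>)) has_sum S \<omega>) A"
    and abs: "(\<lambda>x. norm (a x * exp (of_int (d x) * of_real \<rho>))) summable_on A"
  shows "((\<lambda>x. if d x = m then a x else 0) has_sum cint m \<rho> S) A"
proof -
  let ?w = "\<lambda>t::real. of_real \<rho> + 2 * of_real pi * \<i> * of_real t"
  let ?f = "\<lambda>x t. a x * exp (of_int (d x - m) * ?w t)"
  let ?g = "\<lambda>t. exp (- (of_int m * ?w t)) * S (?w t)"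
  have f: "?f x t = exp (- (of_int m * ?w t)) * (a x * exp (of_int (d x) * ?w t))" for x t
  proof -
    have e: "of_int (d x - m) * ?w t = of_int (d x) * ?w t + - (of_int m * ?w t)"
      by (simp add: left_diff_distrib)
    show ?thesis unfolding e exp_add by (simp only: mult_ac)
  qed
  have u: "uniform_limit {0..1} (\<lambda>X t. \<Sum>x\<in>X. ?f x t) ?g (finite_subsets_at_top A)"
  proof (rule Weierstrass_m_test_general')
    show "norm (?f x t) \<le> norm (exp (- of_int m * of_real \<rho> :: complex)) * norm (a x * exp (of_int (d x) * of_real \<rho>))" for x t
      by (simp add: norm_mult exp_add[symmetric] algebra_simps)
    show "((\<lambda>x. ?f x t) has_sum ?g t) A" for t
      unfolding f by (rule has_sum_cmult_right, rule hs) simp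
    show "(\<lambda>x. norm (exp (- of_int m * of_real \<rho> :: complex)) * norm (a x * exp (of_int (d x) * of_real \<rho>))) summable_on A"
      by (rule summable_on_cmult_right[OF abs])
  qed
  obtain I J where I: "\<And>X. ((\<lambda>t. \<Sum>x\<in>X. ?f x t) has_integral I X) {0..1}" and J: "(?g has_integral J) {0..1}"
    and lim: "(I \<longlongrightarrow> J) (finite_subsets_at_top A)"
  proof (rule uniform_limit_integral[OF u])
    show "continuous_on {0..1} (\<lambda>t. \<Sum>x\<in>X. ?f x t)" for X
      by (intro continuous_intros)
  qed auto
  have "I X = (\<Sum>x\<in>X. if d x = m then a x else 0)" for X
  proof (cases "finite X")
    case True
    have "((\<lambda>t. \<Sum>x\<in>X. ?f x t) has_integral (\<Sum>x\<in>X. a x * (if d x - m = 0 then 1 else 0))) {0..1}"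
      by (intro has_integral_sum has_integral_mult_right integral_exp_int True)
    then have "I X = (\<Sum>x\<in>X. a x * (if d x - m = 0 then 1 else 0))"
      using I has_integral_unique by blast
    then show ?thesis by (auto intro: sum.cong)
  next
    case False
    \<comment> \<open>The net in the definition of a sum ranges over finite sets, but
      \<open>I\<close> is given for every \<open>X\<close>; for infinite \<open>X\<close> both the
      sum and its integral are 0 by convention.\<close>
    then show ?thesis using I[of X] by (simp add: has_integral_0_eq)
  qed
  then have "I = sum (\<lambda>x. if d x = m then a x else 0)" by (rule ext)
  then have "((\<lambda>x. if d x = m then a x else 0) has_sum J) A"
    using lim by (simp add: has_sum_def)
  moreover have "J = cint m \<rho> S" using J by (simp add: cint_def integral_unique)
  ultimately show ?thesis by simp
qed

type_synonym lp = "((complex \<Rightarrow> complex \<Rightarrow> complex) \<times> int) list"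

definition lpe :: "lp \<Rightarrow> complex \<Rightarrow> complex \<Rightarrow> complex \<Rightarrow> complex" where
  "lpe xs \<zeta>1 \<zeta>2 \<omega> = (\<Sum>(c, d)\<leftarrow>xs. c \<zeta>1 \<zeta>2 * exp (of_int d * \<omega>))"

text \<open>Continuation of products is demanded in each variable separately, so separate holomorphy
  is the regularity carried by the coefficients.\<close>

definition sephol :: "(complex \<Rightarrow> complex \<Rightarrow> complex) \<Rightarrow> bool" where
  "sephol c \<longleftrightarrow> (\<forall>\<zeta>2. (\<lambda>\<zeta>1. c \<zeta>1 \<zeta>2) holomorphic_on UNIV) \<and> (\<forall>\<zeta>1. (\<lambda>\<zeta>2. c \<zeta>1 \<zeta>2) holomorphic_on UNIV)"

definition lpol :: "(complex \<Rightarrow> complex \<Rightarrow> complex \<Rightarrow> complex) \<Rightarrow> bool" where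
  "lpol F \<longleftrightarrow> (\<exists>xs. (\<forall>(c, d)\<in>set xs. sephol c) \<and> F = lpe xs)"

lemma sephol_add: "sephol f \<Longrightarrow> sephol g \<Longrightarrow> sephol (\<lambda>x y. f x y + g x y)"
  and sephol_mult: "sephol f \<Longrightarrow> sephol g \<Longrightarrow> sephol (\<lambda>x y. f x y * g x y)"
  and sephol_const: "sephol (\<lambda>x y. l)"
  and sephol_1: "j holomorphic_on UNIV \<Longrightarrow> sephol (\<lambda>x y. j x)"
  and sephol_2: "j holomorphic_on UNIV \<Longrightarrow> sephol (\<lambda>x y. j y)"
  by (auto simp: sephol_def intro!: holomorphic_intros)

lemma lpol_mono: "sephol c \<Longrightarrow> lpol (\<lambda>x y \<omega>. c x y * exp (of_int d * \<omega>))"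
  unfolding lpol_def by (rule exI[of _ "[(c, d)]"]) (auto simp: lpe_def fun_eq_iff)

lemma lpol_sephol: "sephol c \<Longrightarrow> lpol (\<lambda>x y \<omega>. c x y)"
  using lpol_mono[of c 0] by simp

lemma lpol_add: "lpol F \<Longrightarrow> lpol G \<Longrightarrow> lpol (\<lambda>x y \<omega>. F x y \<omega> + G x y \<omega>)"
proof -
  assume "lpol F" "lpol G"
  then obtain xs ys where "\<forall>(c, d)\<in>set xs. sephol c" "F = lpe xs" "\<forall>(c, d)\<in>set ys. sephol c" "G = lpe ys"
    unfolding lpol_def by auto
  then show ?thesis
    unfolding lpol_def by (intro exI[of _ "xs @ ys"]) (auto simp: lpe_def fun_eq_iff)
qed

lemma lpol_sum: "(\<And>i. i \<in> I \<Longrightarrow> lpol (F i)) \<Longrightarrow> lpol (\<lambda>x y \<omega>. \<Sum>i\<in>I. F i x y \<omega>)"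
  by (induction I rule: infinite_finite_induct) (auto intro: lpol_add lpol_sephol sephol_const)

lemma lpol_mult: "lpol F \<Longrightarrow> lpol G \<Longrightarrow> lpol (\<lambda>x y \<omega>. F x y \<omega> * G x y \<omega>)"
proof -
  assume "lpol F" and G: "lpol G"
  then obtain xs where xs: "\<forall>(c, d)\<in>set xs. sephol c" "F = lpe xs" unfolding lpol_def by auto
  obtain ys where ys: "\<forall>(c, d)\<in>set ys. sephol c" "G = lpe ys" using G unfolding lpol_def by auto
  have 1: "lpol (\<lambda>x y \<omega>. c x y * exp (of_int d * \<omega>) * lpe ys x y \<omega>)" if "sephol c" for c d
  proof -
    let ?zs = "map (\<lambda>p. ((\<lambda>x y. c x y * fst p x y), d + snd p)) ys"
    have "c x y * exp (of_int d * \<omega>) * lpe ys x y \<omega> = lpe ?zs x y \<omega>" for x y \<omega>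
      unfolding lpe_def case_prod_unfold sum_list_const_mult[symmetric] map_map o_def
      by (intro arg_cong[where f = sum_list] map_cong refl) (simp add: algebra_simps exp_add)
    then have "(\<lambda>x y \<omega>. c x y * exp (of_int d * \<omega>) * lpe ys x y \<omega>) = lpe ?zs" by (intro ext) simp
    moreover have "\<forall>(c, d)\<in>set ?zs. sephol c"
      using that ys(1) by (fastforce intro!: sephol_mult)
    ultimately show ?thesis unfolding lpol_def by blast
  qed
  have "lpol (\<lambda>x y \<omega>. lpe xs x y \<omega> * lpe ys x y \<omega>)" using xs(1)
  proof (induction xs)
    case Nil
    then show ?case using lpol_sephol[OF sephol_const[of 0]] by (simp add: lpe_def)
  next
    case (Cons p xs)
    obtain c d where p: "p = (c, d)" by (cases p)
    have "lpol (\<lambda>x y \<omega>. c x y * exp (of_int d * \<omega>) * lpe ys x y \<omega> + lpe xs x y \<omega> * lpe ys x y \<omega>)"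
      using Cons by (intro lpol_add 1) (auto simp: p)
    also have "(\<lambda>x y \<omega>. c x y * exp (of_int d * \<omega>) * lpe ys x y \<omega> + lpe xs x y \<omega> * lpe ys x y \<omega>)
       = (\<lambda>x y \<omega>. lpe (p # xs) x y \<omega> * lpe ys x y \<omega>)"
      by (simp add: lpe_def p fun_eq_iff distrib_right)
    finally show ?case .
  qed
  then show ?thesis using xs ys by simp
qed

lemma lpol_prod_mset: "(\<And>i. i \<in># I \<Longrightarrow> lpol (F i)) \<Longrightarrow> lpol (\<lambda>x y \<omega>. \<Prod>i\<in>#I. F i x y \<omega>)"
  by (induction I) (auto intro: lpol_mult lpol_sephol sephol_const)

section \<open>Modes of currents\<close>

text \<open>The matrix elements of \<open>:exp (X \<omega>):\<close> are then monomials in \<open>w = exp \<omega>\<close>; their degrees are given by \<open>deg\<close> below.\<close>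

definition homog :: "int \<Rightarrow> (complex \<Rightarrow> lin) \<Rightarrow> bool" where
  "homog \<epsilon> X \<longleftrightarrow> (\<forall>\<omega> s n. n \<noteq> 0 \<longrightarrow> X \<omega> (Mode s n) = X 0 (Mode s n) * exp (- (of_int n * \<omega>))) \<and>
     (\<forall>\<omega> s. X \<omega> (Q s) = X 0 (Q s)) \<and> (\<forall>\<omega> s. X \<omega> (Mode s 0) = X 0 (Mode s 0) + of_int \<epsilon> * \<omega>)"

definition energy :: "(boson \<times> nat) multiset \<Rightarrow> nat" where
  "energy M = (\<Sum>x\<in>#M. snd x)"

text \<open>On \<open>fock\<close> the sum of the eigenvalues is an integer; \<open>Re\<close> and
  the floor only extract it as an \<open>int\<close>.\<close>

definition charge :: "(boson \<Rightarrow> complex) \<Rightarrow> int" where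
  "charge \<mu> = \<lfloor>Re (\<mu> Ba1 + \<mu> Ba2 + \<mu> Bc)\<rfloor>"

definition deg :: "int \<Rightarrow> state \<Rightarrow> state \<Rightarrow> int" where
  "deg \<epsilon> k b = int (energy (snd k)) - int (energy (snd b)) + \<epsilon> * charge (fst b)"

text \<open>The coefficient of \<open>w\<^sup>m\<close> in \<open>:exp (X \<omega>):\<close>, \<open>w = exp \<omega>\<close>; note that \<open>X\<^sub>n\<close> in the notation of the currents has \<open>m = - n - 1\<close>.\<close>

definition md :: "complex \<Rightarrow> int \<Rightarrow> (complex \<Rightarrow> lin) \<Rightarrow> int \<Rightarrow> oper" where
  "md h \<epsilon> X m k b = (if deg \<epsilon> k b = m then nexp h (X 0) k b else 0)"

lemma charge_eq: "intshift \<mu> \<Longrightarrow> \<mu> Ba1 + \<mu> Ba2 + \<mu> Bc = of_int (charge \<mu>)"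
  unfolding intshift_def charge_def by (metis Ints_cases Re_complex_of_real floor_of_int of_real_of_int_eq)

lemma prod_mset_exp: "(\<Prod>x\<in>#M. exp (of_nat (snd x) * \<omega>)) = exp (of_nat (energy M) * \<omega> :: complex)"
  by (induction M) (auto simp: energy_def distrib_right exp_add)

lemma energy_diff: "N \<subseteq># M \<Longrightarrow> int (energy (M - N)) = int (energy M) - int (energy N)"
  by (metis energy_def add_diff_cancel_right' image_mset_union of_nat_add subset_mset.diff_add sum_mset.union)

lemma energy_diff': "N \<subseteq># M \<Longrightarrow> of_nat (energy (M - N)) = (of_nat (energy M) - of_nat (energy N) :: complex)"
  using arg_cong[OF energy_diff, where f = of_int] by simp

lemma gmat_homog:
  fixes u v :: "boson \<times> nat \<Rightarrow> complex"
  shows "gmat (\<lambda>x. u x * exp (of_nat (snd x) * \<omega>)) (\<lambda>x. v x * exp (- (of_nat (snd x) * \<omega>))) M' M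
    = gmat u v M' M * exp (of_int (int (energy M') - int (energy M)) * \<omega>)"
  unfolding gmat_def sum_distrib_right
proof (rule sum.cong[OF refl])
  fix K assume "K \<in> {K. K \<subseteq># M}"
  then have K: "K \<subseteq># M" by simp
  have c: "cr (\<lambda>x. u x * exp (of_nat (snd x) * \<omega>)) M' K = cr u M' K * exp (of_int (int (energy M') - int (energy K)) * \<omega>)"
    by (auto simp: cr_def mexp_mult prod_mset_exp energy_diff')
  have a: "an (\<lambda>x. v x * exp (- (of_nat (snd x) * \<omega>))) K M = an v K M * exp (of_int (int (energy K) - int (energy M)) * \<omega>)"
    using K prod_mset_exp[where \<omega> = "- \<omega>"]
    by (simp add: an_def mexp_mult energy_diff' algebra_simps)
  show "cr (\<lambda>x. u x * exp (of_nat (snd x) * \<omega>)) M' K * an (\<lambda>x. v x * exp (- (of_nat (snd x) * \<omega>))) K M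
     = cr u M' K * an v K M * exp (of_int (int (energy M') - int (energy M)) * \<omega>)"
    unfolding c a by (simp add: exp_add[symmetric] algebra_simps)
qed

lemma homog_cre: "homog \<epsilon> X \<Longrightarrow> cre (X \<omega>) = (\<lambda>x. cre (X 0) x * exp (of_nat (snd x) * \<omega>))"
  and homog_ann: "homog \<epsilon> X \<Longrightarrow> ann h (X \<omega>) = (\<lambda>x. ann h (X 0) x * exp (- (of_nat (snd x) * \<omega>)))"
proof -
  assume h: "homog \<epsilon> X"
  have "X \<omega> (Mode s (- int n)) = X 0 (Mode s (- int n)) * exp (of_nat n * \<omega>)" if "n > 0" for s n
    using h[unfolded homog_def, THEN conjunct1, rule_format, of "- int n" \<omega> s] that by simp
  then show "cre (X \<omega>) = (\<lambda>x. cre (X 0) x * exp (of_nat (snd x) * \<omega>))"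
    by (auto simp: cre_def fun_eq_iff)
  have "X \<omega> (Mode s (int n)) = X 0 (Mode s (int n)) * exp (- (of_nat n * \<omega>))" if "n > 0" for s n
    using h[unfolded homog_def, THEN conjunct1, rule_format, of "int n" \<omega> s] that by simp
  then show "ann h (X \<omega>) = (\<lambda>x. ann h (X 0) x * exp (- (of_nat (snd x) * \<omega>)))"
    by (auto simp: ann_def fun_eq_iff)
qed

text \<open>All zero modes move with the same \<open>\<epsilon>\<close>, so only the sum of the
  three eigenvalues enters. Its integrality on the Fock space makes the current single valued in
  w.\<close>

lemma homog_zer:
  assumes "homog \<epsilon> X" "intshift \<mu>"
  shows "zer (X \<omega>) \<mu> = zer (X 0) \<mu> * exp (of_int (\<epsilon> * charge \<mu>) * \<omega>)"
proof -
  have X: "X \<omega> (Mode s 0) = X 0 (Mode s 0) + of_int \<epsilon> * \<omega>" for s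
    using assms(1) unfolding homog_def by blast
  have "zer (X \<omega>) \<mu> = zer (X 0) \<mu> * exp (of_int \<epsilon> * (\<mu> Ba1 + \<mu> Ba2 + \<mu> Bc) * \<omega>)"
    unfolding zer_def X exp_add[symmetric] by (simp add: algebra_simps)
  then show ?thesis by (simp add: charge_eq[OF assms(2)])
qed

lemma nexp_homog:
  assumes "homog \<epsilon> X" "b' \<in> fock" "b \<in> fock"
  shows "nexp h (X \<omega>) b' b = nexp h (X 0) b' b * exp (of_int (deg \<epsilon> b' b) * \<omega>)"
proof -
  have Q: "X \<omega> (Q s) = X 0 (Q s)" for s
    using assms(1) unfolding homog_def by blast
  have i: "intshift (fst b)" using assms(3) by (cases b) (simp add: fock_iff)
  show ?thesis
    unfolding nexp_eq[OF assms(2,3)] vop_def Q homog_cre[OF assms(1), of \<omega>] homog_ann[OF assms(1), of h \<omega>]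
      homog_zer[OF assms(1) i, of \<omega>] gmat_homog deg_def
    by (simp add: exp_add[symmetric] algebra_simps)
qed

lemma finite_energy: "finite {M. pos_mset M \<and> energy M = e}"
proof -
  have "{M. pos_mset M \<and> energy M = e} \<subseteq> mset ` {xs. set xs \<subseteq> UNIV \<times> {..e} \<and> length xs \<le> e}"
  proof
    fix M assume "M \<in> {M. pos_mset M \<and> energy M = e}"
    then have M: "pos_mset M" "energy M = e" by auto
    obtain xs where xs: "M = mset xs" using ex_mset[of M] by auto
    have "set xs \<subseteq> UNIV \<times> {..energy (mset xs)} \<and> length xs \<le> energy (mset xs)"
      using M(1) unfolding xs by (induction xs) (force simp: energy_def pos_mset_def)+
    then show "M \<in> mset ` {xs. set xs \<subseteq> UNIV \<times> {..e} \<and> length xs \<le> e}"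
      using xs M(2) by auto
  qed
  moreover have "finite {xs :: (boson \<times> nat) list. set xs \<subseteq> UNIV \<times> {..e} \<and> length xs \<le> e}"
    by (rule finite_lists_length_le) (simp add: boson_UNIV)
  ultimately show ?thesis using finite_subset by blast
qed

lemma nexp_shift: "b' \<in> fock \<Longrightarrow> b \<in> fock \<Longrightarrow> nexp h L b' b \<noteq> 0 \<Longrightarrow> fst b' = (\<lambda>s. fst b s + L (Q s))"
  by (simp add: nexp_eq vop_def split: if_splits)

text \<open>The shift fixes the momentum of the target and the degree fixes its energy; since every
  quantum costs at least one unit of energy, finitely many states remain.\<close>

lemma md_colfin: "colfin (md h \<epsilon> X m)"
  unfolding colfin_def
proof
  fix b assume b: "b \<in> fock"
  let ?\<mu> = "\<lambda>s. fst b s + X 0 (Q s)"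
  let ?e = "nat (m + int (energy (snd b)) - \<epsilon> * charge (fst b))"
  have "{k \<in> fock. md h \<epsilon> X m k b \<noteq> 0} \<subseteq> {?\<mu>} \<times> {M. pos_mset M \<and> energy M = ?e}"
    using nexp_shift[OF _ b] by (auto simp: md_def deg_def fock_iff split: if_splits)
  then show "finite {k \<in> fock. md h \<epsilon> X m k b \<noteq> 0}"
    by (rule finite_subset) (auto intro: finite_energy)
qed

lemma md_rowfin: "rowfin (md h \<epsilon> X m)"
  unfolding rowfin_def
proof
  fix b assume b: "b \<in> fock"
  let ?\<mu> = "\<lambda>s. fst b s - X 0 (Q s)"
  let ?e = "nat (int (energy (snd b)) + \<epsilon> * charge ?\<mu> - m)"
  have "{k \<in> fock. md h \<epsilon> X m b k \<noteq> 0} \<subseteq> {?\<mu>} \<times> {M. pos_mset M \<and> energy M = ?e}"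
  proof
    fix k assume k: "k \<in> {k \<in> fock. md h \<epsilon> X m b k \<noteq> 0}"
    then have "fst b = (\<lambda>s. fst k s + X 0 (Q s))"
      using nexp_shift[OF b, of k] by (auto simp: md_def split: if_splits)
    then have "fst k = ?\<mu>" by (simp add: fun_eq_iff)
    then show "k \<in> {?\<mu>} \<times> {M. pos_mset M \<and> energy M = ?e}"
      using k by (cases k) (auto simp: md_def deg_def fock_iff split: if_splits)
  qed
  then show "finite {k \<in> fock. md h \<epsilon> X m b k \<noteq> 0}"
    by (rule finite_subset) (auto intro: finite_energy)
qed

definition cur :: "complex \<Rightarrow> int \<Rightarrow> (complex \<Rightarrow> lin) \<Rightarrow> bool" where
  "cur h \<epsilon> X \<longleftrightarrow> homog \<epsilon> X \<and> (\<forall>\<omega>. vtx h \<omega> (X \<omega>))"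

text \<open>A mode is attached to no point: on the entries of degree \<open>m\<close> the current at
  any \<omega> equals the mode times exp(m \<omega>). It is therefore majorised at every radius, the
  power of exp \<rho> going into \<open>e\<close>, and can be placed between any two sufficiently
  separated vertex operators.\<close>

lemma md_maj:
  assumes "cur h \<epsilon> X"
  shows "maj h (\<lambda>s. X 0 (Q s)) [\<rho>] (md h \<epsilon> X m)"
proof -
  have h: "homog \<epsilon> X" and v: "vtx h (of_real \<rho>) (X (of_real \<rho>))" using assms by (auto simp: cur_def)
  have Q: "X (of_real \<rho>) (Q s) = X 0 (Q s)" for s
    using h unfolding homog_def by blast
  obtain e where e: "\<And>\<mu>. 0 \<le> e \<mu>" "\<And>b' b. b' \<in> fock \<Longrightarrow> b \<in> fock \<Longrightarrow> norm (nexp h (X (of_real \<rho>)) b' b)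
     \<le> vop (\<lambda>s. X 0 (Q s)) e (majU h [\<rho>]) (majV h [\<rho>]) b' b" and i: "intshift (\<lambda>s. X 0 (Q s))"
    using vtx_maj[OF v] unfolding maj_def Q Re_complex_of_real by blast
  have "norm (md h \<epsilon> X m b' b) \<le> vop (\<lambda>s. X 0 (Q s)) (\<lambda>\<mu>. exp (- of_int m * \<rho>) * e \<mu>) (majU h [\<rho>]) (majV h [\<rho>]) b' b"
    if b: "b' \<in> fock" "b \<in> fock" for b' b
  proof (cases "deg \<epsilon> b' b = m")
    case True
    have "norm (md h \<epsilon> X m b' b) = exp (- of_int m * \<rho>) * norm (nexp h (X (of_real \<rho>)) b' b)"
      unfolding nexp_homog[OF h b, of h "of_real \<rho>"] md_def True by (simp add: norm_mult exp_minus)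
    also have "\<dots> \<le> exp (- of_int m * \<rho>) * vop (\<lambda>s. X 0 (Q s)) e (majU h [\<rho>]) (majV h [\<rho>]) b' b"
      using e(2)[OF b] by (intro mult_left_mono) auto
    also have "\<dots> = vop (\<lambda>s. X 0 (Q s)) (\<lambda>\<mu>. exp (- of_int m * \<rho>) * e \<mu>) (majU h [\<rho>]) (majV h [\<rho>]) b' b"
      by (simp add: vop_def)
    finally show ?thesis .
  next
    case False
    then show ?thesis
      by (simp add: md_def vop_nonneg majU_nonneg majV_nonneg e)
  qed
  then show ?thesis unfolding maj_def using e i by (intro conjI exI[of _ "\<lambda>\<mu>. exp (- of_int m * \<rho>) * e \<mu>"]) auto
qed

text \<open>Multiplication by a mode is an integral of the product with the whole current. The
  circle must lie where that product converges: inside the point of the vertex operator here,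
  outside it in \<open>md_left\<close>.\<close>

lemma md_right:
  assumes X: "cur h \<epsilon> X" and S: "vtx h \<zeta> L" and \<rho>: "Re \<zeta> > \<rho> + 2 * majH h" and b: "b' \<in> fock" "b \<in> fock"
  shows "(nexp h L \<odot> md h \<epsilon> X m) b' b = cint m \<rho> (\<lambda>\<omega>. contr h L (X \<omega>) * nexp h (L + X \<omega>) b' b)"
proof -
  have h: "homog \<epsilon> X" and v: "\<And>\<omega>. vtx h \<omega> (X \<omega>)" using X by (auto simp: cur_def)
  have "((\<lambda>k. if deg \<epsilon> k b = m then nexp h L b' k * nexp h (X 0) k b else 0) has_sum
     cint m \<rho> (\<lambda>\<omega>. contr h L (X \<omega>) * nexp h (L + X \<omega>) b' b)) fock"
  proof (rule has_sum_cint)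
    fix \<omega> :: complex assume "Re \<omega> = \<rho>"
    then have "((\<lambda>k. nexp h L b' k * nexp h (X \<omega>) k b) has_sum contr h L (X \<omega>) * nexp h (L + X \<omega>) b' b) fock"
      using \<rho> b by (intro vtx_nexp_mult[OF S v]) auto
    then show "((\<lambda>k. nexp h L b' k * nexp h (X 0) k b * exp (of_int (deg \<epsilon> k b) * \<omega>)) has_sum
        contr h L (X \<omega>) * nexp h (L + X \<omega>) b' b) fock"
      by (rule has_sum_cong[THEN iffD1, rotated]) (simp add: nexp_homog[OF h _ b(2), of _ h \<omega>] mult.assoc)
  next
    have "(\<lambda>k. norm (nexp h L b' k * nexp h (X (of_real \<rho>)) k b)) summable_on fock"
      using \<rho> b by (intro maj_comp[OF vtx_maj[OF S] vtx_maj[OF v]]) (auto simp: sep_def)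
    then show "(\<lambda>k. norm (nexp h L b' k * nexp h (X 0) k b * exp (of_int (deg \<epsilon> k b) * of_real \<rho>))) summable_on fock"
      by (rule summable_on_cong[THEN iffD1, rotated]) (simp add: nexp_homog[OF h _ b(2), of _ h "of_real \<rho>"] mult.assoc)
  qed
  then have "infsum (\<lambda>k. if deg \<epsilon> k b = m then nexp h L b' k * nexp h (X 0) k b else 0) fock =
     cint m \<rho> (\<lambda>\<omega>. contr h L (X \<omega>) * nexp h (L + X \<omega>) b' b)" by (rule infsumI)
  then show ?thesis by (simp add: oprod_def md_def if_distrib cong: if_cong)
qed

lemma md_left:
  assumes X: "cur h \<epsilon> X" and S: "vtx h \<zeta> L" and \<rho>: "\<rho> > Re \<zeta> + 2 * majH h" and b: "b' \<in> fock" "b \<in> fock"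
  shows "(md h \<epsilon> X m \<odot> nexp h L) b' b = cint m \<rho> (\<lambda>\<omega>. contr h (X \<omega>) L * nexp h (L + X \<omega>) b' b)"
proof -
  have h: "homog \<epsilon> X" and v: "\<And>\<omega>. vtx h \<omega> (X \<omega>)" using X by (auto simp: cur_def)
  have "((\<lambda>k. if deg \<epsilon> b' k = m then nexp h (X 0) b' k * nexp h L k b else 0) has_sum
     cint m \<rho> (\<lambda>\<omega>. contr h (X \<omega>) L * nexp h (L + X \<omega>) b' b)) fock"
  proof (rule has_sum_cint)
    fix \<omega> :: complex assume "Re \<omega> = \<rho>"
    then have "((\<lambda>k. nexp h (X \<omega>) b' k * nexp h L k b) has_sum contr h (X \<omega>) L * nexp h (X \<omega> + L) b' b) fock"
      using \<rho> b by (intro vtx_nexp_mult[OF v S]) auto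
    then show "((\<lambda>k. nexp h (X 0) b' k * nexp h L k b * exp (of_int (deg \<epsilon> b' k) * \<omega>)) has_sum
        contr h (X \<omega>) L * nexp h (L + X \<omega>) b' b) fock"
      unfolding add.commute[of L]
      by (rule has_sum_cong[THEN iffD1, rotated]) (simp add: nexp_homog[OF h b(1), of _ h \<omega>] mult_ac)
  next
    have "(\<lambda>k. norm (nexp h (X (of_real \<rho>)) b' k * nexp h L k b)) summable_on fock"
      using \<rho> b by (intro maj_comp[OF vtx_maj[OF v] vtx_maj[OF S]]) (auto simp: sep_def)
    then show "(\<lambda>k. norm (nexp h (X 0) b' k * nexp h L k b * exp (of_int (deg \<epsilon> b' k) * of_real \<rho>))) summable_on fock"
      by (rule summable_on_cong[THEN iffD1, rotated]) (simp add: nexp_homog[OF h b(1), of _ h "of_real \<rho>"] mult_ac)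
  qed
  then have "infsum (\<lambda>k. if deg \<epsilon> b' k = m then nexp h (X 0) b' k * nexp h L k b else 0) fock =
     cint m \<rho> (\<lambda>\<omega>. contr h (X \<omega>) L * nexp h (L + X \<omega>) b' b)" by (rule infsumI)
  moreover have "(md h \<epsilon> X m \<odot> nexp h L) b' b =
      infsum (\<lambda>k. if deg \<epsilon> b' k = m then nexp h (X 0) b' k * nexp h L k b else 0) fock"
    unfolding oprod_def by (rule infsum_cong) (simp add: md_def)
  ultimately show ?thesis by simp
qed

definition holfam :: "(complex \<Rightarrow> lin) \<Rightarrow> bool" where
  "holfam L \<longleftrightarrow> (\<forall>g. (\<lambda>\<zeta>. L \<zeta> g) holomorphic_on UNIV) \<and> (\<forall>\<zeta> s. L \<zeta> (Q s) = L 0 (Q s))"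

lemma holfam_cre: "holfam L \<Longrightarrow> (\<lambda>\<zeta>. cre (L \<zeta>) x) holomorphic_on UNIV"
  unfolding holfam_def cre_def by (cases x; cases "snd x = 0") (auto intro!: holomorphic_intros)

lemma holfam_ann: "holfam L \<Longrightarrow> (\<lambda>\<zeta>. ann h (L \<zeta>) x) holomorphic_on UNIV"
  unfolding holfam_def ann_def by (cases x; cases "snd x = 0") (auto intro!: holomorphic_intros)

lemma holfam_zer: "holfam L \<Longrightarrow> (\<lambda>\<zeta>. zer (L \<zeta>) \<mu>) holomorphic_on UNIV"
  unfolding holfam_def zer_def by (auto intro!: holomorphic_intros)

lemma zer_add: "zer (L1 + L2) \<mu> = zer L1 \<mu> * zer L2 \<mu>"
  by (simp add: zer_def exp_add[symmetric] algebra_simps)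

lemma lpol_mexp:
  assumes "\<And>x. lpol (\<lambda>a b \<omega>. u a b \<omega> x)"
  shows "lpol (\<lambda>a b \<omega>. mexp (u a b \<omega>) N)"
proof -
  have "lpol (\<lambda>a b \<omega>. (\<Prod>x\<in>#N. u a b \<omega> x) * (1 / of_nat (mfact N)))"
    by (intro lpol_mult lpol_prod_mset assms lpol_sephol sephol_const)
  then show ?thesis by (simp add: mexp_def)
qed

lemma lpol_gmat:
  assumes "\<And>x. lpol (\<lambda>a b \<omega>. u a b \<omega> x)" "\<And>x. lpol (\<lambda>a b \<omega>. v a b \<omega> x)"
  shows "lpol (\<lambda>a b \<omega>. gmat (u a b \<omega>) (v a b \<omega>) M' M)"
  unfolding gmat_def
proof (intro lpol_sum lpol_mult)
  fix K
  show "lpol (\<lambda>x y \<omega>. cr (u x y \<omega>) M' K)"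
    by (cases "K \<subseteq># M'") (auto simp: cr_def intro: lpol_mexp assms lpol_sephol sephol_const)
  have "lpol (\<lambda>x y \<omega>. mexp (v x y \<omega>) (M - K) * (of_nat (mfact M) / of_nat (mfact K)))"
    by (intro lpol_mult lpol_mexp assms lpol_sephol sephol_const)
  then show "lpol (\<lambda>x y \<omega>. an (v x y \<omega>) K M)"
    by (cases "K \<subseteq># M") (auto simp: an_def intro: lpol_sephol sephol_const)
qed

text \<open>A fixed matrix element of a normally ordered exponential uses finitely many quanta,
  hence finitely many powers of w, with coefficients entire in each of the remaining variables. All
  poles of a product come from the scalar contractions.\<close>

lemma lpol_nexp:
  assumes L: "holfam L1" "holfam L3" and X: "homog \<epsilon> X" and b: "b' \<in> fock" "b \<in> fock"
  shows "lpol (\<lambda>\<zeta>1 \<zeta>2 \<omega>. nexp h (L1 \<zeta>1 + X \<omega> + L3 \<zeta>2) b' b)"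
proof -
  have i: "intshift (fst b)" using b(2) by (cases b) (simp add: fock_iff)
  let ?P = "fst b' = (\<lambda>s. fst b s + (L1 0 + X 0 + L3 0) (Q s))"
  have QQ: "(L1 \<zeta>1 + X \<omega> + L3 \<zeta>2) (Q s) = (L1 0 + X 0 + L3 0) (Q s)" for \<zeta>1 \<zeta>2 \<omega> s
  proof -
    have "L1 \<zeta>1 (Q s) = L1 0 (Q s)" using L(1) unfolding holfam_def by blast
    moreover have "L3 \<zeta>2 (Q s) = L3 0 (Q s)" using L(2) unfolding holfam_def by blast
    moreover have "X \<omega> (Q s) = X 0 (Q s)" using X unfolding homog_def by blast
    ultimately show ?thesis unfolding plus_fun_apply by (simp only:)
  qed
  have eq: "nexp h (L1 \<zeta>1 + X \<omega> + L3 \<zeta>2) b' b = (if ?P then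
     (zer (L1 \<zeta>1) (fst b) * (zer (X 0) (fst b) * zer (L3 \<zeta>2) (fst b)) * exp (of_int (\<epsilon> * charge (fst b)) * \<omega>))
     * gmat (\<lambda>x. cre (L1 \<zeta>1) x + cre (X 0) x * exp (of_int (int (snd x)) * \<omega>) + cre (L3 \<zeta>2) x)
         (\<lambda>x. ann h (L1 \<zeta>1) x + ann h (X 0) x * exp (of_int (- int (snd x)) * \<omega>) + ann h (L3 \<zeta>2) x) (snd b') (snd b)
     else 0)" for \<zeta>1 \<zeta>2 \<omega>
    unfolding nexp_eq[OF b] vop_def QQ[of \<zeta>1 \<omega> \<zeta>2] zer_add cre_add ann_add homog_cre[OF X, of \<omega>] homog_ann[OF X, of h \<omega>]
      homog_zer[OF X i, of \<omega>] by (intro if_cong refl) (simp add: mult_ac)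
  show ?thesis
  proof (cases ?P)
    case True
    show ?thesis
      unfolding eq if_P[OF True]
      by (intro lpol_mult lpol_gmat lpol_add lpol_mono sephol_mult sephol_1 sephol_2 sephol_const
          lpol_sephol[OF sephol_1] lpol_sephol[OF sephol_2] holfam_cre holfam_ann holfam_zer L)
  qed (simp only: eq if_False lpol_sephol[OF sephol_const])
qed

definition lcoef :: "lp \<Rightarrow> int \<Rightarrow> complex \<Rightarrow> complex \<Rightarrow> complex" where
  "lcoef xs m \<zeta>1 \<zeta>2 = (\<Sum>(c, d)\<leftarrow>xs. if d = m then c \<zeta>1 \<zeta>2 else 0)"

text \<open>The coefficient of w^m in the Laurent polynomial times the geometric series of 1 / (1 -
  C w); \<open>lge\<close> belongs to 1 / (1 - C / w). As finite sums, polynomial in C, they remain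
  defined where the contour integral is not, which is the source of the meromorphic
  continuation.\<close>

definition lle :: "lp \<Rightarrow> int \<Rightarrow> complex \<Rightarrow> complex \<Rightarrow> complex \<Rightarrow> complex" where
  "lle xs m C \<zeta>1 \<zeta>2 = (\<Sum>(c, d)\<leftarrow>xs. if d \<le> m then c \<zeta>1 \<zeta>2 * C ^ nat (m - d) else 0)"

definition lge :: "lp \<Rightarrow> int \<Rightarrow> complex \<Rightarrow> complex \<Rightarrow> complex \<Rightarrow> complex" where
  "lge xs m C \<zeta>1 \<zeta>2 = (\<Sum>(c, d)\<leftarrow>xs. if d \<ge> m then c \<zeta>1 \<zeta>2 * C ^ nat (d - m) else 0)"

lemma cint_cong: "(\<And>\<omega>. Re \<omega> = \<rho> \<Longrightarrow> F \<omega> = G \<omega>) \<Longrightarrow> cint m \<rho> F = cint m \<rho> G"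
  unfolding cint_def by (intro integral_cong) simp

lemma cint_cmult: "cint m \<rho> (\<lambda>\<omega>. c * F \<omega>) = c * cint m \<rho> F"
proof -
  have "cint m \<rho> (\<lambda>\<omega>. c * F \<omega>) = integral {0..1} (\<lambda>t::real.
     c * (exp (- (of_int m * (of_real \<rho> + 2 * of_real pi * \<i> * of_real t))) * F (of_real \<rho> + 2 * of_real pi * \<i> * of_real t)))"
    unfolding cint_def by (intro integral_cong) simp
  then show ?thesis by (simp add: cint_def)
qed

lemma cint_integrable:
  assumes "continuous_on {\<omega>. Re \<omega> = \<rho>} F"
  shows "(\<lambda>t::real. exp (- (of_int m * (of_real \<rho> + 2 * of_real pi * \<i> * of_real t))) *
     F (of_real \<rho> + 2 * of_real pi * \<i> * of_real t)) integrable_on {0..1}"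
  by (intro integrable_continuous_real continuous_intros continuous_on_compose2[OF assms]) auto

lemma cint_add:
  assumes "continuous_on {\<omega>. Re \<omega> = \<rho>} F" "continuous_on {\<omega>. Re \<omega> = \<rho>} G"
  shows "cint m \<rho> (\<lambda>\<omega>. F \<omega> + G \<omega>) = cint m \<rho> F + cint m \<rho> G"
  using integral_add[OF cint_integrable[OF assms(1)] cint_integrable[OF assms(2)]]
  by (simp add: cint_def distrib_left)

lemma cint_exp: "cint m \<rho> (\<lambda>\<omega>. exp \<omega> * F \<omega>) = cint (m - 1) \<rho> F"
  unfolding cint_def
proof (rule integral_cong)
  fix t :: real
  let ?w = "of_real \<rho> + 2 * of_real pi * \<i> * of_real t"
  have "- (of_int (m - 1) * ?w) = - (of_int m * ?w) + ?w" by (simp add: algebra_simps)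
  then show "exp (- (of_int m * ?w)) * (exp ?w * F ?w) = exp (- (of_int (m - 1) * ?w)) * F ?w"
    by (simp only: exp_add mult.assoc)
qed

lemma continuous_lpe: "continuous_on S (lpe xs \<zeta>1 \<zeta>2)"
proof (induction xs)
  case (Cons p xs)
  have "lpe (p # xs) \<zeta>1 \<zeta>2 = (\<lambda>\<omega>. fst p \<zeta>1 \<zeta>2 * exp (of_int (snd p) * \<omega>) + lpe xs \<zeta>1 \<zeta>2 \<omega>)"
    by (simp add: lpe_def fun_eq_iff case_prod_unfold)
  then show ?case by (auto intro!: continuous_intros Cons)
qed (simp add: lpe_def)

lemma cint_list:
  assumes "continuous_on {\<omega>. Re \<omega> = \<rho>} k"
    and "\<And>d. cint m \<rho> (\<lambda>\<omega>. k \<omega> * exp (of_int d * \<omega>)) = w d"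
  shows "cint m \<rho> (\<lambda>\<omega>. k \<omega> * lpe xs \<zeta>1 \<zeta>2 \<omega>) = (\<Sum>(c, d)\<leftarrow>xs. c \<zeta>1 \<zeta>2 * w d)"
proof (induction xs)
  case Nil
  then show ?case by (simp add: lpe_def cint_def)
next
  case (Cons p xs)
  have "cint m \<rho> (\<lambda>\<omega>. k \<omega> * lpe (p # xs) \<zeta>1 \<zeta>2 \<omega>) =
      cint m \<rho> (\<lambda>\<omega>. fst p \<zeta>1 \<zeta>2 * (k \<omega> * exp (of_int (snd p) * \<omega>)) + k \<omega> * lpe xs \<zeta>1 \<zeta>2 \<omega>)"
    by (rule cint_cong) (simp add: lpe_def case_prod_unfold algebra_simps)
  also have "\<dots> = fst p \<zeta>1 \<zeta>2 * w (snd p) + (\<Sum>(c, d)\<leftarrow>xs. c \<zeta>1 \<zeta>2 * w d)"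
    unfolding cint_add[OF continuous_on_mult[OF continuous_on_const continuous_on_mult[OF assms(1) continuous_on_exp[OF continuous_on_mult[OF continuous_on_const continuous_on_id]]]]
        continuous_on_mult[OF assms(1) continuous_lpe]]
    by (simp add: cint_cmult assms(2) Cons)
  finally show ?case by (simp add: case_prod_unfold)
qed

lemma cint_monom: "cint m \<rho> (\<lambda>\<omega>. exp (of_int d * \<omega>)) = (if d = m then 1 else 0)"
proof -
  have "((\<lambda>x. if d = m then 1 else 0) has_sum cint m \<rho> (\<lambda>\<omega>. exp (of_int d * \<omega>))) {()}"
    by (rule has_sum_cint[where a = "\<lambda>_. 1" and d = "\<lambda>_. d"]) (auto intro: has_sum_finiteI)
  moreover have "((\<lambda>x. if d = m then 1 else 0) has_sum (if d = m then 1 else 0 :: complex)) {()}"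
    by (rule has_sum_finiteI) auto
  ultimately show ?thesis by (rule has_sum_unique)
qed

lemma has_sum_geom: "norm (x::complex) < 1 \<Longrightarrow> ((\<lambda>n. x ^ n) has_sum 1 / (1 - x)) UNIV"
  using geometric_sums[of x] by (intro norm_summable_imp_has_sum) (auto simp: norm_power intro!: summable_geometric)

lemma one_minus_neq_0: "norm (x::complex) < 1 \<Longrightarrow> 1 - x \<noteq> 0"
  by auto

text \<open>The sign \<open>s\<close> treats the expansions at w = 0 and at infinity together. At
  most one term of the geometric series has the required degree.\<close>

lemma cint_geom:
  fixes s d m :: int
  assumes s: "s \<in> {1, -1}" and C: "norm (C * exp (of_int s * of_real \<rho>)) < 1"
  shows "cint m \<rho> (\<lambda>\<omega>. 1 / (1 - C * exp (of_int s * \<omega>)) * exp (of_int d * \<omega>)) =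
     (if s * (m - d) \<ge> 0 then C ^ nat (s * (m - d)) else 0)"
proof -
  have n: "norm (C * exp (of_int s * \<omega>)) < 1" if "Re \<omega> = \<rho>" for \<omega>
    using C that by (simp add: norm_mult)
  have e: "C ^ j * exp (of_int (d + s * int j) * \<omega>) = (C * exp (of_int s * \<omega>)) ^ j * exp (of_int d * \<omega>)" for j \<omega>
    by (simp add: power_mult_distrib exp_of_nat_mult[symmetric] algebra_simps exp_add)
  have "((\<lambda>j. if d + s * int j = m then C ^ j else 0) has_sum
      cint m \<rho> (\<lambda>\<omega>. 1 / (1 - C * exp (of_int s * \<omega>)) * exp (of_int d * \<omega>))) UNIV"
  proof (rule has_sum_cint)
    show "((\<lambda>j. C ^ j * exp (of_int (d + s * int j) * \<omega>)) has_sum 1 / (1 - C * exp (of_int s * \<omega>)) * exp (of_int d * \<omega>)) UNIV"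
      if "Re \<omega> = \<rho>" for \<omega>
      unfolding e by (intro has_sum_cmult_left has_sum_geom n that)
    have "(\<lambda>j. norm (C * exp (of_int s * of_real \<rho>)) ^ j * norm (exp (of_int d * of_real \<rho> :: complex))) summable_on UNIV"
      by (intro summable_on_cmult_left summable_nonneg_imp_summable_on summable_geometric) (use C in auto)
    then show "(\<lambda>j. norm (C ^ j * exp (of_int (d + s * int j) * of_real \<rho>))) summable_on UNIV"
      unfolding e by (simp only: norm_mult norm_power)
  qed
  moreover have "((\<lambda>j. if d + s * int j = m then C ^ j else 0) has_sum
     (if s * (m - d) \<ge> 0 then C ^ nat (s * (m - d)) else 0)) UNIV"
  proof -
    have eqv: "d + s * int j = m \<longleftrightarrow> s * (m - d) \<ge> 0 \<and> j = nat (s * (m - d))" for j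
      using s by auto
    have "((\<lambda>j. if d + s * int j = m then C ^ j else 0) has_sum
     (if s * (m - d) \<ge> 0 then C ^ nat (s * (m - d)) else 0)) {nat (s * (m - d))}"
      unfolding eqv by (intro has_sum_finiteI) auto
    then show ?thesis
      unfolding eqv by (rule has_sum_cong_neutral[THEN iffD1, rotated -1]) auto
  qed
  ultimately show ?thesis by (rule has_sum_unique)
qed

lemma cint_lpe: "cint m \<rho> (lpe xs \<zeta>1 \<zeta>2) = lcoef xs m \<zeta>1 \<zeta>2"
proof -
  have "cint m \<rho> (\<lambda>\<omega>. 1 * lpe xs \<zeta>1 \<zeta>2 \<omega>) = (\<Sum>(c, d)\<leftarrow>xs. c \<zeta>1 \<zeta>2 * (if d = m then 1 else 0))"
    by (rule cint_list) (simp_all add: cint_monom)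
  also have "\<dots> = lcoef xs m \<zeta>1 \<zeta>2"
    unfolding lcoef_def by (intro arg_cong[where f = sum_list] map_cong) auto
  finally show ?thesis by simp
qed

lemma cint_lle:
  assumes "norm (C * exp (of_real \<rho>)) < 1"
  shows "cint m \<rho> (\<lambda>\<omega>. 1 / (1 - C * exp \<omega>) * lpe xs \<zeta>1 \<zeta>2 \<omega>) = lle xs m C \<zeta>1 \<zeta>2"
proof -
  have "cint m \<rho> (\<lambda>\<omega>. 1 / (1 - C * exp \<omega>) * lpe xs \<zeta>1 \<zeta>2 \<omega>) =
      (\<Sum>(c, d)\<leftarrow>xs. c \<zeta>1 \<zeta>2 * (if m - d \<ge> 0 then C ^ nat (m - d) else 0))"
  proof (rule cint_list)
    show "continuous_on {\<omega>. Re \<omega> = \<rho>} (\<lambda>\<omega>. 1 / (1 - C * exp \<omega>))"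
      using assms by (intro continuous_intros ballI one_minus_neq_0) (simp add: norm_mult)
    show "cint m \<rho> (\<lambda>\<omega>. 1 / (1 - C * exp \<omega>) * exp (of_int d * \<omega>)) = (if m - d \<ge> 0 then C ^ nat (m - d) else 0)" for d
      using cint_geom[of 1 C \<rho> m d] assms by simp
  qed
  also have "\<dots> = lle xs m C \<zeta>1 \<zeta>2"
    unfolding lle_def by (intro arg_cong[where f = sum_list] map_cong) auto
  finally show ?thesis .
qed

lemma cint_lge:
  assumes "norm (C * exp (- of_real \<rho>)) < 1"
  shows "cint m \<rho> (\<lambda>\<omega>. 1 / (1 - C * exp (- \<omega>)) * lpe xs \<zeta>1 \<zeta>2 \<omega>) = lge xs m C \<zeta>1 \<zeta>2"
proof -
  have "cint m \<rho> (\<lambda>\<omega>. 1 / (1 - C * exp (- \<omega>)) * lpe xs \<zeta>1 \<zeta>2 \<omega>) =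
      (\<Sum>(c, d)\<leftarrow>xs. c \<zeta>1 \<zeta>2 * (if d - m \<ge> 0 then C ^ nat (d - m) else 0))"
  proof (rule cint_list)
    show "continuous_on {\<omega>. Re \<omega> = \<rho>} (\<lambda>\<omega>. 1 / (1 - C * exp (- \<omega>)))"
      using assms by (intro continuous_intros ballI one_minus_neq_0) (simp add: norm_mult)
    show "cint m \<rho> (\<lambda>\<omega>. 1 / (1 - C * exp (- \<omega>)) * exp (of_int d * \<omega>)) = (if d - m \<ge> 0 then C ^ nat (d - m) else 0)" for d
      using cint_geom[of "-1" C \<rho> m d] assms by simp
  qed
  also have "\<dots> = lge xs m C \<zeta>1 \<zeta>2"
    unfolding lge_def by (intro arg_cong[where f = sum_list] map_cong) auto
  finally show ?thesis .
qed

lemma cint_kernel: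
  assumes "norm (C * exp (of_real \<rho>)) < 1" "norm (C' * exp (- of_real \<rho>)) < 1"
  shows "cint m \<rho> (\<lambda>\<omega>. (p0 + p1 / (1 - C * exp \<omega>) + p2 / (1 - C' * exp (- \<omega>))) * lpe xs \<zeta>1 \<zeta>2 \<omega>)
    = p0 * lcoef xs m \<zeta>1 \<zeta>2 + p1 * lle xs m C \<zeta>1 \<zeta>2 + p2 * lge xs m C' \<zeta>1 \<zeta>2"
proof -
  have c1: "continuous_on {\<omega>. Re \<omega> = \<rho>} (\<lambda>\<omega>. 1 / (1 - C * exp \<omega>) * lpe xs \<zeta>1 \<zeta>2 \<omega>)"
    using assms by (intro continuous_intros continuous_lpe ballI one_minus_neq_0) (simp add: norm_mult)
  have c2: "continuous_on {\<omega>. Re \<omega> = \<rho>} (\<lambda>\<omega>. 1 / (1 - C' * exp (- \<omega>)) * lpe xs \<zeta>1 \<zeta>2 \<omega>)"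
    using assms by (intro continuous_intros continuous_lpe ballI one_minus_neq_0) (simp add: norm_mult)
  note cont = continuous_on_mult[OF continuous_on_const c1] continuous_on_mult[OF continuous_on_const c2]
    continuous_on_mult[OF continuous_on_const continuous_lpe]
  have alg: "(p0 + p1 / A + p2 / B) * N = (p0 * N + p1 * (1 / A * N)) + p2 * (1 / B * N)" for A B N
    by (simp add: distrib_right)
  have "cint m \<rho> (\<lambda>\<omega>. (p0 + p1 / (1 - C * exp \<omega>) + p2 / (1 - C' * exp (- \<omega>))) * lpe xs \<zeta>1 \<zeta>2 \<omega>)
     = cint m \<rho> (\<lambda>\<omega>. (p0 * lpe xs \<zeta>1 \<zeta>2 \<omega> + p1 * (1 / (1 - C * exp \<omega>) * lpe xs \<zeta>1 \<zeta>2 \<omega>))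
         + p2 * (1 / (1 - C' * exp (- \<omega>)) * lpe xs \<zeta>1 \<zeta>2 \<omega>))"
    by (rule cint_cong) (rule alg)
  also have "\<dots> = p0 * lcoef xs m \<zeta>1 \<zeta>2 + p1 * lle xs m C \<zeta>1 \<zeta>2 + p2 * lge xs m C' \<zeta>1 \<zeta>2"
    by (subst cint_add, (intro continuous_on_add cont)+)
      (simp only: cint_add[OF cont(3,1)] cint_cmult cint_lpe cint_lle[OF assms(1)] cint_lge[OF assms(2)])
  finally show ?thesis .
qed

lemma contr_add_left:
  assumes "(\<lambda>x. norm (ann h L1 x * cre L3 x)) summable_on UNIV" "(\<lambda>x. norm (ann h L2 x * cre L3 x)) summable_on UNIV"
  shows "contr h (L1 + L2) L3 = contr h L1 L3 * contr h L2 L3"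
proof -
  have "infsum (\<lambda>x. ann h (L1 + L2) x * cre L3 x) UNIV = infsum (\<lambda>x. ann h L1 x * cre L3 x) UNIV + infsum (\<lambda>x. ann h L2 x * cre L3 x) UNIV"
    unfolding ann_add distrib_right by (rule infsum_add[OF assms[THEN abs_summable_summable]])
  then show ?thesis by (simp add: contr_def exp_add[symmetric] algebra_simps)
qed

lemma vtx_summable:
  assumes "vtx h \<zeta>1 L1" "vtx h \<zeta>2 L2" "Re \<zeta>1 > Re \<zeta>2 + 2 * majH h"
  shows "(\<lambda>x. norm (ann h L1 x * cre L2 x)) summable_on UNIV"
proof -
  have "(\<lambda>x. norm (majV h [Re \<zeta>1] x * majU h [Re \<zeta>2] x)) summable_on UNIV"
    using assms by (intro majVU_summable) (simp add: sep_def)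
  then show ?thesis
  proof (rule summable_on_comparison_test)
    fix x show "norm (ann h L1 x * cre L2 x) \<le> norm (majV h [Re \<zeta>1] x * majU h [Re \<zeta>2] x)"
      using vtx_bounds(2)[OF assms(1), of x] vtx_bounds(1)[OF assms(2), of x]
      by (auto simp: norm_mult abs_mult majU_nonneg majV_nonneg intro!: mult_mono)
  qed auto
qed

lemma majH_nonneg: "0 \<le> majH h"
  by (simp add: majH_def)

text \<open>On a circle between the two points the triple product is absolutely summable, so the
  summations can be interchanged and the integral extracts the degree of the middle factor. The
  kernel is the product of the three pairwise contractions.\<close>

lemma md_sandwich:
  assumes X: "cur h \<epsilon> X" and S: "vtx h \<zeta>1 L1" and T: "vtx h \<zeta>2 L3"
    and \<rho>: "Re \<zeta>1 > \<rho> + 2 * majH h" "\<rho> > Re \<zeta>2 + 2 * majH h" and b: "b' \<in> fock" "b \<in> fock"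
  shows "(nexp h L1 \<odot> (md h \<epsilon> X m \<odot> nexp h L3)) b' b =
    cint m \<rho> (\<lambda>\<omega>. (contr h L1 (X \<omega>) * (contr h L1 L3 * contr h (X \<omega>) L3)) * nexp h (L1 + X \<omega> + L3) b' b)"
    (is "_ = cint m \<rho> ?S")
proof -
  have h: "homog \<epsilon> X" and v: "\<And>\<omega>. vtx h \<omega> (X \<omega>)" using X by (auto simp: cur_def)
  have \<rho>': "Re \<zeta>1 > Re \<zeta>2 + 2 * majH h" using \<rho> majH_nonneg[of h] by linarith
  let ?A = "nexp h L1" and ?B = "\<lambda>\<omega>. nexp h (X \<omega>)" and ?C = "nexp h L3"
  have tr: "(\<lambda>(k, l). norm (?A b' k * ?B \<omega> k l * ?C l b)) summable_on fock \<times> fock" if "Re \<omega> = \<rho>" for \<omega>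
    by (rule maj_triple[OF vtx_maj[OF S] vtx_maj[OF v] vtx_maj[OF T]])
      (use \<rho> \<rho>' that b in \<open>auto simp: sep_def\<close>)
  have hs: "((\<lambda>(k, l). ?A b' k * ?B \<omega> k l * ?C l b) has_sum ?S \<omega>) (fock \<times> fock)" if "Re \<omega> = \<rho>" for \<omega>
  proof -
    have "((\<lambda>(l, k). ?A b' k * ?B \<omega> k l * ?C l b) has_sum ?S \<omega>) (fock \<times> fock)"
    proof (rule has_sum_SigmaI)
      fix l assume l: "l \<in> fock"
      show "((\<lambda>k. case (l, k) of (l, k) \<Rightarrow> ?A b' k * ?B \<omega> k l * ?C l b) has_sum
         contr h L1 (X \<omega>) * nexp h (L1 + X \<omega>) b' l * ?C l b) fock"
        unfolding prod.case using \<rho> that b l by (intro has_sum_cmult_left vtx_nexp_mult[OF S v]) auto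
    next
      have s1: "(\<lambda>x. norm (ann h L1 x * cre L3 x)) summable_on UNIV"
        by (rule vtx_summable[OF S T \<rho>'])
      have s2: "(\<lambda>x. norm (ann h (X \<omega>) x * cre L3 x)) summable_on UNIV"
        by (rule vtx_summable[OF v T]) (use \<rho> that in auto)
      have "((\<lambda>l. nexp h (L1 + X \<omega>) b' l * ?C l b) has_sum contr h (L1 + X \<omega>) L3 * nexp h (L1 + X \<omega> + L3) b' b) fock"
      proof (rule nexp_mult)
        show "(\<lambda>x. norm (ann h (L1 + X \<omega>) x * cre L3 x)) summable_on UNIV"
          by (rule summable_on_comparison_test[OF summable_on_add[OF s1 s2]])
            (auto simp: ann_add distrib_right norm_triangle_ineq)
      qed (use vtx_bounds[OF T] b in auto)
      then have "((\<lambda>l. contr h L1 (X \<omega>) * (nexp h (L1 + X \<omega>) b' l * ?C l b)) has_sum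
          contr h L1 (X \<omega>) * (contr h (L1 + X \<omega>) L3 * nexp h (L1 + X \<omega> + L3) b' b)) fock"
        by (rule has_sum_cmult_right)
      then show "((\<lambda>l. contr h L1 (X \<omega>) * nexp h (L1 + X \<omega>) b' l * ?C l b) has_sum ?S \<omega>) fock"
        by (simp only: contr_add_left[OF s1 s2] mult.assoc)
      show "(\<lambda>(l, k). ?A b' k * ?B \<omega> k l * ?C l b) summable_on fock \<times> fock"
        using abs_summable_summable[OF tr[OF that, unfolded case_prod_unfold]]
        by (subst summable_on_swap) (simp add: case_prod_unfold)
    qed
    then show ?thesis by (subst has_sum_swap) simp
  qed
  let ?a = "\<lambda>(k, l). ?A b' k * ?B 0 k l * ?C l b"
  have eq: "?A b' k * ?B \<omega> k l * ?C l b = ?A b' k * ?B 0 k l * ?C l b * exp (of_int (deg \<epsilon> k l) * \<omega>)"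
    if "k \<in> fock" "l \<in> fock" for k l \<omega>
    using nexp_homog[OF h that, of h \<omega>] by simp
  have "((\<lambda>x. if deg \<epsilon> (fst x) (snd x) = m then ?a x else 0) has_sum cint m \<rho> ?S) (fock \<times> fock)"
  proof (rule has_sum_cint)
    show "((\<lambda>x. ?a x * exp (of_int (deg \<epsilon> (fst x) (snd x)) * \<omega>)) has_sum ?S \<omega>) (fock \<times> fock)" if "Re \<omega> = \<rho>" for \<omega>
      by (rule has_sum_cong[THEN iffD1, rotated, OF hs[OF that]]) (use eq[of _ _ \<omega>] in auto)
    show "(\<lambda>x. norm (?a x * exp (of_int (deg \<epsilon> (fst x) (snd x)) * of_real \<rho>))) summable_on fock \<times> fock"
    proof (rule summable_on_cong[THEN iffD1, rotated, OF tr[of "of_real \<rho>"]])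
      fix x assume "x \<in> fock \<times> fock"
      then show "(case x of (k, l) \<Rightarrow> norm (?A b' k * ?B (of_real \<rho>) k l * ?C l b))
          = norm (?a x * exp (of_int (deg \<epsilon> (fst x) (snd x)) * of_real \<rho>))"
        using eq[of "fst x" "snd x" "of_real \<rho>"] by (cases x) (simp only: prod.case fst_conv snd_conv mem_Sigma_iff simp_thms)
    qed simp
  qed
  then have hs': "((\<lambda>(k, l). ?A b' k * (md h \<epsilon> X m k l * ?C l b)) has_sum cint m \<rho> ?S) (fock \<times> fock)"
    by (rule has_sum_cong[THEN iffD1, rotated]) (auto simp: md_def)
  have "(?A \<odot> (md h \<epsilon> X m \<odot> ?C)) b' b = (\<Sum>\<^sub>\<infinity>k\<in>fock. \<Sum>\<^sub>\<infinity>l\<in>fock. ?A b' k * (md h \<epsilon> X m k l * ?C l b))"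
    by (simp add: oprod_def infsum_cmult_right')
  also have "\<dots> = infsum (\<lambda>(k, l). ?A b' k * (md h \<epsilon> X m k l * ?C l b)) (fock \<times> fock)"
    by (rule infsum_Sigma'_banach[OF has_sum_imp_summable[OF hs']])
  also have "\<dots> = cint m \<rho> ?S" by (rule infsumI[OF hs'])
  finally show ?thesis .
qed

section \<open>Meromorphic continuation of products\<close>

definition vmaj :: "complex \<Rightarrow> (complex \<Rightarrow> oper) \<Rightarrow> bool" where
  "vmaj h S \<longleftrightarrow> (\<exists>\<nu>. \<forall>\<zeta>. maj h \<nu> [Re \<zeta>] (S \<zeta>))"

definition cmaj :: "complex \<Rightarrow> oper \<Rightarrow> bool" where
  "cmaj h f \<longleftrightarrow> rowfin f \<and> colfin f \<and> (\<exists>\<nu>. \<forall>\<rho>. maj h \<nu> [\<rho>] f)"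

definition mero :: "(complex \<Rightarrow> complex \<Rightarrow> oper) \<Rightarrow> bool" where
  "mero F \<longleftrightarrow> (\<forall>b'\<in>fock. \<forall>b\<in>fock.
     (\<forall>\<zeta>2. (\<lambda>\<zeta>1. F \<zeta>1 \<zeta>2 b' b) meromorphic_on UNIV) \<and> (\<forall>\<zeta>1. (\<lambda>\<zeta>2. F \<zeta>1 \<zeta>2 b' b) meromorphic_on UNIV))"

text \<open>\<open>F\<close> is a meromorphic continuation of \<open>A\<close> from the region where \<open>\<bar>z\<^sub>1\<bar>\<close> is large compared with \<open>\<bar>z\<^sub>2\<bar>\<close>.\<close>

definition contd :: "(complex \<Rightarrow> complex \<Rightarrow> oper) \<Rightarrow> (complex \<Rightarrow> complex \<Rightarrow> oper) \<Rightarrow> bool" where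
  "contd A F \<longleftrightarrow> mero F \<and> (\<exists>C. \<forall>\<zeta>1 \<zeta>2. Re \<zeta>1 > Re \<zeta>2 + C \<longrightarrow> eqf (A \<zeta>1 \<zeta>2) (F \<zeta>1 \<zeta>2))"

text \<open>\<open>continued_product\<close> with value and convergence separated, so that it is
  stable under \<open>eqf\<close> and can be combined with the algebra of
  \<open>\<odot>\<close>.\<close>

definition cprod :: "(complex \<Rightarrow> oper) \<Rightarrow> (complex \<Rightarrow> oper) \<Rightarrow> (complex \<Rightarrow> complex \<Rightarrow> oper) \<Rightarrow> bool" where
  "cprod S T F \<longleftrightarrow> contd (\<lambda>\<zeta>1 \<zeta>2. S \<zeta>1 \<odot> T \<zeta>2) F \<and>
     (\<exists>C. \<forall>\<zeta>1 \<zeta>2. Re \<zeta>1 > Re \<zeta>2 + C \<longrightarrow> composable (S \<zeta>1) (T \<zeta>2))"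

lemma cprod_continued:
  assumes "cprod S T F" "\<And>\<zeta>. eqf (S' \<zeta>) (S \<zeta>)" "\<And>\<zeta>. eqf (T' \<zeta>) (T \<zeta>)"
  shows "continued_product S' T' F"
proof -
  obtain C1 C2 where C: "\<And>\<zeta>1 \<zeta>2. Re \<zeta>1 > Re \<zeta>2 + C1 \<Longrightarrow> eqf (S \<zeta>1 \<odot> T \<zeta>2) (F \<zeta>1 \<zeta>2)"
    "\<And>\<zeta>1 \<zeta>2. Re \<zeta>1 > Re \<zeta>2 + C2 \<Longrightarrow> composable (S \<zeta>1) (T \<zeta>2)"
    using assms(1) unfolding cprod_def contd_def by blast
  have "((\<lambda>k. S' \<zeta>1 b' k * T' \<zeta>2 k b) has_sum F \<zeta>1 \<zeta>2 b' b) fock"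
    if "Re \<zeta>1 > Re \<zeta>2 + max C1 C2" "b' \<in> fock" "b \<in> fock" for \<zeta>1 \<zeta>2 b' b
  proof -
    have "(\<lambda>k. S \<zeta>1 b' k * T \<zeta>2 k b) summable_on fock" "infsum (\<lambda>k. S \<zeta>1 b' k * T \<zeta>2 k b) fock = F \<zeta>1 \<zeta>2 b' b"
      using C(1)[of \<zeta>2 \<zeta>1] C(2)[of \<zeta>2 \<zeta>1] that by (auto simp: eqf_def composable_def oprod_def)
    then have "((\<lambda>k. S \<zeta>1 b' k * T \<zeta>2 k b) has_sum F \<zeta>1 \<zeta>2 b' b) fock" by (simp add: has_sum_iff)
    then show ?thesis
      by (rule has_sum_cong[THEN iffD1, rotated])
        (use assms(2)[of \<zeta>1] assms(3)[of \<zeta>2] that in \<open>simp add: eqf_def\<close>)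
  qed
  then show ?thesis
    using assms(1) unfolding continued_product_def cprod_def contd_def mero_def by blast
qed

lemma mero_add: "mero F \<Longrightarrow> mero G \<Longrightarrow> mero (\<lambda>x y. F x y + G x y)"
  unfolding mero_def by (auto intro!: meromorphic_intros)

lemma mero_oscale: "mero F \<Longrightarrow> mero (\<lambda>x y. oscale c (F x y))"
  unfolding mero_def oscale_def by (auto intro!: meromorphic_intros)

lemma mero_row: "rowfin f \<Longrightarrow> mero F \<Longrightarrow> mero (\<lambda>x y. f \<odot> F x y)"
  unfolding mero_def by (auto simp: rowfin_oprod intro!: meromorphic_intros)

lemma mero_col: "colfin f \<Longrightarrow> mero F \<Longrightarrow> mero (\<lambda>x y. F x y \<odot> f)"
  unfolding mero_def by (auto simp: colfin_oprod intro!: meromorphic_intros)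

text \<open>A factor with finite columns turns one of the two sums into a finite one, which may be
  interchanged with any convergent sum. No majorant of the triple product is involved.\<close>

lemma colfin_assoc_comp:
  assumes "colfin f" "composable A B"
  shows "eqf ((A \<odot> B) \<odot> f) (A \<odot> (B \<odot> f))"
  unfolding eqf_def
proof (intro ballI)
  fix b' b assume b: "b' \<in> fock" "b \<in> fock"
  let ?F = "{l. l \<in> fock \<and> f l b \<noteq> 0}"
  have "((\<lambda>k. \<Sum>l\<in>?F. A b' k * B k l * f l b) has_sum (\<Sum>l\<in>?F. (A \<odot> B) b' l * f l b)) fock"
    using assms(2) b unfolding composable_def oprod_def by (intro has_sum_sum has_sum_cmult_left has_sum_infsum) auto
  also have "(\<lambda>k. \<Sum>l\<in>?F. A b' k * B k l * f l b) = (\<lambda>k. A b' k * (B \<odot> f) k b)"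
    by (simp add: colfin_oprod[OF assms(1) b(2)] sum_distrib_left mult.assoc)
  finally have "(A \<odot> (B \<odot> f)) b' b = (\<Sum>l\<in>?F. (A \<odot> B) b' l * f l b)"
    unfolding oprod_def[of A "B \<odot> f"] by (rule infsumI)
  then show "((A \<odot> B) \<odot> f) b' b = (A \<odot> (B \<odot> f)) b' b"
    by (simp add: colfin_oprod[OF assms(1) b(2)])
qed

lemma rowfin_assoc_comp:
  assumes "rowfin f" "composable A B"
  shows "eqf ((f \<odot> A) \<odot> B) (f \<odot> (A \<odot> B))"
  unfolding eqf_def
proof (intro ballI)
  fix b' b assume b: "b' \<in> fock" "b \<in> fock"
  let ?F = "{l. l \<in> fock \<and> f b' l \<noteq> 0}"
  have "((\<lambda>k. \<Sum>l\<in>?F. f b' l * (A l k * B k b)) has_sum (\<Sum>l\<in>?F. f b' l * (A \<odot> B) l b)) fock"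
    using assms(2) b unfolding composable_def oprod_def by (intro has_sum_sum has_sum_cmult_right has_sum_infsum) auto
  also have "(\<lambda>k. \<Sum>l\<in>?F. f b' l * (A l k * B k b)) = (\<lambda>k. (f \<odot> A) b' k * B k b)"
    by (simp add: rowfin_oprod[OF assms(1) b(1)] sum_distrib_right mult.assoc)
  finally have "((f \<odot> A) \<odot> B) b' b = (\<Sum>l\<in>?F. f b' l * (A \<odot> B) l b)"
    unfolding oprod_def[of "f \<odot> A"] by (rule infsumI)
  then show "((f \<odot> A) \<odot> B) b' b = (f \<odot> (A \<odot> B)) b' b"
    by (simp add: rowfin_oprod[OF assms(1) b(1)])
qed

lemma oprod_comb_left:
  "composable A C \<Longrightarrow> composable B C \<Longrightarrow> eqf ((oscale x A + oscale y B) \<odot> C) (oscale x (A \<odot> C) + oscale y (B \<odot> C))"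
  using oprod_add_left[OF comp_oscale_left comp_oscale_left] by (simp only: oprod_oscale_left)

lemma oprod_comb_right:
  "composable C A \<Longrightarrow> composable C B \<Longrightarrow> eqf (C \<odot> (oscale x A + oscale y B)) (oscale x (C \<odot> A) + oscale y (C \<odot> B))"
  using oprod_add_right[OF comp_oscale_right comp_oscale_right] by (simp only: oprod_oscale_right)

lemma oprod_zero_left: "0 \<odot> A = 0" and oprod_zero_right: "A \<odot> 0 = 0"
  by (simp_all add: oprod_def fun_eq_iff)

text \<open>The common shape of the three components defined by brackets: \<open>r\<close> is minus
  the signed bracket parameter and \<open>x\<close> the normalisation, so r is 1/q for
  \<open>phi\<close> and \<open>psi_dual\<close>, where both entries are odd, and -q for
  \<open>phi_dual\<close>.\<close>

definition dbl :: "complex \<Rightarrow> complex \<Rightarrow> oper \<Rightarrow> (complex \<Rightarrow> oper) \<Rightarrow> complex \<Rightarrow> oper" where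
  "dbl x r f S \<zeta> = oscale x (S \<zeta> \<odot> f + oscale r (f \<odot> S \<zeta>))"

lemma dbl_left:
  assumes "composable (S \<zeta> \<odot> f) C" "composable (f \<odot> S \<zeta>) C"
  shows "composable (dbl x r f S \<zeta>) C"
    and "eqf (dbl x r f S \<zeta> \<odot> C) (oscale x ((S \<zeta> \<odot> f) \<odot> C + oscale r ((f \<odot> S \<zeta>) \<odot> C)))"
proof -
  show "composable (dbl x r f S \<zeta>) C"
    unfolding dbl_def by (intro comp_oscale_left comp_add_left assms)
  show "eqf (dbl x r f S \<zeta> \<odot> C) (oscale x ((S \<zeta> \<odot> f) \<odot> C + oscale r ((f \<odot> S \<zeta>) \<odot> C)))"
    unfolding dbl_def oprod_oscale_left
    by (rule eqf_oscale) (use oprod_add_left[OF assms(1) comp_oscale_left[OF assms(2)], of r] in \<open>simp add: oprod_oscale_left\<close>)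
qed

lemma dbl_right:
  assumes "composable C (S \<zeta> \<odot> f)" "composable C (f \<odot> S \<zeta>)"
  shows "composable C (dbl x r f S \<zeta>)"
    and "eqf (C \<odot> dbl x r f S \<zeta>) (oscale x (C \<odot> (S \<zeta> \<odot> f) + oscale r (C \<odot> (f \<odot> S \<zeta>))))"
proof -
  show "composable C (dbl x r f S \<zeta>)"
    unfolding dbl_def by (intro comp_oscale_right comp_add_right assms)
  show "eqf (C \<odot> dbl x r f S \<zeta>) (oscale x (C \<odot> (S \<zeta> \<odot> f) + oscale r (C \<odot> (f \<odot> S \<zeta>))))"
    unfolding dbl_def oprod_oscale_right
    by (rule eqf_oscale) (use oprod_add_right[OF assms(1) comp_oscale_right[OF assms(2)], of r] in \<open>simp add: oprod_oscale_right\<close>)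
qed

text \<open>Modes \<open>f\<close>, \<open>g\<close> of currents are majorised at every radius, so all groupings of \<open>S f g T\<close> converge once \<open>\<bar>z\<^sub>1\<bar>\<close> is large compared with \<open>\<bar>z\<^sub>2\<bar>\<close>.\<close>

definition words :: "oper \<Rightarrow> oper \<Rightarrow> oper \<Rightarrow> oper \<Rightarrow> bool" where
  "words A f g B \<longleftrightarrow> composable A B \<and> composable (A \<odot> f) B \<and> composable (f \<odot> A) B \<and> composable A (g \<odot> B) \<and> composable A (B \<odot> g) \<and>
     composable (A \<odot> f) (B \<odot> g) \<and> composable (A \<odot> f) (g \<odot> B) \<and> composable (f \<odot> A) (B \<odot> g) \<and> composable (f \<odot> A) (g \<odot> B) \<and>
     eqf ((A \<odot> f) \<odot> B) (A \<odot> (f \<odot> B)) \<and>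
     eqf ((A \<odot> f) \<odot> (B \<odot> g)) (((A \<odot> f) \<odot> B) \<odot> g) \<and>
     eqf ((A \<odot> f) \<odot> (g \<odot> B)) (A \<odot> ((f \<odot> g) \<odot> B)) \<and>
     eqf ((f \<odot> A) \<odot> (B \<odot> g)) (f \<odot> ((A \<odot> B) \<odot> g)) \<and>
     eqf ((f \<odot> A) \<odot> (g \<odot> B)) (f \<odot> (A \<odot> (g \<odot> B))) \<and>
     eqf ((f \<odot> A) \<odot> B) (f \<odot> (A \<odot> B)) \<and> eqf ((A \<odot> B) \<odot> g) (A \<odot> (B \<odot> g)) \<and>
     composable (f \<odot> g) B \<and> composable A ((f \<odot> g) \<odot> B)"

lemma words:
  assumes S: "vmaj h S" and T: "vmaj h T" and f: "cmaj h f" and g: "cmaj h g"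
  shows "\<exists>C. \<forall>\<zeta>1 \<zeta>2. Re \<zeta>1 > Re \<zeta>2 + C \<longrightarrow> words (S \<zeta>1) f g (T \<zeta>2)"
proof (intro exI[of _ "6 * majH h + 3"] allI impI)
  fix \<zeta>1 \<zeta>2 assume reg: "Re \<zeta>1 > Re \<zeta>2 + (6 * majH h + 3)"
  let ?A = "S \<zeta>1" and ?B = "T \<zeta>2"
  obtain \<nu>A where A: "maj h \<nu>A [Re \<zeta>1] ?A" using S unfolding vmaj_def by blast
  obtain \<nu>B where B: "maj h \<nu>B [Re \<zeta>2] ?B" using T unfolding vmaj_def by blast
  obtain \<nu>f where mf: "\<And>\<rho>. maj h \<nu>f [\<rho>] f" using f unfolding cmaj_def by blast
  obtain \<nu>g where mg: "\<And>\<rho>. maj h \<nu>g [\<rho>] g" using g unfolding cmaj_def by blast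
  note fin = f[unfolded cmaj_def, THEN conjunct1] f[unfolded cmaj_def, THEN conjunct2, THEN conjunct1]
    g[unfolded cmaj_def, THEN conjunct1] g[unfolded cmaj_def, THEN conjunct2, THEN conjunct1]
  have H: "0 \<le> majH h" by (rule majH_nonneg)
  \<comment> \<open>Radii for the modes, chosen so that r1, Re \<zeta>1, r2, r3, Re \<zeta>2, r4
    decrease with gaps above 2 majH. The three inner gaps account for the constant 6 majH +
    3.\<close>
  define r1 r2 r3 r4 where "r1 = Re \<zeta>1 + 2 * majH h + 1" and "r2 = Re \<zeta>1 - 2 * majH h - 1"
    and "r3 = Re \<zeta>2 + 2 * majH h + 1" and "r4 = Re \<zeta>2 - 2 * majH h - 1"
  note sp = sep_def r1_def r2_def r3_def r4_def
  note f1 = mf[of r1] and f2 = mf[of r2] and g3 = mg[of r3] and g4 = mg[of r4]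
  have s: "sep h [r1] [Re \<zeta>1]" "sep h [Re \<zeta>1] [r2]" "sep h [r2] [r3]" "sep h [r3] [Re \<zeta>2]" "sep h [Re \<zeta>2] [r4]"
    "sep h [Re \<zeta>1] [Re \<zeta>2]" "sep h [r2] [Re \<zeta>2]" "sep h [Re \<zeta>1] [r3]"
    using reg H by (simp_all add: sp)
  have Af: "maj h (\<lambda>s. \<nu>A s + \<nu>f s) [Re \<zeta>1, r2] (?A \<odot> f)" using maj_oprod[OF A f2 s(2)] by simp
  have fA: "maj h (\<lambda>s. \<nu>f s + \<nu>A s) [r1, Re \<zeta>1] (f \<odot> ?A)" using maj_oprod[OF f1 A s(1)] by simp
  have gB: "maj h (\<lambda>s. \<nu>g s + \<nu>B s) [r3, Re \<zeta>2] (g \<odot> ?B)" using maj_oprod[OF g3 B s(4)] by simp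
  have Bg: "maj h (\<lambda>s. \<nu>B s + \<nu>g s) [Re \<zeta>2, r4] (?B \<odot> g)" using maj_oprod[OF B g4 s(5)] by simp
  have cAB: "composable ?A ?B" by (rule maj_imp_comp[OF A B s(6)])
  have cA: "composable ?A (g \<odot> ?B)" "composable ?A (?B \<odot> g)"
    by (rule maj_imp_comp[OF A gB] maj_imp_comp[OF A Bg]; use reg H in \<open>simp add: sp\<close>)+
  have cB: "composable (?A \<odot> f) ?B" "composable (f \<odot> ?A) ?B"
    by (rule maj_imp_comp[OF Af B] maj_imp_comp[OF fA B]; use reg H in \<open>simp add: sp\<close>)+
  have c4: "composable (?A \<odot> f) (?B \<odot> g)" "composable (?A \<odot> f) (g \<odot> ?B)" "composable (f \<odot> ?A) (?B \<odot> g)" "composable (f \<odot> ?A) (g \<odot> ?B)"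
    by (rule maj_imp_comp[OF Af Bg] maj_imp_comp[OF Af gB] maj_imp_comp[OF fA Bg] maj_imp_comp[OF fA gB]; use reg H in \<open>simp add: sp\<close>)+
  have a1: "eqf ((?A \<odot> f) \<odot> ?B) (?A \<odot> (f \<odot> ?B))"
    by (rule maj_assoc[OF A f2 B s(2,6,7)])
  have a2: "eqf ((?A \<odot> f) \<odot> (?B \<odot> g)) (((?A \<odot> f) \<odot> ?B) \<odot> g)"
    by (rule eqf_sym, rule colfin_assoc_comp[OF fin(4) cB(1)])
  have "eqf ((?A \<odot> f) \<odot> (g \<odot> ?B)) (?A \<odot> (f \<odot> (g \<odot> ?B)))"
    by (rule maj_assoc[OF A f2 gB s(2)]) (use reg H in \<open>simp_all add: sp\<close>)
  also have "eqf \<dots> (?A \<odot> ((f \<odot> g) \<odot> ?B))"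
    by (rule eqf_oprod[OF eqf_refl eqf_sym[OF rowfin_assoc[OF fin(1,3)]]])
  finally have a3: "eqf ((?A \<odot> f) \<odot> (g \<odot> ?B)) (?A \<odot> ((f \<odot> g) \<odot> ?B))" .
  have a7: "eqf ((?A \<odot> ?B) \<odot> g) (?A \<odot> (?B \<odot> g))" by (rule colfin_assoc_comp[OF fin(4) cAB])
  have "eqf ((f \<odot> ?A) \<odot> (?B \<odot> g)) (f \<odot> (?A \<odot> (?B \<odot> g)))"
    by (rule rowfin_assoc_comp[OF fin(1) cA(2)])
  also have "eqf \<dots> (f \<odot> ((?A \<odot> ?B) \<odot> g))"
    by (rule eqf_oprod[OF eqf_refl eqf_sym[OF a7]])
  finally have a4: "eqf ((f \<odot> ?A) \<odot> (?B \<odot> g)) (f \<odot> ((?A \<odot> ?B) \<odot> g))" .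
  have a5: "eqf ((f \<odot> ?A) \<odot> (g \<odot> ?B)) (f \<odot> (?A \<odot> (g \<odot> ?B)))"
    by (rule rowfin_assoc_comp[OF fin(1) cA(1)])
  have a6: "eqf ((f \<odot> ?A) \<odot> ?B) (f \<odot> (?A \<odot> ?B))"
    by (rule rowfin_assoc_comp[OF fin(1) cAB])
  have fg: "maj h (\<lambda>s. \<nu>f s + \<nu>g s) [r2, r3] (f \<odot> g)" using maj_oprod[OF f2 g3 s(3)] by simp
  have s5: "sep h [r2, r3] [Re \<zeta>2]" using reg H by (simp add: sp)
  have c5: "composable (f \<odot> g) ?B" by (rule maj_imp_comp[OF fg B s5])
  have c6: "composable ?A ((f \<odot> g) \<odot> ?B)"
    by (rule maj_imp_comp[OF A maj_oprod[OF fg B s5]]) (use reg H in \<open>simp add: sp\<close>)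
  show "words ?A f g ?B"
    unfolding words_def by (intro conjI cAB cA cB c4 a1 a2 a3 a4 a5 a6 a7 c5 c6)
qed

lemma cprodI:
  assumes "mero F" "\<And>\<zeta>1 \<zeta>2. Re \<zeta>1 > Re \<zeta>2 + C \<Longrightarrow> composable (S \<zeta>1) (T \<zeta>2) \<and> eqf (S \<zeta>1 \<odot> T \<zeta>2) (F \<zeta>1 \<zeta>2)"
  shows "cprod S T F"
  using assms unfolding cprod_def contd_def by blast

text \<open>Every word in two operators and at most two copies of \<open>f\<close> reduces to
  \<open>P\<close> or \<open>G\<close> with copies of \<open>f\<close> outside. The one exception, S
  f f T, vanishes by \<open>ff\<close>, so no continuation with two modes inside is ever
  constructed.\<close>

lemma cprod_same:
  assumes S: "vmaj h S" and T: "vmaj h T" and f: "cmaj h f" and ff: "eqf (f \<odot> f) 0"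
    and P: "contd (\<lambda>\<zeta>1 \<zeta>2. S \<zeta>1 \<odot> T \<zeta>2) P" and G: "contd (\<lambda>\<zeta>1 \<zeta>2. S \<zeta>1 \<odot> (f \<odot> T \<zeta>2)) G"
  shows "cprod S T P"
    and "cprod (dbl x r f S) T (\<lambda>\<zeta>1 \<zeta>2. oscale x (G \<zeta>1 \<zeta>2 + oscale r (f \<odot> P \<zeta>1 \<zeta>2)))"
    and "cprod S (dbl y s f T) (\<lambda>\<zeta>1 \<zeta>2. oscale y (P \<zeta>1 \<zeta>2 \<odot> f + oscale s (G \<zeta>1 \<zeta>2)))"
    and "cprod (dbl x r f S) (dbl y s f T) (\<lambda>\<zeta>1 \<zeta>2. oscale x (oscale y (G \<zeta>1 \<zeta>2 \<odot> f)
            + oscale r (oscale y (f \<odot> (P \<zeta>1 \<zeta>2 \<odot> f) + oscale s (f \<odot> G \<zeta>1 \<zeta>2)))))"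
proof -
  obtain C1 where C1: "\<And>\<zeta>1 \<zeta>2. Re \<zeta>1 > Re \<zeta>2 + C1 \<Longrightarrow> words (S \<zeta>1) f f (T \<zeta>2)"
    using words[OF S T f f] by blast
  obtain C2 where C2: "\<And>\<zeta>1 \<zeta>2. Re \<zeta>1 > Re \<zeta>2 + C2 \<Longrightarrow> eqf (S \<zeta>1 \<odot> T \<zeta>2) (P \<zeta>1 \<zeta>2)"
    using P unfolding contd_def by blast
  obtain C3 where C3: "\<And>\<zeta>1 \<zeta>2. Re \<zeta>1 > Re \<zeta>2 + C3 \<Longrightarrow> eqf (S \<zeta>1 \<odot> (f \<odot> T \<zeta>2)) (G \<zeta>1 \<zeta>2)"
    using G unfolding contd_def by blast
  have m: "mero P" "mero G" and fin: "rowfin f" "colfin f"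
    using P G f unfolding contd_def cmaj_def by auto
  let ?C = "max C1 (max C2 C3)"
  show "cprod S T P"
    by (rule cprodI[where C = ?C, OF m(1)]) (use C1 C2 in \<open>auto simp: words_def\<close>)
  have w: "words (S \<zeta>1) f f (T \<zeta>2)" "eqf (S \<zeta>1 \<odot> T \<zeta>2) (P \<zeta>1 \<zeta>2)" "eqf (S \<zeta>1 \<odot> (f \<odot> T \<zeta>2)) (G \<zeta>1 \<zeta>2)"
    if "Re \<zeta>1 > Re \<zeta>2 + ?C" for \<zeta>1 \<zeta>2 using C1[of \<zeta>2 \<zeta>1] C2[of \<zeta>2 \<zeta>1] C3[of \<zeta>2 \<zeta>1] that by auto
  show "cprod (dbl x r f S) T (\<lambda>\<zeta>1 \<zeta>2. oscale x (G \<zeta>1 \<zeta>2 + oscale r (f \<odot> P \<zeta>1 \<zeta>2)))"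
  proof (rule cprodI[where C = ?C])
    show "mero (\<lambda>\<zeta>1 \<zeta>2. oscale x (G \<zeta>1 \<zeta>2 + oscale r (f \<odot> P \<zeta>1 \<zeta>2)))"
      by (intro mero_oscale mero_add mero_row m fin)
    fix \<zeta>1 \<zeta>2 assume "Re \<zeta>1 > Re \<zeta>2 + ?C"
    note w = w[OF this] and wd = w[OF this, unfolded words_def]
    have "eqf (dbl x r f S \<zeta>1 \<odot> T \<zeta>2) (oscale x ((S \<zeta>1 \<odot> f) \<odot> T \<zeta>2 + oscale r ((f \<odot> S \<zeta>1) \<odot> T \<zeta>2)))"
      using wd by (intro dbl_left) auto
    also have "eqf \<dots> (oscale x (G \<zeta>1 \<zeta>2 + oscale r (f \<odot> P \<zeta>1 \<zeta>2)))"
      using wd eqf_trans eqf_oprod[OF eqf_refl w(2)] by (intro eqf_oscale eqf_add) blast+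
    finally show "composable (dbl x r f S \<zeta>1) (T \<zeta>2) \<and> eqf (dbl x r f S \<zeta>1 \<odot> T \<zeta>2) (oscale x (G \<zeta>1 \<zeta>2 + oscale r (f \<odot> P \<zeta>1 \<zeta>2)))"
      using wd by (auto intro!: dbl_left)
  qed
  show "cprod S (dbl y s f T) (\<lambda>\<zeta>1 \<zeta>2. oscale y (P \<zeta>1 \<zeta>2 \<odot> f + oscale s (G \<zeta>1 \<zeta>2)))"
  proof (rule cprodI[where C = ?C])
    show "mero (\<lambda>\<zeta>1 \<zeta>2. oscale y (P \<zeta>1 \<zeta>2 \<odot> f + oscale s (G \<zeta>1 \<zeta>2)))"
      by (intro mero_oscale mero_add mero_col m fin)
    fix \<zeta>1 \<zeta>2 assume "Re \<zeta>1 > Re \<zeta>2 + ?C"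
    note w = w[OF this] and wd = w[OF this, unfolded words_def]
    have "eqf (S \<zeta>1 \<odot> dbl y s f T \<zeta>2) (oscale y (S \<zeta>1 \<odot> (T \<zeta>2 \<odot> f) + oscale s (S \<zeta>1 \<odot> (f \<odot> T \<zeta>2))))"
      using wd by (intro dbl_right) auto
    also have "eqf \<dots> (oscale y (P \<zeta>1 \<zeta>2 \<odot> f + oscale s (G \<zeta>1 \<zeta>2)))"
      using wd eqf_trans eqf_sym eqf_oprod[OF w(2) eqf_refl] by (intro eqf_oscale eqf_add) blast+
    finally show "composable (S \<zeta>1) (dbl y s f T \<zeta>2) \<and> eqf (S \<zeta>1 \<odot> dbl y s f T \<zeta>2) (oscale y (P \<zeta>1 \<zeta>2 \<odot> f + oscale s (G \<zeta>1 \<zeta>2)))"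
      using wd by (auto intro!: dbl_right)
  qed
  show "cprod (dbl x r f S) (dbl y s f T) (\<lambda>\<zeta>1 \<zeta>2. oscale x (oscale y (G \<zeta>1 \<zeta>2 \<odot> f)
            + oscale r (oscale y (f \<odot> (P \<zeta>1 \<zeta>2 \<odot> f) + oscale s (f \<odot> G \<zeta>1 \<zeta>2)))))"
  proof (rule cprodI[where C = ?C])
    show "mero (\<lambda>\<zeta>1 \<zeta>2. oscale x (oscale y (G \<zeta>1 \<zeta>2 \<odot> f)
            + oscale r (oscale y (f \<odot> (P \<zeta>1 \<zeta>2 \<odot> f) + oscale s (f \<odot> G \<zeta>1 \<zeta>2)))))"
      by (intro mero_oscale mero_add mero_col mero_row m fin)
    fix \<zeta>1 \<zeta>2 assume "Re \<zeta>1 > Re \<zeta>2 + ?C"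
    note w = w[OF this] and wd = w[OF this, unfolded words_def]
    let ?W = "dbl y s f T \<zeta>2"
    have c: "composable (S \<zeta>1 \<odot> f) ?W" "composable (f \<odot> S \<zeta>1) ?W" using wd by (auto intro!: dbl_right)
    have z: "eqf ((S \<zeta>1 \<odot> f) \<odot> (f \<odot> T \<zeta>2)) 0"
    proof -
      have "eqf (S \<zeta>1 \<odot> ((f \<odot> f) \<odot> T \<zeta>2)) (S \<zeta>1 \<odot> (0 \<odot> T \<zeta>2))"
        by (intro eqf_oprod eqf_refl ff)
      then show ?thesis using wd eqf_trans unfolding oprod_zero_left oprod_zero_right by blast
    qed
    have g: "eqf ((S \<zeta>1 \<odot> f) \<odot> T \<zeta>2) (G \<zeta>1 \<zeta>2)" using wd w(3) eqf_trans by blast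
    have "eqf (dbl x r f S \<zeta>1 \<odot> ?W) (oscale x ((S \<zeta>1 \<odot> f) \<odot> ?W + oscale r ((f \<odot> S \<zeta>1) \<odot> ?W)))"
      by (rule dbl_left(2)[of S, OF c])
    also have "eqf \<dots> (oscale x (oscale y ((S \<zeta>1 \<odot> f) \<odot> (T \<zeta>2 \<odot> f) + oscale s ((S \<zeta>1 \<odot> f) \<odot> (f \<odot> T \<zeta>2)))
         + oscale r (oscale y ((f \<odot> S \<zeta>1) \<odot> (T \<zeta>2 \<odot> f) + oscale s ((f \<odot> S \<zeta>1) \<odot> (f \<odot> T \<zeta>2))))))"
      using wd by (intro eqf_oscale eqf_add dbl_right) auto
    also have "eqf \<dots> (oscale x (oscale y (G \<zeta>1 \<zeta>2 \<odot> f + oscale s 0)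
         + oscale r (oscale y (f \<odot> (P \<zeta>1 \<zeta>2 \<odot> f) + oscale s (f \<odot> G \<zeta>1 \<zeta>2)))))"
      using wd z eqf_trans eqf_oprod[OF g eqf_refl] eqf_oprod[OF eqf_refl eqf_oprod[OF w(2) eqf_refl]] eqf_oprod[OF eqf_refl w(3)]
      by (intro eqf_oscale eqf_add) blast+
    also have "\<dots> = oscale x (oscale y (G \<zeta>1 \<zeta>2 \<odot> f)
         + oscale r (oscale y (f \<odot> (P \<zeta>1 \<zeta>2 \<odot> f) + oscale s (f \<odot> G \<zeta>1 \<zeta>2))))"
      by (simp add: oscale_def fun_eq_iff)
    finally show "composable (dbl x r f S \<zeta>1) ?W \<and> eqf (dbl x r f S \<zeta>1 \<odot> ?W) (oscale x (oscale y (G \<zeta>1 \<zeta>2 \<odot> f)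
            + oscale r (oscale y (f \<odot> (P \<zeta>1 \<zeta>2 \<odot> f) + oscale s (f \<odot> G \<zeta>1 \<zeta>2)))))"
      using dbl_left(1)[of S, OF c] by blast
  qed
qed

lemma oscale_minus_one: "oscale (-1) (oscale (-1) A) = A"
  by (simp add: oscale_def)

text \<open>\<open>e\<close> anticommutes with \<open>T\<close>, and \<open>f\<close> with \<open>S\<close>; so only the word \<open>S e f T\<close> needs the anticommutator of \<open>e\<close> and \<open>f\<close>.\<close>

lemma cprod_mixed:
  assumes S: "vmaj h S" and T: "vmaj h T" and e: "cmaj h e" and f: "cmaj h f"
    and ef: "eqf K (e \<odot> f + f \<odot> e)" and K: "\<And>\<zeta>. eqf (K \<odot> T \<zeta>) (T \<zeta> \<odot> K')" "colfin K'" "rowfin K"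
    and fS: "\<And>\<zeta>. eqf (S \<zeta> \<odot> f) (oscale (-1) (f \<odot> S \<zeta>))" and eT: "\<And>\<zeta>. eqf (e \<odot> T \<zeta>) (oscale (-1) (T \<zeta> \<odot> e))"
    and P: "contd (\<lambda>\<zeta>1 \<zeta>2. S \<zeta>1 \<odot> T \<zeta>2) P"
  shows "cprod S T P"
    and "cprod (dbl x r e S) T (\<lambda>\<zeta>1 \<zeta>2. oscale x (oscale (-1) (P \<zeta>1 \<zeta>2 \<odot> e) + oscale r (e \<odot> P \<zeta>1 \<zeta>2)))"
    and "cprod S (dbl y s f T) (\<lambda>\<zeta>1 \<zeta>2. oscale y (P \<zeta>1 \<zeta>2 \<odot> f + oscale s (oscale (-1) (f \<odot> P \<zeta>1 \<zeta>2))))"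
    and "cprod (dbl x r e S) (dbl y s f T) (\<lambda>\<zeta>1 \<zeta>2.
        oscale x (oscale y (oscale (-1) (P \<zeta>1 \<zeta>2 \<odot> (e \<odot> f)) + oscale s (P \<zeta>1 \<zeta>2 \<odot> K' - f \<odot> (P \<zeta>1 \<zeta>2 \<odot> e)))
            + oscale r (oscale y (e \<odot> (P \<zeta>1 \<zeta>2 \<odot> f) + oscale s (oscale (-1) ((e \<odot> f) \<odot> P \<zeta>1 \<zeta>2))))))"
proof -
  obtain C1 where C1: "\<And>\<zeta>1 \<zeta>2. Re \<zeta>1 > Re \<zeta>2 + C1 \<Longrightarrow> words (S \<zeta>1) e f (T \<zeta>2)"
    using words[OF S T e f] by blast
  obtain C2 where C2: "\<And>\<zeta>1 \<zeta>2. Re \<zeta>1 > Re \<zeta>2 + C2 \<Longrightarrow> eqf (S \<zeta>1 \<odot> T \<zeta>2) (P \<zeta>1 \<zeta>2)"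
    using P unfolding contd_def by blast
  obtain C3 where C3: "\<And>\<zeta>1 \<zeta>2. Re \<zeta>1 > Re \<zeta>2 + C3 \<Longrightarrow> words (S \<zeta>1) f e (T \<zeta>2)"
    using words[OF S T f e] by blast
  have m: "mero P" and fin: "rowfin f" "colfin f" "rowfin e" "colfin e"
    using P f e unfolding contd_def cmaj_def by auto
  let ?C = "max C1 (max C2 C3)"
  have w: "words (S \<zeta>1) e f (T \<zeta>2)" "eqf (S \<zeta>1 \<odot> T \<zeta>2) (P \<zeta>1 \<zeta>2)" "words (S \<zeta>1) f e (T \<zeta>2)"
    if "Re \<zeta>1 > Re \<zeta>2 + ?C" for \<zeta>1 \<zeta>2 using C1[of \<zeta>2 \<zeta>1] C2[of \<zeta>2 \<zeta>1] C3[of \<zeta>2 \<zeta>1] that by auto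
  show "cprod S T P"
    by (rule cprodI[where C = ?C, OF m(1)]) (use w in \<open>auto simp: words_def\<close>)
  have SeT: "eqf ((S \<zeta>1 \<odot> e) \<odot> T \<zeta>2) (oscale (-1) (P \<zeta>1 \<zeta>2 \<odot> e))" if "Re \<zeta>1 > Re \<zeta>2 + ?C" for \<zeta>1 \<zeta>2
  proof -
    note w = w[OF that] and wd = w(1)[OF that, unfolded words_def] and wd' = w(3)[OF that, unfolded words_def]
    have "eqf ((S \<zeta>1 \<odot> e) \<odot> T \<zeta>2) (S \<zeta>1 \<odot> (e \<odot> T \<zeta>2))" using wd by blast
    also have "eqf \<dots> (S \<zeta>1 \<odot> oscale (-1) (T \<zeta>2 \<odot> e))" by (intro eqf_oprod eqf_refl eT)
    also have "\<dots> = oscale (-1) (S \<zeta>1 \<odot> (T \<zeta>2 \<odot> e))" by (rule oprod_oscale_right)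
    also have "eqf \<dots> (oscale (-1) (P \<zeta>1 \<zeta>2 \<odot> e))"
      by (intro eqf_oscale) (use wd' eqf_sym eqf_trans eqf_oprod[OF w(2) eqf_refl] in blast)
    finally show ?thesis .
  qed
  have SfT: "eqf (S \<zeta>1 \<odot> (f \<odot> T \<zeta>2)) (oscale (-1) (f \<odot> P \<zeta>1 \<zeta>2))" if "Re \<zeta>1 > Re \<zeta>2 + ?C" for \<zeta>1 \<zeta>2
  proof -
    note w = w[OF that] and wd = w(1)[OF that, unfolded words_def] and wd' = w(3)[OF that, unfolded words_def]
    have "eqf (S \<zeta>1 \<odot> (f \<odot> T \<zeta>2)) ((S \<zeta>1 \<odot> f) \<odot> T \<zeta>2)" using wd' eqf_sym by blast
    also have "eqf \<dots> (oscale (-1) (f \<odot> S \<zeta>1) \<odot> T \<zeta>2)" by (intro eqf_oprod eqf_refl fS)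
    also have "\<dots> = oscale (-1) ((f \<odot> S \<zeta>1) \<odot> T \<zeta>2)" by (rule oprod_oscale_left)
    also have "eqf \<dots> (oscale (-1) (f \<odot> P \<zeta>1 \<zeta>2))"
      by (intro eqf_oscale) (use wd' eqf_trans eqf_oprod[OF eqf_refl w(2)] in blast)
    finally show ?thesis .
  qed
  show "cprod (dbl x r e S) T (\<lambda>\<zeta>1 \<zeta>2. oscale x (oscale (-1) (P \<zeta>1 \<zeta>2 \<odot> e) + oscale r (e \<odot> P \<zeta>1 \<zeta>2)))"
  proof (rule cprodI[where C = ?C])
    show "mero (\<lambda>\<zeta>1 \<zeta>2. oscale x (oscale (-1) (P \<zeta>1 \<zeta>2 \<odot> e) + oscale r (e \<odot> P \<zeta>1 \<zeta>2)))"
      by (intro mero_oscale mero_add mero_row mero_col m fin)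
    fix \<zeta>1 \<zeta>2 assume R: "Re \<zeta>1 > Re \<zeta>2 + ?C"
    note w = w[OF R] and wd = w(1)[OF R, unfolded words_def]
    have "eqf (dbl x r e S \<zeta>1 \<odot> T \<zeta>2) (oscale x ((S \<zeta>1 \<odot> e) \<odot> T \<zeta>2 + oscale r ((e \<odot> S \<zeta>1) \<odot> T \<zeta>2)))"
      using wd by (intro dbl_left) auto
    also have "eqf \<dots> (oscale x (oscale (-1) (P \<zeta>1 \<zeta>2 \<odot> e) + oscale r (e \<odot> P \<zeta>1 \<zeta>2)))"
      using wd SeT[OF R] eqf_trans eqf_oprod[OF eqf_refl w(2)] by (intro eqf_oscale eqf_add) blast+
    finally show "composable (dbl x r e S \<zeta>1) (T \<zeta>2) \<and> eqf (dbl x r e S \<zeta>1 \<odot> T \<zeta>2) (oscale x (oscale (-1) (P \<zeta>1 \<zeta>2 \<odot> e) + oscale r (e \<odot> P \<zeta>1 \<zeta>2)))"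
      using wd by (auto intro!: dbl_left)
  qed
  show "cprod S (dbl y s f T) (\<lambda>\<zeta>1 \<zeta>2. oscale y (P \<zeta>1 \<zeta>2 \<odot> f + oscale s (oscale (-1) (f \<odot> P \<zeta>1 \<zeta>2))))"
  proof (rule cprodI[where C = ?C])
    show "mero (\<lambda>\<zeta>1 \<zeta>2. oscale y (P \<zeta>1 \<zeta>2 \<odot> f + oscale s (oscale (-1) (f \<odot> P \<zeta>1 \<zeta>2))))"
      by (intro mero_oscale mero_add mero_col mero_row m fin)
    fix \<zeta>1 \<zeta>2 assume R: "Re \<zeta>1 > Re \<zeta>2 + ?C"
    note w = w[OF R] and wd = w(1)[OF R, unfolded words_def]
    have "eqf (S \<zeta>1 \<odot> dbl y s f T \<zeta>2) (oscale y (S \<zeta>1 \<odot> (T \<zeta>2 \<odot> f) + oscale s (S \<zeta>1 \<odot> (f \<odot> T \<zeta>2))))"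
      using wd by (intro dbl_right) auto
    also have "eqf \<dots> (oscale y (P \<zeta>1 \<zeta>2 \<odot> f + oscale s (oscale (-1) (f \<odot> P \<zeta>1 \<zeta>2))))"
      using wd SfT[OF R] eqf_trans eqf_sym eqf_oprod[OF w(2) eqf_refl] by (intro eqf_oscale eqf_add) blast+
    finally show "composable (S \<zeta>1) (dbl y s f T \<zeta>2) \<and> eqf (S \<zeta>1 \<odot> dbl y s f T \<zeta>2) (oscale y (P \<zeta>1 \<zeta>2 \<odot> f + oscale s (oscale (-1) (f \<odot> P \<zeta>1 \<zeta>2))))"
      using wd by (auto intro!: dbl_right)
  qed
  show "cprod (dbl x r e S) (dbl y s f T) (\<lambda>\<zeta>1 \<zeta>2.
        oscale x (oscale y (oscale (-1) (P \<zeta>1 \<zeta>2 \<odot> (e \<odot> f)) + oscale s (P \<zeta>1 \<zeta>2 \<odot> K' - f \<odot> (P \<zeta>1 \<zeta>2 \<odot> e)))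
            + oscale r (oscale y (e \<odot> (P \<zeta>1 \<zeta>2 \<odot> f) + oscale s (oscale (-1) ((e \<odot> f) \<odot> P \<zeta>1 \<zeta>2))))))"
  proof (rule cprodI[where C = ?C])
    have m1: "mero (\<lambda>\<zeta>1 \<zeta>2. P \<zeta>1 \<zeta>2 \<odot> (e \<odot> f))"
    proof -
      have "mero (\<lambda>\<zeta>1 \<zeta>2. (P \<zeta>1 \<zeta>2 \<odot> e) \<odot> f)" by (intro mero_col m fin)
      then show ?thesis using colfin_assoc[OF fin(4,2)] by (simp add: mero_def eqf_def)
    qed
    have m2: "mero (\<lambda>\<zeta>1 \<zeta>2. (e \<odot> f) \<odot> P \<zeta>1 \<zeta>2)"
    proof -
      have "mero (\<lambda>\<zeta>1 \<zeta>2. e \<odot> (f \<odot> P \<zeta>1 \<zeta>2))" by (intro mero_row m fin)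
      then show ?thesis using rowfin_assoc[OF fin(3,1)] by (simp add: mero_def eqf_def)
    qed
    have md: "F - G = F + oscale (-1) G" for F G :: oper by (simp add: oscale_def fun_eq_iff)
    show "mero (\<lambda>\<zeta>1 \<zeta>2.
        oscale x (oscale y (oscale (-1) (P \<zeta>1 \<zeta>2 \<odot> (e \<odot> f)) + oscale s (P \<zeta>1 \<zeta>2 \<odot> K' - f \<odot> (P \<zeta>1 \<zeta>2 \<odot> e)))
            + oscale r (oscale y (e \<odot> (P \<zeta>1 \<zeta>2 \<odot> f) + oscale s (oscale (-1) ((e \<odot> f) \<odot> P \<zeta>1 \<zeta>2))))))"
      unfolding md by (intro mero_oscale mero_add m1 m2) (intro mero_col mero_row m fin K)+
    fix \<zeta>1 \<zeta>2 assume R: "Re \<zeta>1 > Re \<zeta>2 + ?C"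
    note w = w[OF R] and wd = w(1)[OF R, unfolded words_def] and wd' = w(3)[OF R, unfolded words_def]
    let ?W = "dbl y s f T \<zeta>2" and ?P = "P \<zeta>1 \<zeta>2" and ?A = "S \<zeta>1" and ?B = "T \<zeta>2"
    have c: "composable (?A \<odot> e) ?W" "composable (e \<odot> ?A) ?W" using wd by (auto intro!: dbl_right)
    have t1: "eqf ((?A \<odot> e) \<odot> (?B \<odot> f)) (oscale (-1) (?P \<odot> (e \<odot> f)))"
    proof -
      have "eqf ((?A \<odot> e) \<odot> (?B \<odot> f)) (((?A \<odot> e) \<odot> ?B) \<odot> f)" using wd by blast
      also have "eqf \<dots> (oscale (-1) (?P \<odot> e) \<odot> f)" by (intro eqf_oprod eqf_refl SeT R)
      also have "\<dots> = oscale (-1) ((?P \<odot> e) \<odot> f)" by (rule oprod_oscale_left)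
      also have "eqf \<dots> (oscale (-1) (?P \<odot> (e \<odot> f)))" by (intro eqf_oscale colfin_assoc fin)
      finally show ?thesis .
    qed
    \<comment> \<open>In S e f T neither mode stands beside the operator that it anticommutes with.
      Adding S f e T produces S K T, where \<open>K\<close> moves through T, and in S f e T both
      modes can be moved outside.\<close>
    have t2: "eqf ((?A \<odot> e) \<odot> (f \<odot> ?B)) (?P \<odot> K' - f \<odot> (?P \<odot> e))"
    proof -
      have "eqf (?A \<odot> (K \<odot> ?B)) (?A \<odot> ((e \<odot> f + f \<odot> e) \<odot> ?B))"
        by (intro eqf_oprod eqf_refl ef)
      also have "eqf \<dots> (?A \<odot> ((e \<odot> f) \<odot> ?B + (f \<odot> e) \<odot> ?B))"
        using wd wd' by (intro eqf_oprod eqf_refl oprod_add_left) blast+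
      also have "eqf \<dots> (?A \<odot> ((e \<odot> f) \<odot> ?B) + ?A \<odot> ((f \<odot> e) \<odot> ?B))"
        using wd wd' by (intro oprod_add_right) blast+
      also have "eqf \<dots> ((?A \<odot> e) \<odot> (f \<odot> ?B) + (?A \<odot> f) \<odot> (e \<odot> ?B))"
        using wd wd' eqf_sym by (intro eqf_add) blast+
      finally have 1: "eqf (?A \<odot> (K \<odot> ?B)) ((?A \<odot> e) \<odot> (f \<odot> ?B) + (?A \<odot> f) \<odot> (e \<odot> ?B))" .
      have "eqf (?A \<odot> (K \<odot> ?B)) (?A \<odot> (?B \<odot> K'))"
        by (intro eqf_oprod eqf_refl K)
      also have "eqf \<dots> ((?A \<odot> ?B) \<odot> K')"
        using wd by (intro eqf_sym[OF colfin_assoc_comp] K) blast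
      also have "eqf \<dots> (?P \<odot> K')"
        by (intro eqf_oprod eqf_refl w)
      finally have 2: "eqf (?A \<odot> (K \<odot> ?B)) (?P \<odot> K')" .
      have "eqf ((?A \<odot> f) \<odot> (e \<odot> ?B)) (oscale (-1) (f \<odot> ?A) \<odot> oscale (-1) (?B \<odot> e))"
        by (intro eqf_oprod fS eT)
      also have "\<dots> = (f \<odot> ?A) \<odot> (?B \<odot> e)"
        by (simp only: oprod_oscale_left oprod_oscale_right oscale_minus_one)
      also have "eqf \<dots> (f \<odot> (?P \<odot> e))"
        using wd' eqf_trans eqf_oprod[OF eqf_refl eqf_oprod[OF w(2) eqf_refl]] by blast
      finally have 3: "eqf ((?A \<odot> f) \<odot> (e \<odot> ?B)) (f \<odot> (?P \<odot> e))" .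
      show ?thesis using 1 2 3 by (simp add: eqf_def) (metis add_diff_cancel_right')
    qed
    have t3: "eqf ((e \<odot> ?A) \<odot> (?B \<odot> f)) (e \<odot> (?P \<odot> f))"
      using wd eqf_trans eqf_oprod[OF eqf_refl eqf_oprod[OF w(2) eqf_refl]] by blast
    have t4: "eqf ((e \<odot> ?A) \<odot> (f \<odot> ?B)) (oscale (-1) ((e \<odot> f) \<odot> ?P))"
    proof -
      have "eqf ((e \<odot> ?A) \<odot> (f \<odot> ?B)) (e \<odot> (?A \<odot> (f \<odot> ?B)))" using wd by blast
      also have "eqf \<dots> (e \<odot> oscale (-1) (f \<odot> ?P))" by (intro eqf_oprod eqf_refl SfT R)
      also have "\<dots> = oscale (-1) (e \<odot> (f \<odot> ?P))" by (rule oprod_oscale_right)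
      also have "eqf \<dots> (oscale (-1) ((e \<odot> f) \<odot> ?P))" by (intro eqf_oscale eqf_sym[OF rowfin_assoc] fin)
      finally show ?thesis .
    qed
    have "eqf (dbl x r e S \<zeta>1 \<odot> ?W) (oscale x ((?A \<odot> e) \<odot> ?W + oscale r ((e \<odot> ?A) \<odot> ?W)))"
      by (rule dbl_left(2)[of S, OF c])
    also have "eqf \<dots> (oscale x (oscale y ((?A \<odot> e) \<odot> (?B \<odot> f) + oscale s ((?A \<odot> e) \<odot> (f \<odot> ?B)))
         + oscale r (oscale y ((e \<odot> ?A) \<odot> (?B \<odot> f) + oscale s ((e \<odot> ?A) \<odot> (f \<odot> ?B))))))"
      using wd by (intro eqf_oscale eqf_add dbl_right) auto
    also have "eqf \<dots> (oscale x (oscale y (oscale (-1) (?P \<odot> (e \<odot> f)) + oscale s (?P \<odot> K' - f \<odot> (?P \<odot> e)))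
            + oscale r (oscale y (e \<odot> (?P \<odot> f) + oscale s (oscale (-1) ((e \<odot> f) \<odot> ?P))))))"
      by (intro eqf_oscale eqf_add t1 t2 t3 t4)
    finally show "composable (dbl x r e S \<zeta>1) ?W \<and> eqf (dbl x r e S \<zeta>1 \<odot> ?W) (oscale x (oscale y (oscale (-1) (?P \<odot> (e \<odot> f)) + oscale s (?P \<odot> K' - f \<odot> (?P \<odot> e)))
            + oscale r (oscale y (e \<odot> (?P \<odot> f) + oscale s (oscale (-1) ((e \<odot> f) \<odot> ?P))))))"
      using dbl_left(1)[of S, OF c] by blast
  qed
qed

section \<open>The identity theorem and the elimination of a mode\<close>

text \<open>Meromorphic functions may carry arbitrary values at a sparse set of points. The identity
  theorem is therefore applied to the difference with its singularities removed, and equality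
  returns only off a sparse set. Left half-planes occur when the variable belongs to the right-hand
  factor of a product.\<close>

lemma meromorphic_eq_halfplane:
  assumes f: "f meromorphic_on UNIV" and g: "g meromorphic_on UNIV"
    and eq: "H = {z. Re z > (C::real)} \<or> H = {z. Re z < C}" "\<And>z. z \<in> H \<Longrightarrow> f z = g z"
  shows "\<forall>\<^sub>\<approx>z\<in>UNIV. f z = g z"
proof -
  define d where "d = (\<lambda>z. f z - g z)"
  have d: "d meromorphic_on UNIV" unfolding d_def by (intro meromorphic_intros f g)
  obtain z0 where z0: "z0 \<in> H"
  proof -
    have "of_real (C + 1) \<in> {z. Re z > C}" "of_real (C - 1) \<in> {z. Re z < C}" by auto
    then show ?thesis using eq(1) that by blast
  qed
  have oH: "open H" using eq(1) open_halfspace_Re_gt[of C] open_halfspace_Re_lt[of C] by auto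
  have ev0: "eventually (\<lambda>z. d z = 0) (at z0)"
    using eventually_at_in_open'[OF oH z0] by eventually_elim (simp add: d_def eq(2))
  have rs: "eventually (\<lambda>z. remove_sings d z = d z) (cosparse UNIV)"
    using d by (rule eventually_remove_sings_eq)
  have "eventually (\<lambda>z. remove_sings d z = 0) (at z0)"
    using ev0 eventually_cosparse_imp_eventually_at[OF rs UNIV_I, of z0 UNIV] by eventually_elim simp
  then have "frequently (\<lambda>z. remove_sings d z = 0) (at z0)"
    by (intro eventually_frequently) auto
  then have "remove_sings d z = 0" for z
    by (rule frequently_eq_meromorphic_imp_constant[OF _ remove_sings_nicely_meromorphic[OF d]]) auto
  with rs show ?thesis by (auto elim!: eventually_mono simp: d_def)
qed

text \<open>Two solutions of exp z = c differ by a multiple of 2 \<pi> i, so they cannot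
  accumulate.\<close>

lemma cosparse_exp_neq: "\<forall>\<^sub>\<approx>z\<in>UNIV. exp z \<noteq> (c::complex)"
proof -
  have "eventually (\<lambda>z. exp z \<noteq> c) (at x)" for x
  proof (cases "exp x = c")
    case True
    have "((\<lambda>z. \<bar>Im z - Im x\<bar>) \<longlongrightarrow> \<bar>Im x - Im x\<bar>) (at x)" by (intro tendsto_intros)
    then have "eventually (\<lambda>z. \<bar>Im z - Im x\<bar> < 2 * pi) (at x)"
      by (rule order_tendstoD) simp
    moreover have "eventually (\<lambda>z. z \<noteq> x) (at x)" by (simp add: eventually_at_filter)
    ultimately show ?thesis
      by eventually_elim (use True exp_complex_eqI in metis)
  next
    case False
    have "(exp \<longlongrightarrow> exp x) (at x)" by (intro tendsto_intros)
    then show ?thesis using False by (rule tendsto_imp_eventually_ne)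
  qed
  then show ?thesis by (simp add: eventually_cosparse_open_eq)
qed

text \<open>The exchange relation of a current with a vertex operator, between two modes \<open>f\<close>, \<open>f'\<close> of the current:
  \<open>(\<alpha> f' - \<beta> z f) S(z) = - S(z) (\<gamma> f' - \<delta> z f)\<close>. Moving the current through \<open>S(z\<^sub>1) S(z\<^sub>2)\<close> and
  through \<open>S(z\<^sub>2) S(z\<^sub>1)\<close> gives four equations, from which the terms with \<open>f'\<close> can be eliminated.\<close>

lemma exchange_elim:
  assumes S: "vmaj h S" and f: "cmaj h f" and f': "cmaj h f'"
    and R: "\<And>\<zeta>. eqf (oscale \<alpha> (f' \<odot> S \<zeta>) + oscale (- \<beta> * exp \<zeta>) (f \<odot> S \<zeta>))
               (oscale (- \<gamma>) (S \<zeta> \<odot> f') + oscale (\<delta> * exp \<zeta>) (S \<zeta> \<odot> f))"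
    and P: "contd (\<lambda>\<zeta>1 \<zeta>2. S \<zeta>1 \<odot> S \<zeta>2) P"
    and G: "contd (\<lambda>\<zeta>1 \<zeta>2. S \<zeta>1 \<odot> (f \<odot> S \<zeta>2)) G" and G': "contd (\<lambda>\<zeta>1 \<zeta>2. S \<zeta>1 \<odot> (f' \<odot> S \<zeta>2)) G'"
    and \<rho>: "\<And>\<zeta>2. \<forall>\<^sub>\<approx>\<zeta>1\<in>UNIV. \<forall>b'\<in>fock. \<forall>b\<in>fock. P \<zeta>2 \<zeta>1 b' b = \<rho> \<zeta>1 \<zeta>2 * P \<zeta>1 \<zeta>2 b' b"
    and b: "b' \<in> fock" "b \<in> fock"
  shows "\<forall>\<^sub>\<approx>\<zeta>1\<in>UNIV. \<rho> \<zeta>1 \<zeta>2 * \<alpha> * \<beta> * (exp \<zeta>1 - exp \<zeta>2) * (f \<odot> P \<zeta>1 \<zeta>2) b' b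
     + \<rho> \<zeta>1 \<zeta>2 * (\<alpha> * \<delta> * exp \<zeta>1 - \<beta> * \<gamma> * exp \<zeta>2) * G \<zeta>1 \<zeta>2 b' b
     - (\<alpha> * \<delta> * exp \<zeta>2 - \<beta> * \<gamma> * exp \<zeta>1) * G \<zeta>2 \<zeta>1 b' b
     + \<rho> \<zeta>1 \<zeta>2 * \<gamma> * \<delta> * (exp \<zeta>1 - exp \<zeta>2) * (P \<zeta>1 \<zeta>2 \<odot> f) b' b = 0"
proof -
  have fin: "rowfin f" "colfin f" "rowfin f'" "colfin f'" using f f' by (auto simp: cmaj_def)
  obtain C1 where C1: "\<And>\<zeta>1 \<zeta>2. Re \<zeta>1 > Re \<zeta>2 + C1 \<Longrightarrow> words (S \<zeta>1) f f' (S \<zeta>2)" using words[OF S S f f'] by blast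
  obtain C2 where C2: "\<And>\<zeta>1 \<zeta>2. Re \<zeta>1 > Re \<zeta>2 + C2 \<Longrightarrow> words (S \<zeta>1) f' f (S \<zeta>2)" using words[OF S S f' f] by blast
  obtain C3 where C3: "\<And>\<zeta>1 \<zeta>2. Re \<zeta>1 > Re \<zeta>2 + C3 \<Longrightarrow> eqf (S \<zeta>1 \<odot> S \<zeta>2) (P \<zeta>1 \<zeta>2)" using P unfolding contd_def by blast
  obtain C4 where C4: "\<And>\<zeta>1 \<zeta>2. Re \<zeta>1 > Re \<zeta>2 + C4 \<Longrightarrow> eqf (S \<zeta>1 \<odot> (f \<odot> S \<zeta>2)) (G \<zeta>1 \<zeta>2)" using G unfolding contd_def by blast
  obtain C5 where C5: "\<And>\<zeta>1 \<zeta>2. Re \<zeta>1 > Re \<zeta>2 + C5 \<Longrightarrow> eqf (S \<zeta>1 \<odot> (f' \<odot> S \<zeta>2)) (G' \<zeta>1 \<zeta>2)" using G' unfolding contd_def by blast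
  let ?C = "max C1 (max C2 (max C3 (max C4 C5)))"
  have w: "words (S \<zeta>1) f f' (S \<zeta>2)" "words (S \<zeta>1) f' f (S \<zeta>2)" "eqf (S \<zeta>1 \<odot> S \<zeta>2) (P \<zeta>1 \<zeta>2)"
      "eqf (S \<zeta>1 \<odot> (f \<odot> S \<zeta>2)) (G \<zeta>1 \<zeta>2)" "eqf (S \<zeta>1 \<odot> (f' \<odot> S \<zeta>2)) (G' \<zeta>1 \<zeta>2)"
    if "Re \<zeta>1 > Re \<zeta>2 + ?C" for \<zeta>1 \<zeta>2
    using C1[of \<zeta>2 \<zeta>1] C2[of \<zeta>2 \<zeta>1] C3[of \<zeta>2 \<zeta>1] C4[of \<zeta>2 \<zeta>1] C5[of \<zeta>2 \<zeta>1] that by auto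
  have m: "mero P" "mero G" "mero G'" using P G G' by (auto simp: contd_def)
  have m4: "mero (\<lambda>x y. f \<odot> P x y)" "mero (\<lambda>x y. f' \<odot> P x y)" "mero (\<lambda>x y. P x y \<odot> f)" "mero (\<lambda>x y. P x y \<odot> f')"
    by (intro mero_row mero_col fin m)+
  have R1: "\<alpha> * (f' \<odot> P \<zeta>1 \<zeta>2) b' b + (- \<beta> * exp \<zeta>1) * (f \<odot> P \<zeta>1 \<zeta>2) b' b
      = (- \<gamma>) * G' \<zeta>1 \<zeta>2 b' b + \<delta> * exp \<zeta>1 * G \<zeta>1 \<zeta>2 b' b" if reg: "Re \<zeta>1 > Re \<zeta>2 + ?C" for \<zeta>1 \<zeta>2
  proof -
    note w = w[OF reg] and wd = w(1)[OF reg, unfolded words_def] and wd' = w(2)[OF reg, unfolded words_def]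
    let ?A = "S \<zeta>1" and ?B = "S \<zeta>2"
    have "eqf ((oscale \<alpha> (f' \<odot> ?A) + oscale (- \<beta> * exp \<zeta>1) (f \<odot> ?A)) \<odot> ?B)
              ((oscale (- \<gamma>) (?A \<odot> f') + oscale (\<delta> * exp \<zeta>1) (?A \<odot> f)) \<odot> ?B)"
      by (intro eqf_oprod eqf_refl R)
    moreover have "eqf ((oscale \<alpha> (f' \<odot> ?A) + oscale (- \<beta> * exp \<zeta>1) (f \<odot> ?A)) \<odot> ?B)
        (oscale \<alpha> ((f' \<odot> ?A) \<odot> ?B) + oscale (- \<beta> * exp \<zeta>1) ((f \<odot> ?A) \<odot> ?B))"
      using wd wd' by (intro oprod_comb_left) blast+
    moreover have "eqf ((oscale (- \<gamma>) (?A \<odot> f') + oscale (\<delta> * exp \<zeta>1) (?A \<odot> f)) \<odot> ?B)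
        (oscale (- \<gamma>) ((?A \<odot> f') \<odot> ?B) + oscale (\<delta> * exp \<zeta>1) ((?A \<odot> f) \<odot> ?B))"
      using wd wd' by (intro oprod_comb_left) blast+
    moreover have "eqf ((f' \<odot> ?A) \<odot> ?B) (f' \<odot> P \<zeta>1 \<zeta>2)" "eqf ((f \<odot> ?A) \<odot> ?B) (f \<odot> P \<zeta>1 \<zeta>2)"
      using wd wd' eqf_trans eqf_oprod[OF eqf_refl w(3)] by blast+
    moreover have "eqf ((?A \<odot> f') \<odot> ?B) (G' \<zeta>1 \<zeta>2)" "eqf ((?A \<odot> f) \<odot> ?B) (G \<zeta>1 \<zeta>2)"
      using wd wd' w eqf_trans by blast+
    ultimately show ?thesis using b by (simp add: eqf_def oscale_def)
  qed
  have R2: "\<alpha> * G' \<zeta>1 \<zeta>2 b' b + (- \<beta> * exp \<zeta>2) * G \<zeta>1 \<zeta>2 b' b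
      = (- \<gamma>) * (P \<zeta>1 \<zeta>2 \<odot> f') b' b + \<delta> * exp \<zeta>2 * (P \<zeta>1 \<zeta>2 \<odot> f) b' b" if reg: "Re \<zeta>1 > Re \<zeta>2 + ?C" for \<zeta>1 \<zeta>2
  proof -
    note w = w[OF reg] and wd = w(1)[OF reg, unfolded words_def] and wd' = w(2)[OF reg, unfolded words_def]
    let ?A = "S \<zeta>1" and ?B = "S \<zeta>2"
    have "eqf (?A \<odot> (oscale \<alpha> (f' \<odot> ?B) + oscale (- \<beta> * exp \<zeta>2) (f \<odot> ?B)))
              (?A \<odot> (oscale (- \<gamma>) (?B \<odot> f') + oscale (\<delta> * exp \<zeta>2) (?B \<odot> f)))"
      by (intro eqf_oprod eqf_refl R)
    moreover have "eqf (?A \<odot> (oscale \<alpha> (f' \<odot> ?B) + oscale (- \<beta> * exp \<zeta>2) (f \<odot> ?B)))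
        (oscale \<alpha> (?A \<odot> (f' \<odot> ?B)) + oscale (- \<beta> * exp \<zeta>2) (?A \<odot> (f \<odot> ?B)))"
      using wd wd' by (intro oprod_comb_right) blast+
    moreover have "eqf (?A \<odot> (oscale (- \<gamma>) (?B \<odot> f') + oscale (\<delta> * exp \<zeta>2) (?B \<odot> f)))
        (oscale (- \<gamma>) (?A \<odot> (?B \<odot> f')) + oscale (\<delta> * exp \<zeta>2) (?A \<odot> (?B \<odot> f)))"
      using wd wd' by (intro oprod_comb_right) blast+
    moreover have "eqf (?A \<odot> (?B \<odot> f')) (P \<zeta>1 \<zeta>2 \<odot> f')" "eqf (?A \<odot> (?B \<odot> f)) (P \<zeta>1 \<zeta>2 \<odot> f)"
      using wd wd' eqf_sym eqf_trans eqf_oprod[OF w(3) eqf_refl] by blast+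
    ultimately show ?thesis using b w by (simp add: eqf_def oscale_def)
  qed
  have me: "(\<lambda>z. F z \<zeta>2 b' b) meromorphic_on UNIV" "(\<lambda>z. F \<zeta>2 z b' b) meromorphic_on UNIV" if "mero F" for F
    using that b by (auto simp: mero_def)
  have ex: "exp meromorphic_on UNIV" by (intro analytic_on_imp_meromorphic_on analytic_intros)
  note mm = me[OF m(1)] me[OF m(2)] me[OF m(3)] me[OF m4(1)] me[OF m4(2)] me[OF m4(3)] me[OF m4(4)]
  have "\<forall>\<^sub>\<approx>\<zeta>1\<in>UNIV. \<alpha> * (f' \<odot> P \<zeta>1 \<zeta>2) b' b + (- \<beta> * exp \<zeta>1) * (f \<odot> P \<zeta>1 \<zeta>2) b' b
      = (- \<gamma>) * G' \<zeta>1 \<zeta>2 b' b + \<delta> * exp \<zeta>1 * G \<zeta>1 \<zeta>2 b' b"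
    apply (rule meromorphic_eq_halfplane[where H = "{z. Re z > Re \<zeta>2 + ?C}" and C = "Re \<zeta>2 + ?C"])
    subgoal by (intro meromorphic_intros mm ex)
    subgoal by (intro meromorphic_intros mm ex)
    subgoal by simp
    subgoal by (rule R1, simp)
    done
  moreover have "\<forall>\<^sub>\<approx>\<zeta>1\<in>UNIV. \<alpha> * G' \<zeta>1 \<zeta>2 b' b + (- \<beta> * exp \<zeta>2) * G \<zeta>1 \<zeta>2 b' b
      = (- \<gamma>) * (P \<zeta>1 \<zeta>2 \<odot> f') b' b + \<delta> * exp \<zeta>2 * (P \<zeta>1 \<zeta>2 \<odot> f) b' b"
    apply (rule meromorphic_eq_halfplane[where H = "{z. Re z > Re \<zeta>2 + ?C}" and C = "Re \<zeta>2 + ?C"])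
    subgoal by (intro meromorphic_intros mm ex)
    subgoal by (intro meromorphic_intros mm ex)
    subgoal by simp
    subgoal by (rule R2, simp)
    done
  \<comment> \<open>The same two relations with the points interchanged: now \<zeta>2 carries the
    left factor, and they hold where Re \<zeta>1 is small.\<close>
  moreover have "\<forall>\<^sub>\<approx>\<zeta>1\<in>UNIV. \<alpha> * (f' \<odot> P \<zeta>2 \<zeta>1) b' b + (- \<beta> * exp \<zeta>2) * (f \<odot> P \<zeta>2 \<zeta>1) b' b
      = (- \<gamma>) * G' \<zeta>2 \<zeta>1 b' b + \<delta> * exp \<zeta>2 * G \<zeta>2 \<zeta>1 b' b"
    apply (rule meromorphic_eq_halfplane[where H = "{z. Re z < Re \<zeta>2 - ?C}" and C = "Re \<zeta>2 - ?C"])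
    subgoal by (intro meromorphic_intros mm ex)
    subgoal by (intro meromorphic_intros mm ex)
    subgoal by simp
    subgoal by (rule R1, simp)
    done
  moreover have "\<forall>\<^sub>\<approx>\<zeta>1\<in>UNIV. \<alpha> * G' \<zeta>2 \<zeta>1 b' b + (- \<beta> * exp \<zeta>1) * G \<zeta>2 \<zeta>1 b' b
      = (- \<gamma>) * (P \<zeta>2 \<zeta>1 \<odot> f') b' b + \<delta> * exp \<zeta>1 * (P \<zeta>2 \<zeta>1 \<odot> f) b' b"
    apply (rule meromorphic_eq_halfplane[where H = "{z. Re z < Re \<zeta>2 - ?C}" and C = "Re \<zeta>2 - ?C"])
    subgoal by (intro meromorphic_intros mm ex)
    subgoal by (intro meromorphic_intros mm ex)
    subgoal by simp
    subgoal by (rule R2, simp)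
    done
  ultimately show ?thesis
    using \<rho>[of \<zeta>2]
  proof eventually_elim
    case (elim \<zeta>1)
    have p: "(g \<odot> P \<zeta>2 \<zeta>1) b' b = \<rho> \<zeta>1 \<zeta>2 * (g \<odot> P \<zeta>1 \<zeta>2) b' b" if "rowfin g" for g
      using elim(5) b by (simp add: rowfin_oprod[OF that] sum_distrib_left mult_ac)
    have p': "(P \<zeta>2 \<zeta>1 \<odot> g) b' b = \<rho> \<zeta>1 \<zeta>2 * (P \<zeta>1 \<zeta>2 \<odot> g) b' b" if "colfin g" for g
      using elim(5) b by (simp add: colfin_oprod[OF that] sum_distrib_left mult_ac)
    note E = elim(1-4)[unfolded p[OF fin(1)] p[OF fin(3)] p'[OF fin(2)] p'[OF fin(4)]]
    \<comment> \<open>The four relations are combined with weights proportional to \<rho> \<alpha>,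
      - \<rho> \<gamma>, - \<alpha> and \<gamma>; then f' P, P f' and both values of G' cancel. The
      quasi-symmetry of P has already turned P(z_2, z_1) into \<rho> P(z_1, z_2).\<close>
    have alg: "\<rho> * \<alpha> * \<beta> * (z1 - z2) * fP + \<rho> * (\<alpha> * \<delta> * z1 - \<beta> * \<gamma> * z2) * g
           - (\<alpha> * \<delta> * z2 - \<beta> * \<gamma> * z1) * c + \<rho> * \<gamma> * \<delta> * (z1 - z2) * pf =
        - (\<alpha> * (\<rho> * (\<alpha> * fP' + (- \<beta> * z1) * fP - ((- \<gamma>) * g' + \<delta> * z1 * g)))
        + \<gamma> * (- \<rho> * (\<alpha> * g' + (- \<beta> * z2) * g - ((- \<gamma>) * pf' + \<delta> * z2 * pf)))
        - \<alpha> * (\<alpha> * (\<rho> * fP') + (- \<beta> * z2) * (\<rho> * fP) - ((- \<gamma>) * c' + \<delta> * z2 * c))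
        + \<gamma> * (\<alpha> * c' + (- \<beta> * z1) * c - ((- \<gamma>) * (\<rho> * pf') + \<delta> * z1 * (\<rho> * pf))))"
      for \<rho> fP fP' g g' pf pf' c c' z1 z2 :: complex
      by (simp add: algebra_simps)
    show ?case
      by (rule trans[OF alg[where fP' = "(f' \<odot> P \<zeta>1 \<zeta>2) b' b" and g' = "G' \<zeta>1 \<zeta>2 b' b"
          and pf' = "(P \<zeta>1 \<zeta>2 \<odot> f') b' b" and c' = "G' \<zeta>2 \<zeta>1 b' b"]]) (simp only: E, simp)
  qed
qed

section \<open>A mode between two vertex operators\<close>

definition vfam :: "complex \<Rightarrow> (complex \<Rightarrow> lin) \<Rightarrow> bool" where
  "vfam h L \<longleftrightarrow> holfam L \<and> (\<forall>\<zeta>. vtx h \<zeta> (L \<zeta>))"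

definition sepmer :: "(complex \<Rightarrow> complex \<Rightarrow> complex) \<Rightarrow> bool" where
  "sepmer c \<longleftrightarrow> (\<forall>\<zeta>2. (\<lambda>\<zeta>1. c \<zeta>1 \<zeta>2) meromorphic_on UNIV) \<and> (\<forall>\<zeta>1. (\<lambda>\<zeta>2. c \<zeta>1 \<zeta>2) meromorphic_on UNIV)"

lemma sepmer_add: "sepmer f \<Longrightarrow> sepmer g \<Longrightarrow> sepmer (\<lambda>x y. f x y + g x y)"
  and sepmer_diff: "sepmer f \<Longrightarrow> sepmer g \<Longrightarrow> sepmer (\<lambda>x y. f x y - g x y)"
  and sepmer_mult: "sepmer f \<Longrightarrow> sepmer g \<Longrightarrow> sepmer (\<lambda>x y. f x y * g x y)"
  and sepmer_divide: "sepmer f \<Longrightarrow> sepmer g \<Longrightarrow> sepmer (\<lambda>x y. f x y / g x y)"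
  and sepmer_uminus: "sepmer f \<Longrightarrow> sepmer (\<lambda>x y. - f x y)"
  and sepmer_power: "sepmer f \<Longrightarrow> sepmer (\<lambda>x y. f x y ^ n)"
  and sepmer_const: "sepmer (\<lambda>x y. l)"
  unfolding sepmer_def by (auto intro!: meromorphic_intros)

lemma sepmer_exp: "sepmer (\<lambda>x y. exp x)" "sepmer (\<lambda>x y. exp y)" "sepmer (\<lambda>x y. exp (- x))" "sepmer (\<lambda>x y. exp (- y))"
  unfolding sepmer_def
  by (auto intro!: analytic_on_imp_meromorphic_on analytic_intros)

lemmas sepmer_intros = sepmer_add sepmer_diff sepmer_mult sepmer_divide sepmer_uminus sepmer_power sepmer_const sepmer_exp

lemma sephol_sepmer: "sephol c \<Longrightarrow> sepmer c"
  unfolding sephol_def sepmer_def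
  by (auto intro!: analytic_on_imp_meromorphic_on simp: analytic_on_open)

lemma sepmer_sum_list: "(\<And>p. p \<in> set xs \<Longrightarrow> sepmer (F p)) \<Longrightarrow> sepmer (\<lambda>x y. \<Sum>p\<leftarrow>xs. F p x y)"
  by (induction xs) (auto intro: sepmer_intros)

lemma sepmer_l:
  assumes xs: "\<forall>(c, d)\<in>set xs. sephol c"
  shows sepmer_lcoef: "sepmer (\<lambda>x y. lcoef xs m x y)"
    and sepmer_lle: "sepmer C \<Longrightarrow> sepmer (\<lambda>x y. lle xs m (C x y) x y)"
    and sepmer_lge: "sepmer C \<Longrightarrow> sepmer (\<lambda>x y. lge xs m (C x y) x y)"
proof -
  have c: "sepmer (fst p)" if "p \<in> set xs" for p using bspec[OF xs that] by (simp add: case_prod_unfold sephol_sepmer)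
  show "sepmer (\<lambda>x y. lcoef xs m x y)"
    unfolding lcoef_def case_prod_unfold
  proof (rule sepmer_sum_list)
    fix p assume "p \<in> set xs"
    then show "sepmer (\<lambda>x y. if snd p = m then fst p x y else 0)"
      by (cases "snd p = m") (simp_all add: c sepmer_const)
  qed
  show "sepmer (\<lambda>x y. lle xs m (C x y) x y)" if C: "sepmer C"
    unfolding lle_def case_prod_unfold
  proof (rule sepmer_sum_list)
    fix p assume "p \<in> set xs"
    then show "sepmer (\<lambda>x y. if snd p \<le> m then fst p x y * C x y ^ nat (m - snd p) else 0)"
      by (cases "snd p \<le> m") (simp_all add: c C sepmer_const sepmer_mult sepmer_power)
  qed
  show "sepmer (\<lambda>x y. lge xs m (C x y) x y)" if C: "sepmer C"
    unfolding lge_def case_prod_unfold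
  proof (rule sepmer_sum_list)
    fix p assume "p \<in> set xs"
    then show "sepmer (\<lambda>x y. if m \<le> snd p then fst p x y * C x y ^ nat (snd p - m) else 0)"
      by (cases "m \<le> snd p") (simp_all add: c C sepmer_const sepmer_mult sepmer_power)
  qed
qed

lemma mero_sepmer: "mero F \<longleftrightarrow> (\<forall>b'\<in>fock. \<forall>b\<in>fock. sepmer (\<lambda>x y. F x y b' b))"
  by (simp add: mero_def sepmer_def)

lemma vfam_sepmer:
  assumes "vfam h L1" "vfam h L3" "b' \<in> fock" "b \<in> fock"
  shows "sepmer (\<lambda>\<zeta>1 \<zeta>2. nexp h (L1 \<zeta>1 + L3 \<zeta>2) b' b)"
proof -
  \<comment> \<open>The product of two operators is the three-operator case with the trivial
    current.\<close>
  have "homog 0 (\<lambda>_. 0)" by (simp add: homog_def)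
  then obtain xs where xs: "\<forall>(c, d)\<in>set xs. sephol c" "(\<lambda>\<zeta>1 \<zeta>2 \<omega>. nexp h (L1 \<zeta>1 + 0 + L3 \<zeta>2) b' b) = lpe xs"
    using lpol_nexp[of L1 L3 0 "\<lambda>_. 0" b' b h] assms unfolding vfam_def lpol_def by auto
  have "sepmer (\<lambda>\<zeta>1 \<zeta>2. lpe xs \<zeta>1 \<zeta>2 0)"
    unfolding lpe_def case_prod_unfold
    by (intro sepmer_sum_list sepmer_mult sepmer_const) (use xs(1) in \<open>force intro: sephol_sepmer\<close>)
  then show ?thesis using xs(2)[symmetric] by simp
qed

lemma contd_PP:
  assumes L: "vfam h L1" "vfam h L3" and k: "sepmer \<kappa>"
    and c: "\<And>\<zeta>1 \<zeta>2. Re \<zeta>1 > Re \<zeta>2 + 2 * majH h \<Longrightarrow> contr h (L1 \<zeta>1) (L3 \<zeta>2) = \<kappa> \<zeta>1 \<zeta>2"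
  shows "contd (\<lambda>\<zeta>1 \<zeta>2. nexp h (L1 \<zeta>1) \<odot> nexp h (L3 \<zeta>2)) (\<lambda>\<zeta>1 \<zeta>2. oscale (\<kappa> \<zeta>1 \<zeta>2) (nexp h (L1 \<zeta>1 + L3 \<zeta>2)))"
  unfolding contd_def
proof (intro conjI exI[of _ "2 * majH h"] allI impI)
  show "mero (\<lambda>\<zeta>1 \<zeta>2. oscale (\<kappa> \<zeta>1 \<zeta>2) (nexp h (L1 \<zeta>1 + L3 \<zeta>2)))"
    unfolding mero_sepmer oscale_def using L k by (auto intro!: sepmer_mult vfam_sepmer)
  fix \<zeta>1 \<zeta>2 assume R: "Re \<zeta>1 > Re \<zeta>2 + 2 * majH h"
  show "eqf (nexp h (L1 \<zeta>1) \<odot> nexp h (L3 \<zeta>2)) (oscale (\<kappa> \<zeta>1 \<zeta>2) (nexp h (L1 \<zeta>1 + L3 \<zeta>2)))"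
    unfolding eqf_def oprod_def oscale_def c[OF R, symmetric]
    using L R by (auto simp: vfam_def intro!: infsumI vtx_nexp_mult)
qed

lemma norm_exp_less: "Re z < 0 \<Longrightarrow> norm (exp z) < 1"
  by simp

text \<open>Here \<open>x = c w / z\<^sub>1\<close> and \<open>y = c' z\<^sub>2 / w\<close>; the product \<open>x y\<close> does not depend on \<open>w\<close>, which allows a partial
  fraction decomposition of the kernel in \<open>w\<close>.\<close>

lemma contd_G:
  fixes p q :: complex
  assumes L: "vfam h L1" "vfam h L3" and X: "cur h \<epsilon> X" and k: "sepmer \<kappa>" and bs: "sepmer (\<lambda>_. b0)" "sepmer (\<lambda>_. b1)"
    and c: "\<And>\<zeta>1 \<zeta>2. Re \<zeta>1 > Re \<zeta>2 + 2 * majH h \<Longrightarrow> contr h (L1 \<zeta>1) (L3 \<zeta>2) = \<kappa> \<zeta>1 \<zeta>2"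
    and cL: "\<And>\<zeta> \<omega>. Re \<zeta> > Re \<omega> + 2 * majH h \<Longrightarrow> contr h (L1 \<zeta>) (X \<omega>) = a0 + a1 / (1 - exp (p - \<zeta>) * exp \<omega>)"
    and cR: "\<And>\<zeta> \<omega>. Re \<omega> > Re \<zeta> + 2 * majH h \<Longrightarrow> contr h (X \<omega>) (L3 \<zeta>) = b0 \<zeta> + b1 \<zeta> / (1 - exp (q + \<zeta>) * exp (- \<omega>))"
  shows "\<exists>G. contd (\<lambda>\<zeta>1 \<zeta>2. nexp h (L1 \<zeta>1) \<odot> (md h \<epsilon> X m \<odot> nexp h (L3 \<zeta>2))) G \<and>
    (\<forall>b'\<in>fock. \<forall>b\<in>fock. \<exists>xs. (\<forall>(c, d)\<in>set xs. sephol c) \<and> (\<lambda>\<zeta>1 \<zeta>2 \<omega>. nexp h (L1 \<zeta>1 + X \<omega> + L3 \<zeta>2) b' b) = lpe xs \<and>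
      (\<forall>\<zeta>1 \<zeta>2. G \<zeta>1 \<zeta>2 b' b = \<kappa> \<zeta>1 \<zeta>2 * (
         (a0 * b0 \<zeta>2 - a1 * b1 \<zeta>2 / (1 - exp (p + q) * exp \<zeta>2 / exp \<zeta>1)) * lcoef xs m \<zeta>1 \<zeta>2
       + (a1 * b0 \<zeta>2 + a1 * b1 \<zeta>2 / (1 - exp (p + q) * exp \<zeta>2 / exp \<zeta>1)) * lle xs m (exp (p - \<zeta>1)) \<zeta>1 \<zeta>2
       + (a0 * b1 \<zeta>2 + a1 * b1 \<zeta>2 / (1 - exp (p + q) * exp \<zeta>2 / exp \<zeta>1)) * lge xs m (exp (q + \<zeta>2)) \<zeta>1 \<zeta>2)))"
proof -
  have h: "homog \<epsilon> X" using X by (simp add: cur_def)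
  have hf: "holfam L1" "holfam L3" and v1: "\<And>\<zeta>. vtx h \<zeta> (L1 \<zeta>)" and v3: "\<And>\<zeta>. vtx h \<zeta> (L3 \<zeta>)" using L by (auto simp: vfam_def)
  define xs where "xs b' b = (SOME xs. (\<forall>(c, d)\<in>set xs. sephol c) \<and> (\<lambda>\<zeta>1 \<zeta>2 \<omega>. nexp h (L1 \<zeta>1 + X \<omega> + L3 \<zeta>2) b' b) = lpe xs)" for b' b
  have xs: "\<forall>(c, d)\<in>set (xs b' b). sephol c" "(\<lambda>\<zeta>1 \<zeta>2 \<omega>. nexp h (L1 \<zeta>1 + X \<omega> + L3 \<zeta>2) b' b) = lpe (xs b' b)"
    if "b' \<in> fock" "b \<in> fock" for b' b
    using someI_ex[OF lpol_nexp[OF hf h that, of h, unfolded lpol_def]] unfolding xs_def[of b' b] by blast+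
  define u where "u = (\<lambda>\<zeta>1 \<zeta>2. exp (p + q) * exp \<zeta>2 / exp \<zeta>1)"
  define G where "G = (\<lambda>\<zeta>1 \<zeta>2 b' b. \<kappa> \<zeta>1 \<zeta>2 * (
         (a0 * b0 \<zeta>2 - a1 * b1 \<zeta>2 / (1 - u \<zeta>1 \<zeta>2)) * lcoef (xs b' b) m \<zeta>1 \<zeta>2
       + (a1 * b0 \<zeta>2 + a1 * b1 \<zeta>2 / (1 - u \<zeta>1 \<zeta>2)) * lle (xs b' b) m (exp (p - \<zeta>1)) \<zeta>1 \<zeta>2
       + (a0 * b1 \<zeta>2 + a1 * b1 \<zeta>2 / (1 - u \<zeta>1 \<zeta>2)) * lge (xs b' b) m (exp (q + \<zeta>2)) \<zeta>1 \<zeta>2))"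
  have "contd (\<lambda>\<zeta>1 \<zeta>2. nexp h (L1 \<zeta>1) \<odot> (md h \<epsilon> X m \<odot> nexp h (L3 \<zeta>2))) G"
    unfolding contd_def
  proof (intro conjI exI[of _ "4 * majH h + 2 * norm p + 2 * norm q + 2"] allI impI)
    have "sepmer (\<lambda>x y. exp p * exp (- x))" "sepmer (\<lambda>x y. exp q * exp y)" by (intro sepmer_intros)+
    then have e: "sepmer (\<lambda>x y. exp (p - x))" "sepmer (\<lambda>x y. exp (q + y))" by (simp_all add: exp_add exp_diff exp_minus divide_inverse)
    have su: "sepmer u" unfolding u_def by (intro sepmer_intros)
    show "mero G"
      unfolding mero_sepmer
    proof (intro ballI)
      fix b' b assume b: "b' \<in> fock" "b \<in> fock"
      have "sepmer (\<lambda>\<zeta>1 \<zeta>2. \<kappa> \<zeta>1 \<zeta>2 * (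
         (a0 * b0 \<zeta>2 - a1 * b1 \<zeta>2 / (1 - u \<zeta>1 \<zeta>2)) * lcoef (xs b' b) m \<zeta>1 \<zeta>2
       + (a1 * b0 \<zeta>2 + a1 * b1 \<zeta>2 / (1 - u \<zeta>1 \<zeta>2)) * lle (xs b' b) m (exp (p - \<zeta>1)) \<zeta>1 \<zeta>2
       + (a0 * b1 \<zeta>2 + a1 * b1 \<zeta>2 / (1 - u \<zeta>1 \<zeta>2)) * lge (xs b' b) m (exp (q + \<zeta>2)) \<zeta>1 \<zeta>2))"
        using sepmer_lcoef[OF xs(1)[OF b]] sepmer_lle[OF xs(1)[OF b] e(1)] sepmer_lge[OF xs(1)[OF b] e(2)] k bs su
        by (intro sepmer_mult sepmer_add sepmer_diff sepmer_divide sepmer_const) assumption+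
      then show "sepmer (\<lambda>x y. G x y b' b)" by (simp only: G_def)
    qed
    fix \<zeta>1 \<zeta>2 assume R: "Re \<zeta>1 > Re \<zeta>2 + (4 * majH h + 2 * norm p + 2 * norm q + 2)"
    \<comment> \<open>The circle must respect the separation by 2 majH and both poles: |y| < 1
      forces \<rho> above Re (q + \<zeta>2), and |x| < 1 keeps it below Re (\<zeta>1 - p). The lower
      bound on Re \<zeta>1 - Re \<zeta>2 leaves room for this.\<close>
    define \<rho> where "\<rho> = Re \<zeta>2 + 2 * majH h + norm p + norm q + 1"
    have H: "0 \<le> majH h" "0 \<le> norm p" "0 \<le> norm q" by (simp_all add: majH_nonneg)
    have Rp: "\<bar>Re p\<bar> \<le> norm p" "\<bar>Re q\<bar> \<le> norm q" by (rule abs_Re_le_cmod)+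
    have r: "Re \<zeta>1 > \<rho> + 2 * majH h" "\<rho> > Re \<zeta>2 + 2 * majH h" "Re \<zeta>1 > Re \<zeta>2 + 2 * majH h"
      using R H unfolding \<rho>_def by linarith+
    show "eqf (nexp h (L1 \<zeta>1) \<odot> (md h \<epsilon> X m \<odot> nexp h (L3 \<zeta>2))) (G \<zeta>1 \<zeta>2)"
      unfolding eqf_def
    proof (intro ballI)
      fix b' b assume b: "b' \<in> fock" "b \<in> fock"
      have N: "nexp h (L1 \<zeta>1 + X \<omega> + L3 \<zeta>2) b' b = lpe (xs b' b) \<zeta>1 \<zeta>2 \<omega>" for \<omega>
        using fun_cong[OF fun_cong[OF fun_cong[OF xs(2)[OF b]]]] by simp
      let ?u = "u \<zeta>1 \<zeta>2"
      let ?q0 = "a0 * b0 \<zeta>2 - a1 * b1 \<zeta>2 / (1 - ?u)" and ?q1 = "a1 * b0 \<zeta>2 + a1 * b1 \<zeta>2 / (1 - ?u)"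
        and ?q2 = "a0 * b1 \<zeta>2 + a1 * b1 \<zeta>2 / (1 - ?u)"
      have u1: "1 - ?u \<noteq> 0"
      proof -
        have "?u = exp (p + q + \<zeta>2 - \<zeta>1)" by (simp add: u_def exp_add exp_diff)
        then have "norm ?u < 1" using R Rp H by simp
        then show ?thesis by (rule one_minus_neq_0)
      qed
      have "(nexp h (L1 \<zeta>1) \<odot> (md h \<epsilon> X m \<odot> nexp h (L3 \<zeta>2))) b' b =
        cint m \<rho> (\<lambda>\<omega>. (contr h (L1 \<zeta>1) (X \<omega>) * (contr h (L1 \<zeta>1) (L3 \<zeta>2) * contr h (X \<omega>) (L3 \<zeta>2))) * lpe (xs b' b) \<zeta>1 \<zeta>2 \<omega>)"
        using md_sandwich[OF X v1 v3 r(1,2) b] by (simp add: N)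
      also have "\<dots> = cint m \<rho> (\<lambda>\<omega>. (\<kappa> \<zeta>1 \<zeta>2 * ?q0 + \<kappa> \<zeta>1 \<zeta>2 * ?q1 / (1 - exp (p - \<zeta>1) * exp \<omega>)
          + \<kappa> \<zeta>1 \<zeta>2 * ?q2 / (1 - exp (q + \<zeta>2) * exp (- \<omega>))) * lpe (xs b' b) \<zeta>1 \<zeta>2 \<omega>)"
      proof (rule cint_cong)
        fix \<omega> :: complex assume w: "Re \<omega> = \<rho>"
        let ?x = "exp (p - \<zeta>1) * exp \<omega>" and ?y = "exp (q + \<zeta>2) * exp (- \<omega>)"
        have xy: "?x * ?y = ?u" by (simp add: u_def exp_add exp_diff exp_minus)
        have "?x = exp (p - \<zeta>1 + \<omega>)" "?y = exp (q + \<zeta>2 - \<omega>)" by (simp_all add: exp_add exp_diff exp_minus divide_inverse)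
        then have "norm ?x < 1" "norm ?y < 1" using w R Rp H by (simp_all add: \<rho>_def)
        then have ne: "1 - ?x \<noteq> 0" "1 - ?y \<noteq> 0" by (metis one_minus_neq_0)+
        \<comment> \<open>It rests on 1 / ((1 - x)(1 - y)) = (1 / (1 - x) + 1 / (1 - y) - 1) / (1 -
          x y), where x y is independent of w.\<close>
        have alg: "(a0 + a1 / (1 - x)) * (k * (c0 + c1 / (1 - y))) =
            k * (a0 * c0 - a1 * c1 / (1 - x * y)) + k * (a1 * c0 + a1 * c1 / (1 - x * y)) / (1 - x)
             + k * (a0 * c1 + a1 * c1 / (1 - x * y)) / (1 - y)"
          if "1 - x \<noteq> 0" "1 - y \<noteq> 0" "1 - x * y \<noteq> 0" for x y k c0 c1 :: complex
          using that by (simp add: divide_simps) (simp add: algebra_simps)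
        have "contr h (L1 \<zeta>1) (X \<omega>) * (contr h (L1 \<zeta>1) (L3 \<zeta>2) * contr h (X \<omega>) (L3 \<zeta>2))
          = (a0 + a1 / (1 - ?x)) * (\<kappa> \<zeta>1 \<zeta>2 * (b0 \<zeta>2 + b1 \<zeta>2 / (1 - ?y)))"
          using w r by (simp add: c cL cR)
        also have "\<dots> = \<kappa> \<zeta>1 \<zeta>2 * ?q0 + \<kappa> \<zeta>1 \<zeta>2 * ?q1 / (1 - ?x) + \<kappa> \<zeta>1 \<zeta>2 * ?q2 / (1 - ?y)"
          using alg[OF ne] u1 unfolding xy by blast
        finally show "contr h (L1 \<zeta>1) (X \<omega>) * (contr h (L1 \<zeta>1) (L3 \<zeta>2) * contr h (X \<omega>) (L3 \<zeta>2)) * lpe (xs b' b) \<zeta>1 \<zeta>2 \<omega>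
           = (\<kappa> \<zeta>1 \<zeta>2 * ?q0 + \<kappa> \<zeta>1 \<zeta>2 * ?q1 / (1 - ?x) + \<kappa> \<zeta>1 \<zeta>2 * ?q2 / (1 - ?y)) * lpe (xs b' b) \<zeta>1 \<zeta>2 \<omega>"
          by simp
      qed
      also have "\<dots> = \<kappa> \<zeta>1 \<zeta>2 * ?q0 * lcoef (xs b' b) m \<zeta>1 \<zeta>2 + \<kappa> \<zeta>1 \<zeta>2 * ?q1 * lle (xs b' b) m (exp (p - \<zeta>1)) \<zeta>1 \<zeta>2
         + \<kappa> \<zeta>1 \<zeta>2 * ?q2 * lge (xs b' b) m (exp (q + \<zeta>2)) \<zeta>1 \<zeta>2"
      proof (rule cint_kernel)
        show "norm (exp (p - \<zeta>1) * exp (of_real \<rho>)) < 1" "norm (exp (q + \<zeta>2) * exp (- of_real \<rho>)) < 1"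
          unfolding exp_add[symmetric] using R Rp H by (auto intro!: norm_exp_less simp: \<rho>_def)
      qed
      also have "\<dots> = G \<zeta>1 \<zeta>2 b' b" by (simp add: G_def algebra_simps)
      finally show "(nexp h (L1 \<zeta>1) \<odot> (md h \<epsilon> X m \<odot> nexp h (L3 \<zeta>2))) b' b = G \<zeta>1 \<zeta>2 b' b" .
    qed
  qed
  then show ?thesis
    by (intro exI[of _ G] conjI ballI, assumption) (rule_tac x = "xs b' b" in exI, simp add: xs G_def u_def)
qed

lemma lpol_single:
  assumes "homog \<epsilon> X" "b' \<in> fock" "b \<in> fock"
  shows "\<exists>xs. (\<lambda>\<omega>. nexp h (L + X \<omega>) b' b) = lpe xs 0 0"
proof -
  have "holfam (\<lambda>_. L)" "holfam (\<lambda>_. 0)" by (auto simp: holfam_def)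
  from lpol_nexp[OF this assms, of h] obtain xs where "(\<lambda>\<zeta>1 \<zeta>2 \<omega>. nexp h (L + X \<omega> + 0) b' b) = lpe xs"
    unfolding lpol_def by blast
  then have "(\<lambda>\<omega>. nexp h (L + X \<omega>) b' b) = lpe xs 0 0" by (simp add: fun_eq_iff)
  then show ?thesis by blast
qed

text \<open>In each order a linear polynomial in w clears the pole of the contraction, and both
  cleared contractions are the same polynomial c0 + c1 w. After multiplication by the Laurent
  polynomial nothing depends on the circle any more. Multiplication by w lowers the index of a mode
  by one, which is why two adjacent modes appear.\<close>

lemma exchange:
  assumes X: "cur h \<epsilon> X" and S: "vtx h \<zeta> L"
    and A: "\<And>\<omega>. Re \<zeta> > Re \<omega> + 2 * majH h \<Longrightarrow> contr h L (X \<omega>) * (- \<gamma> * exp \<omega> + \<delta>) = c0 + c1 * exp \<omega> \<and> - \<gamma> * exp \<omega> + \<delta> \<noteq> 0"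
    and B: "\<And>\<omega>. Re \<omega> > Re \<zeta> + 2 * majH h \<Longrightarrow> contr h (X \<omega>) L * (\<alpha> * exp \<omega> + - \<beta>) = c0 + c1 * exp \<omega> \<and> \<alpha> * exp \<omega> + - \<beta> \<noteq> 0"
  shows "eqf (oscale \<alpha> (md h \<epsilon> X (m - 1) \<odot> nexp h L) + oscale (- \<beta>) (md h \<epsilon> X m \<odot> nexp h L))
             (oscale (- \<gamma>) (nexp h L \<odot> md h \<epsilon> X (m - 1)) + oscale \<delta> (nexp h L \<odot> md h \<epsilon> X m))"
  unfolding eqf_def
proof (intro ballI)
  fix b' b assume b: "b' \<in> fock" "b \<in> fock"
  have h: "homog \<epsilon> X" and v: "\<And>\<omega>. vtx h \<omega> (X \<omega>)" using X by (auto simp: cur_def)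
  obtain xs where xs: "(\<lambda>\<omega>. nexp h (L + X \<omega>) b' b) = lpe xs 0 0" using lpol_single[OF h b, of h L] by blast
  define \<rho>1 \<rho>2 where "\<rho>1 = Re \<zeta> - 2 * majH h - 1" and "\<rho>2 = Re \<zeta> + 2 * majH h + 1"
  have comb: "x * cint (m - 1) \<rho> F + y * cint m \<rho> F = c0 * lcoef xs m 0 0 + c1 * lcoef xs (m - 1) 0 0"
    if F: "\<And>\<omega>. Re \<omega> = \<rho> \<Longrightarrow> F \<omega> = K \<omega> * lpe xs 0 0 \<omega>"
      and K: "\<And>\<omega>. Re \<omega> = \<rho> \<Longrightarrow> K \<omega> * (x * exp \<omega> + y) = c0 + c1 * exp \<omega> \<and> x * exp \<omega> + y \<noteq> 0" for x y \<rho> F K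
  proof -
    \<comment> \<open>The hypotheses determine the contraction only through its product with the
      linear factor; rewritten as a quotient it is visibly continuous on the circle.\<close>
    let ?F = "\<lambda>\<omega>. (c0 + c1 * exp \<omega>) / (x * exp \<omega> + y) * lpe xs 0 0 \<omega>"
    have FF: "cint m' \<rho> F = cint m' \<rho> ?F" for m'
    proof (rule cint_cong)
      fix \<omega> assume w: "Re \<omega> = \<rho>"
      have "K \<omega> = (c0 + c1 * exp \<omega>) / (x * exp \<omega> + y)" using K[OF w] by (metis nonzero_eq_divide_eq)
      then show "F \<omega> = ?F \<omega>" using F[OF w] by simp
    qed
    have c: "continuous_on {\<omega>. Re \<omega> = \<rho>} ?F" using K by (intro continuous_intros continuous_lpe) auto
    have c': "continuous_on {\<omega>. Re \<omega> = \<rho>} (\<lambda>\<omega>. x * (exp \<omega> * ?F \<omega>))" "continuous_on {\<omega>. Re \<omega> = \<rho>} (\<lambda>\<omega>. y * ?F \<omega>)"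
      by (intro continuous_intros c)+
    have c'': "continuous_on {\<omega>. Re \<omega> = \<rho>} (\<lambda>\<omega>. c0 * lpe xs 0 0 \<omega>)" "continuous_on {\<omega>. Re \<omega> = \<rho>} (\<lambda>\<omega>. c1 * (exp \<omega> * lpe xs 0 0 \<omega>))"
      by (intro continuous_intros continuous_lpe)+
    have "x * cint (m - 1) \<rho> ?F + y * cint m \<rho> ?F = cint m \<rho> (\<lambda>\<omega>. x * (exp \<omega> * ?F \<omega>) + y * ?F \<omega>)"
      by (simp only: cint_add[OF c'] cint_cmult cint_exp)
    also have "\<dots> = cint m \<rho> (\<lambda>\<omega>. c0 * lpe xs 0 0 \<omega> + c1 * (exp \<omega> * lpe xs 0 0 \<omega>))"
    proof (rule cint_cong)
      fix \<omega> assume w: "Re \<omega> = \<rho>"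
      have alg: "x * (E * (e / d * N)) + y * (e / d * N) = e * N" if "x * E + y = d" "d \<noteq> 0" for E e d N :: complex
      proof -
        have "x * (E * (e / d * N)) + y * (e / d * N) = (x * E + y) / d * e * N" by (simp add: add_divide_distrib algebra_simps)
        then show ?thesis using that by simp
      qed
      have "x * (exp \<omega> * ?F \<omega>) + y * ?F \<omega> = (c0 + c1 * exp \<omega>) * lpe xs 0 0 \<omega>"
        by (rule alg[OF refl]) (use K[OF w] in blast)
      then show "x * (exp \<omega> * ?F \<omega>) + y * ?F \<omega> = c0 * lpe xs 0 0 \<omega> + c1 * (exp \<omega> * lpe xs 0 0 \<omega>)"
        by (simp add: distrib_right)
    qed
    also have "\<dots> = c0 * lcoef xs m 0 0 + c1 * lcoef xs (m - 1) 0 0"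
      by (simp only: cint_add[OF c''] cint_cmult cint_exp cint_lpe)
    finally show ?thesis unfolding FF .
  qed
  have N: "nexp h (L + X \<omega>) b' b = lpe xs 0 0 \<omega>" for \<omega> using fun_cong[OF xs] by simp
  have "\<alpha> * (md h \<epsilon> X (m - 1) \<odot> nexp h L) b' b + - \<beta> * (md h \<epsilon> X m \<odot> nexp h L) b' b
     = c0 * lcoef xs m 0 0 + c1 * lcoef xs (m - 1) 0 0"
    unfolding md_left[OF X S less_add_one[of "Re \<zeta> + 2 * majH h"] b]
  proof (rule comb[where K = "\<lambda>\<omega>. contr h (X \<omega>) L"])
    show "contr h (X \<omega>) L * (\<alpha> * exp \<omega> + - \<beta>) = c0 + c1 * exp \<omega> \<and> \<alpha> * exp \<omega> + - \<beta> \<noteq> 0"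
      if "Re \<omega> = Re \<zeta> + 2 * majH h + 1" for \<omega>
      by (rule B) (use that in simp)
  qed (simp only: N)
  moreover have "- \<gamma> * (nexp h L \<odot> md h \<epsilon> X (m - 1)) b' b + \<delta> * (nexp h L \<odot> md h \<epsilon> X m) b' b
     = c0 * lcoef xs m 0 0 + c1 * lcoef xs (m - 1) 0 0"
  proof -
    have r: "Re \<zeta> > (Re \<zeta> - 2 * majH h - 1) + 2 * majH h" by simp
    show ?thesis
      unfolding md_right[OF X S r b]
    proof (rule comb[where K = "\<lambda>\<omega>. contr h L (X \<omega>)"])
      show "contr h L (X \<omega>) * (- \<gamma> * exp \<omega> + \<delta>) = c0 + c1 * exp \<omega> \<and> - \<gamma> * exp \<omega> + \<delta> \<noteq> 0"
        if "Re \<omega> = Re \<zeta> - 2 * majH h - 1" for \<omega>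
        by (rule A) (use that in simp)
    qed (simp only: N)
  qed
  ultimately show "(oscale \<alpha> (md h \<epsilon> X (m - 1) \<odot> nexp h L) + oscale (- \<beta>) (md h \<epsilon> X m \<odot> nexp h L)) b' b =
      (oscale (- \<gamma>) (nexp h L \<odot> md h \<epsilon> X (m - 1)) + oscale \<delta> (nexp h L \<odot> md h \<epsilon> X m)) b' b"
    by (simp add: oscale_def)
qed

text \<open>The formal delta function at w = exp \<eta>: its two halves are the expansions on either
  side of the pole and overlap in one term, which is subtracted. Every monomial is then simply
  evaluated at \<eta>.\<close>

lemma delta_lpe: "lle xs m (exp (- \<eta>)) x y + lge xs m (exp \<eta>) x y - lcoef xs m x y = exp (- (of_int m * \<eta>)) * lpe xs x y \<eta>"
proof -
  have one: "(if d \<le> m then c * exp (- \<eta>) ^ nat (m - d) else 0) + (if d \<ge> m then c * exp \<eta> ^ nat (d - m) else 0)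
      - (if d = m then c else 0) = exp (- (of_int m * \<eta>)) * (c * exp (of_int d * \<eta>))" for c d
  proof -
    have e: "exp (- (of_int m * \<eta>)) * (c * exp (of_int d * \<eta>)) = c * exp (of_int (d - m) * \<eta>)"
      by (simp add: left_diff_distrib exp_diff exp_minus divide_inverse)
    consider "d < m" | "d = m" | "d > m" by linarith
    then show ?thesis
    proof cases
      case 1
      then show ?thesis unfolding e by (simp add: exp_of_nat_mult[symmetric] algebra_simps)
    next
      case 2
      then show ?thesis unfolding e by simp
    next
      case 3
      then show ?thesis unfolding e by (simp add: exp_of_nat_mult[symmetric] algebra_simps)
    qed
  qed
  have "lle xs m (exp (- \<eta>)) x y + lge xs m (exp \<eta>) x y - lcoef xs m x y =
      (\<Sum>(c, d)\<leftarrow>xs. (if d \<le> m then c x y * exp (- \<eta>) ^ nat (m - d) else 0) + (if d \<ge> m then c x y * exp \<eta> ^ nat (d - m) else 0)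
      - (if d = m then c x y else 0))"
    unfolding lle_def lge_def lcoef_def case_prod_unfold sum_list_addf sum_list_subtractf ..
  also have "\<dots> = exp (- (of_int m * \<eta>)) * lpe xs x y \<eta>"
    unfolding one lpe_def case_prod_unfold sum_list_const_mult ..
  finally show ?thesis .
qed

text \<open>The two products of a current and a vertex operator with a common simple pole at \<open>w = exp \<eta>\<close> are expanded on
  different sides of it, so that their sum is a delta function supported there.\<close>

lemma anticomm_delta:
  assumes X: "cur h \<epsilon> X" and S: "vtx h \<zeta> L" and n: "norm (\<eta> - \<zeta>) \<le> 2 * norm h"
    and A: "\<And>\<omega>. Re \<zeta> > Re \<omega> + 2 * majH h \<Longrightarrow> contr h L (X \<omega>) = a0 + a1 / (1 - exp (\<omega> - \<eta>))"
    and B: "\<And>\<omega>. Re \<omega> > Re \<zeta> + 2 * majH h \<Longrightarrow> contr h (X \<omega>) L = - a1 - a0 + a1 / (1 - exp (\<eta> - \<omega>))"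
  shows "eqf (md h \<epsilon> X m \<odot> nexp h L + nexp h L \<odot> md h \<epsilon> X m)
     (oscale (a1 * exp (- (of_int m * \<eta>))) (nexp h (L + X \<eta>)))"
  unfolding eqf_def
proof (intro ballI)
  fix b' b assume b: "b' \<in> fock" "b \<in> fock"
  have h: "homog \<epsilon> X" and v: "\<And>\<omega>. vtx h \<omega> (X \<omega>)" using X by (auto simp: cur_def)
  obtain xs where xs: "(\<lambda>\<omega>. nexp h (L + X \<omega>) b' b) = lpe xs 0 0" using lpol_single[OF h b, of h L] by blast
  have N: "nexp h (L + X \<omega>) b' b = lpe xs 0 0 \<omega>" for \<omega> using fun_cong[OF xs] by simp
  have Re: "\<bar>Re \<eta> - Re \<zeta>\<bar> \<le> majH h"
    using abs_Re_le_cmod[of "\<eta> - \<zeta>"] n norm_ge_zero[of h] unfolding majH_def by simp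
  have H: "0 \<le> majH h" by (rule majH_nonneg)
  have z: "norm (0 * exp (of_real \<rho>) :: complex) < 1" "norm (0 * exp (- of_real \<rho>) :: complex) < 1" for \<rho> by simp_all
  define \<rho>2 where "\<rho>2 = Re \<zeta> + 2 * majH h + 1"
  have r2: "\<rho>2 > Re \<zeta> + 2 * majH h" by (simp add: \<rho>2_def)
  have n2: "norm (exp \<eta> * exp (- of_real \<rho>2)) < 1"
    unfolding exp_add[symmetric] using Re H by (intro norm_exp_less) (simp add: \<rho>2_def)
  have "(md h \<epsilon> X m \<odot> nexp h L) b' b = cint m \<rho>2 (\<lambda>\<omega>. (- a1 - a0 + 0 / (1 - 0 * exp \<omega>) + a1 / (1 - exp \<eta> * exp (- \<omega>))) * lpe xs 0 0 \<omega>)"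
    unfolding md_left[OF X S r2 b]
    by (rule cint_cong) (use r2 in \<open>simp add: B N exp_diff exp_minus divide_inverse\<close>)
  also have "\<dots> = (- a1 - a0) * lcoef xs m 0 0 + a1 * lge xs m (exp \<eta>) 0 0"
    unfolding cint_kernel[OF z(1) n2] by simp
  finally have 1: "(md h \<epsilon> X m \<odot> nexp h L) b' b = (- a1 - a0) * lcoef xs m 0 0 + a1 * lge xs m (exp \<eta>) 0 0" .
  define \<rho>1 where "\<rho>1 = Re \<zeta> - 2 * majH h - 1"
  have r1: "Re \<zeta> > \<rho>1 + 2 * majH h" by (simp add: \<rho>1_def)
  have n1: "norm (exp (- \<eta>) * exp (of_real \<rho>1)) < 1"
    unfolding exp_add[symmetric] using Re H by (intro norm_exp_less) (simp add: \<rho>1_def)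
  have "(nexp h L \<odot> md h \<epsilon> X m) b' b = cint m \<rho>1 (\<lambda>\<omega>. (a0 + a1 / (1 - exp (- \<eta>) * exp \<omega>) + 0 / (1 - 0 * exp (- \<omega>))) * lpe xs 0 0 \<omega>)"
    unfolding md_right[OF X S r1 b]
    by (rule cint_cong) (use r1 in \<open>simp add: A N exp_diff exp_minus divide_inverse mult.commute\<close>)
  also have "\<dots> = a0 * lcoef xs m 0 0 + a1 * lle xs m (exp (- \<eta>)) 0 0"
    unfolding cint_kernel[OF n1 z(2)] by simp
  finally have 2: "(nexp h L \<odot> md h \<epsilon> X m) b' b = a0 * lcoef xs m 0 0 + a1 * lle xs m (exp (- \<eta>)) 0 0" .
  have "(md h \<epsilon> X m \<odot> nexp h L) b' b + (nexp h L \<odot> md h \<epsilon> X m) b' b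
     = a1 * (lle xs m (exp (- \<eta>)) 0 0 + lge xs m (exp \<eta>) 0 0 - lcoef xs m 0 0)"
    unfolding 1 2 by (simp add: algebra_simps)
  then show "(md h \<epsilon> X m \<odot> nexp h L + nexp h L \<odot> md h \<epsilon> X m) b' b = oscale (a1 * exp (- (of_int m * \<eta>))) (nexp h (L + X \<eta>)) b' b"
    unfolding delta_lpe by (simp add: oscale_def N)
qed

text \<open>Against an operator with finite rows the product with the current is a finite sum, so no
  region has to be respected and the unit circle serves for all modes.\<close>

lemma md_cint_right:
  assumes X: "homog \<epsilon> X" and f: "rowfin f" and b: "b' \<in> fock" "b \<in> fock"
  shows "(f \<odot> md h \<epsilon> X m) b' b = cint m 0 (\<lambda>\<zeta>. (f \<odot> nexp h (X \<zeta>)) b' b)"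
proof -
  let ?F = "{k. k \<in> fock \<and> f b' k \<noteq> 0}"
  have fin: "finite ?F" using f b by (simp add: rowfin_def)
  have "((\<lambda>k. if deg \<epsilon> k b = m then f b' k * nexp h (X 0) k b else 0) has_sum cint m 0 (\<lambda>\<zeta>. (f \<odot> nexp h (X \<zeta>)) b' b)) ?F"
  proof (rule has_sum_cint)
    fix \<omega>
    show "((\<lambda>k. f b' k * nexp h (X 0) k b * exp (of_int (deg \<epsilon> k b) * \<omega>)) has_sum (f \<odot> nexp h (X \<omega>)) b' b) ?F"
      unfolding rowfin_oprod[OF f b(1)]
      by (rule has_sum_finiteI[OF fin], rule sum.cong) (use b in \<open>auto simp: nexp_homog[OF X, of _ _ h \<omega>]\<close>)
  qed (use fin in auto)
  then have "cint m 0 (\<lambda>\<zeta>. (f \<odot> nexp h (X \<zeta>)) b' b) = (\<Sum>k\<in>?F. if deg \<epsilon> k b = m then f b' k * nexp h (X 0) k b else 0)"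
    by (rule has_sum_unique[OF _ has_sum_finite[OF fin]])
  also have "\<dots> = (f \<odot> md h \<epsilon> X m) b' b"
    unfolding rowfin_oprod[OF f b(1)] by (intro sum.cong) (auto simp: md_def)
  finally show ?thesis ..
qed

lemma md_cint_left:
  assumes X: "homog \<epsilon> X" and f: "colfin f" and b: "b' \<in> fock" "b \<in> fock"
  shows "(md h \<epsilon> X m \<odot> f) b' b = cint m 0 (\<lambda>\<zeta>. (nexp h (X \<zeta>) \<odot> f) b' b)"
proof -
  let ?F = "{k. k \<in> fock \<and> f k b \<noteq> 0}"
  have fin: "finite ?F" using f b by (simp add: colfin_def)
  have "((\<lambda>k. if deg \<epsilon> b' k = m then nexp h (X 0) b' k * f k b else 0) has_sum cint m 0 (\<lambda>\<zeta>. (nexp h (X \<zeta>) \<odot> f) b' b)) ?F"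
  proof (rule has_sum_cint)
    fix \<omega>
    show "((\<lambda>k. nexp h (X 0) b' k * f k b * exp (of_int (deg \<epsilon> b' k) * \<omega>)) has_sum (nexp h (X \<omega>) \<odot> f) b' b) ?F"
      unfolding colfin_oprod[OF f b(2)]
      by (rule has_sum_finiteI[OF fin], rule sum.cong) (use b in \<open>auto simp: nexp_homog[OF X, of _ _ h \<omega>]\<close>)
  qed (use fin in auto)
  then have "cint m 0 (\<lambda>\<zeta>. (nexp h (X \<zeta>) \<odot> f) b' b) = (\<Sum>k\<in>?F. if deg \<epsilon> b' k = m then nexp h (X 0) b' k * f k b else 0)"
    by (rule has_sum_unique[OF _ has_sum_finite[OF fin]])
  also have "\<dots> = (md h \<epsilon> X m \<odot> f) b' b"
    unfolding colfin_oprod[OF f b(2)] by (intro sum.cong) (auto simp: md_def)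
  finally show ?thesis ..
qed

section \<open>Families of vertex operators and q-differences\<close>

lemma vfam_vx:
  assumes "norm \<kappa> \<le> 1" "{\<alpha>, \<beta>, \<gamma>} \<subseteq> {-1, 0, 1}" "norm a \<le> 2 * norm h" "norm b \<le> 2 * norm h" "norm c \<le> 2 * norm h"
  shows "vfam h (\<lambda>\<zeta>. vx h \<kappa> \<alpha> \<beta> \<gamma> \<theta> (\<zeta> + a) (\<zeta> + b) (\<zeta> + c))"
proof -
  have "(\<lambda>\<zeta>. vx h \<kappa> \<alpha> \<beta> \<gamma> \<theta> (\<zeta> + a) (\<zeta> + b) (\<zeta> + c) g) holomorphic_on UNIV" for g
  proof (cases g)
    case (Q s)
    then show ?thesis by (simp add: vx_def)
  next
    case (Mode s n)
    then show ?thesis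
      by (cases "n = 0"; cases "qint h n = 0"; cases s) (auto simp: vx_def intro!: holomorphic_intros)
  qed
  then have "holfam (\<lambda>\<zeta>. vx h \<kappa> \<alpha> \<beta> \<gamma> \<theta> (\<zeta> + a) (\<zeta> + b) (\<zeta> + c))"
    by (simp add: holfam_def) (simp add: vx_def)
  moreover have "vtx h \<zeta> (vx h \<kappa> \<alpha> \<beta> \<gamma> \<theta> (\<zeta> + a) (\<zeta> + b) (\<zeta> + c))" for \<zeta>
    unfolding vtx_def by (intro exI conjI, rule refl) (use assms in auto)
  ultimately show ?thesis by (simp add: vfam_def)
qed

lemma cur_vx:
  assumes "norm \<kappa> \<le> 1" "\<epsilon> \<in> {-1, 0, 1}" "norm a \<le> 2 * norm h" "norm b \<le> 2 * norm h" "norm c \<le> 2 * norm h"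
  shows "cur h \<epsilon> (\<lambda>\<zeta>. vx h \<kappa> 0 \<epsilon> \<epsilon> \<theta> (\<zeta> + a) (\<zeta> + b) (\<zeta> + c))"
proof -
  have "vfam h (\<lambda>\<zeta>. vx h \<kappa> 0 \<epsilon> \<epsilon> \<theta> (\<zeta> + a) (\<zeta> + b) (\<zeta> + c))"
    by (rule vfam_vx) (use assms in auto)
  moreover have "exp (- (of_int n * (\<omega> + x))) = exp (- (of_int n * x)) * exp (- (of_int n * \<omega>))" for n :: int and \<omega> x :: complex
    by (simp add: exp_add[symmetric] algebra_simps)
  then have "homog \<epsilon> (\<lambda>\<zeta>. vx h \<kappa> 0 \<epsilon> \<epsilon> \<theta> (\<zeta> + a) (\<zeta> + b) (\<zeta> + c))"
    unfolding homog_def by (auto simp: vx_def algebra_simps split: boson.split)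
  ultimately show ?thesis by (simp add: cur_def vfam_def)
qed

lemma exp_neq_Re: "Re x > Re y \<Longrightarrow> exp x \<noteq> exp y"
  by (metis less_irrefl norm_exp_eq_Re exp_less_cancel_iff)

lemma phase_apply:
  assumes "b \<in> fock"
  shows "(S \<odot> oexp (oscale \<theta> (mode_op h Bc 0))) b' b = S b' b * exp (\<theta> * fst b Bc)"
proof -
  have E: "oexp (oscale \<theta> (mode_op h Bc 0)) k b = (if k = b then exp (\<theta> * fst b Bc) else 0)" for k
    by (rule oexp_diag) (use assms in \<open>auto simp: oscale_def mode_op_def\<close>)
  show ?thesis
    unfolding oprod_def by (subst infsum_single[of _ b]) (use assms in \<open>auto simp: E\<close>)
qed

lemma maj_comb:
  assumes "maj h \<nu> rs A" "maj h \<nu> rs B"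
  shows "maj h \<nu> rs (oscale x (A - B))"
proof -
  obtain d1 d2 where e: "\<And>\<mu>. 0 \<le> d1 \<mu>" "\<And>\<mu>. 0 \<le> d2 \<mu>"
    "\<And>b' b. b' \<in> fock \<Longrightarrow> b \<in> fock \<Longrightarrow> norm (A b' b) \<le> vop \<nu> d1 (majU h rs) (majV h rs) b' b"
    "\<And>b' b. b' \<in> fock \<Longrightarrow> b \<in> fock \<Longrightarrow> norm (B b' b) \<le> vop \<nu> d2 (majU h rs) (majV h rs) b' b"
    using assms unfolding maj_def by metis
  have "norm (oscale x (A - B) b' b) \<le> vop \<nu> (\<lambda>\<mu>. norm x * (d1 \<mu> + d2 \<mu>)) (majU h rs) (majV h rs) b' b"
    if b: "b' \<in> fock" "b \<in> fock" for b' b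
  proof -
    have "norm (oscale x (A - B) b' b) \<le> norm x * (norm (A b' b) + norm (B b' b))"
      by (simp add: oscale_def norm_mult mult_left_mono norm_triangle_ineq4)
    also have "\<dots> \<le> norm x * (vop \<nu> d1 (majU h rs) (majV h rs) b' b + vop \<nu> d2 (majU h rs) (majV h rs) b' b)"
      by (intro mult_left_mono add_mono e b) simp
    also have "\<dots> = vop \<nu> (\<lambda>\<mu>. norm x * (d1 \<mu> + d2 \<mu>)) (majU h rs) (majV h rs) b' b"
      by (simp add: vop_def algebra_simps)
    finally show ?thesis .
  qed
  then show ?thesis
    using assms(1) e unfolding maj_def by (intro conjI exI[of _ "\<lambda>\<mu>. norm x * (d1 \<mu> + d2 \<mu>)"]) auto
qed

lemma rowfin_comb: "rowfin A \<Longrightarrow> rowfin B \<Longrightarrow> rowfin (oscale x (A - B))"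
  and colfin_comb: "colfin A \<Longrightarrow> colfin B \<Longrightarrow> colfin (oscale x (A - B))"
proof -
  have *: "finite {k\<in>fock. x * (F k - G k) \<noteq> 0}" if "finite {k\<in>fock. F k \<noteq> 0}" "finite {k\<in>fock. G k \<noteq> 0}" for F G :: "state \<Rightarrow> complex"
    by (rule finite_subset[OF _ finite_UnI[OF that]]) auto
  show "rowfin A \<Longrightarrow> rowfin B \<Longrightarrow> rowfin (oscale x (A - B))"
    and "colfin A \<Longrightarrow> colfin B \<Longrightarrow> colfin (oscale x (A - B))"
    unfolding rowfin_def colfin_def oscale_def using * by simp_all
qed

lemma comp_comb_left: "composable A C \<Longrightarrow> composable B C \<Longrightarrow> composable (oscale x (A - B)) C"
  and comp_comb_right: "composable C A \<Longrightarrow> composable C B \<Longrightarrow> composable C (oscale x (A - B))"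
proof -
  have *: "oscale x (A - B) = oscale x (A + oscale (-1) B)" by (simp add: oscale_def fun_eq_iff)
  show "composable A C \<Longrightarrow> composable B C \<Longrightarrow> composable (oscale x (A - B)) C"
    "composable C A \<Longrightarrow> composable C B \<Longrightarrow> composable C (oscale x (A - B))"
    unfolding * by (intro comp_oscale_left comp_oscale_right comp_add_left comp_add_right; assumption)+
qed

lemma oprod_diff_left: "composable A C \<Longrightarrow> composable B C \<Longrightarrow> eqf (oscale x (A - B) \<odot> C) (oscale x (A \<odot> C - B \<odot> C))"
  and oprod_diff_right: "composable C A \<Longrightarrow> composable C B \<Longrightarrow> eqf (C \<odot> oscale x (A - B)) (oscale x (C \<odot> A - C \<odot> B))"
proof -
  have *: "oscale x (A - B) = oscale x (A + oscale (-1) B)" for A B by (simp add: oscale_def fun_eq_iff)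
  show "composable A C \<Longrightarrow> composable B C \<Longrightarrow> eqf (oscale x (A - B) \<odot> C) (oscale x (A \<odot> C - B \<odot> C))"
    unfolding * oprod_oscale_left
    using oprod_add_left[of A C "oscale (-1) B"] by (intro eqf_oscale) (simp add: oprod_oscale_left comp_oscale_left)
  show "composable C A \<Longrightarrow> composable C B \<Longrightarrow> eqf (C \<odot> oscale x (A - B)) (oscale x (C \<odot> A - C \<odot> B))"
    unfolding * oprod_oscale_right
    using oprod_add_right[of C A "oscale (-1) B"] by (intro eqf_oscale) (simp add: oprod_oscale_right comp_oscale_right)
qed

lemma cprod_cong:
  assumes "cprod S T F" "\<And>\<zeta>. eqf (S' \<zeta>) (S \<zeta>)" "\<And>\<zeta>. eqf (T' \<zeta>) (T \<zeta>)"
  shows "cprod S' T' F"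
proof -
  have c: "composable (S' x) (T' y) \<longleftrightarrow> composable (S x) (T y)" for x y
    unfolding composable_def by (intro ball_cong refl summable_on_cong) (use assms(2)[of x] assms(3)[of y] in \<open>simp add: eqf_def\<close>)
  have "eqf (S' x \<odot> T' y) (F x y) \<longleftrightarrow> eqf (S x \<odot> T y) (F x y)" for x y
    using eqf_oprod[OF assms(2)[of x] assms(3)[of y]] eqf_sym eqf_trans by blast
  then show ?thesis using assms(1) unfolding cprod_def contd_def c by simp
qed

lemma mero_comb: "sepmer c \<Longrightarrow> mero F \<Longrightarrow> mero G \<Longrightarrow> mero (\<lambda>x y. oscale (c x y) (F x y - G x y))"
  unfolding mero_sepmer oscale_def by (auto intro!: sepmer_intros)

lemma cprodE:
  assumes "cprod S T F"
  obtains C where "mero F" "\<And>x y. Re x > Re y + C \<Longrightarrow> composable (S x) (T y)" "\<And>x y. Re x > Re y + C \<Longrightarrow> eqf (S x \<odot> T y) (F x y)"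
proof -
  obtain C1 C2 where C: "\<And>x y. Re x > Re y + C1 \<Longrightarrow> eqf (S x \<odot> T y) (F x y)" "\<And>x y. Re x > Re y + C2 \<Longrightarrow> composable (S x) (T y)" "mero F"
    using assms unfolding cprod_def contd_def by blast
  show ?thesis
    by (rule that[of "max C1 C2"]) (use C in auto)
qed

lemma cprod_comb_left:
  assumes "cprod A T F" "cprod B T G" "sepmer (\<lambda>x y. c x)"
  shows "cprod (\<lambda>\<zeta>. oscale (c \<zeta>) (A \<zeta> - B \<zeta>)) T (\<lambda>x y. oscale (c x) (F x y - G x y))"
proof -
  obtain C1 where 1: "mero F" "\<And>x y. Re x > Re y + C1 \<Longrightarrow> composable (A x) (T y)" "\<And>x y. Re x > Re y + C1 \<Longrightarrow> eqf (A x \<odot> T y) (F x y)"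
    using cprodE[OF assms(1)] by blast
  obtain C2 where 2: "mero G" "\<And>x y. Re x > Re y + C2 \<Longrightarrow> composable (B x) (T y)" "\<And>x y. Re x > Re y + C2 \<Longrightarrow> eqf (B x \<odot> T y) (G x y)"
    using cprodE[OF assms(2)] by blast
  show ?thesis
  proof (rule cprodI[where C = "max C1 C2"])
    show "mero (\<lambda>x y. oscale (c x) (F x y - G x y))" by (rule mero_comb) fact+
    fix x y :: complex assume "Re x > Re y + max C1 C2"
    then have R: "Re x > Re y + C1" "Re x > Re y + C2" by auto
    show "composable (oscale (c x) (A x - B x)) (T y) \<and> eqf (oscale (c x) (A x - B x) \<odot> T y) (oscale (c x) (F x y - G x y))"
      by (intro conjI comp_comb_left 1 2 R eqf_trans[OF oprod_diff_left] eqf_oscale eqf_diff)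
  qed
qed

lemma cprod_comb_right:
  assumes "cprod S A F" "cprod S B G" "sepmer (\<lambda>x y. c y)"
  shows "cprod S (\<lambda>\<zeta>. oscale (c \<zeta>) (A \<zeta> - B \<zeta>)) (\<lambda>x y. oscale (c y) (F x y - G x y))"
proof -
  obtain C1 where 1: "mero F" "\<And>x y. Re x > Re y + C1 \<Longrightarrow> composable (S x) (A y)" "\<And>x y. Re x > Re y + C1 \<Longrightarrow> eqf (S x \<odot> A y) (F x y)"
    using cprodE[OF assms(1)] by blast
  obtain C2 where 2: "mero G" "\<And>x y. Re x > Re y + C2 \<Longrightarrow> composable (S x) (B y)" "\<And>x y. Re x > Re y + C2 \<Longrightarrow> eqf (S x \<odot> B y) (G x y)"
    using cprodE[OF assms(2)] by blast
  show ?thesis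
  proof (rule cprodI[where C = "max C1 C2"])
    show "mero (\<lambda>x y. oscale (c y) (F x y - G x y))" by (rule mero_comb) fact+
    fix x y :: complex assume "Re x > Re y + max C1 C2"
    then have R: "Re x > Re y + C1" "Re x > Re y + C2" by auto
    show "composable (S x) (oscale (c y) (A y - B y)) \<and> eqf (S x \<odot> oscale (c y) (A y - B y)) (oscale (c y) (F x y - G x y))"
      by (intro conjI comp_comb_right 1 2 R eqf_trans[OF oprod_diff_right] eqf_oscale eqf_diff)
  qed
qed

lemma vfam_vmaj: "vfam h L \<Longrightarrow> vmaj h (\<lambda>\<zeta>. nexp h (L \<zeta>))"
proof -
  assume L: "vfam h L"
  have "(\<lambda>s. L \<zeta> (Q s)) = (\<lambda>s. L 0 (Q s))" for \<zeta> using L unfolding vfam_def holfam_def by blast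
  moreover have "maj h (\<lambda>s. L \<zeta> (Q s)) [Re \<zeta>] (nexp h (L \<zeta>))" for \<zeta>
    by (rule vtx_maj) (use L in \<open>simp add: vfam_def\<close>)
  ultimately have "maj h (\<lambda>s. L 0 (Q s)) [Re \<zeta>] (nexp h (L \<zeta>))" for \<zeta> by metis
  then show ?thesis unfolding vmaj_def by blast
qed

lemma cprod_PP:
  assumes "vfam h L1" "vfam h L3" "sepmer \<kappa>"
    and "\<And>\<zeta>1 \<zeta>2. Re \<zeta>1 > Re \<zeta>2 + 2 * majH h \<Longrightarrow> contr h (L1 \<zeta>1) (L3 \<zeta>2) = \<kappa> \<zeta>1 \<zeta>2"
  shows "cprod (\<lambda>\<zeta>. nexp h (L1 \<zeta>)) (\<lambda>\<zeta>. nexp h (L3 \<zeta>)) (\<lambda>\<zeta>1 \<zeta>2. oscale (\<kappa> \<zeta>1 \<zeta>2) (nexp h (L1 \<zeta>1 + L3 \<zeta>2)))"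
  unfolding cprod_def
proof
  show "contd (\<lambda>\<zeta>1 \<zeta>2. nexp h (L1 \<zeta>1) \<odot> nexp h (L3 \<zeta>2)) (\<lambda>\<zeta>1 \<zeta>2. oscale (\<kappa> \<zeta>1 \<zeta>2) (nexp h (L1 \<zeta>1 + L3 \<zeta>2)))"
    by (rule contd_PP) fact+
  have "composable (nexp h (L1 x)) (nexp h (L3 y))" if "Re x > Re y + 2 * majH h" for x y
    using assms(1,2) that by (intro maj_imp_comp[OF vtx_maj vtx_maj]) (auto simp: vfam_def sep_def)
  then show "\<exists>C. \<forall>x y. Re x > Re y + C \<longrightarrow> composable (nexp h (L1 x)) (nexp h (L3 y))" by blast
qed

lemma md_cmaj: "cur h \<epsilon> X \<Longrightarrow> cmaj h (md h \<epsilon> X m)"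
  unfolding cmaj_def using md_maj md_rowfin md_colfin by blast

lemma cprod_words:
  assumes S: "vmaj h S" and T: "vmaj h T" and f: "cmaj h f" and G: "contd (\<lambda>x y. S x \<odot> (f \<odot> T y)) G"
  shows "cprod S (\<lambda>\<zeta>. f \<odot> T \<zeta>) G"
  using words[OF S T f f] G unfolding cprod_def words_def by blast

text \<open>A commutation relation with the current at every point is integrated over the unit
  circle and becomes the same relation with its mode.\<close>

lemma eqf_md:
  assumes X: "homog \<epsilon> X" and f: "rowfin f" "colfin f" and R: "\<And>\<zeta>. eqf (f \<odot> nexp h (X \<zeta>)) (oscale c (nexp h (X \<zeta>) \<odot> f))"
  shows "eqf (f \<odot> md h \<epsilon> X m) (oscale c (md h \<epsilon> X m \<odot> f))"
  unfolding eqf_def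
proof (intro ballI)
  fix b' b assume b: "b' \<in> fock" "b \<in> fock"
  have "(f \<odot> md h \<epsilon> X m) b' b = cint m 0 (\<lambda>\<zeta>. c * (nexp h (X \<zeta>) \<odot> f) b' b)"
    unfolding md_cint_right[OF X f(1) b] by (rule cint_cong) (use R b in \<open>simp add: eqf_def oscale_def\<close>)
  also have "\<dots> = c * cint m 0 (\<lambda>\<zeta>. (nexp h (X \<zeta>) \<odot> f) b' b)" by (rule cint_cmult)
  also have "\<dots> = oscale c (md h \<epsilon> X m \<odot> f) b' b" by (simp add: oscale_def md_cint_left[OF X f(2) b])
  finally show "(f \<odot> md h \<epsilon> X m) b' b = oscale c (md h \<epsilon> X m \<odot> f) b' b" .
qed

section \<open>The operators of the realization and their contractions\<close>

text \<open>The arguments of the exponentials that define $\phi_2(z)$, $\phi^*_1(z)$, $X^+(z)$ and the two terms, with the shifts \<open>q\<^sup>\<plusminus>\<^sup>1\<close> of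
  the argument of \<open>c\<close>, of the \<open>q\<close>-derivatives in $\psi^*_2(z)$ and $X^-(z)$.\<close>

definition phiL :: "complex \<Rightarrow> complex \<Rightarrow> lin" where
  "phiL h \<zeta> = vx h (1 / 2) (-1) 1 1 (- (\<i> * of_real pi)) (\<zeta> + h) (\<zeta> + 2 * h) (\<zeta> + h)"

definition dualL :: "complex \<Rightarrow> complex \<Rightarrow> lin" where
  "dualL h \<zeta> = vx h (1 / 2) 1 0 0 (\<i> * of_real pi) (\<zeta> + h) \<zeta> \<zeta>"

definition psiL :: "complex \<Rightarrow> complex \<Rightarrow> complex \<Rightarrow> lin" where
  "psiL h t \<zeta> = vx h (- 1 / 2) 1 (-1) (-1) (\<i> * of_real pi) (\<zeta> + h) \<zeta> (\<zeta> + (h + t * h))"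

definition plusL :: "complex \<Rightarrow> complex \<Rightarrow> lin" where
  "plusL h \<zeta> = vx h (- 1 / 2) 0 1 1 0 \<zeta> \<zeta> \<zeta>"

definition minusL :: "complex \<Rightarrow> complex \<Rightarrow> complex \<Rightarrow> lin" where
  "minusL h s \<zeta> = vx h (1 / 2) 0 (-1) (-1) 0 \<zeta> \<zeta> (\<zeta> + s * h)"

lemma vfam_phiL: "vfam h (phiL h)"
  using vfam_vx[of "1 / 2" "-1" 1 1 h h "2 * h" h "- (\<i> * of_real pi)"] by (simp add: phiL_def[abs_def])

lemma vfam_dualL: "vfam h (dualL h)"
  using vfam_vx[of "1 / 2" 1 0 0 h h 0 0 "\<i> * of_real pi"] by (simp add: dualL_def[abs_def])

lemma vfam_psiL: "t \<in> {1, -1} \<Longrightarrow> vfam h (psiL h t)"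
  using vfam_vx[of "- 1 / 2" 1 "-1" "-1" h h 0 "h + t * h" "\<i> * of_real pi"] by (auto simp: psiL_def[abs_def])

lemma cur_plusL: "cur h 1 (plusL h)"
  using cur_vx[of "- 1 / 2" 1 0 h 0 0 0] by (simp add: plusL_def[abs_def])

lemma cur_minusL: "s \<in> {1, -1} \<Longrightarrow> cur h (- 1) (minusL h s)"
  using cur_vx[of "1 / 2" "-1" 0 h 0 "s * h" 0] by (auto simp: minusL_def[abs_def])

lemma exp_i_pi: "exp (\<i> * of_real pi) = -1" "exp (- (\<i> * of_real pi)) = -1"
  by (simp_all add: exp_minus)

locale generic =
  fixes h :: complex
  assumes gen: "\<forall>n::nat. 0 < n \<longrightarrow> exp h ^ n \<noteq> 1"
begin

text \<open>Instances of \<open>contr_vx\<close>. The leading minus signs arise when exp(- i \<pi>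
  c_0) or exp(i \<pi> c_0) on the left passes an operator that shifts c_0 by 1 or -1. The parameters
  \<open>s\<close> and \<open>t\<close> select the terms of the q-derivatives.\<close>

lemma contractions:
  assumes R: "Re x > Re y + 2 * majH h" and s: "s \<in> {1, -1}" and t: "t \<in> {1, -1}"
  shows contr_phi_minus: "contr h (phiL h x) (minusL h s y) = - ((exp h * exp x - exp h * exp y) / (exp h * exp x - exp (s * h) * exp y))" (is ?G1)
    and contr_minus_phi: "contr h (minusL h s x) (phiL h y) = (exp x - exp h * exp h * exp y) / (exp (s * h) * exp x - exp h * exp y)" (is ?G2)
    and contr_psi_minus: "contr h (psiL h t x) (minusL h s y) = - ((exp (t * h) * exp h * exp x - exp (s * h) * exp y) / (exp h * exp x - exp y))" (is ?G3)
    and contr_minus_psi: "contr h (minusL h s x) (psiL h t y) = (exp (s * h) * exp x - exp (t * h) * exp h * exp y) / (exp x - exp h * exp y)" (is ?G4)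
    and contr_psi_plus: "contr h (psiL h t x) (plusL h y) = - ((exp h * exp x - exp y / exp h) / (exp (t * h) * exp h * exp x - exp y))" (is ?G5)
    and contr_plus_psi: "contr h (plusL h x) (psiL h t y) = (exp x - exp y) / (exp x - exp (t * h) * exp h * exp y)" (is ?G6)
    and contr_minus_plus: "contr h (minusL h s x) (plusL h y) = 1 / (exp (s * h) * exp x - exp y)" (is ?G7)
    and contr_plus_minus: "contr h (plusL h x) (minusL h s y) = 1 / (exp x - exp (s * h) * exp y)" (is ?G8)
    and contr_minus_minus: "contr h (minusL h t x) (minusL h s y) = exp (t * h) * exp x - exp (s * h) * exp y" (is ?G9)
    and contr_plus_plus: "contr h (plusL h x) (plusL h y) = exp x - exp y" (is ?G10)
    and contr_phi_phi: "contr h (phiL h x) (phiL h y) = - ((exp h * exp x - exp h * exp y) /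
          (exp h * exp x - exp h * exp h * exp h * exp y) / (exp h * exp h * exp x - exp h * exp h * exp y))" (is ?G11)
    and contr_psi_psi: "contr h (psiL h s x) (psiL h t y) = - ((exp (s * h) * exp h * exp x - exp (t * h) * exp h * exp y) /
          (exp h * exp x - exp y / exp h) / (exp x - exp y))" (is ?G12)
    and contr_phi_dual: "contr h (phiL h x) (dualL h y) = exp h * exp h * (exp x - exp y)" (is ?G13)
    and contr_minus_dual: "contr h (minusL h s x) (dualL h y) = 1 / (exp x - exp h * exp h * exp y)" (is ?G14)
    and contr_psi_phi: "contr h (psiL h t x) (phiL h y) = - ((exp h * exp x - exp h * exp h * exp y) * (exp x - exp h * exp y) /
          (exp (t * h) * exp h * exp x - exp h * exp y))" (is ?G15)
    and contr_phi_psi: "contr h (phiL h x) (psiL h t y) = - ((exp h * exp x - exp y) * (exp h * exp h * exp x - exp h * exp y) /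
          (exp h * exp x - exp (t * h) * exp h * exp y))" (is ?G16)
proof -
  have n: "\<bar>Re h\<bar> \<le> norm h" "0 \<le> norm h" by (simp_all add: abs_Re_le_cmod)
  have st: "Re (s * h) = Re h \<or> Re (s * h) = - Re h" "Re (t * h) = Re h \<or> Re (t * h) = - Re h" using s t by auto
  have e2: "exp (2 * h) = exp h * exp h" "exp (h * 2) = exp h * exp h" "exp (- h) = 1 / exp h"
    by (simp_all add: exp_double mult.commute[of h 2] power2_eq_square exp_minus divide_inverse)
  note d = phiL_def minusL_def plusL_def psiL_def dualL_def
  note simps = exp_add e2 exp_i_pi power_int_minus divide_inverse algebra_simps
  have h1: "(1 / 2 + 1 / 2) * h = h" "(1 / 2 + - 1 / 2) * h = 0" "(- 1 / 2 + 1 / 2) * h = 0" "(- 1 / 2 + - 1 / 2) * h = - h"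
    by simp_all
  have c: "exp h * (u * inverse (exp h)) = u" for u by simp
  note facts = R[unfolded majH_def] n st
  show ?G1 ?G2 ?G3 ?G4 ?G5 ?G6 ?G7 ?G8 ?G9 ?G10 ?G11 ?G12 ?G13 ?G14 ?G15 ?G16
    by (unfold d, insert facts) (subst contr_vx[OF gen]; (unfold h1)?; auto simp: simps c)+
qed

text \<open>The argument of \<open>c\<close> in \<open>phiL\<close> equals that of
  \<open>H^{*,1}\<close>, so the zero from the pairing of \<open>c\<close> cancels the pole from the
  pairing with \<open>H^1\<close>; what is left is the sign of the phase.\<close>

lemma contr_phi_plus: "Re x > Re y + 2 * majH h \<Longrightarrow> contr h (phiL h x) (plusL h y) = -1"
  and contr_plus_phi: "Re x > Re y + 2 * majH h \<Longrightarrow> contr h (plusL h x) (phiL h y) = 1"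
proof -
  assume R: "Re x > Re y + 2 * majH h"
  have n: "\<bar>Re h\<bar> \<le> norm h" "0 \<le> norm h" by (simp_all add: abs_Re_le_cmod)
  have h1: "(1 / 2 + - 1 / 2) * h = 0" "(- 1 / 2 + 1 / 2) * h = 0" by simp_all
  have "exp (x + h) \<noteq> exp y" "exp x \<noteq> exp (y + h)"
    by (rule exp_neq_Re; use R n in \<open>simp add: majH_def\<close>)+
  then have ne: "exp (x + h) - exp y \<noteq> 0" "exp x - exp (y + h) \<noteq> 0" by simp_all
  show "contr h (phiL h x) (plusL h y) = -1"
    unfolding phiL_def plusL_def
    by (subst contr_vx[OF gen]; (unfold h1)?) (use R n ne in \<open>auto simp: majH_def exp_i_pi power_int_minus\<close>)
  show "contr h (plusL h x) (phiL h y) = 1"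
    unfolding phiL_def plusL_def
    by (subst contr_vx[OF gen]; (unfold h1)?) (use R n ne in \<open>auto simp: majH_def exp_i_pi power_int_minus\<close>)
qed

end

definition psi_op :: "complex \<Rightarrow> complex \<Rightarrow> oper" where
  "psi_op h \<zeta> = oscale (1 / ((exp h - exp (- h)) * exp \<zeta>)) (nexp h (psiL h 1 \<zeta>) - nexp h (psiL h (-1) \<zeta>))"

text \<open>The q-derivative carries a factor 1/w that is kept out of the exponentials. Hence f_1,
  the coefficient of w^(-1) in the current, is \<open>fmode h 0\<close>, whereas e_1 is
  \<open>emode h (-1)\<close>.\<close>

definition fmode :: "complex \<Rightarrow> int \<Rightarrow> oper" where
  "fmode h m = oscale (1 / (exp h - exp (- h))) (md h (- 1) (minusL h 1) m - md h (- 1) (minusL h (-1)) m)"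

definition emode :: "complex \<Rightarrow> int \<Rightarrow> oper" where
  "emode h m = md h 1 (plusL h) m"

lemma cint_nexp:
  assumes "homog \<epsilon> X" "b' \<in> fock" "b \<in> fock"
  shows "cint m 0 (\<lambda>\<zeta>. nexp h (X \<zeta>) b' b) = md h \<epsilon> X m b' b"
proof -
  have "cint m 0 (\<lambda>\<zeta>. nexp h (X \<zeta>) b' b) = cint m 0 (\<lambda>\<zeta>. nexp h (X 0) b' b * exp (of_int (deg \<epsilon> b' b) * \<zeta>))"
    by (rule cint_cong) (rule nexp_homog[OF assms])
  then show ?thesis by (simp add: cint_cmult cint_monom md_def)
qed

lemma fourier_mode_cint: "fourier_mode X 0 b' b = cint (-1) 0 (\<lambda>\<zeta>. X \<zeta> b' b)"
  by (simp add: fourier_mode_def cint_def)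

lemma eqf_dbl:
  assumes "eqf f f'" "eqf (S \<zeta>) (S' \<zeta>)"
  shows "eqf (dbl x r f S \<zeta>) (dbl x r f' S' \<zeta>)"
  unfolding dbl_def by (intro eqf_oscale eqf_add eqf_oprod assms)

context generic
begin

lemma qq: "exp h - exp (- h) \<noteq> 0"
  by (rule generic_q[OF gen])

lemma lin_vx: "lscale (of_int i) (H1_dual h \<kappa> a) + lscale (of_int j) (H1 h \<kappa> b) + lscale (of_int k) (c_field h c) = vx h \<kappa> i j k 0 a b c"
  by (simp only: H1_dual_vx[OF gen, of \<kappa> a 0 0] H1_vx[of h \<kappa> b 0 0] c_field_vx[of h c \<kappa> 0 0] vx_sum)

lemma phi2_eq: "eqf (phi h 2 \<zeta>) (nexp h (phiL h \<zeta>))"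
proof -
  have "- H1_dual h (1 / 2) (\<zeta> + h) + H1 h (1 / 2) (\<zeta> + 2 * h) + c_field h (\<zeta> + h)
      = vx h (1 / 2) (-1) 1 1 0 (\<zeta> + h) (\<zeta> + 2 * h) (\<zeta> + h)"
    using lin_vx[of "-1" "1 / 2" "\<zeta> + h" 1 "\<zeta> + 2 * h" 1 "\<zeta> + h"] by (simp add: lscale_def fun_eq_iff)
  then show ?thesis
    using nexp_phase[of _ _ h h "1 / 2" "-1" 1 1 "\<zeta> + h" "\<zeta> + 2 * h" "\<zeta> + h" "- (\<i> * of_real pi)"]
    by (simp add: phi_def phiL_def eqf_def)
qed

lemma dual1_eq: "eqf (phi_dual h 1 \<zeta>) (nexp h (dualL h \<zeta>))"
  using nexp_phase[of _ _ h h "1 / 2" 1 0 0 "\<zeta> + h" \<zeta> \<zeta> "\<i> * of_real pi"]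
  by (simp add: phi_dual_def dualL_def eqf_def H1_dual_vx[OF gen, of _ _ \<zeta> \<zeta>])

lemma psi2_eq: "eqf (psi_dual h 2 \<zeta>) (psi_op h \<zeta>)"
proof -
  have L: "H1_dual h (- 1 / 2) (\<zeta> + h) - H1 h (- 1 / 2) \<zeta> - c_field h (\<zeta> + t * h + h) = vx h (- 1 / 2) 1 (-1) (-1) 0 (\<zeta> + h) \<zeta> (\<zeta> + (h + t * h))" for t
    using lin_vx[of 1 "- 1 / 2" "\<zeta> + h" "-1" \<zeta> "-1" "\<zeta> + (h + t * h)"] by (simp add: lscale_def fun_eq_iff algebra_simps)
  show ?thesis
    unfolding eqf_def
  proof (intro ballI)
    fix b' b assume b: "b' \<in> fock" "b \<in> fock"
    have N: "nexp h (H1_dual h (- 1 / 2) (\<zeta> + h) - H1 h (- 1 / 2) \<zeta> - c_field h (\<zeta> + t * h + h)) b' b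
        * exp (\<i> * of_real pi * fst b Bc) = nexp h (psiL h t \<zeta>) b' b" for t
      using nexp_phase[OF b, of h h "- 1 / 2" 1 "-1" "-1" "\<zeta> + h" \<zeta> "\<zeta> + (h + t * h)" "\<i> * of_real pi"]
      unfolding L phase_apply[OF b(2)] psiL_def .
    show "psi_dual h 2 \<zeta> b' b = psi_op h \<zeta> b' b"
    proof -
      have "psi_dual h 2 \<zeta> b' b = qderiv h (\<lambda>\<xi>. nexp h (H1_dual h (- 1 / 2) (\<zeta> + h) - H1 h (- 1 / 2) \<zeta> - c_field h (\<xi> + h))) \<zeta> b' b
          * exp (\<i> * of_real pi * fst b Bc)"
        by (simp add: psi_dual_def Let_def phase_apply[OF b(2)])
      then show ?thesis
        using N[of 1] N[of "-1"] by (simp add: qderiv_def psi_op_def oscale_def left_diff_distrib diff_divide_distrib)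
    qed
  qed
qed

lemma e1_eq: "eqf (e1 h) (emode h (-1))"
  unfolding eqf_def
proof (intro ballI)
  fix b' b assume b: "b' \<in> fock" "b \<in> fock"
  have L: "H1 h (- 1 / 2) \<zeta> + c_field h \<zeta> = plusL h \<zeta>" for \<zeta>
    using lin_vx[of 0 "- 1 / 2" \<zeta> 1 \<zeta> 1 \<zeta>] by (simp add: lscale_def fun_eq_iff plusL_def)
  show "e1 h b' b = emode h (-1) b' b"
    unfolding e1_def fourier_mode_cint X_plus_def L emode_def
    by (rule cint_nexp) (use b cur_plusL in \<open>auto simp: cur_def\<close>)
qed

lemma f1_eq: "eqf (f1 h) (fmode h 0)"
  unfolding eqf_def
proof (intro ballI)
  fix b' b assume b: "b' \<in> fock" "b \<in> fock"
  let ?k = "exp h - exp (- h)"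
  have L: "- H1 h (1 / 2) \<zeta> - c_field h (\<zeta> + s * h) = minusL h s \<zeta>" for \<zeta> s
    using lin_vx[of 0 "1 / 2" \<zeta> "-1" \<zeta> "-1" "\<zeta> + s * h"] by (simp add: lscale_def fun_eq_iff minusL_def)
  have N: "nexp h (minusL h s \<zeta>) b' b = nexp h (minusL h s 0) b' b * exp (of_int (deg (-1) b' b) * \<zeta>)" if "s \<in> {1, -1}" for s \<zeta>
    by (rule nexp_homog) (use b cur_minusL[OF that] in \<open>auto simp: cur_def\<close>)
  have "f1 h b' b = cint (0 - 1) 0 (\<lambda>\<zeta>. X_minus h \<zeta> b' b)"
    unfolding f1_def fourier_mode_cint by simp
  also have "\<dots> = cint 0 0 (\<lambda>\<zeta>. exp \<zeta> * X_minus h \<zeta> b' b)" by (rule cint_exp[symmetric])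
  also have "\<dots> = cint 0 0 (\<lambda>\<zeta>. (nexp h (minusL h 1 0) b' b - nexp h (minusL h (-1) 0) b' b) / ?k * exp (of_int (deg (-1) b' b) * \<zeta>))"
  proof (rule cint_cong)
    fix \<zeta>
    have "X_minus h \<zeta> b' b = (nexp h (minusL h 1 \<zeta>) b' b - nexp h (minusL h (-1) \<zeta>) b' b) / (?k * exp \<zeta>)"
      using L[of \<zeta> 1] L[of \<zeta> "-1"] by (simp add: X_minus_def qderiv_def)
    then show "exp \<zeta> * X_minus h \<zeta> b' b = (nexp h (minusL h 1 0) b' b - nexp h (minusL h (-1) 0) b' b) / ?k * exp (of_int (deg (-1) b' b) * \<zeta>)"
      using qq N[of 1 \<zeta>] N[of "-1" \<zeta>] by (simp add: field_simps)
  qed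
  also have "\<dots> = fmode h 0 b' b"
    unfolding cint_cmult cint_monom by (simp add: fmode_def oscale_def md_def)
  finally show "f1 h b' b = fmode h 0 b' b" .
qed

lemma phi1_eq: "eqf (phi h 1 \<zeta>) (dbl (-1) (exp (- h)) (fmode h 0) (\<lambda>\<zeta>. nexp h (phiL h \<zeta>)) \<zeta>)"
proof -
  have "phi h 1 \<zeta> = dbl (-1) (exp (- h)) (f1 h) (phi h 2) \<zeta>"
    by (simp add: phi_def Let_def bracket_def grade_def dbl_def oscale_def fun_eq_iff)
  then show ?thesis by (simp only:) (rule eqf_dbl; rule f1_eq phi2_eq)
qed

lemma dual2_eq: "eqf (phi_dual h 2 \<zeta>) (dbl (exp (- h)) (- exp h) (fmode h 0) (\<lambda>\<zeta>. nexp h (dualL h \<zeta>)) \<zeta>)"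
proof -
  have "phi_dual h 2 \<zeta> = dbl (exp (- h)) (- exp h) (f1 h) (phi_dual h 1) \<zeta>"
    by (simp add: phi_dual_def Let_def bracket_def grade_def dbl_def oscale_def fun_eq_iff)
  then show ?thesis by (simp only:) (rule eqf_dbl; rule f1_eq dual1_eq)
qed

lemma psi1_eq: "eqf (psi_dual h 1 \<zeta>) (dbl (exp h) (exp (- h)) (emode h (-1)) (psi_op h) \<zeta>)"
proof -
  have "psi_dual h 1 \<zeta> = dbl (exp h) (exp (- h)) (e1 h) (psi_dual h 2) \<zeta>"
    by (simp add: psi_dual_def Let_def bracket_def grade_def dbl_def oscale_def fun_eq_iff)
  then show ?thesis by (simp only:) (rule eqf_dbl; rule e1_eq psi2_eq)
qed

lemma cmaj_fmode: "cmaj h (fmode h m)"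
proof -
  have Q: "(\<lambda>s. minusL h 1 0 (Q s)) = (\<lambda>s. minusL h (-1) 0 (Q s))" by (auto simp: minusL_def vx_def)
  have "maj h (\<lambda>s. minusL h 1 0 (Q s)) [\<rho>] (fmode h m)" for \<rho>
    unfolding fmode_def using md_maj[OF cur_minusL[of 1 h]] md_maj[OF cur_minusL[of "-1" h]] unfolding Q by (intro maj_comb) auto
  moreover have "rowfin (fmode h m)" "colfin (fmode h m)"
    unfolding fmode_def by (intro rowfin_comb colfin_comb md_rowfin md_colfin)+
  ultimately show ?thesis unfolding cmaj_def by blast
qed

lemma cmaj_emode: "cmaj h (emode h m)"
  unfolding emode_def by (rule md_cmaj[OF cur_plusL])

lemma vmaj_phi: "vmaj h (\<lambda>\<zeta>. nexp h (phiL h \<zeta>))" and vmaj_dual: "vmaj h (\<lambda>\<zeta>. nexp h (dualL h \<zeta>))"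
  by (intro vfam_vmaj vfam_phiL vfam_dualL)+

lemma vmaj_psi: "vmaj h (psi_op h)"
proof -
  have Q: "(\<lambda>s. psiL h t \<zeta> (Q s)) = (\<lambda>s. psiL h 1 0 (Q s))" for t \<zeta> by (auto simp: psiL_def vx_def)
  have "maj h (\<lambda>s. psiL h 1 0 (Q s)) [Re \<zeta>] (nexp h (psiL h t \<zeta>))" if "t \<in> {1, -1}" for t \<zeta>
    using vtx_maj[of h \<zeta> "psiL h t \<zeta>"] vfam_psiL[OF that] unfolding Q[of t \<zeta>] vfam_def by blast
  then show ?thesis unfolding vmaj_def psi_op_def by (intro exI allI maj_comb) auto
qed

end

lemma comb_apply:
  assumes b: "b' \<in> fock" "b \<in> fock"
  shows row_comb_left: "rowfin A \<Longrightarrow> rowfin B \<Longrightarrow> (oscale x (A - B) \<odot> S) b' b = x * ((A \<odot> S) b' b - (B \<odot> S) b' b)"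
    and row_comb_right: "rowfin f \<Longrightarrow> (f \<odot> oscale x (A - B)) b' b = x * ((f \<odot> A) b' b - (f \<odot> B) b' b)"
    and col_comb_left: "colfin f \<Longrightarrow> (oscale x (A - B) \<odot> f) b' b = x * ((A \<odot> f) b' b - (B \<odot> f) b' b)"
    and col_comb_right: "colfin A \<Longrightarrow> colfin B \<Longrightarrow> (S \<odot> oscale x (A - B)) b' b = x * ((S \<odot> A) b' b - (S \<odot> B) b' b)"
proof -
  show "rowfin A \<Longrightarrow> rowfin B \<Longrightarrow> (oscale x (A - B) \<odot> S) b' b = x * ((A \<odot> S) b' b - (B \<odot> S) b' b)"
    using oprod_diff_left[of A S B x] b by (simp add: rowfin_comp eqf_def oscale_def)
  show "rowfin f \<Longrightarrow> (f \<odot> oscale x (A - B)) b' b = x * ((f \<odot> A) b' b - (f \<odot> B) b' b)"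
    using oprod_diff_right[of f A B x] b by (simp add: rowfin_comp eqf_def oscale_def)
  show "colfin f \<Longrightarrow> (oscale x (A - B) \<odot> f) b' b = x * ((A \<odot> f) b' b - (B \<odot> f) b' b)"
    using oprod_diff_left[of A f B x] b by (simp add: colfin_comp eqf_def oscale_def)
  show "colfin A \<Longrightarrow> colfin B \<Longrightarrow> (S \<odot> oscale x (A - B)) b' b = x * ((S \<odot> A) b' b - (S \<odot> B) b' b)"
    using oprod_diff_right[of S A B x] b by (simp add: colfin_comp eqf_def oscale_def)
qed

section \<open>Anticommutators and exchange relations of the modes\<close>

definition anti :: "oper \<Rightarrow> oper \<Rightarrow> bool" where
  "anti A B \<longleftrightarrow> eqf (A \<odot> B) (oscale (-1) (B \<odot> A))"

lemma anti_sym: "anti A B \<Longrightarrow> anti B A"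
  by (auto simp: anti_def eqf_def oscale_def)

lemma anti_comb_mode: "anti A S \<Longrightarrow> anti B S \<Longrightarrow> rowfin A \<Longrightarrow> rowfin B \<Longrightarrow> colfin A \<Longrightarrow> colfin B \<Longrightarrow> anti (oscale x (A - B)) S"
  by (auto simp: anti_def eqf_def oscale_def[of "-1"] row_comb_left col_comb_right algebra_simps)

lemma anti_self: "anti A A \<Longrightarrow> eqf (A \<odot> A) 0"
  by (auto simp: anti_def eqf_def oscale_def)

lemma anti_md:
  assumes "homog \<epsilon> X" "rowfin f" "colfin f" "\<And>\<zeta>. anti f (nexp h (X \<zeta>))"
  shows "anti f (md h \<epsilon> X m)"
  unfolding anti_def by (rule eqf_md) (use assms in \<open>auto simp: anti_def\<close>)

definition diagop :: "(state \<Rightarrow> complex) \<Rightarrow> oper" where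
  "diagop d b' b = (if b' = b then d b else 0)"

lemma diagop_left: "b' \<in> fock \<Longrightarrow> (diagop d \<odot> S) b' b = d b' * S b' b"
  unfolding oprod_def diagop_def by (subst infsum_single[of _ b']) auto

lemma diagop_right: "b \<in> fock \<Longrightarrow> (S \<odot> diagop d) b' b = S b' b * d b"
  unfolding oprod_def diagop_def by (subst infsum_single[of _ b]) auto

lemma diagop_fin: "rowfin (diagop d)" "colfin (diagop d)"
proof -
  have "finite {k \<in> fock. diagop d k b \<noteq> 0}" "finite {k \<in> fock. diagop d b k \<noteq> 0}" for b
    by (rule finite_subset[of _ "{b}"]; auto simp: diagop_def)+
  then show "rowfin (diagop d)" "colfin (diagop d)" by (simp_all add: rowfin_def colfin_def)
qed

text \<open>For x = y = 1 this is the q-integer of the zero mode A^1_0, the value of e_1 f_1 + f_1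
  e_1. The weights x and y record how the two powers of q change when the operator is moved past one
  that shifts A^1_0.\<close>

definition Kop :: "complex \<Rightarrow> complex \<Rightarrow> complex \<Rightarrow> oper" where
  "Kop h x y = diagop (\<lambda>b. (x * exp (h * (fst b Ba1 + fst b Ba2)) - y * exp (- (h * (fst b Ba1 + fst b Ba2)))) / (exp h - exp (- h)))"

text \<open>A purely creating or purely annihilating exponential changes the energy unless it acts
  as the identity, so its part of degree 0 is the identity.\<close>

lemma gmat_energy:
  fixes u v :: "boson \<times> nat \<Rightarrow> complex"
  assumes "u = (\<lambda>_. 0) \<or> v = (\<lambda>_. 0)" "energy M' = energy M" "pos_mset M'" "pos_mset M"
  shows "gmat u v M' M = (if M' = M then 1 else 0)"
proof -
  have sub: "A = B" if "A \<subseteq># B" "energy A = energy B" "pos_mset B" for A B :: "(boson \<times> nat) multiset"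
  proof -
    have "B - A = {#}"
    proof (rule ccontr)
      assume "B - A \<noteq> {#}"
      then obtain x where x: "x \<in># B - A" by (rule multiset_nonemptyE)
      then have "snd x > 0" using that(3) in_diffD[OF x] by (force simp: pos_mset_def)
      moreover have "snd x \<le> energy (B - A)"
        using multi_member_split[OF x] by (auto simp: energy_def)
      moreover have "energy (B - A) = 0" using energy_diff[OF that(1)] that(2) by simp
      ultimately show False by simp
    qed
    then show ?thesis using that(1) by (metis subset_mset.diff_add add.left_neutral)
  qed
  have "cr u M' K * an v K M = (if K = M \<and> M' = M then 1 else 0)" if K: "K \<subseteq># M" for K
    using assms(1)
  proof
    assume u: "u = (\<lambda>_. 0)"
    have c: "cr u M' K = (if K = M' then 1 else 0)"
      unfolding u cr_def mexp_zero by (auto simp: Diff_eq_empty_iff_mset intro: subset_mset.antisym)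
    show ?thesis
    proof (cases "K = M'")
      case True
      then have "K = M" using sub[OF K] assms by simp
      then show ?thesis using True c by (simp add: an_def)
    qed (auto simp: c)
  next
    assume v: "v = (\<lambda>_. 0)"
    have c: "an v K M = (if K = M then 1 else 0)"
      unfolding v an_def mexp_zero using K by (auto simp: Diff_eq_empty_iff_mset dest: subset_mset.antisym)
    show ?thesis
    proof (cases "K = M")
      case True
      then have "an v K M = 1" using c by simp
      then show ?thesis using True sub[of M M'] assms(2,3) by (auto simp: cr_def)
    qed (auto simp: c)
  qed
  then have "gmat u v M' M = (\<Sum>K\<in>{K. K \<subseteq># M}. if K = M \<and> M' = M then 1 else 0)"
    unfolding gmat_def by (intro sum.cong) auto
  also have "\<dots> = (if M' = M then 1 else 0)"
    by (simp add: finite_submsets sum.delta cong: if_cong)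
  finally show ?thesis .
qed

lemma continuous_md:
  assumes X: "homog \<epsilon> X" and b: "b' \<in> fock" "b \<in> fock"
  shows "rowfin f \<Longrightarrow> continuous_on A (\<lambda>\<zeta>. (f \<odot> nexp h (X \<zeta>)) b' b)"
    and "colfin f \<Longrightarrow> continuous_on A (\<lambda>\<zeta>. (nexp h (X \<zeta>) \<odot> f) b' b)"
proof -
  have 1: "continuous_on A (\<lambda>\<zeta>. nexp h (X \<zeta>) k l)" if "k \<in> fock" "l \<in> fock" for k l
  proof -
    have eq: "(\<lambda>\<zeta>. nexp h (X \<zeta>) k l) = (\<lambda>\<zeta>. nexp h (X 0) k l * exp (of_int (deg \<epsilon> k l) * \<zeta>))"
      by (rule ext) (rule nexp_homog[OF X that])
    show ?thesis by (subst eq) (intro continuous_intros)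
  qed
  show "rowfin f \<Longrightarrow> continuous_on A (\<lambda>\<zeta>. (f \<odot> nexp h (X \<zeta>)) b' b)"
    by (simp add: rowfin_oprod b) (intro continuous_on_sum continuous_on_mult 1 continuous_on_const; use b in simp)
  show "colfin f \<Longrightarrow> continuous_on A (\<lambda>\<zeta>. (nexp h (X \<zeta>) \<odot> f) b' b)"
    by (simp add: colfin_oprod b) (intro continuous_on_sum continuous_on_mult 1 continuous_on_const; use b in simp)
qed

context generic
begin

text \<open>The contraction of two such currents is a polynomial in w that changes sign with the
  order. With constant clearing factors 1 and -1 the exchange lemma becomes anticommutation.\<close>

lemma anti_minus:
  assumes "s \<in> {1, -1}" "t \<in> {1, -1}"
  shows "anti (md h (-1) (minusL h s) m) (nexp h (minusL h t \<zeta>))"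
proof -
  have v: "vtx h \<zeta> (minusL h t \<zeta>)" using cur_minusL[OF assms(2)] by (simp add: cur_def)
  have "eqf (oscale 0 (md h (-1) (minusL h s) (m - 1) \<odot> nexp h (minusL h t \<zeta>)) + oscale (- (-1)) (md h (-1) (minusL h s) m \<odot> nexp h (minusL h t \<zeta>)))
     (oscale (- 0) (nexp h (minusL h t \<zeta>) \<odot> md h (-1) (minusL h s) (m - 1)) + oscale (-1) (nexp h (minusL h t \<zeta>) \<odot> md h (-1) (minusL h s) m))"
    by (rule exchange[OF cur_minusL[OF assms(1)] v, where ?c0.0 = "- exp (t * h) * exp \<zeta>" and ?c1.0 = "exp (s * h)"])
      (use assms in \<open>auto simp: contr_minus_minus\<close>)
  then show ?thesis by (simp add: anti_def eqf_def oscale_def)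
qed

lemma anti_plus: "anti (emode h m) (nexp h (plusL h \<zeta>))"
proof -
  have v: "vtx h \<zeta> (plusL h \<zeta>)" using cur_plusL by (simp add: cur_def)
  have "eqf (oscale 0 (md h 1 (plusL h) (m - 1) \<odot> nexp h (plusL h \<zeta>)) + oscale (- (-1)) (md h 1 (plusL h) m \<odot> nexp h (plusL h \<zeta>)))
     (oscale (- 0) (nexp h (plusL h \<zeta>) \<odot> md h 1 (plusL h) (m - 1)) + oscale (-1) (nexp h (plusL h \<zeta>) \<odot> md h 1 (plusL h) m))"
    by (rule exchange[OF cur_plusL v, where ?c0.0 = "- exp \<zeta>" and ?c1.0 = 1])
      (auto simp: contr_plus_plus[where s = 1 and t = 1])
  then show ?thesis by (simp add: anti_def eqf_def oscale_def emode_def)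
qed

lemma fmode_fin: "rowfin (fmode h m)" "colfin (fmode h m)" and emode_fin: "rowfin (emode h m)" "colfin (emode h m)"
  using cmaj_fmode cmaj_emode by (auto simp: cmaj_def)

lemma homog_minus: "s \<in> {1, -1} \<Longrightarrow> homog (-1) (minusL h s)" and homog_plus: "homog 1 (plusL h)"
  using cur_minusL cur_plusL by (auto simp: cur_def)

text \<open>The current is fermionic: each mode anticommutes with the current at every point, hence
  with itself, and 2 f f = 0.\<close>

lemma fmode_sq: "eqf (fmode h m \<odot> fmode h m) 0"
proof -
  have "anti (fmode h m) (nexp h (minusL h t \<zeta>))" if "t \<in> {1, -1}" for t \<zeta>
    unfolding fmode_def by (intro anti_comb_mode anti_minus md_rowfin md_colfin) (use that in auto)
  then have 1: "anti (fmode h m) (md h (-1) (minusL h t) m)" if "t \<in> {1, -1}" for t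
    using that by (intro anti_md homog_minus fmode_fin) auto
  have "anti (fmode h m) (fmode h m)"
    by (subst (1) fmode_def, intro anti_comb_mode md_rowfin md_colfin anti_sym[OF 1]) auto
  then show ?thesis by (rule anti_self)
qed

lemma emode_sq: "eqf (emode h m \<odot> emode h m) 0"
proof -
  have "anti (emode h m) (md h 1 (plusL h) m)"
    by (intro anti_md homog_plus emode_fin anti_plus)
  then show ?thesis by (intro anti_self) (simp add: emode_def)
qed

text \<open>The contractions are the constants -1 and 1, so the residue in
  \<open>anticomm_delta\<close> is 0 and no delta function is left.\<close>

lemma anti_phi_e: "anti (emode h m) (nexp h (phiL h \<zeta>))"
proof -
  have v: "vtx h \<zeta> (phiL h \<zeta>)" using vfam_phiL by (simp add: vfam_def)
  have "eqf (md h 1 (plusL h) m \<odot> nexp h (phiL h \<zeta>) + nexp h (phiL h \<zeta>) \<odot> md h 1 (plusL h) m)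
     (oscale (0 * exp (- (of_int m * \<zeta>))) (nexp h (phiL h \<zeta> + plusL h \<zeta>)))"
    by (rule anticomm_delta[OF cur_plusL v, where ?a0.0 = "-1"]) (auto simp: contr_phi_plus contr_plus_phi)
  then show ?thesis by (simp add: anti_def eqf_def oscale_def emode_def eq_neg_iff_add_eq_0)
qed

text \<open>Both orders have their pole at w = q z, and its residue q^s - q^t vanishes when the two
  q-shifts agree.\<close>

lemma anticomm_psi_minus:
  assumes s: "s \<in> {1, -1}" and t: "t \<in> {1, -1}"
  shows "eqf (md h (-1) (minusL h s) m \<odot> nexp h (psiL h t \<zeta>) + nexp h (psiL h t \<zeta>) \<odot> md h (-1) (minusL h s) m)
     (oscale ((exp (s * h) - exp (t * h)) * exp (- (of_int m * (\<zeta> + h)))) (nexp h (psiL h t \<zeta> + minusL h s (\<zeta> + h))))"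
proof (rule anticomm_delta[OF cur_minusL[OF s], where ?a0.0 = "- exp (s * h)"])
  show "vtx h \<zeta> (psiL h t \<zeta>)" using vfam_psiL[OF t] by (simp add: vfam_def)
  have n: "\<bar>Re h\<bar> \<le> norm h" "0 \<le> norm h" by (simp_all add: abs_Re_le_cmod)
  fix \<omega>
  have e: "exp (\<omega> - (\<zeta> + h)) = exp \<omega> / (exp h * exp \<zeta>)" "exp (\<zeta> + h - \<omega>) = exp h * exp \<zeta> / exp \<omega>"
    by (simp_all add: exp_diff exp_add)
  {
    assume R: "Re \<zeta> > Re \<omega> + 2 * majH h"
    have "exp (\<zeta> + h) \<noteq> exp \<omega>" by (rule exp_neq_Re) (use R n in \<open>simp add: majH_def\<close>)
    then have ne: "exp h * exp \<zeta> - exp \<omega> \<noteq> 0" by (simp add: exp_add mult.commute)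
    show "contr h (psiL h t \<zeta>) (minusL h s \<omega>) = - exp (s * h) + (exp (s * h) - exp (t * h)) / (1 - exp (\<omega> - (\<zeta> + h)))"
      unfolding contr_psi_minus[OF R s t] e using ne by (simp add: field_simps)
  }
  {
    assume R: "Re \<omega> > Re \<zeta> + 2 * majH h"
    have "exp \<omega> \<noteq> exp (\<zeta> + h)" by (rule exp_neq_Re) (use R n in \<open>simp add: majH_def\<close>)
    then have ne: "exp \<omega> - exp h * exp \<zeta> \<noteq> 0" by (simp add: exp_add mult.commute)
    show "contr h (minusL h s \<omega>) (psiL h t \<zeta>) =
      - (exp (s * h) - exp (t * h)) - - exp (s * h) + (exp (s * h) - exp (t * h)) / (1 - exp (\<zeta> + h - \<omega>))"
      unfolding contr_minus_psi[OF R s t] e using ne by (simp add: field_simps)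
  }
qed simp

text \<open>For s and t different the delta functions do not vanish individually. At w = q z,
  however, the normally ordered operators for (s,t) = (1,-1) and (-1,1) coincide, and their residues
  are opposite; the two terms cancel in the double q-difference.\<close>

lemma anti_psi_f: "anti (fmode h m) (psi_op h \<zeta>)"
  unfolding anti_def eqf_def
proof (intro ballI)
  fix b' b assume b: "b' \<in> fock" "b \<in> fock"
  define d where "d s = md h (-1) (minusL h s) m" for s
  define N where "N t = nexp h (psiL h t \<zeta>)" for t
  have dfin: "rowfin (d s)" "colfin (d s)" for s by (simp_all add: d_def md_rowfin md_colfin)
  have L: "psiL h (-1) \<zeta> + minusL h 1 (\<zeta> + h) = psiL h 1 \<zeta> + minusL h (-1) (\<zeta> + h)"
  proof
    fix g show "(psiL h (-1) \<zeta> + minusL h 1 (\<zeta> + h)) g = (psiL h 1 \<zeta> + minusL h (-1) (\<zeta> + h)) g"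
    proof (cases g)
      case (Mode s n)
      then show ?thesis
        by (cases "n = 0"; cases s) (simp_all add: psiL_def minusL_def vx_def diff_divide_distrib add_divide_distrib add.commute)
    qed (simp add: psiL_def minusL_def vx_def)
  qed
  have D: "(d s \<odot> N t) b' b + (N t \<odot> d s) b' b = (exp (s * h) - exp (t * h)) * exp (- (of_int m * (\<zeta> + h))) * nexp h (psiL h t \<zeta> + minusL h s (\<zeta> + h)) b' b"
    if "s \<in> {1, -1}" "t \<in> {1, -1}" for s t
    using anticomm_psi_minus[OF that, of m \<zeta>] b by (simp add: eqf_def oscale_def d_def N_def)
  have "(d 1 \<odot> N 1) b' b + (N 1 \<odot> d 1) b' b = 0" "(d (-1) \<odot> N (-1)) b' b + (N (-1) \<odot> d (-1)) b' b = 0"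
    "(d 1 \<odot> N (-1)) b' b + (N (-1) \<odot> d 1) b' b + ((d (-1) \<odot> N 1) b' b + (N 1 \<odot> d (-1)) b' b) = 0"
  proof -
    define x where "x = exp (- (of_int m * (\<zeta> + h))) * nexp h (psiL h 1 \<zeta> + minusL h (-1) (\<zeta> + h)) b' b"
    have x: "(d 1 \<odot> N (-1)) b' b + (N (-1) \<odot> d 1) b' b = (exp h - exp (- h)) * x"
      "(d (-1) \<odot> N 1) b' b + (N 1 \<odot> d (-1)) b' b = (exp (- h) - exp h) * x"
      using D[of 1 "-1"] D[of "-1" 1] by (simp_all add: L x_def mult.assoc)
    show "(d 1 \<odot> N (-1)) b' b + (N (-1) \<odot> d 1) b' b + ((d (-1) \<odot> N 1) b' b + (N 1 \<odot> d (-1)) b' b) = 0"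
      unfolding x by (simp add: algebra_simps)
  qed (use D[of 1 1] D[of "-1" "-1"] in simp_all)
  then have z: "(d 1 \<odot> N 1) b' b = - (N 1 \<odot> d 1) b' b" "(d (-1) \<odot> N (-1)) b' b = - (N (-1) \<odot> d (-1)) b' b"
    "(d 1 \<odot> N (-1)) b' b = - (N (-1) \<odot> d 1) b' b - (d (-1) \<odot> N 1) b' b - (N 1 \<odot> d (-1)) b' b"
    by (simp_all add: algebra_simps eq_neg_iff_add_eq_0)
  show "(fmode h m \<odot> psi_op h \<zeta>) b' b = oscale (-1) (psi_op h \<zeta> \<odot> fmode h m) b' b"
    unfolding fmode_def psi_op_def d_def[symmetric] N_def[symmetric] oscale_def[of "-1"]
      row_comb_left[OF b dfin(1) dfin(1)] row_comb_right[OF b dfin(1)] col_comb_right[OF b dfin(2) dfin(2)] col_comb_left[OF b dfin(2)] z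
    by (simp add: algebra_simps)
qed

text \<open>The residue exp(- \<eta>) at the pole is compensated by the power of w belonging to the
  mode index -1.\<close>

lemma anticomm_plus_minus:
  assumes s: "s \<in> {1, -1}"
  shows "eqf (emode h (-1) \<odot> nexp h (minusL h s \<zeta>) + nexp h (minusL h s \<zeta>) \<odot> emode h (-1)) (nexp h (minusL h s \<zeta> + plusL h (\<zeta> + s * h)))"
proof -
  let ?\<eta> = "\<zeta> + s * h"
  have v: "vtx h \<zeta> (minusL h s \<zeta>)" using cur_minusL[OF s] by (simp add: cur_def)
  have n: "\<bar>Re h\<bar> \<le> norm h" "0 \<le> norm h" "Re (s * h) = Re h \<or> Re (s * h) = - Re h" using s by (auto simp: abs_Re_le_cmod)
  have "eqf (md h 1 (plusL h) (-1) \<odot> nexp h (minusL h s \<zeta>) + nexp h (minusL h s \<zeta>) \<odot> md h 1 (plusL h) (-1))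
     (oscale (exp (- ?\<eta>) * exp (- (of_int (-1) * ?\<eta>))) (nexp h (minusL h s \<zeta> + plusL h ?\<eta>)))"
  proof (rule anticomm_delta[OF cur_plusL v, where ?a0.0 = 0])
    show "norm (\<zeta> + s * h - \<zeta>) \<le> 2 * norm h" using s by auto
    fix \<omega>
    have e: "exp (\<omega> - (\<zeta> + s * h)) = exp \<omega> / (exp (s * h) * exp \<zeta>)" "exp (\<zeta> + s * h - \<omega>) = exp (s * h) * exp \<zeta> / exp \<omega>"
      "exp (- (\<zeta> + s * h)) = 1 / (exp (s * h) * exp \<zeta>)"
      by (simp_all add: exp_diff exp_add exp_minus divide_inverse)
    {
      assume R: "Re \<zeta> > Re \<omega> + 2 * majH h"
      have "exp (\<zeta> + s * h) \<noteq> exp \<omega>" by (rule exp_neq_Re) (use R n in \<open>auto simp: majH_def\<close>)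
      then have ne: "exp (s * h) * exp \<zeta> - exp \<omega> \<noteq> 0" by (simp add: exp_add mult.commute)
      show "contr h (minusL h s \<zeta>) (plusL h \<omega>) = 0 + exp (- (\<zeta> + s * h)) / (1 - exp (\<omega> - (\<zeta> + s * h)))"
        unfolding contr_minus_plus[OF R s s] e using ne by (simp add: field_simps)
    }
    {
      assume R: "Re \<omega> > Re \<zeta> + 2 * majH h"
      have "exp \<omega> \<noteq> exp (\<zeta> + s * h)" by (rule exp_neq_Re) (use R n in \<open>auto simp: majH_def\<close>)
      then have ne: "exp \<omega> - exp (s * h) * exp \<zeta> \<noteq> 0" by (simp add: exp_add mult.commute)
      show "contr h (plusL h \<omega>) (minusL h s \<zeta>) = - exp (- (\<zeta> + s * h)) - 0 + exp (- (\<zeta> + s * h)) / (1 - exp (\<zeta> + s * h - \<omega>))"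
        unfolding contr_plus_minus[OF R s s] e using ne by (simp add: field_simps)
    }
  qed
  also have "exp (- ?\<eta>) * exp (- (of_int (-1) * ?\<eta>)) = 1" by (simp flip: exp_add)
  finally have "eqf (md h 1 (plusL h) (-1) \<odot> nexp h (minusL h s \<zeta>) + nexp h (minusL h s \<zeta>) \<odot> md h 1 (plusL h) (-1))
     (oscale 1 (nexp h (minusL h s \<zeta> + plusL h ?\<eta>)))" .
  moreover have "oscale 1 A = A" for A by (simp add: oscale_def)
  ultimately show ?thesis by (simp only: emode_def)
qed

text \<open>At the merged point all momenta and the oscillators of \<open>c\<close> cancel. Of the
  other oscillators the creation part cancels for s = 1 and the annihilation part for s = -1, so the
  part of degree 0 is diagonal; the zero modes give q to the power s A^1_0.\<close>

lemma md_plus_minus: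
  assumes s: "s \<in> {1, -1}" and b: "b' \<in> fock" "b \<in> fock"
  shows "md h 0 (\<lambda>\<zeta>. minusL h s \<zeta> + plusL h (\<zeta> + s * h)) 0 b' b = diagop (\<lambda>b. exp (s * h * (fst b Ba1 + fst b Ba2))) b' b"
proof -
  let ?L = "minusL h s 0 + plusL h (s * h)"
  have Q: "?L (Q g) = 0" for g by (cases g) (simp_all add: minusL_def plusL_def vx_def)
  have z: "zer ?L \<mu> = exp (s * h * (\<mu> Ba1 + \<mu> Ba2))" for \<mu>
    by (simp add: zer_def minusL_def plusL_def vx_def algebra_simps)
  have e: "exp (- (of_nat n * h / 2)) * exp (of_nat n * h) = exp (of_nat n * h / 2)" for n
    unfolding exp_add[symmetric] by (rule arg_cong[where f = exp]) (simp add: field_simps)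
  have "cre ?L = (\<lambda>_. 0) \<or> ann h ?L = (\<lambda>_. 0)"
  proof (cases "s = 1")
    case True
    have "cre ?L x = 0" for x
    proof (cases x)
      case (Pair g n)
      then show ?thesis
        by (cases g) (simp_all add: True cre_def minusL_def plusL_def vx_def e flip: diff_divide_distrib add_divide_distrib)
    qed
    then show ?thesis by auto
  next
    case False
    then have s': "s = -1" using s by auto
    have "ann h ?L x = 0" for x
    proof (cases x)
      case (Pair g n)
      then show ?thesis
        by (cases g) (simp_all add: s' ann_def minusL_def plusL_def vx_def e flip: diff_divide_distrib add_divide_distrib)
    qed
    then show ?thesis by auto
  qed
  moreover have "pos_mset (snd b')" "pos_mset (snd b)" using b by (cases b', cases b, simp add: fock_iff)+
  ultimately have g: "gmat (cre ?L) (ann h ?L) (snd b') (snd b) = (if snd b' = snd b then 1 else 0)" if "energy (snd b') = energy (snd b)"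
    using that by (intro gmat_energy) auto
  have "nexp h ?L b' b = diagop (\<lambda>b. exp (s * h * (fst b Ba1 + fst b Ba2))) b' b" if "energy (snd b') = energy (snd b)"
    unfolding nexp_eq[OF b] vop_def g[OF that] Q z by (auto simp: diagop_def prod_eq_iff)
  moreover have "diagop (\<lambda>b. exp (s * h * (fst b Ba1 + fst b Ba2))) b' b = 0" if "energy (snd b') \<noteq> energy (snd b)"
    using that by (auto simp: diagop_def)
  ultimately show ?thesis by (auto simp: md_def deg_def)
qed

text \<open>Integrating the delta function relation over the remaining point gives q^A and q^(-A),
  with A = A^1_0, for the two terms of the q-derivative; their difference is the q-integer.\<close>

lemma anticomm_e_f: "eqf (Kop h 1 1) (emode h (-1) \<odot> fmode h 0 + fmode h 0 \<odot> emode h (-1))"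
  unfolding eqf_def
proof (intro ballI)
  fix b' b assume b: "b' \<in> fock" "b \<in> fock"
  let ?e = "emode h (-1)"
  define d where "d s = md h (-1) (minusL h s) 0" for s
  have dfin: "rowfin (d s)" "colfin (d s)" for s by (simp_all add: d_def md_rowfin md_colfin)
  have *: "(?e \<odot> d s) b' b + (d s \<odot> ?e) b' b = diagop (\<lambda>b. exp (s * h * (fst b Ba1 + fst b Ba2))) b' b"
    if s: "s \<in> {1, -1}" for s
  proof -
    have h0: "homog 0 (\<lambda>\<zeta>. minusL h s \<zeta> + plusL h (\<zeta> + s * h))"
      unfolding homog_def
      by (auto simp: minusL_def plusL_def vx_def exp_add[symmetric] algebra_simps diff_divide_distrib add_divide_distrib split: boson.split)
    have "(?e \<odot> d s) b' b + (d s \<odot> ?e) b' b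
       = cint 0 0 (\<lambda>\<zeta>. (?e \<odot> nexp h (minusL h s \<zeta>)) b' b) + cint 0 0 (\<lambda>\<zeta>. (nexp h (minusL h s \<zeta>) \<odot> ?e) b' b)"
      unfolding d_def by (simp only: md_cint_right[OF homog_minus[OF s] emode_fin(1) b] md_cint_left[OF homog_minus[OF s] emode_fin(2) b])
    also have "\<dots> = cint 0 0 (\<lambda>\<zeta>. (?e \<odot> nexp h (minusL h s \<zeta>)) b' b + (nexp h (minusL h s \<zeta>) \<odot> ?e) b' b)"
      by (rule cint_add[symmetric]) (rule continuous_md[OF homog_minus[OF s] b], rule emode_fin)+
    also have "\<dots> = cint 0 0 (\<lambda>\<zeta>. nexp h (minusL h s \<zeta> + plusL h (\<zeta> + s * h)) b' b)"
      by (rule cint_cong) (use anticomm_plus_minus[OF s] b in \<open>simp add: eqf_def\<close>)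
    also have "\<dots> = diagop (\<lambda>b. exp (s * h * (fst b Ba1 + fst b Ba2))) b' b"
      unfolding cint_nexp[OF h0 b] by (rule md_plus_minus[OF s b])
    finally show ?thesis .
  qed
  have "(?e \<odot> fmode h 0 + fmode h 0 \<odot> ?e) b' b
     = 1 / (exp h - exp (- h)) * (((?e \<odot> d 1) b' b + (d 1 \<odot> ?e) b' b) - ((?e \<odot> d (-1)) b' b + (d (-1) \<odot> ?e) b' b))"
    unfolding fmode_def d_def[symmetric] plus_fun_def row_comb_left[OF b dfin(1) dfin(1)] col_comb_right[OF b dfin(2) dfin(2)]
    by (simp only: algebra_simps)
  also have "\<dots> = Kop h 1 1 b' b" by (simp add: * Kop_def diagop_def diff_divide_distrib)
  finally show "Kop h 1 1 b' b = (?e \<odot> fmode h 0 + fmode h 0 \<odot> ?e) b' b" ..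
qed

end

definition shifts :: "complex \<Rightarrow> oper \<Rightarrow> bool" where
  "shifts e S \<longleftrightarrow> (\<forall>b'\<in>fock. \<forall>b\<in>fock. S b' b \<noteq> 0 \<longrightarrow> fst b' Ba1 + fst b' Ba2 = fst b Ba1 + fst b Ba2 + e)"

lemma shifts_nexp: "L (Q Ba1) + L (Q Ba2) = e \<Longrightarrow> shifts e (nexp h L)"
  unfolding shifts_def
proof (intro ballI impI)
  fix b' b assume "L (Q Ba1) + L (Q Ba2) = e" "b' \<in> fock" "b \<in> fock" "nexp h L b' b \<noteq> 0"
  then show "fst b' Ba1 + fst b' Ba2 = fst b Ba1 + fst b Ba2 + e"
    using nexp_shift[of b' b h L] by (simp add: algebra_simps)
qed

lemma shifts_comb: "shifts e A \<Longrightarrow> shifts e B \<Longrightarrow> shifts e (oscale x (A - B))"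
  and shifts_oscale: "shifts e A \<Longrightarrow> shifts e (oscale x A)"
  unfolding shifts_def oscale_def by force+

lemma Kop_comm:
  assumes "shifts e S"
  shows "eqf (Kop h x y \<odot> S) (S \<odot> Kop h (x * exp (h * e)) (y * exp (- (h * e))))"
  unfolding eqf_def
proof (intro ballI)
  fix b' b assume b: "b' \<in> fock" "b \<in> fock"
  show "(Kop h x y \<odot> S) b' b = (S \<odot> Kop h (x * exp (h * e)) (y * exp (- (h * e)))) b' b"
  proof (cases "S b' b = 0")
    case False
    then have "fst b' Ba1 + fst b' Ba2 = fst b Ba1 + fst b Ba2 + e" using assms b by (auto simp: shifts_def)
    moreover have "exp (h * (m + e)) = exp (h * m) * exp (h * e)" "exp (- (h * (m + e))) = exp (- (h * m)) * exp (- (h * e))" for m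
      unfolding exp_add[symmetric] by (simp_all add: algebra_simps)
    ultimately show ?thesis
      unfolding Kop_def diagop_left[OF b(1)] diagop_right[OF b(2)] by (simp only: mult_ac)
  qed (simp add: Kop_def diagop_left diagop_right b)
qed

lemma Kop_fin: "rowfin (Kop h x y)" "colfin (Kop h x y)"
  unfolding Kop_def by (rule diagop_fin)+

definition exch :: "complex \<Rightarrow> complex \<Rightarrow> complex \<Rightarrow> complex \<Rightarrow> oper \<Rightarrow> oper \<Rightarrow> oper \<Rightarrow> bool" where
  "exch \<alpha> \<beta> \<gamma> \<delta> f' f S \<longleftrightarrow> eqf (oscale \<alpha> (f' \<odot> S) + oscale (- \<beta>) (f \<odot> S)) (oscale (- \<gamma>) (S \<odot> f') + oscale \<delta> (S \<odot> f))"

lemma exch_comb_mode: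
  assumes "exch \<alpha> \<beta> \<gamma> \<delta> f' f S" "exch \<alpha> \<beta> \<gamma> \<delta> g' g S"
    and "rowfin f" "colfin f" "rowfin f'" "colfin f'" "rowfin g" "colfin g" "rowfin g'" "colfin g'"
  shows "exch \<alpha> \<beta> \<gamma> \<delta> (oscale x (f' - g')) (oscale x (f - g)) S"
  unfolding exch_def eqf_def
proof (intro ballI)
  fix b' b assume b: "b' \<in> fock" "b \<in> fock"
  have 1: "\<alpha> * (f' \<odot> S) b' b - \<beta> * (f \<odot> S) b' b = - \<gamma> * (S \<odot> f') b' b + \<delta> * (S \<odot> f) b' b"
    "\<alpha> * (g' \<odot> S) b' b - \<beta> * (g \<odot> S) b' b = - \<gamma> * (S \<odot> g') b' b + \<delta> * (S \<odot> g) b' b"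
    using assms(1,2) b by (simp_all add: exch_def eqf_def oscale_def)
  have "\<alpha> * (x * (F' - G')) + - \<beta> * (x * (F - G)) = x * ((\<alpha> * F' - \<beta> * F) - (\<alpha> * G' - \<beta> * G))" for F' G' F G
    by (simp add: algebra_simps)
  moreover have "- \<gamma> * (x * (F' - G')) + \<delta> * (x * (F - G)) = x * ((- \<gamma> * F' + \<delta> * F) - (- \<gamma> * G' + \<delta> * G))" for F' G' F G
    by (simp add: algebra_simps)
  ultimately show "(oscale \<alpha> (oscale x (f' - g') \<odot> S) + oscale (- \<beta>) (oscale x (f - g) \<odot> S)) b' b =
     (oscale (- \<gamma>) (S \<odot> oscale x (f' - g')) + oscale \<delta> (S \<odot> oscale x (f - g))) b' b"
    unfolding plus_fun_def oscale_def[of \<alpha>] oscale_def[of "- \<beta>"] oscale_def[of "- \<gamma>"] oscale_def[of \<delta>]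
      row_comb_left[OF b assms(3,7)] row_comb_left[OF b assms(5,9)] col_comb_right[OF b assms(4,8)] col_comb_right[OF b assms(6,10)]
    by (simp only: 1)
qed

lemma exch_comb_op:
  assumes "exch \<alpha> \<beta> \<gamma> \<delta> f' f S" "exch \<alpha> \<beta> \<gamma> \<delta> f' f T"
    and "rowfin f" "colfin f" "rowfin f'" "colfin f'"
  shows "exch \<alpha> \<beta> \<gamma> \<delta> f' f (oscale x (S - T))"
  unfolding exch_def eqf_def
proof (intro ballI)
  fix b' b assume b: "b' \<in> fock" "b \<in> fock"
  have 1: "\<alpha> * (f' \<odot> S) b' b - \<beta> * (f \<odot> S) b' b = - \<gamma> * (S \<odot> f') b' b + \<delta> * (S \<odot> f) b' b"
    "\<alpha> * (f' \<odot> T) b' b - \<beta> * (f \<odot> T) b' b = - \<gamma> * (T \<odot> f') b' b + \<delta> * (T \<odot> f) b' b"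
    using assms(1,2) b by (simp_all add: exch_def eqf_def oscale_def)
  have "\<alpha> * (x * (F' - G')) + - \<beta> * (x * (F - G)) = x * ((\<alpha> * F' - \<beta> * F) - (\<alpha> * G' - \<beta> * G))" for F' G' F G
    by (simp add: algebra_simps)
  moreover have "- \<gamma> * (x * (F' - G')) + \<delta> * (x * (F - G)) = x * ((- \<gamma> * F' + \<delta> * F) - (- \<gamma> * G' + \<delta> * G))" for F' G' F G
    by (simp add: algebra_simps)
  ultimately show "(oscale \<alpha> (f' \<odot> oscale x (S - T)) + oscale (- \<beta>) (f \<odot> oscale x (S - T))) b' b =
     (oscale (- \<gamma>) (oscale x (S - T) \<odot> f') + oscale \<delta> (oscale x (S - T) \<odot> f)) b' b"
    unfolding plus_fun_def oscale_def[of \<alpha>] oscale_def[of "- \<beta>"] oscale_def[of "- \<gamma>"] oscale_def[of \<delta>]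
      row_comb_right[OF b assms(3)] row_comb_right[OF b assms(5)] col_comb_left[OF b assms(4)] col_comb_left[OF b assms(6)]
    by (simp only: 1)
qed

lemma cprod_G_ex:
  assumes L: "vfam h L1" "vfam h L3" and X: "cur h \<epsilon> X" and k: "sepmer \<kappa>"
    and c: "\<And>\<zeta>1 \<zeta>2. Re \<zeta>1 > Re \<zeta>2 + 2 * majH h \<Longrightarrow> contr h (L1 \<zeta>1) (L3 \<zeta>2) = \<kappa> \<zeta>1 \<zeta>2"
    and cL: "\<exists>a0 a1 p. \<forall>\<zeta> \<omega>. Re \<zeta> > Re \<omega> + 2 * majH h \<longrightarrow> contr h (L1 \<zeta>) (X \<omega>) = a0 + a1 / (1 - exp (p - \<zeta>) * exp \<omega>)"
    and cR: "\<exists>b0 b1 q. \<forall>\<zeta> \<omega>. Re \<omega> > Re \<zeta> + 2 * majH h \<longrightarrow> contr h (X \<omega>) (L3 \<zeta>) = b0 + b1 / (1 - exp (q + \<zeta>) * exp (- \<omega>))"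
  shows "\<exists>G. cprod (\<lambda>\<zeta>. nexp h (L1 \<zeta>)) (\<lambda>\<zeta>. md h \<epsilon> X m \<odot> nexp h (L3 \<zeta>)) G"
proof -
  obtain a0 a1 p where a: "\<And>\<zeta> \<omega>. Re \<zeta> > Re \<omega> + 2 * majH h \<Longrightarrow> contr h (L1 \<zeta>) (X \<omega>) = a0 + a1 / (1 - exp (p - \<zeta>) * exp \<omega>)" using cL by blast
  obtain b0 b1 q where b: "\<And>\<zeta> \<omega>. Re \<omega> > Re \<zeta> + 2 * majH h \<Longrightarrow> contr h (X \<omega>) (L3 \<zeta>) = b0 + b1 / (1 - exp (q + \<zeta>) * exp (- \<omega>))" using cR by blast
  obtain G where "contd (\<lambda>\<zeta>1 \<zeta>2. nexp h (L1 \<zeta>1) \<odot> (md h \<epsilon> X m \<odot> nexp h (L3 \<zeta>2))) G"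
    using contd_G[OF L X k sepmer_const sepmer_const c a b] by blast
  then show ?thesis
    using cprod_words[OF vfam_vmaj[OF L(1)] vfam_vmaj[OF L(2)] md_cmaj[OF X]] by blast
qed

context generic
begin

lemma shifts_phi: "shifts (-1) (nexp h (phiL h \<zeta>))"
  by (rule shifts_nexp) (simp add: phiL_def vx_def)

lemma shifts_psi: "shifts 1 (psi_op h \<zeta>)"
  unfolding psi_op_def by (intro shifts_comb shifts_nexp) (simp_all add: psiL_def vx_def)

text \<open>The clearing factors q (w - z) and q^2 z - w are dictated by the poles: w = z in the
  order current, vertex operator, and w = q^2 z in the other one. They serve both terms of the
  q-derivative, although in each order one of the two contractions is constant. Only c1 depends on
  \<open>s\<close>, so the relation passes to the difference.\<close>

lemma exch_phi: "exch (exp h) (exp h * exp \<zeta>) 1 (exp h * exp h * exp \<zeta>) (fmode h (m - 1)) (fmode h m) (nexp h (phiL h \<zeta>))"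
proof -
  have v: "vtx h \<zeta> (phiL h \<zeta>)" using vfam_phiL by (simp add: vfam_def)
  have n: "\<bar>Re h\<bar> \<le> norm h" "0 \<le> norm h" by (simp_all add: abs_Re_le_cmod)
  have q: "exp h \<noteq> 0" "exp (- h) = 1 / exp h" by (simp_all add: exp_minus divide_inverse)
  have A: "- 1 * exp \<omega> + exp h * exp h * exp \<zeta> \<noteq> 0" "exp \<zeta> * exp h - exp \<omega> * exp h \<noteq> 0" if "Re \<zeta> > Re \<omega> + 2 * majH h" for \<omega>
  proof -
    have "exp \<omega> \<noteq> exp \<zeta> * exp h * exp h" "exp \<omega> \<noteq> exp \<zeta>" unfolding exp_add[symmetric] by (rule exp_neq_Re[symmetric]; use that n in \<open>simp add: majH_def\<close>)+
    then show "- 1 * exp \<omega> + exp h * exp h * exp \<zeta> \<noteq> 0" "exp \<zeta> * exp h - exp \<omega> * exp h \<noteq> 0" by (simp_all add: algebra_simps)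
  qed
  have B: "exp h * exp \<omega> + - (exp h * exp \<zeta>) \<noteq> 0" "exp \<omega> - exp h * exp h * exp \<zeta> \<noteq> 0" if "Re \<omega> > Re \<zeta> + 2 * majH h" for \<omega>
  proof -
    have "exp \<omega> \<noteq> exp \<zeta> * exp h * exp h" "exp \<omega> \<noteq> exp \<zeta>" unfolding exp_add[symmetric] by (rule exp_neq_Re; use that n in \<open>simp add: majH_def\<close>)+
    then show "exp h * exp \<omega> + - (exp h * exp \<zeta>) \<noteq> 0" "exp \<omega> - exp h * exp h * exp \<zeta> \<noteq> 0" by (simp_all add: algebra_simps)
  qed
  have "exch (exp h) (exp h * exp \<zeta>) 1 (exp h * exp h * exp \<zeta>) (md h (-1) (minusL h s) (m - 1)) (md h (-1) (minusL h s) m) (nexp h (phiL h \<zeta>))"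
    if s: "s \<in> {1, -1}" for s
    unfolding exch_def
  proof (rule exchange[OF cur_minusL[OF s] v, where ?c0.0 = "- exp h * exp h * exp \<zeta>" and ?c1.0 = "if s = 1 then 1 else exp h * exp h"]; intro conjI)
    fix \<omega>
    {
      assume R: "Re \<zeta> > Re \<omega> + 2 * majH h"
      show "contr h (phiL h \<zeta>) (minusL h s \<omega>) * (- 1 * exp \<omega> + exp h * exp h * exp \<zeta>)
         = - exp h * exp h * exp \<zeta> + (if s = 1 then 1 else exp h * exp h) * exp \<omega>"
      proof (cases "s = 1")
        case True
        then show ?thesis unfolding contr_phi_minus[OF R s s] using A[OF R] by (simp add: field_simps)
      next
        case False
        then have "s = -1" using s by auto
        then show ?thesis unfolding contr_phi_minus[OF R s s] using A[OF R] q(1) by (simp add: q(2) divide_simps; simp add: algebra_simps)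
      qed
      show "- 1 * exp \<omega> + exp h * exp h * exp \<zeta> \<noteq> 0" by (rule A[OF R])
    }
    {
      assume R: "Re \<omega> > Re \<zeta> + 2 * majH h"
      show "contr h (minusL h s \<omega>) (phiL h \<zeta>) * (exp h * exp \<omega> + - (exp h * exp \<zeta>))
         = - exp h * exp h * exp \<zeta> + (if s = 1 then 1 else exp h * exp h) * exp \<omega>"
      proof (cases "s = 1")
        case True
        then show ?thesis unfolding contr_minus_phi[OF R s s] using B[OF R] by (simp add: field_simps)
      next
        case False
        then have "s = -1" using s by auto
        then show ?thesis unfolding contr_minus_phi[OF R s s] using B[OF R] q(1) by (simp add: q(2) divide_simps; simp add: algebra_simps)
      qed
      show "exp h * exp \<omega> + - (exp h * exp \<zeta>) \<noteq> 0" by (rule B[OF R])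
    }
  qed
  then show ?thesis unfolding fmode_def by (intro exch_comb_mode md_rowfin md_colfin) auto
qed

text \<open>Here the poles are at w = q^2 z and w = z, cleared by w/q - q z and z - w. The
  q-derivative now sits in the vertex operator, so the relation is combined over \<open>t\<close>
  with the modes held fixed.\<close>

lemma exch_psi: "exch (1 / exp h) (exp h * exp \<zeta>) 1 (exp \<zeta>) (emode h (m - 1)) (emode h m) (psi_op h \<zeta>)"
proof -
  have n: "\<bar>Re h\<bar> \<le> norm h" "0 \<le> norm h" by (simp_all add: abs_Re_le_cmod)
  have q: "exp h \<noteq> 0" "exp (- h) = 1 / exp h" by (simp_all add: exp_minus divide_inverse)
  have A: "- 1 * exp \<omega> + exp \<zeta> \<noteq> 0" "exp h * exp h * exp \<zeta> - exp \<omega> \<noteq> 0" if "Re \<zeta> > Re \<omega> + 2 * majH h" for \<omega>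
  proof -
    have "exp \<omega> \<noteq> exp \<zeta> * exp h * exp h" "exp \<omega> \<noteq> exp \<zeta>" unfolding exp_add[symmetric] by (rule exp_neq_Re[symmetric]; use that n in \<open>simp add: majH_def\<close>)+
    then show "- 1 * exp \<omega> + exp \<zeta> \<noteq> 0" "exp h * exp h * exp \<zeta> - exp \<omega> \<noteq> 0" by (simp_all add: algebra_simps)
  qed
  have B: "1 / exp h * exp \<omega> + - (exp h * exp \<zeta>) \<noteq> 0" "exp \<omega> - exp h * exp h * exp \<zeta> \<noteq> 0" "exp \<omega> - exp \<zeta> \<noteq> 0" if "Re \<omega> > Re \<zeta> + 2 * majH h" for \<omega>
  proof -
    have "exp \<omega> \<noteq> exp \<zeta> * exp h * exp h" "exp \<omega> \<noteq> exp \<zeta>" unfolding exp_add[symmetric] by (rule exp_neq_Re; use that n in \<open>simp add: majH_def\<close>)+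
    then show "1 / exp h * exp \<omega> + - (exp h * exp \<zeta>) \<noteq> 0" "exp \<omega> - exp h * exp h * exp \<zeta> \<noteq> 0" "exp \<omega> - exp \<zeta> \<noteq> 0" by (simp_all add: field_simps)
  qed
  have "exch (1 / exp h) (exp h * exp \<zeta>) 1 (exp \<zeta>) (md h 1 (plusL h) (m - 1)) (md h 1 (plusL h) m) (nexp h (psiL h t \<zeta>))"
    if t: "t \<in> {1, -1}" for t
    unfolding exch_def
  proof (rule exchange[OF cur_plusL, where ?c0.0 = "if t = 1 then - exp \<zeta> / exp h else - exp h * exp \<zeta>" and ?c1.0 = "1 / exp h"]; (intro conjI)?)
    show "vtx h \<zeta> (psiL h t \<zeta>)" using vfam_psiL[OF t] by (simp add: vfam_def)
    fix \<omega>
    {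
      assume R: "Re \<zeta> > Re \<omega> + 2 * majH h"
      show "contr h (psiL h t \<zeta>) (plusL h \<omega>) * (- 1 * exp \<omega> + exp \<zeta>)
         = (if t = 1 then - exp \<zeta> / exp h else - exp h * exp \<zeta>) + 1 / exp h * exp \<omega>"
      proof (cases "t = 1")
        case True
        then show ?thesis unfolding contr_psi_plus[OF R t t] using A[OF R] q(1) by (simp add: q(2) divide_simps; simp add: algebra_simps)
      next
        case False
        then have "t = -1" using t by auto
        then show ?thesis unfolding contr_psi_plus[OF R t t] using A[OF R] q(1) by (simp add: q(2) divide_simps; simp add: algebra_simps)
      qed
      show "- 1 * exp \<omega> + exp \<zeta> \<noteq> 0" by (rule A[OF R])
    }
    {
      assume R: "Re \<omega> > Re \<zeta> + 2 * majH h"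
      show "contr h (plusL h \<omega>) (psiL h t \<zeta>) * (1 / exp h * exp \<omega> + - (exp h * exp \<zeta>))
         = (if t = 1 then - exp \<zeta> / exp h else - exp h * exp \<zeta>) + 1 / exp h * exp \<omega>"
      proof (cases "t = 1")
        case True
        then show ?thesis unfolding contr_plus_psi[OF R t t] using B[OF R] q(1) by (simp add: q(2) divide_simps; simp add: algebra_simps)
      next
        case False
        then have "t = -1" using t by auto
        then show ?thesis unfolding contr_plus_psi[OF R t t] using B[OF R] q(1) by (simp add: q(2) divide_simps)
      qed
      show "1 / exp h * exp \<omega> + - (exp h * exp \<zeta>) \<noteq> 0" by (rule B[OF R])
    }
  qed
  then show ?thesis unfolding psi_op_def emode_def by (intro exch_comb_op md_rowfin md_colfin) auto
qed

end

section \<open>Continued products of the components\<close>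

lemma tendsto_l:
  assumes xs: "\<forall>(c, d)\<in>set xs. sephol c"
  shows tendsto_lcoef: "((\<lambda>\<xi>. lcoef xs m \<xi> y) \<longlongrightarrow> lcoef xs m x y) (at x)"
    and tendsto_lle: "(C \<longlongrightarrow> c) (at x) \<Longrightarrow> ((\<lambda>\<xi>. lle xs m (C \<xi>) \<xi> y) \<longlongrightarrow> lle xs m c x y) (at x)"
    and tendsto_lge: "((\<lambda>\<xi>. lge xs m c \<xi> y) \<longlongrightarrow> lge xs m c x y) (at x)"
proof -
  have t: "((\<lambda>\<xi>. fst p \<xi> y) \<longlongrightarrow> fst p x y) (at x)" if "p \<in> set xs" for p
  proof -
    have "sephol (fst p)" using bspec[OF xs that] by (simp add: case_prod_unfold)
    then have "(\<lambda>\<xi>. fst p \<xi> y) holomorphic_on UNIV" by (simp add: sephol_def)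
    then have "continuous_on UNIV (\<lambda>\<xi>. fst p \<xi> y)" by (rule holomorphic_on_imp_continuous_on)
    then show ?thesis by (simp add: continuous_on_def)
  qed
  have s: "((\<lambda>\<xi>. \<Sum>p\<leftarrow>zs. F p \<xi>) \<longlongrightarrow> (\<Sum>p\<leftarrow>zs. F' p)) (at x)" if "\<And>p. p \<in> set zs \<Longrightarrow> (F p \<longlongrightarrow> F' p) (at x)"
    for zs :: lp and F :: "_ \<Rightarrow> complex \<Rightarrow> complex" and F'
    using that by (induction zs) (auto intro!: tendsto_add)
  show "((\<lambda>\<xi>. lcoef xs m \<xi> y) \<longlongrightarrow> lcoef xs m x y) (at x)"
    unfolding lcoef_def case_prod_unfold by (rule s) (use t in auto)
  show "((\<lambda>\<xi>. lle xs m (C \<xi>) \<xi> y) \<longlongrightarrow> lle xs m c x y) (at x)" if "(C \<longlongrightarrow> c) (at x)"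
    unfolding lle_def case_prod_unfold by (rule s) (use t that in \<open>auto intro!: tendsto_intros\<close>)
  show "((\<lambda>\<xi>. lge xs m c \<xi> y) \<longlongrightarrow> lge xs m c x y) (at x)"
    unfolding lge_def case_prod_unfold by (rule s) (use t in \<open>auto intro!: tendsto_intros\<close>)
qed

lemma nexp_zero: "b' \<in> fock \<Longrightarrow> b \<in> fock \<Longrightarrow> nexp h 0 b' b = oid b' b"
proof -
  assume b: "b' \<in> fock" "b \<in> fock"
  have "cre 0 = (\<lambda>_. 0)" "ann h 0 = (\<lambda>_. 0)" by (auto simp: cre_def ann_def)
  then show ?thesis unfolding nexp_eq[OF b] vop_def by (auto simp: gmat_zero zer_def oid_def prod_eq_iff)
qed

definition P_phi :: "complex \<Rightarrow> complex \<Rightarrow> complex \<Rightarrow> oper" where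
  "P_phi h x y = oscale (- ((exp h * exp x - exp h * exp y) / (exp h * exp x - exp h * exp h * exp h * exp y) /
     (exp h * exp h * exp x - exp h * exp h * exp y))) (nexp h (phiL h x + phiL h y))"

definition P_dual :: "complex \<Rightarrow> complex \<Rightarrow> complex \<Rightarrow> oper" where
  "P_dual h x y = oscale (exp h * exp h * (exp x - exp y)) (nexp h (phiL h x + dualL h y))"

definition psi_coef :: "complex \<Rightarrow> complex \<Rightarrow> complex" where
  "psi_coef h x = 1 / ((exp h - exp (- h)) * exp x)"

text \<open>The contribution of the shift by q^s in the left and by q^t in the right
  q-derivative.\<close>

definition PN_psi :: "complex \<Rightarrow> complex \<Rightarrow> complex \<Rightarrow> complex \<Rightarrow> complex \<Rightarrow> oper" where
  "PN_psi h s t x y = oscale (- ((exp (s * h) * exp h * exp x - exp (t * h) * exp h * exp y) /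
     (exp h * exp x - exp y / exp h) / (exp x - exp y))) (nexp h (psiL h s x + psiL h t y))"

definition P_psi :: "complex \<Rightarrow> complex \<Rightarrow> complex \<Rightarrow> oper" where
  "P_psi h x y = oscale (psi_coef h x) (oscale (psi_coef h y) (PN_psi h 1 1 x y - PN_psi h 1 (-1) x y)
     - oscale (psi_coef h y) (PN_psi h (-1) 1 x y - PN_psi h (-1) (-1) x y))"

definition PN_psi_phi :: "complex \<Rightarrow> complex \<Rightarrow> complex \<Rightarrow> complex \<Rightarrow> oper" where
  "PN_psi_phi h t x y = oscale (- ((exp h * exp x - exp h * exp h * exp y) * (exp x - exp h * exp y) /
     (exp (t * h) * exp h * exp x - exp h * exp y))) (nexp h (psiL h t x + phiL h y))"

definition PN_phi_psi :: "complex \<Rightarrow> complex \<Rightarrow> complex \<Rightarrow> complex \<Rightarrow> oper" where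
  "PN_phi_psi h t x y = oscale (- ((exp h * exp x - exp y) * (exp h * exp h * exp x - exp h * exp y) /
     (exp h * exp x - exp (t * h) * exp h * exp y))) (nexp h (phiL h x + psiL h t y))"

definition P_psi_phi :: "complex \<Rightarrow> complex \<Rightarrow> complex \<Rightarrow> oper" where
  "P_psi_phi h x y = oscale (psi_coef h x) (PN_psi_phi h 1 x y - PN_psi_phi h (-1) x y)"

definition P_phi_psi :: "complex \<Rightarrow> complex \<Rightarrow> complex \<Rightarrow> oper" where
  "P_phi_psi h x y = oscale (psi_coef h y) (PN_phi_psi h 1 x y - PN_phi_psi h (-1) x y)"

lemma psi_op_eq: "psi_op h = (\<lambda>\<zeta>. oscale (psi_coef h \<zeta>) (nexp h (psiL h 1 \<zeta>) - nexp h (psiL h (-1) \<zeta>)))"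
  by (simp add: psi_op_def psi_coef_def fun_eq_iff)

lemma sepmer_psi_coef: "sepmer (\<lambda>x y. psi_coef h x)" "sepmer (\<lambda>x y. psi_coef h y)"
  unfolding psi_coef_def by (intro sepmer_intros)+

context generic
begin

lemma cprod_phi: "cprod (\<lambda>\<zeta>. nexp h (phiL h \<zeta>)) (\<lambda>\<zeta>. nexp h (phiL h \<zeta>)) (P_phi h)"
  unfolding P_phi_def[abs_def]
  by (rule cprod_PP[OF vfam_phiL vfam_phiL]) (intro sepmer_intros, rule contr_phi_phi[where s = 1 and t = 1], auto)

lemma cprod_dual: "cprod (\<lambda>\<zeta>. nexp h (phiL h \<zeta>)) (\<lambda>\<zeta>. nexp h (dualL h \<zeta>)) (P_dual h)"
  unfolding P_dual_def[abs_def]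
  by (rule cprod_PP[OF vfam_phiL vfam_dualL]) (intro sepmer_intros, rule contr_phi_dual[where s = 1 and t = 1], auto)

lemma cprod_PN_psi:
  assumes "s \<in> {1, -1}" "t \<in> {1, -1}"
  shows "cprod (\<lambda>\<zeta>. nexp h (psiL h s \<zeta>)) (\<lambda>\<zeta>. nexp h (psiL h t \<zeta>)) (PN_psi h s t)"
  unfolding PN_psi_def[abs_def]
  by (rule cprod_PP[OF vfam_psiL vfam_psiL]) (use assms in \<open>simp_all add: contr_psi_psi sepmer_intros\<close>)

lemma cprod_psi: "cprod (psi_op h) (psi_op h) (P_psi h)"
  unfolding P_psi_def[abs_def] psi_op_eq
  by (intro cprod_comb_left cprod_comb_right cprod_PN_psi sepmer_psi_coef) auto

lemma cprod_psi_phi: "cprod (psi_op h) (\<lambda>\<zeta>. nexp h (phiL h \<zeta>)) (P_psi_phi h)"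
proof -
  have "cprod (\<lambda>\<zeta>. nexp h (psiL h t \<zeta>)) (\<lambda>\<zeta>. nexp h (phiL h \<zeta>)) (PN_psi_phi h t)" if "t \<in> {1, -1}" for t
    unfolding PN_psi_phi_def[abs_def]
    by (rule cprod_PP[OF vfam_psiL[OF that] vfam_phiL]) (use that in \<open>simp_all add: contr_psi_phi[where s = 1] sepmer_intros\<close>)
  then show ?thesis
    unfolding P_psi_phi_def[abs_def] psi_op_eq by (intro cprod_comb_left sepmer_psi_coef) auto
qed

lemma cprod_phi_psi: "cprod (\<lambda>\<zeta>. nexp h (phiL h \<zeta>)) (psi_op h) (P_phi_psi h)"
proof -
  have "cprod (\<lambda>\<zeta>. nexp h (phiL h \<zeta>)) (\<lambda>\<zeta>. nexp h (psiL h t \<zeta>)) (PN_phi_psi h t)" if "t \<in> {1, -1}" for t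
    unfolding PN_phi_psi_def[abs_def]
    by (rule cprod_PP[OF vfam_phiL vfam_psiL[OF that]]) (use that in \<open>simp_all add: contr_phi_psi[where s = 1] sepmer_intros\<close>)
  then show ?thesis
    unfolding P_phi_psi_def[abs_def] psi_op_eq by (intro cprod_comb_right sepmer_psi_coef) auto
qed

text \<open>The two denominators are negatives of each other, so both sides take the default value
  of division by zero at the same points. The equality holds everywhere, and with it the mixed
  relation.\<close>

lemma P_phi_psi_swap: "P_phi_psi h y x = oscale (-1) (P_psi_phi h x y)"
proof -
  have k: "- ((exp h * exp y - exp x) * (exp h * exp h * exp y - exp h * exp x) / (exp h * exp y - u * exp h * exp x))
     = (-1) * - ((exp h * exp x - exp h * exp h * exp y) * (exp x - exp h * exp y) / (u * exp h * exp x - exp h * exp y))" for u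
  proof -
    have 1: "(exp h * exp y - exp x) * (exp h * exp h * exp y - exp h * exp x) = (exp h * exp x - exp h * exp h * exp y) * (exp x - exp h * exp y)"
      by (simp add: algebra_simps)
    have 2: "exp h * exp y - u * exp h * exp x = - (u * exp h * exp x - exp h * exp y)" by simp
    show ?thesis unfolding 1 2 by (simp only: divide_minus_right minus_minus mult_minus_left mult_1)
  qed
  have "PN_phi_psi h t y x = oscale (-1) (PN_psi_phi h t x y)" for t
    unfolding PN_phi_psi_def PN_psi_phi_def k by (simp add: oscale_def add.commute mult.assoc)
  then show ?thesis
    unfolding P_phi_psi_def P_psi_phi_def by (simp add: oscale_def fun_eq_iff algebra_simps)
qed

lemma P_phi_swap:
  assumes "exp x \<noteq> exp h * exp h * exp y" "exp y \<noteq> exp h * exp h * exp x" 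
  shows "P_phi h y x = oscale ((exp x - exp h * exp h * exp y) / (exp y - exp h * exp h * exp x)) (P_phi h x y)"
proof -
  let ?X = "exp x" and ?Y = "exp y" and ?q = "exp h"
  have "- ((?q * ?Y - ?q * ?X) / (?q * ?Y - ?q * ?q * ?q * ?X) / (?q * ?q * ?Y - ?q * ?q * ?X)) =
    (?X - ?q * ?q * ?Y) / (?Y - ?q * ?q * ?X) * - ((?q * ?X - ?q * ?Y) / (?q * ?X - ?q * ?q * ?q * ?Y) / (?q * ?q * ?X - ?q * ?q * ?Y))"
  proof (cases "?X = ?Y")
    case False
    have 1: "?q * ?Y - ?q * ?q * ?q * ?X = ?q * (?Y - ?q * ?q * ?X)" "?q * ?X - ?q * ?q * ?q * ?Y = ?q * (?X - ?q * ?q * ?Y)"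
      "?q * ?q * ?Y - ?q * ?q * ?X = - (?q * ?q * (?X - ?Y))" "?q * ?q * ?X - ?q * ?q * ?Y = ?q * ?q * (?X - ?Y)"
      "?q * ?Y - ?q * ?X = - (?q * (?X - ?Y))" "?q * ?X - ?q * ?Y = ?q * (?X - ?Y)"
      by (simp_all add: algebra_simps)
    have "?X - ?q * ?q * ?Y \<noteq> 0" "?Y - ?q * ?q * ?X \<noteq> 0" "?X - ?Y \<noteq> 0" using assms False by simp_all
    then show ?thesis unfolding 1 by simp
  qed simp
  then show ?thesis unfolding P_phi_def by (simp add: oscale_def add.commute fun_eq_iff)
qed

text \<open>Interchanging the points also interchanges \<open>s\<close> and \<open>t\<close>, but
  the resulting ratio does not depend on them. It can therefore be pulled out of the double
  q-difference.\<close>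

lemma P_psi_swap:
  assumes "exp h * exp x \<noteq> exp y / exp h" "exp h * exp y \<noteq> exp x / exp h"
  shows "P_psi h y x = oscale ((exp h * exp x - exp y / exp h) / (exp h * exp y - exp x / exp h)) (P_psi h x y)"
proof -
  let ?X = "exp x" and ?Y = "exp y" and ?q = "exp h"
  have k: "- ((u * ?Y - v * ?X) / (?q * ?Y - ?X / ?q) / (?Y - ?X)) =
    (?q * ?X - ?Y / ?q) / (?q * ?Y - ?X / ?q) * - ((v * ?X - u * ?Y) / (?q * ?X - ?Y / ?q) / (?X - ?Y))" for u v
  proof -
    have 1: "u * ?Y - v * ?X = - (v * ?X - u * ?Y)" "?Y - ?X = - (?X - ?Y)" by simp_all
    have 2: "?q * ?X - ?Y / ?q \<noteq> 0" using assms by simp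
    have "- (- n / E / - m) = D / E * - (n / D / m)" if "D \<noteq> 0" for D E n m :: complex
      using that by (cases "m = 0"; cases "E = 0") (simp_all add: field_simps)
    from this[OF 2] show ?thesis unfolding 1 .
  qed
  have N: "PN_psi h s t y x = oscale ((?q * ?X - ?Y / ?q) / (?q * ?Y - ?X / ?q)) (PN_psi h t s x y)" for s t
    unfolding PN_psi_def k by (simp add: oscale_def add.commute mult.assoc)
  have "oscale c2 (oscale c1 (oscale r A - oscale r B) - oscale c1 (oscale r C - oscale r D))
      = oscale r (oscale c1 (oscale c2 (A - C) - oscale c2 (B - D)))" for c1 c2 r A B C D
    by (simp add: oscale_def fun_eq_iff algebra_simps)
  then show ?thesis unfolding P_psi_def N .
qed

text \<open>Partial fraction form of the contraction, with explicit constants: the value of the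
  inverse relation is read off from the residues, 0 for this term of the q-derivative and q^2 - 1
  for the other.\<close>

lemma pf_phi_minus1:
  assumes "Re \<zeta> > Re \<omega> + 2 * majH h"
  shows "contr h (phiL h \<zeta>) (minusL h 1 \<omega>) = - 1 + 0 / (1 - exp (0 - \<zeta>) * exp \<omega>)"
proof -
  have "exp \<omega> \<noteq> exp \<zeta>" by (rule exp_neq_Re[symmetric]) (use assms majH_nonneg[of h] in simp)
  then show ?thesis unfolding contr_phi_minus[OF assms insertI1 insertI1] by (simp add: field_simps)
qed

lemma pf_phi_minus2:
  assumes "Re \<zeta> > Re \<omega> + 2 * majH h"
  shows "contr h (phiL h \<zeta>) (minusL h (-1) \<omega>) = - (exp h * exp h) + (exp h * exp h - 1) / (1 - exp (- (2 * h) - \<zeta>) * exp \<omega>)"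
proof -
  have n: "\<bar>Re h\<bar> \<le> norm h" "0 \<le> norm h" by (simp_all add: abs_Re_le_cmod)
  have ne: "exp \<omega> \<noteq> exp \<zeta> * exp h * exp h" unfolding exp_add[symmetric] by (rule exp_neq_Re[symmetric]) (use assms n in \<open>simp add: majH_def\<close>)
  have e: "exp (- (2 * h) - \<zeta>) = 1 / (exp h * exp h * exp \<zeta>)" "exp (-1 * h) = 1 / exp h"
    by (simp_all add: exp_diff exp_minus exp_double power2_eq_square divide_inverse)
  show ?thesis
    unfolding contr_phi_minus[OF assms insertI2[OF insertI1] insertI1] unfolding e using ne by (simp add: divide_simps; simp add: algebra_simps)
qed

lemma pf_minus_phi:
  assumes "s \<in> {1, -1}"
  shows "\<exists>b0 b1 q. \<forall>\<zeta> \<omega>. Re \<omega> > Re \<zeta> + 2 * majH h \<longrightarrow> contr h (minusL h s \<omega>) (phiL h \<zeta>) = b0 + b1 / (1 - exp (q + \<zeta>) * exp (- \<omega>))"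
proof -
  have n: "\<bar>Re h\<bar> \<le> norm h" "0 \<le> norm h" by (simp_all add: abs_Re_le_cmod)
  have e: "exp (0 + \<zeta>) * exp (- \<omega>) = exp \<zeta> / exp \<omega>" "exp (-1 * h) = 1 / exp h" for \<zeta> \<omega> :: complex by (simp_all add: exp_minus divide_inverse)
  have ne: "exp \<omega> \<noteq> exp \<zeta> * exp h * exp h" "exp \<omega> \<noteq> exp \<zeta>" if "Re \<omega> > Re \<zeta> + 2 * majH h" for \<zeta> \<omega>
    unfolding exp_add[symmetric] by (rule exp_neq_Re; use that n in \<open>simp add: majH_def\<close>)+
  show ?thesis
  proof (cases "s = 1")
    case True
    have "contr h (minusL h s \<omega>) (phiL h \<zeta>) = exp h + ((1 - exp h * exp h) / exp h) / (1 - exp (0 + \<zeta>) * exp (- \<omega>))"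
      if R: "Re \<omega> > Re \<zeta> + 2 * majH h" for \<zeta> \<omega>
      unfolding contr_minus_phi[OF R assms assms] unfolding e True using ne[OF R] by (simp add: divide_simps; simp add: algebra_simps)
    then show ?thesis by blast
  next
    case False
    then have s: "s = -1" using assms by simp
    have "contr h (minusL h s \<omega>) (phiL h \<zeta>) = exp h + 0 / (1 - exp (0 + \<zeta>) * exp (- \<omega>))"
      if R: "Re \<omega> > Re \<zeta> + 2 * majH h" for \<zeta> \<omega>
      unfolding contr_minus_phi[OF R assms assms] unfolding e s using ne[OF R] by (simp add: divide_simps; simp add: algebra_simps)
    then show ?thesis by blast
  qed
qed

lemma pf_psi_plus:
  assumes "t \<in> {1, -1}"
  shows "\<exists>a0 a1 p. \<forall>\<zeta> \<omega>. Re \<zeta> > Re \<omega> + 2 * majH h \<longrightarrow> contr h (psiL h t \<zeta>) (plusL h \<omega>) = a0 + a1 / (1 - exp (p - \<zeta>) * exp \<omega>)"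
    and "\<exists>b0 b1 q. \<forall>\<zeta> \<omega>. Re \<omega> > Re \<zeta> + 2 * majH h \<longrightarrow> contr h (plusL h \<omega>) (psiL h t \<zeta>) = b0 + b1 / (1 - exp (q + \<zeta>) * exp (- \<omega>))"
proof -
  have n: "\<bar>Re h\<bar> \<le> norm h" "0 \<le> norm h" by (simp_all add: abs_Re_le_cmod)
  have e: "exp (0 - \<zeta>) * exp \<omega> = exp \<omega> / exp \<zeta>" "exp (2 * h + \<zeta>) * exp (- \<omega>) = exp h * exp h * exp \<zeta> / exp \<omega>" "exp (-1 * h) = 1 / exp h" for \<zeta> \<omega> :: complex
    by (simp_all add: exp_add exp_minus exp_double power2_eq_square divide_inverse)
  have ne: "exp \<omega> \<noteq> exp \<zeta> * exp h * exp h" "exp \<omega> \<noteq> exp \<zeta>" if "Re \<omega> > Re \<zeta> + 2 * majH h" for \<zeta> \<omega>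
    unfolding exp_add[symmetric] by (rule exp_neq_Re; use that n in \<open>simp add: majH_def\<close>)+
  have ne': "exp \<omega> \<noteq> exp \<zeta> * exp h * exp h" "exp \<omega> \<noteq> exp \<zeta>" if "Re \<zeta> > Re \<omega> + 2 * majH h" for \<zeta> \<omega>
    unfolding exp_add[symmetric] by (rule exp_neq_Re[symmetric]; use that n in \<open>simp add: majH_def\<close>)+
  show "\<exists>a0 a1 p. \<forall>\<zeta> \<omega>. Re \<zeta> > Re \<omega> + 2 * majH h \<longrightarrow> contr h (psiL h t \<zeta>) (plusL h \<omega>) = a0 + a1 / (1 - exp (p - \<zeta>) * exp \<omega>)"
  proof (cases "t = 1")
    case True
    have "contr h (psiL h t \<zeta>) (plusL h \<omega>) = - (1 / exp h) + 0 / (1 - exp (0 - \<zeta>) * exp \<omega>)"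
      if R: "Re \<zeta> > Re \<omega> + 2 * majH h" for \<zeta> \<omega>
      unfolding contr_psi_plus[OF R assms assms] unfolding e True using ne'[OF R] by (simp add: divide_simps; simp add: algebra_simps)
    then show ?thesis by blast
  next
    case False
    then have t: "t = -1" using assms by simp
    have "contr h (psiL h t \<zeta>) (plusL h \<omega>) = - (1 / exp h) + (1 / exp h - exp h) / (1 - exp (0 - \<zeta>) * exp \<omega>)"
      if R: "Re \<zeta> > Re \<omega> + 2 * majH h" for \<zeta> \<omega>
      unfolding contr_psi_plus[OF R assms assms] unfolding e t using ne'[OF R] by (simp add: divide_simps; simp add: algebra_simps)
    then show ?thesis by blast
  qed
  show "\<exists>b0 b1 q. \<forall>\<zeta> \<omega>. Re \<omega> > Re \<zeta> + 2 * majH h \<longrightarrow> contr h (plusL h \<omega>) (psiL h t \<zeta>) = b0 + b1 / (1 - exp (q + \<zeta>) * exp (- \<omega>))"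
  proof (cases "t = 1")
    case True
    have "contr h (plusL h \<omega>) (psiL h t \<zeta>) = 1 / (exp h * exp h) + (1 - 1 / (exp h * exp h)) / (1 - exp (2 * h + \<zeta>) * exp (- \<omega>))"
      if R: "Re \<omega> > Re \<zeta> + 2 * majH h" for \<zeta> \<omega>
      unfolding contr_plus_psi[OF R assms assms] unfolding e True using ne[OF R] by (simp add: divide_simps; simp add: algebra_simps)
    then show ?thesis by blast
  next
    case False
    then have t: "t = -1" using assms by simp
    have "contr h (plusL h \<omega>) (psiL h t \<zeta>) = 1 + 0 / (1 - exp (2 * h + \<zeta>) * exp (- \<omega>))"
      if R: "Re \<omega> > Re \<zeta> + 2 * majH h" for \<zeta> \<omega>
      unfolding contr_plus_psi[OF R assms assms] unfolding e t using ne[OF R] by (simp add: divide_simps)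
    then show ?thesis by blast
  qed
qed

lemma cprod_phi_f_phi: "\<exists>G. cprod (\<lambda>\<zeta>. nexp h (phiL h \<zeta>)) (\<lambda>\<zeta>. fmode h m \<odot> nexp h (phiL h \<zeta>)) G"
proof -
  have "\<exists>G. cprod (\<lambda>\<zeta>. nexp h (phiL h \<zeta>)) (\<lambda>\<zeta>. md h (-1) (minusL h s) m \<odot> nexp h (phiL h \<zeta>)) G" if s: "s \<in> {1, -1}" for s
  proof (rule cprod_G_ex[OF vfam_phiL vfam_phiL cur_minusL[OF s]])
    show "\<exists>a0 a1 p. \<forall>\<zeta> \<omega>. Re \<zeta> > Re \<omega> + 2 * majH h \<longrightarrow> contr h (phiL h \<zeta>) (minusL h s \<omega>) = a0 + a1 / (1 - exp (p - \<zeta>) * exp \<omega>)"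
      using s pf_phi_minus1 pf_phi_minus2 by blast
    show "contr h (phiL h x) (phiL h y) = - ((exp h * exp x - exp h * exp y) / (exp h * exp x - exp h * exp h * exp h * exp y) /
       (exp h * exp h * exp x - exp h * exp h * exp y))" if "Re x > Re y + 2 * majH h" for x y
      by (rule contr_phi_phi[OF that insertI1 insertI1])
  qed (intro sepmer_intros, rule pf_minus_phi[OF s])
  from this[of 1] this[of "-1"] obtain G1 G2 where
    "cprod (\<lambda>\<zeta>. nexp h (phiL h \<zeta>)) (\<lambda>\<zeta>. md h (-1) (minusL h 1) m \<odot> nexp h (phiL h \<zeta>)) G1"
    "cprod (\<lambda>\<zeta>. nexp h (phiL h \<zeta>)) (\<lambda>\<zeta>. md h (-1) (minusL h (-1)) m \<odot> nexp h (phiL h \<zeta>)) G2" by auto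
  from cprod_comb_right[OF this sepmer_const]
  have "cprod (\<lambda>\<zeta>. nexp h (phiL h \<zeta>)) (\<lambda>\<zeta>. fmode h m \<odot> nexp h (phiL h \<zeta>)) (\<lambda>x y. oscale (1 / (exp h - exp (- h))) (G1 x y - G2 x y))"
    by (rule cprod_cong[OF _ eqf_refl]) (unfold fmode_def, intro oprod_diff_left rowfin_comp md_rowfin)
  then show ?thesis by blast
qed

lemma cprod_psi_e_psi: "\<exists>G. cprod (psi_op h) (\<lambda>\<zeta>. emode h m \<odot> psi_op h \<zeta>) G"
proof -
  have "\<exists>G. cprod (\<lambda>\<zeta>. nexp h (psiL h s \<zeta>)) (\<lambda>\<zeta>. emode h m \<odot> nexp h (psiL h t \<zeta>)) G" if s: "s \<in> {1, -1}" and t: "t \<in> {1, -1}" for s t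
    unfolding emode_def
  proof (rule cprod_G_ex[OF vfam_psiL[OF s] vfam_psiL[OF t] cur_plusL])
    show "contr h (psiL h s x) (psiL h t y) = - ((exp (s * h) * exp h * exp x - exp (t * h) * exp h * exp y) /
          (exp h * exp x - exp y / exp h) / (exp x - exp y))" if "Re x > Re y + 2 * majH h" for x y
      by (rule contr_psi_psi[OF that s t])
  qed (intro sepmer_intros, rule pf_psi_plus(1)[OF s], rule pf_psi_plus(2)[OF t])
  then obtain G where G: "\<And>s t. s \<in> {1, -1} \<Longrightarrow> t \<in> {1, -1} \<Longrightarrow>
      cprod (\<lambda>\<zeta>. nexp h (psiL h s \<zeta>)) (\<lambda>\<zeta>. emode h m \<odot> nexp h (psiL h t \<zeta>)) (G s t)" by metis
  have R: "eqf (emode h m \<odot> psi_op h \<zeta>) (oscale (psi_coef h \<zeta>) (emode h m \<odot> nexp h (psiL h 1 \<zeta>) - emode h m \<odot> nexp h (psiL h (-1) \<zeta>)))" for \<zeta>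
    unfolding psi_op_eq by (intro oprod_diff_right rowfin_comp emode_fin)
  have "cprod (\<lambda>\<zeta>. nexp h (psiL h s \<zeta>)) (\<lambda>\<zeta>. emode h m \<odot> psi_op h \<zeta>) (\<lambda>x y. oscale (psi_coef h y) (G s 1 x y - G s (-1) x y))"
    if s: "s \<in> {1, -1}" for s
    by (rule cprod_cong[OF cprod_comb_right[OF G[OF s] G[OF s] sepmer_psi_coef(2)] eqf_refl R]) auto
  from cprod_comb_left[OF this[of 1] this[of "-1"] sepmer_psi_coef(1)]
  have "cprod (psi_op h) (\<lambda>\<zeta>. emode h m \<odot> psi_op h \<zeta>) (\<lambda>x y. oscale (psi_coef h x) (oscale (psi_coef h y) (G 1 1 x y - G 1 (-1) x y)
     - oscale (psi_coef h y) (G (-1) 1 x y - G (-1) (-1) x y)))"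
    unfolding psi_op_eq by simp
  then show ?thesis by blast
qed

end

section \<open>Words in a nilpotent mode and limits\<close>

lemma tendsto_row:
  assumes "rowfin f" "b' \<in> fock" "b \<in> fock" "\<And>k. k \<in> fock \<Longrightarrow> ((\<lambda>\<xi>. A \<xi> k b) \<longlongrightarrow> l k b) F"
  shows "((\<lambda>\<xi>. (f \<odot> A \<xi>) b' b) \<longlongrightarrow> (f \<odot> l) b' b) F"
  unfolding rowfin_oprod[OF assms(1,2)] by (intro tendsto_intros assms) simp

lemma tendsto_col:
  assumes "colfin f" "b' \<in> fock" "b \<in> fock" "\<And>k. k \<in> fock \<Longrightarrow> ((\<lambda>\<xi>. A \<xi> b' k) \<longlongrightarrow> l b' k) F"
  shows "((\<lambda>\<xi>. (A \<xi> \<odot> f) b' b) \<longlongrightarrow> (l \<odot> f) b' b) F"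
  unfolding colfin_oprod[OF assms(1,3)] by (intro tendsto_intros assms) simp

lemma colfin_prod: "colfin f \<Longrightarrow> colfin g \<Longrightarrow> colfin (f \<odot> g)"
  unfolding colfin_def
proof
  fix b assume f: "\<forall>b\<in>fock. finite {k \<in> fock. f k b \<noteq> 0}" and g: "\<forall>b\<in>fock. finite {k \<in> fock. g k b \<noteq> 0}" and b: "b \<in> fock"
  have "{k \<in> fock. (f \<odot> g) k b \<noteq> 0} \<subseteq> (\<Union>l\<in>{l \<in> fock. g l b \<noteq> 0}. {k \<in> fock. f k l \<noteq> 0})"
  proof
    fix k assume k: "k \<in> {k \<in> fock. (f \<odot> g) k b \<noteq> 0}"
    have "\<exists>l\<in>fock. f k l * g l b \<noteq> 0"
    proof (rule ccontr)
      assume "\<not> ?thesis"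
      then have "(f \<odot> g) k b = 0" unfolding oprod_def by (intro infsum_0) auto
      then show False using k by simp
    qed
    then show "k \<in> (\<Union>l\<in>{l \<in> fock. g l b \<noteq> 0}. {k \<in> fock. f k l \<noteq> 0})" using k by auto
  qed
  then show "finite {k \<in> fock. (f \<odot> g) k b \<noteq> 0}" by (rule finite_subset) (use f g b in auto)
qed

lemma rowfin_prod: "rowfin f \<Longrightarrow> rowfin g \<Longrightarrow> rowfin (f \<odot> g)"
  unfolding rowfin_def
proof
  fix b assume f: "\<forall>b\<in>fock. finite {k \<in> fock. f b k \<noteq> 0}" and g: "\<forall>b\<in>fock. finite {k \<in> fock. g b k \<noteq> 0}" and b: "b \<in> fock"
  have "{k \<in> fock. (f \<odot> g) b k \<noteq> 0} \<subseteq> (\<Union>l\<in>{l \<in> fock. f b l \<noteq> 0}. {k \<in> fock. g l k \<noteq> 0})"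
  proof
    fix k assume k: "k \<in> {k \<in> fock. (f \<odot> g) b k \<noteq> 0}"
    have "\<exists>l\<in>fock. f b l * g l k \<noteq> 0"
    proof (rule ccontr)
      assume "\<not> ?thesis"
      then have "(f \<odot> g) b k = 0" unfolding oprod_def by (intro infsum_0) auto
      then show False using k by simp
    qed
    then show "k \<in> (\<Union>l\<in>{l \<in> fock. f b l \<noteq> 0}. {k \<in> fock. g l k \<noteq> 0})" using k by auto
  qed
  then show "finite {k \<in> fock. (f \<odot> g) b k \<noteq> 0}" by (rule finite_subset) (use f g b in auto)
qed

lemma nilpotent_words:
  assumes "rowfin f" "colfin f" "eqf (f \<odot> f) 0" "b' \<in> fock" "b \<in> fock"
  shows "((f \<odot> P) \<odot> f) b' b = (f \<odot> (P \<odot> f)) b' b" "((P \<odot> f) \<odot> f) b' b = 0" "(f \<odot> (f \<odot> P)) b' b = 0"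
proof -
  show "((f \<odot> P) \<odot> f) b' b = (f \<odot> (P \<odot> f)) b' b"
    using rowcolfin_assoc[OF assms(1,2), of P] assms by (simp add: eqf_def)
  have "((P \<odot> f) \<odot> f) b' b = (P \<odot> (f \<odot> f)) b' b"
    using colfin_assoc[OF assms(2,2), of P] assms by (simp add: eqf_def)
  also have "\<dots> = (P \<odot> 0) b' b"
    using eqf_oprod[OF eqf_refl assms(3), of P] assms by (simp only: eqf_def)
  finally show "((P \<odot> f) \<odot> f) b' b = 0" by (simp add: oprod_zero_right)
  have "(f \<odot> (f \<odot> P)) b' b = ((f \<odot> f) \<odot> P) b' b"
    using rowfin_assoc[OF assms(1,1), of P] assms by (simp add: eqf_def)
  also have "\<dots> = (0 \<odot> P) b' b"
    using eqf_oprod[OF assms(3) eqf_refl, of P] assms by (simp only: eqf_def)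
  finally show "(f \<odot> (f \<odot> P)) b' b = 0" by (simp add: oprod_zero_left)
qed

text \<open>An identity off a sparse set for each matrix element may be multiplied by
  \<open>f\<close>, because a row or column of \<open>f\<close> involves only finitely many of them.
  Of the two words multiplied by \<open>t x\<close>, the one with adjacent copies of
  \<open>f\<close> disappears.\<close>

lemma eliminated_words:
  assumes f: "rowfin f" "colfin f" "eqf (f \<odot> f) 0" and b: "b' \<in> fock" "b \<in> fock"
    and E: "\<And>b' b. b' \<in> fock \<Longrightarrow> b \<in> fock \<Longrightarrow> \<forall>\<^sub>\<approx>x\<in>UNIV. C x b' b = B x b' b + t x * ((f \<odot> P x) b' b + (P x \<odot> f) b' b)"
  shows "\<forall>\<^sub>\<approx>x\<in>UNIV. (C x \<odot> f) b' b = (B x \<odot> f) b' b + t x * (f \<odot> (P x \<odot> f)) b' b \<and>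
    (f \<odot> C x) b' b = (f \<odot> B x) b' b + t x * (f \<odot> (P x \<odot> f)) b' b"
proof -
  let ?F1 = "{k \<in> fock. f k b \<noteq> 0}" and ?F2 = "{k \<in> fock. f b' k \<noteq> 0}"
  have fin: "finite ?F1" "finite ?F2" using f b by (auto simp: rowfin_def colfin_def)
  have "\<forall>\<^sub>\<approx>x\<in>UNIV. \<forall>k\<in>?F1. C x b' k = B x b' k + t x * ((f \<odot> P x) b' k + (P x \<odot> f) b' k)"
    by (rule eventually_ball_finite[OF fin(1)]) (use E b in auto)
  moreover have "\<forall>\<^sub>\<approx>x\<in>UNIV. \<forall>k\<in>?F2. C x k b = B x k b + t x * ((f \<odot> P x) k b + (P x \<odot> f) k b)"
    by (rule eventually_ball_finite[OF fin(2)]) (use E b in auto)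
  ultimately show ?thesis
  proof eventually_elim
    case (elim x)
    have "(C x \<odot> f) b' b = (\<Sum>k\<in>?F1. (B x b' k + t x * ((f \<odot> P x) b' k + (P x \<odot> f) b' k)) * f k b)"
      unfolding colfin_oprod[OF f(2) b(2)] using elim(1) by (intro sum.cong) auto
    also have "\<dots> = (B x \<odot> f) b' b + t x * (((f \<odot> P x) \<odot> f) b' b + ((P x \<odot> f) \<odot> f) b' b)"
      unfolding colfin_oprod[OF f(2) b(2)] by (simp add: distrib_right sum.distrib sum_distrib_left mult.assoc distrib_left)
    finally have 1: "(C x \<odot> f) b' b = (B x \<odot> f) b' b + t x * (f \<odot> (P x \<odot> f)) b' b"
      by (simp add: nilpotent_words[OF f b])
    have "(f \<odot> C x) b' b = (\<Sum>k\<in>?F2. f b' k * (B x k b + t x * ((f \<odot> P x) k b + (P x \<odot> f) k b)))"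
      unfolding rowfin_oprod[OF f(1) b(1)] using elim(2) by (intro sum.cong) auto
    also have "\<dots> = (f \<odot> B x) b' b + t x * ((f \<odot> (f \<odot> P x)) b' b + (f \<odot> (P x \<odot> f)) b' b)"
      unfolding rowfin_oprod[OF f(1) b(1)] by (simp add: distrib_left sum.distrib sum_distrib_left mult_ac)
    finally show ?case using 1 by (simp add: nilpotent_words[OF f b])
  qed
qed

lemma eqf_words:
  assumes "eqf P' (oscale \<rho> P)" "b' \<in> fock" "b \<in> fock"
  shows "P' b' b = \<rho> * P b' b" "(f \<odot> P') b' b = \<rho> * (f \<odot> P) b' b" "(P' \<odot> f) b' b = \<rho> * (P \<odot> f) b' b"
    "(f \<odot> (P' \<odot> f)) b' b = \<rho> * (f \<odot> (P \<odot> f)) b' b"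
proof -
  have "eqf (f \<odot> P') (oscale \<rho> (f \<odot> P))" "eqf (P' \<odot> f) (oscale \<rho> (P \<odot> f))"
    using eqf_oprod[OF eqf_refl assms(1), of f] eqf_oprod[OF assms(1) eqf_refl, of f]
    by (simp_all only: oprod_oscale_left oprod_oscale_right)
  moreover from this(2) have "eqf (f \<odot> (P' \<odot> f)) (oscale \<rho> (f \<odot> (P \<odot> f)))"
    using eqf_oprod[OF eqf_refl, of "P' \<odot> f" "oscale \<rho> (P \<odot> f)" f] by (simp only: oprod_oscale_right)
  ultimately show "P' b' b = \<rho> * P b' b" "(f \<odot> P') b' b = \<rho> * (f \<odot> P) b' b" "(P' \<odot> f) b' b = \<rho> * (P \<odot> f) b' b"
    "(f \<odot> (P' \<odot> f)) b' b = \<rho> * (f \<odot> (P \<odot> f)) b' b"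
    using assms by (simp_all add: eqf_def oscale_def)
qed

text \<open>The four outcomes of \<open>cprod_same\<close>, with flags for the bracketed factors, so
  that one statement covers all index pairs.\<close>

definition same :: "complex \<Rightarrow> complex \<Rightarrow> complex \<Rightarrow> complex \<Rightarrow> oper \<Rightarrow> bool \<Rightarrow> bool \<Rightarrow> oper \<Rightarrow> oper \<Rightarrow> oper" where
  "same x r y s f d d' P G =
    (if d then if d' then oscale x (oscale y (G \<odot> f) + oscale r (oscale y (f \<odot> (P \<odot> f) + oscale s (f \<odot> G)))) else oscale x (G + oscale r (f \<odot> P))
     else if d' then oscale y (P \<odot> f + oscale s G) else P)"

lemma cprod_same_if:
  assumes "vmaj h S" "vmaj h T" "cmaj h f" "eqf (f \<odot> f) 0" "cprod S T P" "cprod S (\<lambda>\<zeta>. f \<odot> T \<zeta>) G"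
  shows "cprod (if d then dbl x r f S else S) (if d' then dbl y s f T else T) (\<lambda>\<zeta>1 \<zeta>2. same x r y s f d d' (P \<zeta>1 \<zeta>2) (G \<zeta>1 \<zeta>2))"
proof -
  have "contd (\<lambda>\<zeta>1 \<zeta>2. S \<zeta>1 \<odot> T \<zeta>2) P" "contd (\<lambda>\<zeta>1 \<zeta>2. S \<zeta>1 \<odot> (f \<odot> T \<zeta>2)) G"
    using assms(5,6) by (simp_all add: cprod_def)
  from cprod_same[OF assms(1-4) this] show ?thesis by (cases d; cases d') (simp_all add: same_def)
qed

definition mixed :: "complex \<Rightarrow> complex \<Rightarrow> complex \<Rightarrow> complex \<Rightarrow> oper \<Rightarrow> oper \<Rightarrow> oper \<Rightarrow> bool \<Rightarrow> bool \<Rightarrow> oper \<Rightarrow> oper" where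
  "mixed x r y s e f K' d d' P =
    (if d then if d' then oscale x (oscale y (oscale (-1) (P \<odot> (e \<odot> f)) + oscale s (P \<odot> K' - f \<odot> (P \<odot> e)))
            + oscale r (oscale y (e \<odot> (P \<odot> f) + oscale s (oscale (-1) ((e \<odot> f) \<odot> P)))))
       else oscale x (oscale (-1) (P \<odot> e) + oscale r (e \<odot> P))
     else if d' then oscale y (P \<odot> f + oscale s (oscale (-1) (f \<odot> P))) else P)"

lemma cprod_mixed_if:
  assumes S: "vmaj h S" and T: "vmaj h T" and e: "cmaj h e" and f: "cmaj h f"
    and ef: "eqf K (e \<odot> f + f \<odot> e)" and K: "\<And>\<zeta>. eqf (K \<odot> T \<zeta>) (T \<zeta> \<odot> K')" "colfin K'" "rowfin K"
    and fS: "\<And>\<zeta>. anti f (S \<zeta>)" and eT: "\<And>\<zeta>. anti e (T \<zeta>)" and P: "cprod S T P"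
  shows "cprod (if d then dbl x r e S else S) (if d' then dbl y s f T else T) (\<lambda>\<zeta>1 \<zeta>2. mixed x r y s e f K' d d' (P \<zeta>1 \<zeta>2))"
proof -
  have "contd (\<lambda>\<zeta>1 \<zeta>2. S \<zeta>1 \<odot> T \<zeta>2) P" using P by (simp add: cprod_def)
  from cprod_mixed[OF S T e f ef K anti_sym[OF fS, unfolded anti_def] eT[unfolded anti_def] this]
  show ?thesis by (cases d; cases d') (simp_all add: mixed_def)
qed

lemma cosparse_exp: "c \<noteq> 0 \<Longrightarrow> \<forall>\<^sub>\<approx>x\<in>UNIV. c * exp x \<noteq> (d::complex)"
  using cosparse_exp_neq[of "d / c"] by (auto elim!: eventually_mono simp: field_simps)

context generic
begin

text \<open>At w = q^2 z the exponents of the two vertex operators and of the term with shift 1/q in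
  the current add up to 0. The delta function at this point is therefore the identity
  operator.\<close>

lemma dual_lins: "phiL h \<zeta> + minusL h (-1) (2 * h + \<zeta>) + dualL h \<zeta> = 0"
proof
  fix g show "(phiL h \<zeta> + minusL h (-1) (2 * h + \<zeta>) + dualL h \<zeta>) g = 0 g"
  proof (cases g)
    case (Q s)
    then show ?thesis by (cases s) (simp_all add: phiL_def minusL_def dualL_def vx_def)
  next
    case (Mode s n)
    have "exp (- (of_int n * (2 * h + \<zeta>))) = exp (- (of_int n * (\<zeta> + 2 * h)))" "exp (- (of_int n * (h + \<zeta>))) = exp (- (of_int n * (\<zeta> + h)))"
      by (simp_all add: add.commute)
    then show ?thesis using Mode
      by (cases "n = 0"; cases s) (simp_all add: phiL_def minusL_def dualL_def vx_def algebra_simps diff_divide_distrib add_divide_distrib)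
  qed
qed

lemma P_dual_limit:
  assumes b: "b' \<in> fock" "b \<in> fock"
  shows "((\<lambda>\<xi>. P_dual h \<xi> \<zeta> b' b) \<longlongrightarrow> 0) (at \<zeta>)"
proof -
  have "holfam (phiL h)" "holfam (dualL h)" "homog 0 (\<lambda>_. 0)" using vfam_phiL vfam_dualL by (auto simp: vfam_def homog_def)
  from lpol_nexp[OF this b, of h] obtain xs where xs: "\<forall>(c, d)\<in>set xs. sephol c"
    and N: "(\<lambda>\<zeta>1 \<zeta>2 \<omega>. nexp h (phiL h \<zeta>1 + 0 + dualL h \<zeta>2) b' b) = lpe xs" unfolding lpol_def by auto
  have "nexp h (phiL h \<xi> + dualL h \<zeta>) b' b = lpe xs \<xi> \<zeta> 0" for \<xi> using fun_cong[OF fun_cong[OF fun_cong[OF N]], of \<xi> \<zeta> 0] by simp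
  \<comment> \<open>The delta function identity at \<eta> = 0 expresses the Laurent polynomial by
    the three sums whose limits are known.\<close>
  also have "lpe xs \<xi> \<zeta> 0 = exp (- (of_int 0 * 0)) * lpe xs \<xi> \<zeta> 0" for \<xi> by simp
  also have "\<dots> \<xi> = lle xs 0 (exp (- 0)) \<xi> \<zeta> + lge xs 0 (exp 0) \<xi> \<zeta> - lcoef xs 0 \<xi> \<zeta>" for \<xi> by (rule delta_lpe[symmetric])
  finally have N': "nexp h (phiL h \<xi> + dualL h \<zeta>) b' b = lle xs 0 (exp (- 0)) \<xi> \<zeta> + lge xs 0 (exp 0) \<xi> \<zeta> - lcoef xs 0 \<xi> \<zeta>" for \<xi> .
  have "((\<lambda>\<xi>. exp h * exp h * (exp \<xi> - exp \<zeta>) * (lle xs 0 (exp (- 0)) \<xi> \<zeta> + lge xs 0 (exp 0) \<xi> \<zeta> - lcoef xs 0 \<xi> \<zeta>))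
     \<longlongrightarrow> exp h * exp h * (exp \<zeta> - exp \<zeta>) * (lle xs 0 (exp (- 0)) \<zeta> \<zeta> + lge xs 0 (exp 0) \<zeta> \<zeta> - lcoef xs 0 \<zeta> \<zeta>)) (at \<zeta>)"
    by (intro tendsto_intros tendsto_lcoef tendsto_lle tendsto_lge xs)
  then show ?thesis by (simp add: P_dual_def oscale_def N')
qed

lemma pf_minus_dual:
  assumes R: "Re \<omega> > Re \<zeta> + 2 * majH h" and s: "s \<in> {1, -1}"
  shows "contr h (minusL h s \<omega>) (dualL h \<zeta>) = - (exp (- \<zeta>) / (exp h * exp h)) + exp (- \<zeta>) / (exp h * exp h) / (1 - exp (2 * h + \<zeta>) * exp (- \<omega>))"
proof -
  have n: "\<bar>Re h\<bar> \<le> norm h" "0 \<le> norm h" by (simp_all add: abs_Re_le_cmod)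
  have e: "exp (2 * h + \<zeta>) * exp (- \<omega>) = exp h * exp h * exp \<zeta> / exp \<omega>" "exp (- \<zeta>) = 1 / exp \<zeta>"
    by (simp_all add: exp_add exp_minus exp_double power2_eq_square divide_inverse)
  have "exp \<omega> \<noteq> exp \<zeta> * exp h * exp h"
    unfolding exp_add[symmetric] by (rule exp_neq_Re; use R n in \<open>simp add: majH_def\<close>)
  then show ?thesis unfolding contr_minus_dual[OF R s s] e by (simp add: divide_simps; simp add: algebra_simps)
qed

text \<open>The contraction of the outer operators vanishes at z_1 = z_2. This removes the term of
  \<open>f\<close> with shift q; in the term with shift 1/q the zero meets the pole 1 / (1 - z_2 /
  z_1), and q^2 - 1 times a delta function remains. Dividing the difference by q - 1/q gives
  -q.\<close>

lemma cprod_phi_f_dual: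
  "\<exists>G. cprod (\<lambda>\<zeta>. nexp h (phiL h \<zeta>)) (\<lambda>\<zeta>. fmode h 0 \<odot> nexp h (dualL h \<zeta>)) G \<and>
    (\<forall>b'\<in>fock. \<forall>b\<in>fock. \<forall>\<zeta>. ((\<lambda>\<xi>. G \<xi> \<zeta> b' b) \<longlongrightarrow> - (exp h * oid b' b)) (at \<zeta>))"
proof -
  let ?q = "exp h"
  have k: "sepmer (\<lambda>x y. ?q * ?q * (exp x - exp y))" and b0: "sepmer (\<lambda>x y. - (exp (- y) / (?q * ?q)))" and b1: "sepmer (\<lambda>x y. exp (- y) / (?q * ?q))"
    by (intro sepmer_intros)+
  have c: "contr h (phiL h x) (dualL h y) = ?q * ?q * (exp x - exp y)" if "Re x > Re y + 2 * majH h" for x y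
    by (rule contr_phi_dual[OF that insertI1 insertI1])
  have m: "1 \<in> {1, -1 :: complex}" "-1 \<in> {1, -1 :: complex}" by simp_all
  obtain G1 where G1: "contd (\<lambda>\<zeta>1 \<zeta>2. nexp h (phiL h \<zeta>1) \<odot> (md h (-1) (minusL h 1) 0 \<odot> nexp h (dualL h \<zeta>2))) G1"
    and F1: "\<And>b' b. b' \<in> fock \<Longrightarrow> b \<in> fock \<Longrightarrow> \<exists>xs. (\<forall>(c, d)\<in>set xs. sephol c) \<and>
      (\<lambda>\<zeta>1 \<zeta>2 \<omega>. nexp h (phiL h \<zeta>1 + minusL h 1 \<omega> + dualL h \<zeta>2) b' b) = lpe xs \<and>
      (\<forall>\<zeta>1 \<zeta>2. G1 \<zeta>1 \<zeta>2 b' b = ?q * ?q * (exp \<zeta>1 - exp \<zeta>2) *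
      ((- 1 * - (exp (- \<zeta>2) / (?q * ?q)) - 0 * (exp (- \<zeta>2) / (?q * ?q)) / (1 - exp (0 + 2 * h) * exp \<zeta>2 / exp \<zeta>1)) * lcoef xs 0 \<zeta>1 \<zeta>2
      + (0 * - (exp (- \<zeta>2) / (?q * ?q)) + 0 * (exp (- \<zeta>2) / (?q * ?q)) / (1 - exp (0 + 2 * h) * exp \<zeta>2 / exp \<zeta>1)) * lle xs 0 (exp (0 - \<zeta>1)) \<zeta>1 \<zeta>2
      + (- 1 * (exp (- \<zeta>2) / (?q * ?q)) + 0 * (exp (- \<zeta>2) / (?q * ?q)) / (1 - exp (0 + 2 * h) * exp \<zeta>2 / exp \<zeta>1)) * lge xs 0 (exp (2 * h + \<zeta>2)) \<zeta>1 \<zeta>2))"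
    using contd_G[OF vfam_phiL vfam_dualL cur_minusL[OF m(1)] k b0 b1 c pf_phi_minus1 pf_minus_dual[OF _ m(1)], of 0] by blast
  obtain G2 where G2: "contd (\<lambda>\<zeta>1 \<zeta>2. nexp h (phiL h \<zeta>1) \<odot> (md h (-1) (minusL h (-1)) 0 \<odot> nexp h (dualL h \<zeta>2))) G2"
    and F2: "\<And>b' b. b' \<in> fock \<Longrightarrow> b \<in> fock \<Longrightarrow> \<exists>xs. (\<forall>(c, d)\<in>set xs. sephol c) \<and>
      (\<lambda>\<zeta>1 \<zeta>2 \<omega>. nexp h (phiL h \<zeta>1 + minusL h (-1) \<omega> + dualL h \<zeta>2) b' b) = lpe xs \<and>
      (\<forall>\<zeta>1 \<zeta>2. G2 \<zeta>1 \<zeta>2 b' b = ?q * ?q * (exp \<zeta>1 - exp \<zeta>2) *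
      ((- (?q * ?q) * - (exp (- \<zeta>2) / (?q * ?q)) - (?q * ?q - 1) * (exp (- \<zeta>2) / (?q * ?q)) / (1 - exp (- (2 * h) + 2 * h) * exp \<zeta>2 / exp \<zeta>1)) * lcoef xs 0 \<zeta>1 \<zeta>2
      + ((?q * ?q - 1) * - (exp (- \<zeta>2) / (?q * ?q)) + (?q * ?q - 1) * (exp (- \<zeta>2) / (?q * ?q)) / (1 - exp (- (2 * h) + 2 * h) * exp \<zeta>2 / exp \<zeta>1)) * lle xs 0 (exp (- (2 * h) - \<zeta>1)) \<zeta>1 \<zeta>2
      + (- (?q * ?q) * (exp (- \<zeta>2) / (?q * ?q)) + (?q * ?q - 1) * (exp (- \<zeta>2) / (?q * ?q)) / (1 - exp (- (2 * h) + 2 * h) * exp \<zeta>2 / exp \<zeta>1)) * lge xs 0 (exp (2 * h + \<zeta>2)) \<zeta>1 \<zeta>2))"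
    using contd_G[OF vfam_phiL vfam_dualL cur_minusL[OF m(2)] k b0 b1 c pf_phi_minus2 pf_minus_dual[OF _ m(2)], of 0] by blast
  have L1: "((\<lambda>\<xi>. G1 \<xi> \<zeta> b' b) \<longlongrightarrow> 0) (at \<zeta>)" if b: "b' \<in> fock" "b \<in> fock" for b' b \<zeta>
  proof -
    from F1[OF b] obtain xs where xs: "\<forall>(c, d)\<in>set xs. sephol c" and G: "\<And>\<zeta>1 \<zeta>2. G1 \<zeta>1 \<zeta>2 b' b = ?q * ?q * (exp \<zeta>1 - exp \<zeta>2) *
      ((- 1 * - (exp (- \<zeta>2) / (?q * ?q)) - 0 * (exp (- \<zeta>2) / (?q * ?q)) / (1 - exp (0 + 2 * h) * exp \<zeta>2 / exp \<zeta>1)) * lcoef xs 0 \<zeta>1 \<zeta>2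
      + (0 * - (exp (- \<zeta>2) / (?q * ?q)) + 0 * (exp (- \<zeta>2) / (?q * ?q)) / (1 - exp (0 + 2 * h) * exp \<zeta>2 / exp \<zeta>1)) * lle xs 0 (exp (0 - \<zeta>1)) \<zeta>1 \<zeta>2
      + (- 1 * (exp (- \<zeta>2) / (?q * ?q)) + 0 * (exp (- \<zeta>2) / (?q * ?q)) / (1 - exp (0 + 2 * h) * exp \<zeta>2 / exp \<zeta>1)) * lge xs 0 (exp (2 * h + \<zeta>2)) \<zeta>1 \<zeta>2)" by blast
    have G': "G1 \<xi> \<zeta> b' b = ?q * ?q * (exp \<xi> - exp \<zeta>) *
      (exp (- \<zeta>) / (?q * ?q) * lcoef xs 0 \<xi> \<zeta> - exp (- \<zeta>) / (?q * ?q) * lge xs 0 (exp (2 * h + \<zeta>)) \<xi> \<zeta>)" for \<xi>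
      unfolding G by simp
    have "((\<lambda>\<xi>. G1 \<xi> \<zeta> b' b) \<longlongrightarrow> ?q * ?q * (exp \<zeta> - exp \<zeta>) *
      (exp (- \<zeta>) / (?q * ?q) * lcoef xs 0 \<zeta> \<zeta> - exp (- \<zeta>) / (?q * ?q) * lge xs 0 (exp (2 * h + \<zeta>)) \<zeta> \<zeta>)) (at \<zeta>)"
      unfolding G' by (intro tendsto_mult tendsto_diff tendsto_const tendsto_exp tendsto_ident_at tendsto_lcoef tendsto_lge xs)
    then show ?thesis by simp
  qed
  have L2: "((\<lambda>\<xi>. G2 \<xi> \<zeta> b' b) \<longlongrightarrow> (?q * ?q - 1) * oid b' b) (at \<zeta>)" if b: "b' \<in> fock" "b \<in> fock" for b' b \<zeta>
  proof -
    from F2[OF b] obtain xs where xs: "\<forall>(c, d)\<in>set xs. sephol c"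
      and N: "(\<lambda>\<zeta>1 \<zeta>2 \<omega>. nexp h (phiL h \<zeta>1 + minusL h (-1) \<omega> + dualL h \<zeta>2) b' b) = lpe xs"
      and G: "\<And>\<zeta>1 \<zeta>2. G2 \<zeta>1 \<zeta>2 b' b = ?q * ?q * (exp \<zeta>1 - exp \<zeta>2) *
      ((- (?q * ?q) * - (exp (- \<zeta>2) / (?q * ?q)) - (?q * ?q - 1) * (exp (- \<zeta>2) / (?q * ?q)) / (1 - exp (- (2 * h) + 2 * h) * exp \<zeta>2 / exp \<zeta>1)) * lcoef xs 0 \<zeta>1 \<zeta>2
      + ((?q * ?q - 1) * - (exp (- \<zeta>2) / (?q * ?q)) + (?q * ?q - 1) * (exp (- \<zeta>2) / (?q * ?q)) / (1 - exp (- (2 * h) + 2 * h) * exp \<zeta>2 / exp \<zeta>1)) * lle xs 0 (exp (- (2 * h) - \<zeta>1)) \<zeta>1 \<zeta>2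
      + (- (?q * ?q) * (exp (- \<zeta>2) / (?q * ?q)) + (?q * ?q - 1) * (exp (- \<zeta>2) / (?q * ?q)) / (1 - exp (- (2 * h) + 2 * h) * exp \<zeta>2 / exp \<zeta>1)) * lge xs 0 (exp (2 * h + \<zeta>2)) \<zeta>1 \<zeta>2)"
      by blast
    \<comment> \<open>The result of cancelling the zero exp \<xi> - exp \<zeta> against the pole. It
      agrees with G2 wherever exp \<xi> and exp \<zeta> differ and is continuous at
      \<open>\<zeta>\<close>.\<close>
    let ?H = "\<lambda>\<xi>. ?q * ?q * (exp \<xi> - exp \<zeta>) * ((- (?q * ?q) * - (exp (- \<zeta>) / (?q * ?q))) * lcoef xs 0 \<xi> \<zeta>
       + ((?q * ?q - 1) * - (exp (- \<zeta>) / (?q * ?q))) * lle xs 0 (exp (- (2 * h) - \<xi>)) \<xi> \<zeta> + (- (?q * ?q) * (exp (- \<zeta>) / (?q * ?q))) * lge xs 0 (exp (2 * h + \<zeta>)) \<xi> \<zeta>)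
       + ?q * ?q * exp \<xi> * ((?q * ?q - 1) * (exp (- \<zeta>) / (?q * ?q))) * (lle xs 0 (exp (- (2 * h) - \<xi>)) \<xi> \<zeta> + lge xs 0 (exp (2 * h + \<zeta>)) \<xi> \<zeta> - lcoef xs 0 \<xi> \<zeta>)"
    have t1: "((\<lambda>\<xi>. ?H \<xi>) \<longlongrightarrow> ?H \<zeta>) (at \<zeta>)"
      by (intro tendsto_add tendsto_mult tendsto_diff tendsto_const tendsto_exp tendsto_ident_at tendsto_lcoef tendsto_lle tendsto_lge xs)
    have t2: "?H \<zeta> = (?q * ?q - 1) * oid b' b"
    proof -
      have "exp (- (2 * h) - \<zeta>) = exp (- (2 * h + \<zeta>))" by simp
      then have "lle xs 0 (exp (- (2 * h) - \<zeta>)) \<zeta> \<zeta> + lge xs 0 (exp (2 * h + \<zeta>)) \<zeta> \<zeta> - lcoef xs 0 \<zeta> \<zeta> = lpe xs \<zeta> \<zeta> (2 * h + \<zeta>)"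
        using delta_lpe[of xs 0 "2 * h + \<zeta>" \<zeta> \<zeta>] by simp
      also have "\<dots> = oid b' b"
        using fun_cong[OF fun_cong[OF fun_cong[OF N]], of \<zeta> "2 * h + \<zeta>" \<zeta>] nexp_zero[OF b, of h] unfolding dual_lins by simp
      finally show ?thesis by (simp add: exp_minus)
    qed
    have t3: "eventually (\<lambda>\<xi>. ?H \<xi> = G2 \<xi> \<zeta> b' b) (at \<zeta>)"
    proof -
      have "eventually (\<lambda>\<xi>. exp \<xi> \<noteq> exp \<zeta>) (at \<zeta>)"
        using eventually_cosparse_imp_eventually_at[OF cosparse_exp_neq UNIV_I, of "exp \<zeta>" \<zeta> UNIV] .
      then show ?thesis
      proof eventually_elim
        case (elim \<xi>)
        have alg: "k * ((A0 - B / d) * l0 + (A1 + B / d) * l1 + (A2 + B / d) * l2) = k * (A0 * l0 + A1 * l1 + A2 * l2) + k / d * B * (l1 + l2 - l0)"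
          for k d A0 A1 A2 B l0 l1 l2 :: complex by (simp add: divide_inverse algebra_simps)
        have "?q * ?q * (exp \<xi> - exp \<zeta>) / (1 - exp (- (2 * h) + 2 * h) * exp \<zeta> / exp \<xi>) = ?q * ?q * exp \<xi>"
          using elim by (simp add: field_simps)
        then show ?case unfolding G alg by simp
      qed
    qed
    from Lim_transform_eventually[OF t1[unfolded t2] t3] show ?thesis .
  qed
  have w: "cprod (\<lambda>\<zeta>. nexp h (phiL h \<zeta>)) (\<lambda>\<zeta>. md h (-1) (minusL h s) 0 \<odot> nexp h (dualL h \<zeta>)) G"
    if "contd (\<lambda>\<zeta>1 \<zeta>2. nexp h (phiL h \<zeta>1) \<odot> (md h (-1) (minusL h s) 0 \<odot> nexp h (dualL h \<zeta>2))) G" "s \<in> {1, -1}" for s G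
    by (rule cprod_words[OF vmaj_phi vmaj_dual md_cmaj[OF cur_minusL[OF that(2)]] that(1)])
  from cprod_comb_right[OF w[OF G1 m(1)] w[OF G2 m(2)] sepmer_const]
  have "cprod (\<lambda>\<zeta>. nexp h (phiL h \<zeta>)) (\<lambda>\<zeta>. fmode h 0 \<odot> nexp h (dualL h \<zeta>)) (\<lambda>x y. oscale (1 / (exp h - exp (- h))) (G1 x y - G2 x y))"
    by (rule cprod_cong[OF _ eqf_refl]) (unfold fmode_def, intro oprod_diff_left rowfin_comp md_rowfin)
  moreover have "((\<lambda>\<xi>. oscale (1 / (exp h - exp (- h))) (G1 \<xi> \<zeta> - G2 \<xi> \<zeta>) b' b) \<longlongrightarrow> - (exp h * oid b' b)) (at \<zeta>)"
    if b: "b' \<in> fock" "b \<in> fock" for b' b \<zeta>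
  proof -
    have "((\<lambda>\<xi>. 1 / (exp h - exp (- h)) * (G1 \<xi> \<zeta> b' b - G2 \<xi> \<zeta> b' b)) \<longlongrightarrow> 1 / (exp h - exp (- h)) * (0 - (?q * ?q - 1) * oid b' b)) (at \<zeta>)"
      by (intro tendsto_intros L1 L2 b)
    moreover have "1 / (exp h - exp (- h)) * (0 - (?q * ?q - 1) * oid b' b) = - (exp h * oid b' b)"
    proof -
      have "?q * ?q - 1 = ?q * (exp h - exp (- h))" by (simp add: right_diff_distrib flip: exp_add)
      then show ?thesis using qq by simp
    qed
    ultimately show ?thesis by (simp add: oscale_def)
  qed
  ultimately show ?thesis by blast
qed

end

section \<open>The R-matrix relations\<close>

lemma Rmat_values:
  assumes "(z - 1) / (z * q - inverse q) = A" "(q - inverse q) / (z * q - inverse q) = B" "(q - inverse q) * z / (z * q - inverse q) = C"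
    "(z * inverse q - q) / (z * q - inverse q) = E"
  shows "Rmat q z 1 1 1 1 = 1" "Rmat q z 1 2 1 2 = A" "Rmat q z 2 1 2 1 = A" "Rmat q z 2 1 1 2 = B" "Rmat q z 1 2 2 1 = C" "Rmat q z 2 2 2 2 = E"
    "Rmat q z 1 1 1 2 = 0" "Rmat q z 1 1 2 1 = 0" "Rmat q z 1 1 2 2 = 0" "Rmat q z 1 2 1 1 = 0" "Rmat q z 1 2 2 2 = 0"
    "Rmat q z 2 1 1 1 = 0" "Rmat q z 2 1 2 2 = 0" "Rmat q z 2 2 1 1 = 0" "Rmat q z 2 2 1 2 = 0" "Rmat q z 2 2 2 1 = 0"
  unfolding assms[symmetric] by (simp_all add: Rmat_def)

lemma sum_12: "(\<Sum>k\<in>{1, 2::nat}. g k) = g 1 + (g 2 :: complex)"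
  by simp

text \<open>Besides these identities the exchange relations only need that $P(z_2,z_1) = \rho P(z_1,z_2)$ with \<open>\<rho> = - E\<close> for
  $\phi$ and \<open>\<rho> = - 1 / E\<close> for $\psi^*$.\<close>

lemma R_identities:
  fixes q X Y :: complex
  assumes q: "q \<noteq> 0" and Y: "Y \<noteq> 0" and D: "q * q * X - Y \<noteq> 0" and r: "r = 1 / q"
  obtains A B C E where "(X / Y - 1) / (X / Y * q - inverse q) = A" "(q - inverse q) / (X / Y * q - inverse q) = B"
    "(q - inverse q) * (X / Y) / (X / Y * q - inverse q) = C" "(X / Y * inverse q - q) / (X / Y * q - inverse q) = E"
    "A = q * (X - Y) / (q * q * X - Y)" "E = (X - q * q * Y) / (q * q * X - Y)"
    "A + B * r = r" "B = A * r - E" "A * r + C = 1" "A = C * r + E * r"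
proof
  have d: "X / Y * q - inverse q = (q * q * X - Y) / (q * Y)" using q Y by (simp add: field_simps)
  show "(X / Y - 1) / (X / Y * q - inverse q) = q * (X - Y) / (q * q * X - Y)" "(q - inverse q) / (X / Y * q - inverse q) = (q * q - 1) * Y / (q * q * X - Y)"
    "(q - inverse q) * (X / Y) / (X / Y * q - inverse q) = (q * q - 1) * X / (q * q * X - Y)"
    "(X / Y * inverse q - q) / (X / Y * q - inverse q) = (X - q * q * Y) / (q * q * X - Y)"
    unfolding d divide_divide_eq_right
    by (rule arg_cong[where f = "\<lambda>n. n / (q * q * X - Y)"], use q Y in \<open>simp add: field_simps\<close>)+
  have "q * (X - Y) / D + (q * q - 1) * Y / D * r = r" "(q * q - 1) * Y / D = q * (X - Y) / D * r - (X - q * q * Y) / D"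
    "q * (X - Y) / D * r + (q * q - 1) * X / D = 1" "q * (X - Y) / D = (q * q - 1) * X / D * r + (X - q * q * Y) / D * r"
    if "D \<noteq> 0" "q * q * X - Y = D" for D
    unfolding r using that(1) q by (simp_all add: divide_simps) (simp_all add: that(2)[symmetric] algebra_simps)
  from this[OF D refl]
  show "q * (X - Y) / (q * q * X - Y) + (q * q - 1) * Y / (q * q * X - Y) * r = r"
    "(q * q - 1) * Y / (q * q * X - Y) = q * (X - Y) / (q * q * X - Y) * r - (X - q * q * Y) / (q * q * X - Y)"
    "q * (X - Y) / (q * q * X - Y) * r + (q * q - 1) * X / (q * q * X - Y) = 1"
    "q * (X - Y) / (q * q * X - Y) = (q * q - 1) * X / (q * q * X - Y) * r + (X - q * q * Y) / (q * q * X - Y) * r" .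
qed (rule refl)+

lemma same_apply:
  "same x r y s f True True P G b' b = x * (y * (G \<odot> f) b' b + r * (y * ((f \<odot> (P \<odot> f)) b' b + s * (f \<odot> G) b' b)))"
  "same x r y s f True False P G b' b = x * (G b' b + r * (f \<odot> P) b' b)"
  "same x r y s f False True P G b' b = y * ((P \<odot> f) b' b + s * G b' b)"
  "same x r y s f False False P G b' b = P b' b"
  by (simp_all add: same_def oscale_def)

context generic
begin

text \<open>The eliminated relation solved for G(z_2, z_1). The resulting coefficient of f P + P f
  is the R-matrix entry (z - 1) / (z q - 1/q) at z = z_1 / z_2; it is through this coefficient that
  the R-matrix enters.\<close>

lemma phi_exchange:
  assumes G: "cprod (\<lambda>\<zeta>. nexp h (phiL h \<zeta>)) (\<lambda>\<zeta>. fmode h 0 \<odot> nexp h (phiL h \<zeta>)) G"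
    and b: "b' \<in> fock" "b \<in> fock"
  shows "\<forall>\<^sub>\<approx>x\<in>UNIV. G y x b' b = G x y b' b + exp h * (exp x - exp y) / (exp h * exp h * exp x - exp y) *
    ((fmode h 0 \<odot> P_phi h x y) b' b + (P_phi h x y \<odot> fmode h 0) b' b)"
proof -
  let ?q = "exp h"
  obtain G' where G': "cprod (\<lambda>\<zeta>. nexp h (phiL h \<zeta>)) (\<lambda>\<zeta>. fmode h (0 - 1) \<odot> nexp h (phiL h \<zeta>)) G'"
    using cprod_phi_f_phi by blast
  have ne: "\<forall>\<^sub>\<approx>x\<in>UNIV. 1 * exp x \<noteq> ?q * ?q * exp y" "\<forall>\<^sub>\<approx>x\<in>UNIV. ?q * ?q * exp x \<noteq> exp y" for y
    by (intro cosparse_exp; simp)+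
  have \<rho>: "\<forall>\<^sub>\<approx>x\<in>UNIV. \<forall>b'\<in>fock. \<forall>b\<in>fock. P_phi h y x b' b =
      (exp x - ?q * ?q * exp y) / (exp y - ?q * ?q * exp x) * P_phi h x y b' b" for y
    using ne(1)[of y] ne(2)[of y] by eventually_elim (subst P_phi_swap; simp add: oscale_def)
  have R: "eqf (oscale ?q (fmode h (0 - 1) \<odot> nexp h (phiL h \<zeta>)) + oscale (- ?q * exp \<zeta>) (fmode h 0 \<odot> nexp h (phiL h \<zeta>)))
      (oscale (- 1) (nexp h (phiL h \<zeta>) \<odot> fmode h (0 - 1)) + oscale (?q * ?q * exp \<zeta>) (nexp h (phiL h \<zeta>) \<odot> fmode h 0))" for \<zeta>
    using exch_phi[of \<zeta> 0] unfolding exch_def by simp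
  have "\<forall>\<^sub>\<approx>x\<in>UNIV. (exp x - ?q * ?q * exp y) / (exp y - ?q * ?q * exp x) * ?q * ?q * (exp x - exp y) * (fmode h 0 \<odot> P_phi h x y) b' b
     + (exp x - ?q * ?q * exp y) / (exp y - ?q * ?q * exp x) * (?q * (?q * ?q) * exp x - ?q * 1 * exp y) * G x y b' b
     - (?q * (?q * ?q) * exp y - ?q * 1 * exp x) * G y x b' b
     + (exp x - ?q * ?q * exp y) / (exp y - ?q * ?q * exp x) * 1 * (?q * ?q) * (exp x - exp y) * (P_phi h x y \<odot> fmode h 0) b' b = 0"
    by (rule exchange_elim[OF vmaj_phi cmaj_fmode cmaj_fmode R cprod_phi[unfolded cprod_def, THEN conjunct1]
      G[unfolded cprod_def, THEN conjunct1] G'[unfolded cprod_def, THEN conjunct1] \<rho> b])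
  with ne(1)[of y] ne(2)[of y] show ?thesis
  proof eventually_elim
    case (elim x)
    let ?X = "exp x" and ?Y = "exp y" and ?a = "(fmode h 0 \<odot> P_phi h x y) b' b" and ?d = "(P_phi h x y \<odot> fmode h 0) b' b"
      and ?b = "G x y b' b" and ?c = "G y x b' b"
    have D: "?Y - ?q * ?q * ?X \<noteq> 0" "?X - ?q * ?q * ?Y \<noteq> 0" using elim(1,2) by auto
    \<comment> \<open>The two denominators are made opaque, so that the field arithmetic below
      treats them as variables.\<close>
    have "\<exists>D. D = ?Y - ?q * ?q * ?X" "\<exists>N. N = ?X - ?q * ?q * ?Y" by simp_all
    then obtain D N where DN: "D = ?Y - ?q * ?q * ?X" "N = ?X - ?q * ?q * ?Y" by blast
    have ne0: "D \<noteq> 0" "N \<noteq> 0" using D DN by simp_all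
    have s: "?q * (?q * ?q) * ?X - ?q * 1 * ?Y = - ?q * D" "?q * (?q * ?q) * ?Y - ?q * 1 * ?X = - ?q * N" "?q * ?q * ?X - ?Y = - D"
      unfolding DN by (simp_all add: algebra_simps)
    have "N / D * q * q * z * a + N / D * (- q * D) * b - (- q * N) * c + N / D * 1 * (q * q) * z * d = q * N * (q * z * (a + d) / D - b + c)"
      for q z a b c d :: complex using ne0(1) by (simp add: field_simps)
    then have "?q * N * (?q * (?X - ?Y) * (?a + ?d) / D - ?b + ?c) = 0"
      using elim(3) unfolding DN[symmetric] s by simp
    then have "?q * (?X - ?Y) * (?a + ?d) / D - ?b + ?c = 0" using ne0 by simp
    then have "?c = ?b - ?q * (?X - ?Y) * (?a + ?d) / D" by algebra
    then show ?case unfolding s by (simp only: divide_minus_right mult_minus_left times_divide_eq_left add_uminus_conv_diff)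
  qed
qed

text \<open>The same elimination with other constants. The quasi-symmetry factor is the inverse of
  the one for \<open>phi\<close>, and so the denominator has the points interchanged.\<close>

lemma psi_exchange:
  assumes G: "cprod (psi_op h) (\<lambda>\<zeta>. emode h (-1) \<odot> psi_op h \<zeta>) G"
    and b: "b' \<in> fock" "b \<in> fock"
  shows "\<forall>\<^sub>\<approx>x\<in>UNIV. G y x b' b = G x y b' b + - (exp h * (exp x - exp y) / (exp h * exp h * exp y - exp x)) *
    ((emode h (-1) \<odot> P_psi h x y) b' b + (P_psi h x y \<odot> emode h (-1)) b' b)"
proof -
  let ?q = "exp h" and ?e = "emode h (-1)"
  obtain G' where G': "cprod (psi_op h) (\<lambda>\<zeta>. emode h (-1 - 1) \<odot> psi_op h \<zeta>) G'"
    using cprod_psi_e_psi by blast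
  have ne: "\<forall>\<^sub>\<approx>x\<in>UNIV. 1 * exp x \<noteq> ?q * ?q * exp y" "\<forall>\<^sub>\<approx>x\<in>UNIV. ?q * ?q * exp x \<noteq> exp y" for y
    by (intro cosparse_exp; simp)+
  have \<rho>: "\<forall>\<^sub>\<approx>x\<in>UNIV. \<forall>b'\<in>fock. \<forall>b\<in>fock. P_psi h y x b' b =
      (?q * exp x - exp y / ?q) / (?q * exp y - exp x / ?q) * P_psi h x y b' b" for y
    using ne(1)[of y] ne(2)[of y] by eventually_elim (subst P_psi_swap; simp add: oscale_def field_simps)
  have R: "eqf (oscale (1 / ?q) (emode h (-1 - 1) \<odot> psi_op h \<zeta>) + oscale (- ?q * exp \<zeta>) (?e \<odot> psi_op h \<zeta>))
      (oscale (- 1) (psi_op h \<zeta> \<odot> emode h (-1 - 1)) + oscale (1 * exp \<zeta>) (psi_op h \<zeta> \<odot> ?e))" for \<zeta>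
    using exch_psi[of \<zeta> "-1"] unfolding exch_def by simp
  have "\<forall>\<^sub>\<approx>x\<in>UNIV. (?q * exp x - exp y / ?q) / (?q * exp y - exp x / ?q) * (1 / ?q) * ?q * (exp x - exp y) * (?e \<odot> P_psi h x y) b' b
     + (?q * exp x - exp y / ?q) / (?q * exp y - exp x / ?q) * (1 / ?q * 1 * exp x - ?q * 1 * exp y) * G x y b' b
     - (1 / ?q * 1 * exp y - ?q * 1 * exp x) * G y x b' b
     + (?q * exp x - exp y / ?q) / (?q * exp y - exp x / ?q) * 1 * 1 * (exp x - exp y) * (P_psi h x y \<odot> ?e) b' b = 0"
    by (rule exchange_elim[OF vmaj_psi cmaj_emode cmaj_emode R cprod_psi[unfolded cprod_def, THEN conjunct1]
      G[unfolded cprod_def, THEN conjunct1] G'[unfolded cprod_def, THEN conjunct1] \<rho> b])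
  with ne(1)[of y] ne(2)[of y] show ?thesis
  proof eventually_elim
    case (elim x)
    let ?X = "exp x" and ?Y = "exp y" and ?a = "(?e \<odot> P_psi h x y) b' b" and ?d = "(P_psi h x y \<odot> ?e) b' b"
      and ?b = "G x y b' b" and ?c = "G y x b' b"
    have "\<exists>D. D = ?q * ?q * ?Y - ?X" "\<exists>N. N = ?q * ?q * ?X - ?Y" by simp_all
    then obtain D N where DN: "D = ?q * ?q * ?Y - ?X" "N = ?q * ?q * ?X - ?Y" by blast
    have ne0: "D \<noteq> 0" "N \<noteq> 0" using elim(1,2) DN by auto
    have s: "?q * ?X - ?Y / ?q = N / ?q" "?q * ?Y - ?X / ?q = D / ?q" "1 / ?q * 1 * ?X - ?q * 1 * ?Y = - D / ?q"
      "1 / ?q * 1 * ?Y - ?q * 1 * ?X = - N / ?q"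
      unfolding DN by (simp_all add: field_simps)
    have "N / q / (D / q) * (1 / q) * q * z * a + N / q / (D / q) * (- D / q) * b - (- N / q) * c + N / q / (D / q) * 1 * 1 * z * d
      = N / q * (q * z * (a + d) / D - b + c)" if "q \<noteq> 0" for q z a b c d :: complex using ne0(1) that by (simp add: field_simps)
    then have "N / ?q * (?q * (?X - ?Y) * (?a + ?d) / D - ?b + ?c) = 0"
      using elim(3) exp_not_eq_zero unfolding DN[symmetric] s by metis
    then have "?q * (?X - ?Y) * (?a + ?d) / D - ?b + ?c = 0" using ne0 by simp
    then have "?c = ?b - ?q * (?X - ?Y) * (?a + ?d) / D" by algebra
    then show ?case unfolding DN[symmetric] by (simp only: divide_minus_right mult_minus_left times_divide_eq_left add_uminus_conv_diff)
  qed
qed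

end

lemma grade_signs: "(- 1 :: complex) ^ (grade 1 * grade 1) = 1" "(- 1 :: complex) ^ (grade 1 * grade 2) = 1"
  "(- 1 :: complex) ^ (grade 2 * grade 1) = 1" "(- 1 :: complex) ^ (grade 2 * grade 2) = -1"
  by (simp_all add: grade_def)

lemma mixed_apply:
  "mixed x r y s e f K' True True P b' b = x * (y * (- (P \<odot> (e \<odot> f)) b' b + s * ((P \<odot> K') b' b - (f \<odot> (P \<odot> e)) b' b))
      + r * (y * ((e \<odot> (P \<odot> f)) b' b - s * ((e \<odot> f) \<odot> P) b' b)))"
  "mixed x r y s e f K' True False P b' b = x * (- (P \<odot> e) b' b + r * (e \<odot> P) b' b)"
  "mixed x r y s e f K' False True P b' b = y * ((P \<odot> f) b' b - s * (f \<odot> P) b' b)"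
  "mixed x r y s e f K' False False P b' b = P b' b"
  by (simp_all add: mixed_def oscale_def)

context generic
begin

text \<open>After elimination everything is expressed by P, G, P f, f P, G f, f G and f P f at one
  order of the points. Each index pair is then a linear identity in these words, which the relations
  between the entries of the R-matrix make true.\<close>

lemma phi_relation:
  assumes G: "cprod (\<lambda>\<zeta>. nexp h (phiL h \<zeta>)) (\<lambda>\<zeta>. fmode h 0 \<odot> nexp h (phiL h \<zeta>)) G"
    and F: "\<And>i j x y. F i j x y = same (- 1) (exp (- h)) (- 1) (exp (- h)) (fmode h 0) (i = (1::nat)) (j = (1::nat)) (P_phi h x y) (G x y)"
    and ij: "i \<in> {1, 2}" "j \<in> {1, 2}" and b: "b' \<in> fock" "b \<in> fock"
  shows "\<forall>\<^sub>\<approx>x\<in>UNIV. F j i y x b' b =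
    (\<Sum>k\<in>{1, 2}. \<Sum>l\<in>{1, 2}. Rmat (exp h) (exp x / exp y) k l i j * F k l x y b' b * (- 1) ^ (grade i * grade j))"
proof -
  let ?q = "exp h" and ?f = "fmode h 0" and ?r = "exp (- h)"
  have ne: "\<forall>\<^sub>\<approx>x\<in>UNIV. 1 * exp x \<noteq> ?q * ?q * exp y" "\<forall>\<^sub>\<approx>x\<in>UNIV. ?q * ?q * exp x \<noteq> exp y"
    by (intro cosparse_exp; simp)+
  have ev: "\<forall>\<^sub>\<approx>x\<in>UNIV. (G y x \<odot> ?f) b' b = (G x y \<odot> ?f) b' b + ?q * (exp x - exp y) / (?q * ?q * exp x - exp y) * (?f \<odot> (P_phi h x y \<odot> ?f)) b' b \<and>
    (?f \<odot> G y x) b' b = (?f \<odot> G x y) b' b + ?q * (exp x - exp y) / (?q * ?q * exp x - exp y) * (?f \<odot> (P_phi h x y \<odot> ?f)) b' b"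
    by (rule eliminated_words[OF fmode_fin fmode_sq b]) (rule phi_exchange[OF G])
  show ?thesis
    using ne phi_exchange[OF G b, of y] ev
  proof eventually_elim
    case (elim x)
    have D: "?q * ?q * exp x - exp y \<noteq> 0" and r: "?r = 1 / ?q" using elim(2) by (simp_all add: exp_minus divide_inverse)
    obtain A B C E where R: "(exp x / exp y - 1) / (exp x / exp y * ?q - inverse ?q) = A" "(?q - inverse ?q) / (exp x / exp y * ?q - inverse ?q) = B"
      "(?q - inverse ?q) * (exp x / exp y) / (exp x / exp y * ?q - inverse ?q) = C" "(exp x / exp y * inverse ?q - ?q) / (exp x / exp y * ?q - inverse ?q) = E"
      and A: "A = ?q * (exp x - exp y) / (?q * ?q * exp x - exp y)" and E: "E = (exp x - ?q * ?q * exp y) / (?q * ?q * exp x - exp y)"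
      and I: "A + B * ?r = ?r" "B = A * ?r - E" "A * ?r + C = 1" "A = C * ?r + E * ?r"
      using R_identities[OF exp_not_eq_zero exp_not_eq_zero D r] by metis
    have "P_phi h y x = oscale ((exp x - ?q * ?q * exp y) / (exp y - ?q * ?q * exp x)) (P_phi h x y)"
      by (rule P_phi_swap) (use elim(1,2) in auto)
    also have "(exp x - ?q * ?q * exp y) / (exp y - ?q * ?q * exp x) = - E"
      unfolding E minus_divide_right by simp
    finally have "eqf (P_phi h y x) (oscale (- E) (P_phi h x y))" by simp
    note W = eqf_words[OF this b]
    note c = elim(3,4)[folded A]
    have v: "F 1 1 u w b' b = (G u w \<odot> ?f) b' b + ?r * ((?f \<odot> (P_phi h u w \<odot> ?f)) b' b + ?r * (?f \<odot> G u w) b' b)"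
      "F 1 2 u w b' b = - (G u w b' b + ?r * (?f \<odot> P_phi h u w) b' b)"
      "F 2 1 u w b' b = - ((P_phi h u w \<odot> ?f) b' b + ?r * G u w b' b)" "F 2 2 u w b' b = P_phi h u w b' b" for u w
      by (simp_all add: F same_apply algebra_simps)
    show ?case
      using ij
    proof (elim insertE emptyE; hypsubst)
      show "F 1 1 y x b' b = (\<Sum>k\<in>{1, 2}. \<Sum>l\<in>{1, 2}. Rmat ?q (exp x / exp y) k l 1 1 * F k l x y b' b * (- 1) ^ (grade 1 * grade 1))"
        unfolding sum_12 Rmat_values[OF R] grade_signs v W using c I by algebra
      show "F 2 1 y x b' b = (\<Sum>k\<in>{1, 2}. \<Sum>l\<in>{1, 2}. Rmat ?q (exp x / exp y) k l 1 2 * F k l x y b' b * (- 1) ^ (grade 1 * grade 2))"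
        unfolding sum_12 Rmat_values[OF R] grade_signs v W using c I by algebra
      show "F 1 2 y x b' b = (\<Sum>k\<in>{1, 2}. \<Sum>l\<in>{1, 2}. Rmat ?q (exp x / exp y) k l 2 1 * F k l x y b' b * (- 1) ^ (grade 2 * grade 1))"
        unfolding sum_12 Rmat_values[OF R] grade_signs v W using c I by algebra
      show "F 2 2 y x b' b = (\<Sum>k\<in>{1, 2}. \<Sum>l\<in>{1, 2}. Rmat ?q (exp x / exp y) k l 2 2 * F k l x y b' b * (- 1) ^ (grade 2 * grade 2))"
        unfolding sum_12 Rmat_values[OF R] grade_signs v W by algebra
    qed
  qed
qed

text \<open>Linear algebra as for \<open>phi\<close>, but the R-matrix now multiplies the products
  at interchanged points. The factors \<rho> that these carry are removed by \<rho> E = -1.\<close>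

lemma psi_relation:
  assumes G: "cprod (psi_op h) (\<lambda>\<zeta>. emode h (-1) \<odot> psi_op h \<zeta>) G"
    and F: "\<And>i j x y. F i j x y = same (exp h) (exp (- h)) (exp h) (exp (- h)) (emode h (-1)) (i = (1::nat)) (j = (1::nat)) (P_psi h x y) (G x y)"
    and ij: "i \<in> {1, 2}" "j \<in> {1, 2}" and b: "b' \<in> fock" "b \<in> fock"
  shows "\<forall>\<^sub>\<approx>x\<in>UNIV. F i j x y b' b =
    (\<Sum>k\<in>{1, 2}. \<Sum>l\<in>{1, 2}. Rmat (exp h) (exp x / exp y) i j k l * F l k y x b' b * (- 1) ^ (grade i * grade j))"
proof -
  let ?q = "exp h" and ?f = "emode h (-1)" and ?r = "exp (- h)"
  have ne: "\<forall>\<^sub>\<approx>x\<in>UNIV. 1 * exp x \<noteq> ?q * ?q * exp y" "\<forall>\<^sub>\<approx>x\<in>UNIV. ?q * ?q * exp x \<noteq> exp y"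
    by (intro cosparse_exp; simp)+
  have ev: "\<forall>\<^sub>\<approx>x\<in>UNIV. (G y x \<odot> ?f) b' b = (G x y \<odot> ?f) b' b + - (?q * (exp x - exp y) / (?q * ?q * exp y - exp x)) * (?f \<odot> (P_psi h x y \<odot> ?f)) b' b \<and>
    (?f \<odot> G y x) b' b = (?f \<odot> G x y) b' b + - (?q * (exp x - exp y) / (?q * ?q * exp y - exp x)) * (?f \<odot> (P_psi h x y \<odot> ?f)) b' b"
    by (rule eliminated_words[OF emode_fin emode_sq b]) (rule psi_exchange[OF G])
  show ?thesis
    using ne psi_exchange[OF G b, of y] ev
  proof eventually_elim
    case (elim x)
    have D: "?q * ?q * exp x - exp y \<noteq> 0" and r: "?r = 1 / ?q" using elim(2) by (simp_all add: exp_minus divide_inverse)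
    have D': "?q * ?q * exp y - exp x \<noteq> 0" using elim(1) by simp
    obtain A B C E where R: "(exp x / exp y - 1) / (exp x / exp y * ?q - inverse ?q) = A" "(?q - inverse ?q) / (exp x / exp y * ?q - inverse ?q) = B"
      "(?q - inverse ?q) * (exp x / exp y) / (exp x / exp y * ?q - inverse ?q) = C" "(exp x / exp y * inverse ?q - ?q) / (exp x / exp y * ?q - inverse ?q) = E"
      and A: "A = ?q * (exp x - exp y) / (?q * ?q * exp x - exp y)" and E: "E = (exp x - ?q * ?q * exp y) / (?q * ?q * exp x - exp y)"
      and I: "A + B * ?r = ?r" "B = A * ?r - E" "A * ?r + C = 1" "A = C * ?r + E * ?r"
      using R_identities[OF exp_not_eq_zero exp_not_eq_zero D r] by metis
    \<comment> \<open>The quasi-symmetry factor of P. It is -1/E, and the coefficient in the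
      exchange relation is -A times it.\<close>
    define \<rho> where "\<rho> = (?q * ?q * exp x - exp y) / (?q * ?q * exp y - exp x)"
    have \<rho>: "\<rho> * E = - 1" "- (?q * (exp x - exp y) / (?q * ?q * exp y - exp x)) = - (A * \<rho>)"
    proof -
      have *: "N / M * (- M / N) = - 1" "- (u / M) = - (u / N * (N / M))" if "N \<noteq> 0" "M \<noteq> 0" for N M u :: complex using that by simp_all
      have E': "E = - (?q * ?q * exp y - exp x) / (?q * ?q * exp x - exp y)" unfolding E by simp
      show "\<rho> * E = - 1" unfolding E' \<rho>_def by (rule *(1)[OF D D'])
      show "- (?q * (exp x - exp y) / (?q * ?q * exp y - exp x)) = - (A * \<rho>)" unfolding A \<rho>_def by (rule *(2)[OF D D'])
    qed
    have "P_psi h y x = oscale ((?q * exp x - exp y / ?q) / (?q * exp y - exp x / ?q)) (P_psi h x y)"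
      by (rule P_psi_swap) (use elim(1,2) in \<open>auto simp: field_simps\<close>)
    also have "(?q * exp x - exp y / ?q) / (?q * exp y - exp x / ?q) = \<rho>"
    proof -
      have "?q * exp x - exp y / ?q = (?q * ?q * exp x - exp y) / ?q" "?q * exp y - exp x / ?q = (?q * ?q * exp y - exp x) / ?q"
        by (simp_all add: field_simps)
      then show ?thesis unfolding \<rho>_def by simp
    qed
    finally have "eqf (P_psi h y x) (oscale \<rho> (P_psi h x y))" by simp
    note W = eqf_words[OF this b]
    note c = elim(3,4)[unfolded \<rho>(2)]
    have qr: "?q * ?r = 1" by (simp add: exp_minus)
    have v: "F 1 1 u w b' b = ?q * ?q * ((G u w \<odot> ?f) b' b + ?r * ((?f \<odot> (P_psi h u w \<odot> ?f)) b' b + ?r * (?f \<odot> G u w) b' b))"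
      "F 1 2 u w b' b = ?q * (G u w b' b + ?r * (?f \<odot> P_psi h u w) b' b)"
      "F 2 1 u w b' b = ?q * ((P_psi h u w \<odot> ?f) b' b + ?r * G u w b' b)" "F 2 2 u w b' b = P_psi h u w b' b" for u w
      unfolding F by (simp_all add: same_apply) (simp add: algebra_simps)
    show ?case
      using ij
    proof (elim insertE emptyE; hypsubst)
      show "F 1 1 x y b' b = (\<Sum>k\<in>{1, 2}. \<Sum>l\<in>{1, 2}. Rmat ?q (exp x / exp y) 1 1 k l * F l k y x b' b * (- 1) ^ (grade 1 * grade 1))"
        unfolding sum_12 Rmat_values[OF R] grade_signs v W using c I \<rho>(1) by algebra
      show "F 1 2 x y b' b = (\<Sum>k\<in>{1, 2}. \<Sum>l\<in>{1, 2}. Rmat ?q (exp x / exp y) 1 2 k l * F l k y x b' b * (- 1) ^ (grade 1 * grade 2))"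
        unfolding sum_12 Rmat_values[OF R] grade_signs v W using c I \<rho>(1) by algebra
      show "F 2 1 x y b' b = (\<Sum>k\<in>{1, 2}. \<Sum>l\<in>{1, 2}. Rmat ?q (exp x / exp y) 2 1 k l * F l k y x b' b * (- 1) ^ (grade 2 * grade 1))"
        unfolding sum_12 Rmat_values[OF R] grade_signs v W using c I \<rho>(1) by algebra
      show "F 2 2 x y b' b = (\<Sum>k\<in>{1, 2}. \<Sum>l\<in>{1, 2}. Rmat ?q (exp x / exp y) 2 2 k l * F l k y x b' b * (- 1) ^ (grade 2 * grade 2))"
        unfolding sum_12 Rmat_values[OF R] grade_signs v W using \<rho>(1) by algebra
    qed
  qed
qed

text \<open>Only i = j = 1 needs an argument. Each side contains e f + f e moved past one operator,
  hence a q-integer with displaced weights. The two displaced ones add up to (q + 1/q) times the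
  plain one, which commutes with the product, since \<open>psi_op\<close> raises A^1_0 by 1 and
  phi_2 lowers it by 1.\<close>

lemma psi_phi_relation:
  assumes b: "b' \<in> fock" "b \<in> fock" and ij: "i \<in> {1, 2}" "j \<in> {1, 2}"
  shows "mixed (exp h) (exp (- h)) (- 1) (exp (- h)) (emode h (-1)) (fmode h 0) (Kop h (exp (- h)) (exp h)) (i = (1::nat)) (j = (1::nat)) (P_psi_phi h x y) b' b
    = mixed (- 1) (exp (- h)) (exp h) (exp (- h)) (fmode h 0) (emode h (-1)) (Kop h (exp h) (exp (- h))) (j = 1) (i = 1) (P_phi_psi h y x) b' b
      * (- 1) ^ (grade i * grade j)"
proof -
  let ?q = "exp h" and ?r = "exp (- h)" and ?e = "emode h (-1)" and ?f = "fmode h 0" and ?P = "P_psi_phi h x y"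
  have qr: "?q * ?r = 1" by (simp add: exp_minus)
  have w: "(P_phi_psi h y x \<odot> A) b' b = - (?P \<odot> A) b' b" "(A \<odot> P_phi_psi h y x) b' b = - (A \<odot> ?P) b' b"
    "(A \<odot> (P_phi_psi h y x \<odot> B)) b' b = - (A \<odot> (?P \<odot> B)) b' b" "P_phi_psi h y x b' b = - ?P b' b" for A B
    unfolding P_phi_psi_swap oprod_oscale_left oprod_oscale_right by (simp_all add: oscale_def)
  have K0: "(Kop h 1 1 \<odot> ?P) b' b = (?P \<odot> Kop h 1 1) b' b"
  proof -
    have "shifts 0 ?P"
      unfolding P_psi_phi_def PN_psi_phi_def
      by (intro shifts_comb shifts_oscale shifts_nexp) (simp_all add: psiL_def phiL_def vx_def)
    from Kop_comm[OF this, of h 1 1] show ?thesis using b by (simp add: eqf_def)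
  qed
  have K1: "(?P \<odot> Kop h 1 1) b' b = (?P \<odot> (?e \<odot> ?f)) b' b + (?P \<odot> (?f \<odot> ?e)) b' b"
  proof -
    have "eqf (?P \<odot> Kop h 1 1) (?P \<odot> (?e \<odot> ?f + ?f \<odot> ?e))" by (rule eqf_oprod[OF eqf_refl anticomm_e_f])
    also have "eqf \<dots> (?P \<odot> (?e \<odot> ?f) + ?P \<odot> (?f \<odot> ?e))"
      by (intro oprod_add_right colfin_comp colfin_prod emode_fin fmode_fin)
    finally show ?thesis using b by (simp add: eqf_def)
  qed
  have K2: "(Kop h 1 1 \<odot> ?P) b' b = ((?e \<odot> ?f) \<odot> ?P) b' b + ((?f \<odot> ?e) \<odot> ?P) b' b"
  proof -
    have "eqf (Kop h 1 1 \<odot> ?P) ((?e \<odot> ?f + ?f \<odot> ?e) \<odot> ?P)" by (rule eqf_oprod[OF anticomm_e_f eqf_refl])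
    also have "eqf \<dots> ((?e \<odot> ?f) \<odot> ?P + (?f \<odot> ?e) \<odot> ?P)"
      by (intro oprod_add_left rowfin_comp rowfin_prod emode_fin fmode_fin)
    finally show ?thesis using b by (simp add: eqf_def)
  qed
  \<comment> \<open>The q-integer identity [N - 1] + [N + 1] = (q + 1/q) [N].\<close>
  have K3: "(?P \<odot> Kop h ?r ?q) b' b + (?P \<odot> Kop h ?q ?r) b' b = (?q + ?r) * (?P \<odot> Kop h 1 1) b' b"
  proof -
    have "p * ((?r * u - ?q * v) / k) + p * ((?q * u - ?r * v) / k) = (?q + ?r) * (p * ((1 * u - 1 * v) / k))" for p u v k
      by (simp add: divide_inverse algebra_simps)
    then show ?thesis unfolding Kop_def diagop_right[OF b(2)] .
  qed
  show ?thesis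
    using ij
  proof (elim insertE emptyE; hypsubst)
    show "mixed ?q ?r (- 1) ?r ?e ?f (Kop h ?r ?q) (1 = (1::nat)) (1 = (1::nat)) ?P b' b
      = mixed (- 1) ?r ?q ?r ?f ?e (Kop h ?q ?r) (1 = (1::nat)) (1 = (1::nat)) (P_phi_psi h y x) b' b * (- 1) ^ (grade 1 * grade 1)"
      unfolding simp_thms mixed_apply w grade_signs using K0 K1 K2 K3 qr by algebra
  qed (simp_all add: mixed_apply w grade_def)
qed

lemma phi_eq: "i \<in> {1, 2} \<Longrightarrow> eqf (phi h i \<zeta>) ((if i = 1 then dbl (- 1) (exp (- h)) (fmode h 0) (\<lambda>\<zeta>. nexp h (phiL h \<zeta>)) else (\<lambda>\<zeta>. nexp h (phiL h \<zeta>))) \<zeta>)"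
  and dual_eq: "i \<in> {1, 2} \<Longrightarrow> eqf (phi_dual h i \<zeta>) ((if i = 2 then dbl (exp (- h)) (- exp h) (fmode h 0) (\<lambda>\<zeta>. nexp h (dualL h \<zeta>)) else (\<lambda>\<zeta>. nexp h (dualL h \<zeta>))) \<zeta>)"
  and psi_eq: "i \<in> {1, 2} \<Longrightarrow> eqf (psi_dual h i \<zeta>) ((if i = 1 then dbl (exp h) (exp (- h)) (emode h (-1)) (psi_op h) else psi_op h) \<zeta>)"
  using phi1_eq phi2_eq dual1_eq dual2_eq psi1_eq psi2_eq by auto

text \<open>In the limit all words with P vanish and G becomes -q times the identity. The two
  diagonal components give q directly. For i = 1, j = 2 the surviving words G f and f G both tend to
  -q f, and their weights cancel.\<close>

lemma inverse_relation:
  assumes G: "\<And>b' b \<zeta>. b' \<in> fock \<Longrightarrow> b \<in> fock \<Longrightarrow> ((\<lambda>\<xi>. G \<xi> \<zeta> b' b) \<longlongrightarrow> - (exp h * oid b' b)) (at \<zeta>)"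
    and ij: "i \<in> {1, 2}" "j \<in> {1, 2}" and b: "b' \<in> fock" "b \<in> fock"
  shows "((\<lambda>\<xi>. same (- 1) (exp (- h)) (exp (- h)) (- exp h) (fmode h 0) (i = (1::nat)) (j = (2::nat)) (P_dual h \<xi> \<zeta>) (G \<xi> \<zeta>) b' b)
    \<longlongrightarrow> exp h * (if i = j then 1 else 0) * oid b' b) (at \<zeta>)"
proof -
  let ?q = "exp h" and ?r = "exp (- h)" and ?f = "fmode h 0" and ?Z = "oscale (- exp h) oid"
  have qr: "?r * ?q = 1" by (simp flip: exp_add)
  have G': "((\<lambda>\<xi>. G \<xi> \<zeta> k l) \<longlongrightarrow> ?Z k l) (at \<zeta>)" if "k \<in> fock" "l \<in> fock" for k l
    using G[OF that, of \<zeta>] by (simp add: oscale_def)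
  have P: "((\<lambda>\<xi>. P_dual h \<xi> \<zeta> k l) \<longlongrightarrow> 0 k l) (at \<zeta>)" if "k \<in> fock" "l \<in> fock" for k l
    using P_dual_limit[OF that] by simp
  have Pf: "((\<lambda>\<xi>. (P_dual h \<xi> \<zeta> \<odot> ?f) k l) \<longlongrightarrow> 0) (at \<zeta>)" if "k \<in> fock" "l \<in> fock" for k l
    using tendsto_col[where A = "\<lambda>\<xi>. P_dual h \<xi> \<zeta>" and l = 0, OF fmode_fin(2) that P[OF that(1)]] by (simp add: oprod_zero_left)
  have fP: "((\<lambda>\<xi>. (?f \<odot> P_dual h \<xi> \<zeta>) b' b) \<longlongrightarrow> 0) (at \<zeta>)"
    using tendsto_row[where A = "\<lambda>\<xi>. P_dual h \<xi> \<zeta>" and l = 0, OF fmode_fin(1) b P[OF _ b(2)]] by (simp add: oprod_zero_right)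
  have fPf: "((\<lambda>\<xi>. (?f \<odot> (P_dual h \<xi> \<zeta> \<odot> ?f)) b' b) \<longlongrightarrow> 0) (at \<zeta>)"
    using tendsto_row[where A = "\<lambda>\<xi>. P_dual h \<xi> \<zeta> \<odot> ?f" and l = 0, OF fmode_fin(1) b] Pf[OF _ b(2)] by (simp add: oprod_zero_right)
  have Gf: "((\<lambda>\<xi>. (G \<xi> \<zeta> \<odot> ?f) b' b) \<longlongrightarrow> - ?q * ?f b' b) (at \<zeta>)"
    using tendsto_col[where A = "\<lambda>\<xi>. G \<xi> \<zeta>" and l = ?Z, OF fmode_fin(2) b G'[OF b(1)]]
    unfolding oprod_oscale_left unfolding oscale_def oprod_oid_left[OF b(1)] .
  have fG: "((\<lambda>\<xi>. (?f \<odot> G \<xi> \<zeta>) b' b) \<longlongrightarrow> - ?q * ?f b' b) (at \<zeta>)"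
    using tendsto_row[where A = "\<lambda>\<xi>. G \<xi> \<zeta>" and l = ?Z, OF fmode_fin(1) b G'[OF _ b(2)]]
    unfolding oprod_oscale_right unfolding oscale_def oprod_oid_right[OF b(2)] .
  show ?thesis
    using ij
  proof (elim insertE emptyE; hypsubst)
    have "((\<lambda>\<xi>. - 1 * (G \<xi> \<zeta> b' b + ?r * (?f \<odot> P_dual h \<xi> \<zeta>) b' b)) \<longlongrightarrow> - 1 * (- (?q * oid b' b) + ?r * 0)) (at \<zeta>)"
      by (intro tendsto_mult tendsto_add tendsto_const G b fP)
    then show "((\<lambda>\<xi>. same (- 1) ?r ?r (- ?q) ?f (1 = (1::nat)) (1 = (2::nat)) (P_dual h \<xi> \<zeta>) (G \<xi> \<zeta>) b' b)
      \<longlongrightarrow> ?q * (if (1::nat) = 1 then 1 else 0) * oid b' b) (at \<zeta>)"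
      by (simp add: same_apply)
    have "((\<lambda>\<xi>. - 1 * (?r * (G \<xi> \<zeta> \<odot> ?f) b' b + ?r * (?r * ((?f \<odot> (P_dual h \<xi> \<zeta> \<odot> ?f)) b' b + - ?q * (?f \<odot> G \<xi> \<zeta>) b' b))))
      \<longlongrightarrow> - 1 * (?r * (- ?q * ?f b' b) + ?r * (?r * (0 + - ?q * (- ?q * ?f b' b))))) (at \<zeta>)"
      by (intro tendsto_mult tendsto_add tendsto_const Gf fPf fG)
    moreover have e: "- 1 * (?r * (- ?q * ?f b' b) + ?r * (?r * (0 + - ?q * (- ?q * ?f b' b)))) = 0" using qr by algebra
    ultimately show "((\<lambda>\<xi>. same (- 1) ?r ?r (- ?q) ?f (1 = (1::nat)) (2 = (2::nat)) (P_dual h \<xi> \<zeta>) (G \<xi> \<zeta>) b' b)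
      \<longlongrightarrow> ?q * (if (1::nat) = 2 then 1 else 0) * oid b' b) (at \<zeta>)"
      unfolding e by (simp add: same_apply)
    show "((\<lambda>\<xi>. same (- 1) ?r ?r (- ?q) ?f (2 = (1::nat)) (1 = (2::nat)) (P_dual h \<xi> \<zeta>) (G \<xi> \<zeta>) b' b)
      \<longlongrightarrow> ?q * (if (2::nat) = 1 then 1 else 0) * oid b' b) (at \<zeta>)"
      using P[OF b] by (simp add: same_apply)
    have "((\<lambda>\<xi>. ?r * ((P_dual h \<xi> \<zeta> \<odot> ?f) b' b + - ?q * G \<xi> \<zeta> b' b)) \<longlongrightarrow> ?r * (0 + - ?q * - (?q * oid b' b))) (at \<zeta>)"
      by (intro tendsto_mult tendsto_add tendsto_const G b Pf)
    moreover have e: "?r * (0 + - ?q * - (?q * oid b' b)) = ?q * oid b' b" using qr by algebra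
    ultimately show "((\<lambda>\<xi>. same (- 1) ?r ?r (- ?q) ?f (2 = (1::nat)) (2 = (2::nat)) (P_dual h \<xi> \<zeta>) (G \<xi> \<zeta>) b' b)
      \<longlongrightarrow> ?q * (if (2::nat) = 2 then 1 else 0) * oid b' b) (at \<zeta>)"
      unfolding e by (simp add: same_apply)
  qed
qed

end

section \<open>The graded Faddeev-Zamolodchikov and invertibility relations\<close>

theorem proposition2:
  fixes h q :: complex
  assumes q: "q = exp h"
    and generic: "\<forall>n::nat. 0 < n \<longrightarrow> q ^ n \<noteq> 1"
  shows
    "\<exists>F_phi F_psi F_psi_phi F_phi_psi F_inv :: nat \<Rightarrow> nat \<Rightarrow> complex \<Rightarrow> complex \<Rightarrow> oper.
       (\<forall>i\<in>{1, 2}. \<forall>j\<in>{1, 2}.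
          continued_product (phi h i) (phi h j) (F_phi i j) \<and>
          continued_product (psi_dual h i) (psi_dual h j) (F_psi i j) \<and>
          continued_product (psi_dual h i) (phi h j) (F_psi_phi i j) \<and>
          continued_product (phi h i) (psi_dual h j) (F_phi_psi i j) \<and>
          continued_product (phi h i) (phi_dual h j) (F_inv i j)) \<and>
       (\<forall>i\<in>{1, 2}. \<forall>j\<in>{1, 2}. \<forall>b'\<in>fock. \<forall>b\<in>fock. \<forall>\<zeta>2. \<forall>\<^sub>\<approx>\<zeta>1\<in>UNIV.
          F_phi j i \<zeta>2 \<zeta>1 b' b =
            (\<Sum>k\<in>{1, 2}. \<Sum>l\<in>{1, 2}.
               Rmat q (exp \<zeta>1 / exp \<zeta>2) k l i j * F_phi k l \<zeta>1 \<zeta>2 b' b * (- 1) ^ (grade i * grade j))) \<and>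
       (\<forall>i\<in>{1, 2}. \<forall>j\<in>{1, 2}. \<forall>b'\<in>fock. \<forall>b\<in>fock. \<forall>\<zeta>2. \<forall>\<^sub>\<approx>\<zeta>1\<in>UNIV.
          F_psi i j \<zeta>1 \<zeta>2 b' b =
            (\<Sum>k\<in>{1, 2}. \<Sum>l\<in>{1, 2}.
               Rmat q (exp \<zeta>1 / exp \<zeta>2) i j k l * F_psi l k \<zeta>2 \<zeta>1 b' b * (- 1) ^ (grade i * grade j))) \<and>
       (\<forall>i\<in>{1, 2}. \<forall>j\<in>{1, 2}. \<forall>b'\<in>fock. \<forall>b\<in>fock. \<forall>\<zeta>2. \<forall>\<^sub>\<approx>\<zeta>1\<in>UNIV.
          F_psi_phi i j \<zeta>1 \<zeta>2 b' b = F_phi_psi j i \<zeta>2 \<zeta>1 b' b * (- 1) ^ (grade i * grade j)) \<and>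
       (\<forall>i\<in>{1, 2}. \<forall>j\<in>{1, 2}. \<forall>b'\<in>fock. \<forall>b\<in>fock. \<forall>\<zeta>.
          ((\<lambda>\<xi>. F_inv i j \<xi> \<zeta> b' b) \<longlongrightarrow> q * (if i = j then 1 else 0) * oid b' b) (at \<zeta>))"
proof -
  have gen: "generic h" by (rule generic.intro) (use q generic in simp)
  interpret generic h by (rule gen)
  obtain G1 where G1: "cprod (\<lambda>\<zeta>. nexp h (phiL h \<zeta>)) (\<lambda>\<zeta>. fmode h 0 \<odot> nexp h (phiL h \<zeta>)) G1"
    using cprod_phi_f_phi by blast
  obtain G2 where G2: "cprod (psi_op h) (\<lambda>\<zeta>. emode h (-1) \<odot> psi_op h \<zeta>) G2"
    using cprod_psi_e_psi by blast
  obtain G3 where G3: "cprod (\<lambda>\<zeta>. nexp h (phiL h \<zeta>)) (\<lambda>\<zeta>. fmode h 0 \<odot> nexp h (dualL h \<zeta>)) G3"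
    and G3': "\<And>b' b \<zeta>. b' \<in> fock \<Longrightarrow> b \<in> fock \<Longrightarrow> ((\<lambda>\<xi>. G3 \<xi> \<zeta> b' b) \<longlongrightarrow> - (exp h * oid b' b)) (at \<zeta>)"
    using cprod_phi_f_dual by blast
  let ?r = "exp (- h)" and ?f = "fmode h 0" and ?e = "emode h (-1)"
  define F1 where "F1 = (\<lambda>i j x y. same (- 1) ?r (- 1) ?r ?f (i = (1::nat)) (j = (1::nat)) (P_phi h x y) (G1 x y))"
  define F2 where "F2 = (\<lambda>i j x y. same (exp h) ?r (exp h) ?r ?e (i = (1::nat)) (j = (1::nat)) (P_psi h x y) (G2 x y))"
  define F3 where "F3 = (\<lambda>i j x y. mixed (exp h) ?r (- 1) ?r ?e ?f (Kop h ?r (exp h)) (i = (1::nat)) (j = (1::nat)) (P_psi_phi h x y))"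
  define F4 where "F4 = (\<lambda>i j x y. mixed (- 1) ?r (exp h) ?r ?f ?e (Kop h (exp h) ?r) (i = (1::nat)) (j = (1::nat)) (P_phi_psi h x y))"
  define F5 where "F5 = (\<lambda>i j x y. same (- 1) ?r ?r (- exp h) ?f (i = (1::nat)) (j = (2::nat)) (P_dual h x y) (G3 x y))"
  \<comment> \<open>The weights on the right come from the shifts of A^1_0, by -1 for phi_2 and by 1
    for psi^*_2. Each of the two mixed orders needs the relation for its right-hand factor.\<close>
  have K: "eqf (Kop h 1 1 \<odot> nexp h (phiL h \<zeta>)) (nexp h (phiL h \<zeta>) \<odot> Kop h ?r (exp h))"
    "eqf (Kop h 1 1 \<odot> psi_op h \<zeta>) (psi_op h \<zeta> \<odot> Kop h (exp h) ?r)" for \<zeta>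
    using Kop_comm[OF shifts_phi, of h 1 1 \<zeta>] Kop_comm[OF shifts_psi, of h 1 1 \<zeta>] by simp_all
  have ef: "eqf (Kop h 1 1) (?f \<odot> ?e + ?e \<odot> ?f)" using anticomm_e_f by (simp only: add.commute)
  have C: "continued_product (phi h i) (phi h j) (F1 i j)" "continued_product (psi_dual h i) (psi_dual h j) (F2 i j)"
    "continued_product (psi_dual h i) (phi h j) (F3 i j)" "continued_product (phi h i) (psi_dual h j) (F4 i j)"
    "continued_product (phi h i) (phi_dual h j) (F5 i j)" if ij: "i \<in> {1, 2}" "j \<in> {1, 2}" for i j
    unfolding F1_def F2_def F3_def F4_def F5_def
    subgoal by (rule cprod_continued[OF cprod_same_if[OF vmaj_phi vmaj_phi cmaj_fmode fmode_sq cprod_phi G1] phi_eq[OF ij(1)] phi_eq[OF ij(2)]])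
    subgoal by (rule cprod_continued[OF cprod_same_if[OF vmaj_psi vmaj_psi cmaj_emode emode_sq cprod_psi G2] psi_eq[OF ij(1)] psi_eq[OF ij(2)]])
    subgoal by (rule cprod_continued[OF cprod_mixed_if[OF vmaj_psi vmaj_phi cmaj_emode cmaj_fmode anticomm_e_f K(1) Kop_fin(2) Kop_fin(1)
        anti_psi_f anti_phi_e cprod_psi_phi] psi_eq[OF ij(1)] phi_eq[OF ij(2)]])
    subgoal by (rule cprod_continued[OF cprod_mixed_if[OF vmaj_phi vmaj_psi cmaj_fmode cmaj_emode ef K(2) Kop_fin(2) Kop_fin(1)
        anti_phi_e anti_psi_f cprod_phi_psi] phi_eq[OF ij(1)] psi_eq[OF ij(2)]])
    subgoal by (rule cprod_continued[OF cprod_same_if[OF vmaj_phi vmaj_dual cmaj_fmode fmode_sq cprod_dual G3] phi_eq[OF ij(1)] dual_eq[OF ij(2)]])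
    done
  show ?thesis
    unfolding q
  proof (rule exI[of _ F1], rule exI[of _ F2], rule exI[of _ F3], rule exI[of _ F4], rule exI[of _ F5], intro conjI ballI allI)
    fix i j :: nat and b' b \<zeta>2
    assume ij: "i \<in> {1, 2}" "j \<in> {1, 2}" and b: "b' \<in> fock" "b \<in> fock"
    show "\<forall>\<^sub>\<approx>\<zeta>1\<in>UNIV. F1 j i \<zeta>2 \<zeta>1 b' b = (\<Sum>k\<in>{1, 2}. \<Sum>l\<in>{1, 2}.
        Rmat (exp h) (exp \<zeta>1 / exp \<zeta>2) k l i j * F1 k l \<zeta>1 \<zeta>2 b' b * (- 1) ^ (grade i * grade j))"
      by (rule phi_relation[OF G1 _ ij b]) (simp add: F1_def)
    show "\<forall>\<^sub>\<approx>\<zeta>1\<in>UNIV. F2 i j \<zeta>1 \<zeta>2 b' b = (\<Sum>k\<in>{1, 2}. \<Sum>l\<in>{1, 2}.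
        Rmat (exp h) (exp \<zeta>1 / exp \<zeta>2) i j k l * F2 l k \<zeta>2 \<zeta>1 b' b * (- 1) ^ (grade i * grade j))"
      by (rule psi_relation[OF G2 _ ij b]) (simp add: F2_def)
    show "\<forall>\<^sub>\<approx>\<zeta>1\<in>UNIV. F3 i j \<zeta>1 \<zeta>2 b' b = F4 j i \<zeta>2 \<zeta>1 b' b * (- 1) ^ (grade i * grade j)"
      unfolding F3_def F4_def by (rule always_eventually) (rule allI, rule psi_phi_relation[OF b ij])
    show "((\<lambda>\<xi>. F5 i j \<xi> \<zeta>2 b' b) \<longlongrightarrow> exp h * (if i = j then 1 else 0) * oid b' b) (at \<zeta>2)"
      unfolding F5_def by (rule inverse_relation[OF G3' ij b])
  qed (simp_all only: C)
qed

end
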